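(* For every fixed $0<\varepsilon<1/2$, there exist $\eta_\varepsilon>0$ and a sequence of finite posets $P$, with $n=|P|\to\infty$ along the sequence, such that $$S_P=\omega(n^{1/2-\varepsilon}),\qquad \delta_3(P)\le \tfrac16-\eta_\varepsilon .$$ Furthermore, the posets in the sequence satisfy $w(P)=\omega(n^{1/2-\varepsilon})$ and $\delta(P)=1/2$.
   Context: Let $P$ be a finite poset; $w(P)$ is its width (maximum size of an antichain). Let $F$ be a uniformly random point of the order polytope $\mathcal{O}(P)=\{z\in[0,1]^P: z_x\le z_y\text{ if }x<_P y\}$. For $x\in P$ put $Q_x=\max_{y<_P x}F(y)$ and $R_x=\min_{y>_P x}F(y)$, with $Q_x=0$ if $x$ is minimal and $R_x=1$ if $x$ is maximal, and put $c_x=\mathbb{E}(F(x)-Q_x)=\mathbb{E}(R_x-F(x))$ (these two expectations are equal). Write $S_P=\sum_{x\in P}c_x$. For $|P|\ge k$, $\delta_k(P)=\max\min_{\pi\in S_k}\mathbb{P}(x_{\pi(1)}\prec\cdots\prec x_{\pi(k)})$, where the maximum is over all $k$-tuples of pairwise distinct $x_1,\dots,x_k\in P$, the minimum over permutations $\pi$ of $\{1,\dots,k\}$, and $\prec$ is a uniformly random linear extension of $P$. Write $\delta(P)=\delta_2(P)$. $a=\omega(b)$ means $a/b\to\infty$ along the sequence. *)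

theory Defs
  imports "HOL-Probability.Probability" "HOL-Combinatorics.Permutations"
begin

text \<open>
  A poset is a pair of a carrier \<open>A\<close> and a reflexive order \<open>r\<close> with
  \<^term>\<open>partial_order_on A r\<close>; \<open>(x, y) \<in> r\<close> reads "x is below or equal to y".
  The strict order is \<open>r - Id\<close>, with strict down-sets \<^const>\<open>underS\<close> and
  strict up-sets \<^const>\<open>aboveS\<close>.
\<close>

definition antichain :: "'a rel \<Rightarrow> 'a set \<Rightarrow> bool" where
  "antichain r C \<longleftrightarrow> (\<forall>x\<in>C. \<forall>y\<in>C. x \<noteq> y \<longrightarrow> (x, y) \<notin> r)"

definition width :: "'a set \<Rightarrow> 'a rel \<Rightarrow> nat" where
  "width A r = Max (card ` {C. C \<subseteq> A \<and> antichain r C})"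

definition order_polytope :: "'a set \<Rightarrow> 'a rel \<Rightarrow> ('a \<Rightarrow> real) set" where
  "order_polytope A r =
     {z \<in> A \<rightarrow>\<^sub>E {0..1}. \<forall>x y. (x, y) \<in> r - Id \<longrightarrow> z x \<le> z y}"

definition order_polytope_measure :: "'a set \<Rightarrow> 'a rel \<Rightarrow> ('a \<Rightarrow> real) measure" where
  "order_polytope_measure A r = uniform_measure (Pi\<^sub>M A (\<lambda>_. lborel)) (order_polytope A r)"

definition lower_bd :: "'a rel \<Rightarrow> ('a \<Rightarrow> real) \<Rightarrow> 'a \<Rightarrow> real" where
  "lower_bd r F x = (if underS r x = {} then 0 else Max (F ` underS r x))"

text \<open>
  The mean gap \<open>c\<^sub>x\<close> below \<open>x\<close>. By symmetry of the fibres of the order polytope in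
  direction \<open>x\<close>, it equals the mean of the gap between \<open>F x\<close> and the least value of \<open>F\<close>
  on \<^term>\<open>aboveS r x\<close> (or 1 if this set is empty).
\<close>

definition mean_gap :: "'a set \<Rightarrow> 'a rel \<Rightarrow> 'a \<Rightarrow> real" where
  "mean_gap A r x = (\<integral>F. (F x - lower_bd r F x) \<partial>order_polytope_measure A r)"

definition gap_sum :: "'a set \<Rightarrow> 'a rel \<Rightarrow> real" where
  "gap_sum A r = (\<Sum>x\<in>A. mean_gap A r x)"

definition linear_extensions :: "'a set \<Rightarrow> 'a rel \<Rightarrow> 'a rel set" where
  "linear_extensions A r = {L. linear_order_on A L \<and> r \<subseteq> L}"

definition chain_prob ::
    "'a set \<Rightarrow> 'a rel \<Rightarrow> nat \<Rightarrow> (nat \<Rightarrow> 'a) \<Rightarrow> (nat \<Rightarrow> nat) \<Rightarrow> real" where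
  "chain_prob A r k x \<pi> =
     measure_pmf.prob (pmf_of_set (linear_extensions A r))
       {L. \<forall>i\<in>{1..<k}. (x (\<pi> i), x (\<pi> (i + 1))) \<in> L - Id}"

text \<open>
  \<open>k\<close>-tuples of distinct elements are injective functions on \<open>{1..k}\<close>.
  The value is meaningful only for \<^term>\<open>k \<le> card A\<close>, since otherwise the maximum is
  over the empty set.
\<close>

definition delta :: "nat \<Rightarrow> 'a set \<Rightarrow> 'a rel \<Rightarrow> real" where
  "delta k A r =
     Max ((\<lambda>x. Min (chain_prob A r k x ` {\<pi>. \<pi> permutes {1..k}}))
          ` {x \<in> {1..k} \<rightarrow>\<^sub>E A. inj_on x {1..k}})"

end

theory Submission
  imports Defs
begin

text \<open>
  The posets are built recursively: \<open>P\<^bsub>k+1\<^esub>\<close> consists of two incomparable copies of the ordinal sum of a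
  chain of \<open>L\<close> points, two copies of \<open>P\<^sub>k\<close> and another chain of \<open>L\<close> points, where \<open>L\<close> is about
  \<open>|P\<^sub>k| / g\<close> for a large constant \<open>g\<close>. Each step multiplies the size by at most \<open>4 (1 + 2 / g)\<close>,
  doubles the width and multiplies the sum of the mean gaps by at least \<open>2 / (1 + 2 / g)\<close>, so both
  outgrow \<open>n powr (1 / 2 - \<epsilon>)\<close> when \<open>g\<close> is large in terms of \<open>\<epsilon>\<close>.

  A random point of the polytope of an ordinal sum restricts, on a summand \<open>P\<close> with \<open>p\<close> points below
  and \<open>q\<close> points above, to \<open>u + (1 - w - u) G\<close>, where \<open>G\<close> is a random point of the polytope of \<open>P\<close> and
  \<open>(u, w)\<close> is an independent Dirichlet vector; disjoint unions give product measures. This yields by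
  induction that the coordinates have variance \<open>O(1 / n)\<close> and nonnegatively correlated upper level
  events, and that for all \<open>x\<close>, \<open>y\<close> some \<open>y'\<close> comparable to \<open>y\<close> has the same marginal as \<open>x\<close>.

  In a triple that is not handled by comparability or induction, \<open>x\<close> and \<open>y\<close> lie in the same copy of
  \<open>P\<^sub>k\<close> and \<open>z\<close> lies in the other branch. Choose \<open>y'\<close> comparable to \<open>y\<close> and \<open>z'\<close> comparable to \<open>z\<close>, both with the
  marginal of \<open>x\<close>. The common affine map moves \<open>F x\<close> and \<open>F y'\<close> together on the scale of their standard
  deviation, hence the probability that \<open>F z'\<close> is below both of them exceeds \<open>1 / 3\<close> by a constant. If all
  six orders of the triple had probability near \<open>1 / 6\<close>, then, by comparability, the events
  \<open>F z < F x\<close> and \<open>F z < F y\<close> would be close to \<open>F z' < F x\<close> and \<open>F z' < F y'\<close>, and \<open>z\<close> would fall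
  between \<open>x\<close> and \<open>y\<close> with probability less than \<open>1 / 3\<close> by a constant, a contradiction.
\<close>

text \<open>Doubling in parallel leaves the variance of a coordinate unchanged while the size
  doubles, so a variance of order \<open>1 / n\<close> survives only if the series step shrinks
  variances enough. Two copies in series do this up to an added \<open>1 / (4 * N)\<close> from the
  random affine map; without padding, the resulting bound for size times variance would grow by a
  constant at each level. The chains push the share of a copy in its branch strictly below one half,
  which makes the recursion contract to a bound of order \<open>g / n\<close>. The same chains keep
  both \<open>u\<close> and \<open>w\<close> away from 0, so that a copy can drift up or down on the
  scale \<open>1 / sqrt N\<close> at a bounded cost in probability. They are also the only loss
  against the exponent 1/2, which comes from quadrupling the size while doubling the width. The
  number 1/3 is the probability that a given one of three independent variables with a common
  continuous law is the smallest; the joint motion of \<open>F x\<close> and \<open>F y'\<close>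
  raises it through the variance of a conditional survival probability.\<close>

section \<open>Order polytopes, slabs and volumes\<close>

abbreviation PL :: "'a set \<Rightarrow> ('a \<Rightarrow> real) measure" where
  "PL A \<equiv> Pi\<^sub>M A (\<lambda>_. lborel)"

definition res :: "'a rel \<Rightarrow> 'a set \<Rightarrow> 'a rel" where
  "res r X = r \<inter> X \<times> X"

definition pvol :: "'a set \<Rightarrow> 'a rel \<Rightarrow> ennreal" where
  "pvol A r = emeasure (PL A) (order_polytope A r)"

text \<open>The default values, 0 here and 1 for \<open>high\<close>, are the walls of the cube, so
  that a summand at either end of an ordinal sum obeys the same formulas as one in the
  middle.\<close>

definition low :: "'a set \<Rightarrow> ('a \<Rightarrow> real) \<Rightarrow> real" where
  "low D F = (if D = {} then 0 else Max (F ` D))"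

definition high :: "'a set \<Rightarrow> ('a \<Rightarrow> real) \<Rightarrow> real" where
  "high E F = (if E = {} then 1 else Min (F ` E))"

interpretation lborel_prod: product_sigma_finite "\<lambda>_ :: 'a. lborel :: real measure"
  by standard

lemma space_PL: "space (PL A) = A \<rightarrow>\<^sub>E UNIV"
  by (simp add: space_PiM)

lemma order_polytope_iff:
  assumes "r \<subseteq> A \<times> A"
  shows "z \<in> order_polytope A r \<longleftrightarrow>
    z \<in> space (PL A) \<and> (\<forall>x\<in>A. 0 \<le> z x \<and> z x \<le> 1) \<and> (\<forall>p\<in>r. z (fst p) \<le> z (snd p))"
proof -
  have 1: "(\<forall>x y. (x, y) \<in> r - Id \<longrightarrow> z x \<le> z y) \<longleftrightarrow> (\<forall>p\<in>r. z (fst p) \<le> z (snd p))"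
    by (metis Diff_iff order_refl pair_in_Id_conv prod.collapse fst_conv snd_conv)
  show ?thesis
    unfolding order_polytope_def space_PL mem_Collect_eq 1 by (auto simp: PiE_iff)
qed

lemma sets_order_polytope[measurable]:
  assumes "finite A" "r \<subseteq> A \<times> A"
  shows "order_polytope A r \<in> sets (PL A)"
proof -
  have f: "finite r" using assms finite_subset by blast
  have "order_polytope A r = {z \<in> space (PL A). (\<forall>x\<in>A. 0 \<le> z x \<and> z x \<le> 1) \<and> (\<forall>p\<in>r. z (fst p) \<le> z (snd p))}"
    using order_polytope_iff[OF assms(2)] by blast
  moreover have "\<dots> \<in> sets (PL A)"
  proof (intro sets.sets_Collect_conj sets.sets_Collect_finite_All assms(1) f)
    fix x assume [measurable]: "x \<in> A"
    show "{z \<in> space (PL A). 0 \<le> z x} \<in> sets (PL A)" by measurable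
    show "{z \<in> space (PL A). z x \<le> 1} \<in> sets (PL A)" by measurable
  next
    fix p assume "p \<in> r"
    with assms have [measurable]: "fst p \<in> A" "snd p \<in> A" by auto
    show "{z \<in> space (PL A). z (fst p) \<le> z (snd p)} \<in> sets (PL A)" by measurable
  qed
  ultimately show ?thesis by simp
qed

lemma nn_integral_PL_empty: "(\<integral>\<^sup>+F. f F \<partial>PL {}) = f (\<lambda>_. undefined)"
  by (rule lborel_prod.nn_integral_empty) simp

text \<open>One-dimensional substitution in each coordinate, by induction on the index set; every
  coordinate contributes one factor \<open>c\<close> of the Jacobian.\<close>

lemma nn_integral_PL_affine:
  fixes f :: "('a \<Rightarrow> real) \<Rightarrow> ennreal"
  assumes "finite A" "0 < c" "f \<in> borel_measurable (PL A)"
  shows "(\<integral>\<^sup>+F. f F \<partial>PL A) = ennreal (c ^ card A) * (\<integral>\<^sup>+G. f (\<lambda>i\<in>A. a + c * G i) \<partial>PL A)"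
  using assms(1,3)
proof (induction A arbitrary: f rule: finite_induct)
  case empty
  have "(\<lambda>i\<in>{}. a + c * G i) = (\<lambda>_. undefined)" for G :: "'a \<Rightarrow> real" by (simp add: restrict_def)
  then show ?case unfolding nn_integral_PL_empty by simp
next
  case (insert i A)
  note [measurable] = insert.prems
  have "(\<integral>\<^sup>+F. f F \<partial>PL (insert i A)) = (\<integral>\<^sup>+x. (\<integral>\<^sup>+y. f (x(i:=y)) \<partial>lborel) \<partial>PL A)"
    by (rule lborel_prod.product_nn_integral_insert[OF insert.hyps(1,2) insert.prems])
  also have "\<dots> = (\<integral>\<^sup>+x. ennreal c * (\<integral>\<^sup>+y. f (x(i:=a+c*y)) \<partial>lborel) \<partial>PL A)"
  proof (rule nn_integral_cong)
    fix x assume "x \<in> space (PL A)"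
    then have [measurable]: "(\<lambda>y. f (x(i:=y))) \<in> borel_measurable lborel" by measurable
    show "(\<integral>\<^sup>+y. f (x(i:=y)) \<partial>lborel) = ennreal c * (\<integral>\<^sup>+y. f (x(i:=a+c*y)) \<partial>lborel)"
      using nn_integral_real_affine[of "\<lambda>y. f (x(i:=y))" c a] assms(2) by simp
  qed
  also have "\<dots> = ennreal c * (\<integral>\<^sup>+x. (\<integral>\<^sup>+y. f (x(i:=a+c*y)) \<partial>lborel) \<partial>PL A)"
    by (rule nn_integral_cmult) measurable
  also have "(\<integral>\<^sup>+x. (\<integral>\<^sup>+y. f (x(i:=a+c*y)) \<partial>lborel) \<partial>PL A) =
    ennreal (c ^ card A) * (\<integral>\<^sup>+x. (\<integral>\<^sup>+y. f ((\<lambda>j\<in>A. a+c*x j)(i:=a+c*y)) \<partial>lborel) \<partial>PL A)"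
    by (rule insert.IH) measurable
  also have "(\<integral>\<^sup>+x. (\<integral>\<^sup>+y. f ((\<lambda>j\<in>A. a+c*x j)(i:=a+c*y)) \<partial>lborel) \<partial>PL A) =
    (\<integral>\<^sup>+x. (\<integral>\<^sup>+y. f (\<lambda>j\<in>insert i A. a+c*(x(i:=y)) j) \<partial>lborel) \<partial>PL A)"
  proof -
    have "(\<lambda>j\<in>A. a+c*x j)(i:=a+c*y) = (\<lambda>j\<in>insert i A. a+c*(x(i:=y)) j)" for x :: "'a \<Rightarrow> real" and y
      using insert.hyps by (auto simp: fun_eq_iff)
    then show ?thesis by simp
  qed
  also have "\<dots> = (\<integral>\<^sup>+G. f (\<lambda>j\<in>insert i A. a+c*G j) \<partial>PL (insert i A))"
    by (rule lborel_prod.product_nn_integral_insert[OF insert.hyps(1,2), symmetric]) measurable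
  finally have "(\<integral>\<^sup>+F. f F \<partial>PL (insert i A)) =
    ennreal c * (ennreal (c ^ card A) * (\<integral>\<^sup>+G. f (\<lambda>j\<in>insert i A. a+c*G j) \<partial>PL (insert i A)))" .
  moreover have "ennreal (c ^ card (insert i A)) = ennreal c * ennreal (c ^ card A)"
    using insert.hyps assms(2) by (simp add: ennreal_mult)
  ultimately show ?case by (simp only: mult.assoc)
qed

text \<open>Order constraints are invariant under increasing affine maps, so the part of the
  polytope inside the cube with sides \<open>[a, a + c]\<close> is a scaled copy of the whole
  polytope. The exact laws of extreme coordinates and of summands rest on this
  self-similarity.\<close>

lemma affine_mem_order_polytope:
  assumes r: "r \<subseteq> P \<times> P" and c: "0 < c" and a: "0 \<le> a" "a + c \<le> 1"
  shows "((\<lambda>i\<in>P. a + c * G i) \<in> order_polytope P r \<and> (\<forall>i\<in>P. a \<le> a + c * G i \<and> a + c * G i \<le> a + c))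
    \<longleftrightarrow> restrict G P \<in> order_polytope P r"
proof -
  have rr: "fst p \<in> P \<and> snd p \<in> P" if "p \<in> r" for p using r that by auto
  have *: "(\<forall>i\<in>P. 0 \<le> a + c * G i \<and> a + c * G i \<le> 1) \<and> (\<forall>i\<in>P. a \<le> a + c * G i \<and> a + c * G i \<le> a + c)
     \<longleftrightarrow> (\<forall>i\<in>P. 0 \<le> G i \<and> G i \<le> 1)"
  proof -
    have "a + c * x \<le> a + c \<longleftrightarrow> x \<le> 1" for x using c by (auto simp: mult_le_cancel_left1)
    moreover have "a \<le> a + c * x \<longleftrightarrow> 0 \<le> x" for x using c by (auto simp: zero_le_mult_iff)
    ultimately show ?thesis using a by (meson dual_order.trans)
  qed
  have "(\<forall>p\<in>r. a + c * G (fst p) \<le> a + c * G (snd p)) \<longleftrightarrow> (\<forall>p\<in>r. G (fst p) \<le> G (snd p))"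
    using c by auto
  then show ?thesis unfolding order_polytope_iff[OF r] space_PL
    using * rr by (auto simp del: add_le_cancel_left)
qed

lemma low_measurable[measurable]: "finite D \<Longrightarrow> D \<subseteq> A \<Longrightarrow> low D \<in> borel_measurable (PL A)"
proof (cases "D = {}")
  case True then have "low D = (\<lambda>_. 0)" by (auto simp: low_def)
  then show ?thesis by simp
next
  case False
  assume "finite D" "D \<subseteq> A"
  moreover have "low D = (\<lambda>F. Max ((\<lambda>i. F i) ` D))" using False by (auto simp: low_def)
  moreover have "(\<lambda>F. Max ((\<lambda>i. F i) ` D)) \<in> borel_measurable (PL A)"
    using calculation by (intro borel_measurable_Max) (auto intro!: measurable_component_singleton)
  ultimately show ?thesis by simp
qed

lemma high_measurable[measurable]: "finite D \<Longrightarrow> D \<subseteq> A \<Longrightarrow> high D \<in> borel_measurable (PL A)"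
proof (cases "D = {}")
  case True then have "high D = (\<lambda>_. 1)" by (auto simp: high_def)
  then show ?thesis by simp
next
  case False
  assume "finite D" "D \<subseteq> A"
  moreover have "high D = (\<lambda>F. Min ((\<lambda>i. F i) ` D))" using False by (auto simp: high_def)
  moreover have "(\<lambda>F. Min ((\<lambda>i. F i) ` D)) \<in> borel_measurable (PL A)"
    using calculation by (intro borel_measurable_Min) (auto intro!: measurable_component_singleton)
  ultimately show ?thesis by simp
qed

lemma nn_integral_order_polytope_slab:
  fixes f :: "('a \<Rightarrow> real) \<Rightarrow> ennreal"
  assumes fin: "finite P" and r: "r \<subseteq> P \<times> P" and a: "0 \<le> a" and c: "0 < c" "a + c \<le> 1"
    and f[measurable]: "f \<in> borel_measurable (PL P)"
  shows "(\<integral>\<^sup>+F. f F * indicator (order_polytope P r) F * indicator {F. \<forall>i\<in>P. a \<le> F i \<and> F i \<le> a + c} F \<partial>PL P)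
    = ennreal (c ^ card P) * (\<integral>\<^sup>+G. f (\<lambda>i\<in>P. a + c * G i) * indicator (order_polytope P r) G \<partial>PL P)"
proof -
  note sets_order_polytope[OF fin r, measurable]
  have S: "Measurable.pred (PL P) (\<lambda>F. F \<in> {F. \<forall>i\<in>P. a \<le> F i \<and> F i \<le> a + c})"
    unfolding mem_Collect_eq using fin by (intro pred_intros_finite) measurable
  have "(\<integral>\<^sup>+F. f F * indicator (order_polytope P r) F * indicator {F. \<forall>i\<in>P. a \<le> F i \<and> F i \<le> a + c} F \<partial>PL P)
    = ennreal (c ^ card P) * (\<integral>\<^sup>+G. f (\<lambda>i\<in>P. a + c * G i) * indicator (order_polytope P r) (\<lambda>i\<in>P. a + c * G i)
         * indicator {F. \<forall>i\<in>P. a \<le> F i \<and> F i \<le> a + c} (\<lambda>i\<in>P. a + c * G i) \<partial>PL P)"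
    using fin c(1) S
    by (intro nn_integral_PL_affine) (auto intro!: borel_measurable_times borel_measurable_indicator' f sets_order_polytope[OF fin r])
  also have "(\<integral>\<^sup>+G. f (\<lambda>i\<in>P. a + c * G i) * indicator (order_polytope P r) (\<lambda>i\<in>P. a + c * G i)
         * indicator {F. \<forall>i\<in>P. a \<le> F i \<and> F i \<le> a + c} (\<lambda>i\<in>P. a + c * G i) \<partial>PL P)
     = (\<integral>\<^sup>+G. f (\<lambda>i\<in>P. a + c * G i) * indicator (order_polytope P r) G \<partial>PL P)"
  proof (rule nn_integral_cong)
    fix G :: "'a \<Rightarrow> real" assume "G \<in> space (PL P)"
    then have "restrict G P = G" by (auto simp: space_PL)
    with affine_mem_order_polytope[OF r c(1) a c(2), of G]
    show "f (\<lambda>i\<in>P. a + c * G i) * indicator (order_polytope P r) (\<lambda>i\<in>P. a + c * G i)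
         * indicator {F. \<forall>i\<in>P. a \<le> F i \<and> F i \<le> a + c} (\<lambda>i\<in>P. a + c * G i)
      = f (\<lambda>i\<in>P. a + c * G i) * indicator (order_polytope P r) G"
      by (auto simp: indicator_def)
  qed
  finally show ?thesis .
qed

lemma pvol_le_1: assumes "finite A" shows "pvol A r \<le> 1"
proof -
  have "pvol A r \<le> emeasure (PL A) (A \<rightarrow>\<^sub>E {0..1})"
    unfolding pvol_def using assms
    by (intro emeasure_mono) (auto simp: order_polytope_def intro!: sets_PiM_I_finite)
  also have "\<dots> = 1" using assms by (subst lborel_prod.emeasure_PiM) auto
  finally show ?thesis .
qed

lemma nn_integral_pvol:
  "finite A \<Longrightarrow> r \<subseteq> A \<times> A \<Longrightarrow> (\<integral>\<^sup>+F. indicator (order_polytope A r) F \<partial>PL A) = pvol A r"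
  by (simp add: pvol_def sets_order_polytope)

section \<open>Laws of the extreme coordinates\<close>

text \<open>The law of the maximum of \<open>p\<close> independent uniform variables, that is
  Beta(p, 1). The case \<open>p = 0\<close> is the point mass at 0, matching the value of
  \<open>low\<close> on the empty set.\<close>

definition alpha :: "nat \<Rightarrow> real measure" where
  "alpha p = (if p = 0 then return borel 0
     else density lborel (\<lambda>x. ennreal (p * x ^ (p - 1)) * indicator {0..1} x))"

lemma sets_alpha[simp, measurable_cong]: "sets (alpha p) = sets borel"
  by (simp add: alpha_def)
lemma space_alpha[simp]: "space (alpha p) = UNIV"
  by (simp add: alpha_def)

lemma alpha_atMost:
  assumes "0 \<le> s" "s \<le> 1"
  shows "emeasure (alpha p) {..s} = ennreal (s ^ p)"
proof (cases "p = 0")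
  case True then show ?thesis using assms by (simp add: alpha_def)
next
  case False
  have "emeasure (alpha p) {..s} = (\<integral>\<^sup>+x. ennreal (p * x ^ (p - 1)) * indicator {0..1} x * indicator {..s} x \<partial>lborel)"
    using False by (simp add: alpha_def emeasure_density)
  also have "\<dots> = (\<integral>\<^sup>+x. ennreal (p * x ^ (p - 1)) * indicator {0..s} x \<partial>lborel)"
    using assms by (intro nn_integral_cong) (auto simp: indicator_def)
  also have "\<dots> = ennreal (s ^ p - 0 ^ p)"
    by (rule nn_integral_FTC_Icc[where F = "\<lambda>x. x ^ p"]) (use assms in \<open>auto intro!: derivative_eq_intros\<close>)
  finally show ?thesis using False by (simp add: power_0_left)
qed

lemma prob_space_alpha: "prob_space (alpha p)"
proof
  have "emeasure (alpha p) UNIV = 1"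
  proof (cases "p = 0")
    case False
    have "emeasure (alpha p) UNIV = (\<integral>\<^sup>+x. ennreal (p * x ^ (p - 1)) * indicator {0..1} x \<partial>lborel)"
      using False by (simp add: alpha_def emeasure_density)
    also have "\<dots> = ennreal (1 ^ p - 0 ^ p)"
      by (rule nn_integral_FTC_Icc[where F = "\<lambda>x. x ^ p"]) (auto intro!: derivative_eq_intros)
    finally show ?thesis using False by (simp add: power_0_left)
  qed (simp add: alpha_def)
  then show "emeasure (alpha p) (space (alpha p)) = 1" by simp
qed

lemma AE_alpha: "AE u in alpha p. 0 \<le> u \<and> u \<le> 1"
proof (cases "p = 0")
  case True
  then have "alpha p = return borel 0" by (simp add: alpha_def)
  moreover have "AE u in return borel (0::real). 0 \<le> u \<and> u \<le> 1"
    by (subst AE_return) auto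
  ultimately show ?thesis by (simp only:)
next
  case False
  then have "alpha p = density lborel (\<lambda>x. ennreal (p * x ^ (p - 1)) * indicator {0..1} x)"
    by (simp add: alpha_def)
  moreover have "AE u in density lborel (\<lambda>x. ennreal (p * x ^ (p - 1)) * indicator {0..1} x). 0 \<le> u \<and> u \<le> 1"
    by (subst AE_density) (auto simp: indicator_def intro!: AE_I2)
  ultimately show ?thesis by (simp only:)
qed

text \<open>Size biasing: \<open>x * (p * x ^ (p - 1))\<close> is \<open>p / (p + 1)\<close> times
  the density that belongs to \<open>p + 1\<close>. For \<open>p = 0\<close> both sides vanish,
  since the point mass sits at 0.\<close>

lemma alpha_moment:
  assumes [measurable]: "g \<in> borel_measurable borel"
  shows "(\<integral>\<^sup>+u. ennreal u * g u \<partial>alpha p) = ennreal (real p / (real p + 1)) * (\<integral>\<^sup>+u. g u \<partial>alpha (Suc p))"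
proof (cases "p = 0")
  case True then show ?thesis by (simp add: alpha_def nn_integral_return)
next
  case False
  have "(\<integral>\<^sup>+u. ennreal u * g u \<partial>alpha p) = (\<integral>\<^sup>+x. (ennreal (p * x ^ (p - 1)) * indicator {0..1} x) * (ennreal x * g x) \<partial>lborel)"
    using False by (simp add: alpha_def nn_integral_density)
  also have "\<dots> = (\<integral>\<^sup>+x. ennreal (real p / (real p + 1)) * ((ennreal (Suc p * x ^ p) * indicator {0..1} x) * g x) \<partial>lborel)"
  proof (rule nn_integral_cong)
    fix x :: real
    show "(ennreal (p * x ^ (p - 1)) * indicator {0..1} x) * (ennreal x * g x) =
      ennreal (real p / (real p + 1)) * ((ennreal (Suc p * x ^ p) * indicator {0..1} x) * g x)"
    proof (cases "x \<in> {0..1}")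
      case True
      then have "ennreal (p * x ^ (p - 1)) * ennreal x = ennreal (p * x ^ p)"
        using False by (cases p) (auto simp flip: ennreal_mult simp: mult_ac)
      moreover have "ennreal (real p / (real p + 1)) * ennreal (Suc p * x ^ p) = ennreal (p * x ^ p)"
        using True by (subst ennreal_mult[symmetric]) (auto simp: field_simps)
      ultimately show ?thesis using True by (simp add: mult.assoc[symmetric])
    qed simp
  qed
  also have "\<dots> = ennreal (real p / (real p + 1)) * (\<integral>\<^sup>+u. g u \<partial>alpha (Suc p))"
    by (simp add: alpha_def nn_integral_density nn_integral_cmult)
  finally show ?thesis .
qed

section \<open>The uniform law on an order polytope\<close>

abbreviation opm :: "'a set \<Rightarrow> 'a rel \<Rightarrow> ('a \<Rightarrow> real) measure" where
  "opm \<equiv> order_polytope_measure"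

lemma partial_order_on_sub: "partial_order_on A r \<Longrightarrow> r \<subseteq> A \<times> A"
  by (simp add: partial_order_on_def preorder_on_def)

lemma partial_order_on_res:
  "partial_order_on A r \<Longrightarrow> X \<subseteq> A \<Longrightarrow> partial_order_on X (res r X)"
proof -
  assume po: "partial_order_on A r" and X: "X \<subseteq> A"
  have "trans (res r X)"
    using po unfolding res_def partial_order_on_def preorder_on_def
    by (intro transI) (auto dest: transD)
  moreover have "antisym (res r X)"
    using po unfolding res_def partial_order_on_def by (auto intro: antisym_subset)
  moreover have "refl_on X (res r X)"
    using po X unfolding res_def partial_order_on_def preorder_on_def refl_on_def by auto
  ultimately show ?thesis
    by (auto simp: partial_order_on_def preorder_on_def res_def)
qed

lemma res_sub: "res r X \<subseteq> X \<times> X"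
  by (simp add: res_def)

text \<open>Giving \<open>x\<close> the interval of length \<open>1 / n\<close> that starts at
  \<open>k x / n\<close>, with \<open>k x\<close> the number of points strictly below
  \<open>x\<close>, makes the intervals increase along the order, so a whole box lies inside the
  polytope.\<close>

lemma pvol_pos:
  assumes fin: "finite A" and po: "partial_order_on A r"
  shows "0 < pvol A r"
proof (cases "A = {}")
  case True
  then have "r = {}" using partial_order_on_sub[OF po] by auto
  then have "order_polytope A r = space (PL A)" using True by (auto simp: order_polytope_def space_PL)
  then show ?thesis using True by (simp add: pvol_def PiM_empty emeasure_count_space_finite)
next
  case False
  define n where "n = card A"
  define k where "k x = card (underS r x)" for x
  have n: "n > 0" using fin False by (simp add: n_def card_gt_0_iff)
  have sub: "underS r x \<subseteq> A - {x}" for x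
    using partial_order_on_sub[OF po] by (auto simp: underS_def)
  have kn: "k x + 1 \<le> n" if "x \<in> A" for x
  proof -
    have "k x \<le> card (A - {x})" unfolding k_def using sub fin by (intro card_mono) auto
    then show ?thesis using that fin n by (simp add: n_def)
  qed
  have mono: "k x + 1 \<le> k y" if "(x, y) \<in> r" "x \<noteq> y" for x y
  proof -
    have "underS r x \<subseteq> underS r y" "x \<in> underS r y" "x \<notin> underS r x"
      using po that unfolding underS_def partial_order_on_def preorder_on_def trans_def antisym_def by blast+
    then have "underS r x \<subset> underS r y" by blast
    moreover have "finite (underS r y)" using finite_subset[OF sub] fin by auto
    ultimately have "card (underS r x) < card (underS r y)" by (intro psubset_card_mono)
    then show ?thesis by (simp add: k_def)
  qed
  let ?B = "Pi\<^sub>E A (\<lambda>x. {real (k x) / n .. (real (k x) + 1) / n})"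
  have "?B \<subseteq> order_polytope A r"
  proof
    fix z assume z: "z \<in> ?B"
    have "z x \<in> {0..1}" if "x \<in> A" for x
    proof -
      have "real (k x) / n \<le> z x" "z x \<le> (real (k x) + 1) / n" using z that by (auto simp: PiE_iff)
      moreover have "(real (k x) + 1) / n \<le> 1" using kn[OF that] n by (simp add: field_simps)
      moreover have "0 \<le> real (k x) / n" by simp
      ultimately show ?thesis by (simp only: atLeastAtMost_iff) linarith
    qed
    moreover have "z x \<le> z y" if "(x, y) \<in> r" "x \<noteq> y" for x y
    proof -
      have "x \<in> A" "y \<in> A" using that partial_order_on_sub[OF po] by auto
      then have "z x \<le> (real (k x) + 1) / n" "real (k y) / n \<le> z y" using z by (auto simp: PiE_iff)
      moreover have "(real (k x) + 1) / n \<le> real (k y) / n"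
        using mono[OF that] by (intro divide_right_mono) (linarith, simp)
      ultimately show ?thesis by linarith
    qed
    ultimately show "z \<in> order_polytope A r" using z by (auto simp: order_polytope_def PiE_iff)
  qed
  then have "emeasure (PL A) ?B \<le> pvol A r"
    unfolding pvol_def using fin partial_order_on_sub[OF po]
    by (intro emeasure_mono sets_order_polytope) auto
  moreover have "emeasure (PL A) ?B = (\<Prod>x\<in>A. ennreal (1 / n))"
  proof (subst lborel_prod.emeasure_PiM[OF fin])
    have "emeasure lborel {real (k x) / n .. (real (k x) + 1) / n} = ennreal (1 / n)" for x
    proof -
      have "real (k x) / n \<le> (real (k x) + 1) / n" by (intro divide_right_mono) auto
      then show ?thesis by (simp add: diff_divide_distrib[symmetric])
    qed
    then show "(\<Prod>x\<in>A. emeasure lborel {real (k x) / n .. (real (k x) + 1) / n}) = (\<Prod>x\<in>A. ennreal (1 / n))"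
      by simp
  qed simp
  moreover have "(\<Prod>x\<in>A. ennreal (1 / n)) = ennreal ((1 / n) ^ card A)"
    by (simp only: prod_constant ennreal_power[of "1 / n", simplified])
  moreover have "0 < ennreal ((1 / n) ^ card A)" using n by (simp only: ennreal_less_zero_iff) simp
  ultimately show ?thesis by (simp only:)
qed

lemma pvol_fin: "finite A \<Longrightarrow> pvol A r < \<top>"
  by (metis pvol_le_1 ennreal_one_less_top order_le_less_trans)

lemma sets_opm[simp, measurable_cong]: "sets (opm A r) = sets (PL A)"
  by (simp add: order_polytope_measure_def)

lemma space_opm[simp]: "space (opm A r) = space (PL A)"
  by (simp add: order_polytope_measure_def)

lemma nn_integral_opm:
  assumes "finite A" "r \<subseteq> A \<times> A" "f \<in> borel_measurable (PL A)"
  shows "(\<integral>\<^sup>+F. f F \<partial>opm A r) = (\<integral>\<^sup>+F. f F * indicator (order_polytope A r) F \<partial>PL A) / pvol A r"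
  unfolding order_polytope_measure_def pvol_def
  by (rule nn_integral_uniform_measure) (use assms sets_order_polytope in auto)

lemma nn_integral_PL_opm:
  assumes "finite A" "partial_order_on A r" "f \<in> borel_measurable (PL A)"
  shows "(\<integral>\<^sup>+F. f F * indicator (order_polytope A r) F \<partial>PL A) = pvol A r * (\<integral>\<^sup>+F. f F \<partial>opm A r)"
proof -
  have "pvol A r \<noteq> 0" "pvol A r \<noteq> \<top>"
    using pvol_pos[OF assms(1,2)] pvol_fin[OF assms(1), of r] by auto
  then show ?thesis
    using nn_integral_opm[OF assms(1) partial_order_on_sub[OF assms(2)] assms(3)]
    by (simp add: ennreal_times_divide mult_divide_eq_ennreal mult.commute[of "pvol A r"])
qed

lemma prob_space_opm:
  assumes "finite A" "partial_order_on A r"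
  shows "prob_space (opm A r)"
  unfolding order_polytope_measure_def
proof (rule prob_space_uniform_measure)
  show "emeasure (PL A) (order_polytope A r) \<noteq> 0"
    using pvol_pos[OF assms] by (simp add: pvol_def)
  show "emeasure (PL A) (order_polytope A r) \<noteq> \<infinity>"
    using pvol_fin[OF assms(1), of r] by (simp add: pvol_def)
qed

lemma AE_opm:
  assumes "finite A" "partial_order_on A r"
  shows "AE F in opm A r. F \<in> order_polytope A r"
  unfolding order_polytope_measure_def
  by (rule AE_uniform_measureI) (use assms partial_order_on_sub in \<open>auto intro!: sets_order_polytope\<close>)

text \<open>By self-similarity the slab event has probability \<open>c ^ card P\<close> whatever the
  order is, just as for independent uniform coordinates.\<close>

lemma slab_prob:
  assumes fin: "finite P" and po: "partial_order_on P r" and a: "0 \<le> a" "0 < c" "a + c \<le> 1"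
  shows "emeasure (opm P r) {F \<in> space (PL P). \<forall>i\<in>P. a \<le> F i \<and> F i \<le> a + c} = ennreal (c ^ card P)"
proof -
  note r = partial_order_on_sub[OF po]
  let ?S = "{F \<in> space (PL P). \<forall>i\<in>P. a \<le> F i \<and> F i \<le> a + c}"
  have S[measurable]: "?S \<in> sets (PL P)"
    using fin by (intro sets.sets_Collect_finite_All) measurable
  have "emeasure (opm P r) ?S = (\<integral>\<^sup>+F. indicator ?S F \<partial>opm P r)" by simp
  also have "\<dots> = (\<integral>\<^sup>+F. indicator ?S F * indicator (order_polytope P r) F \<partial>PL P) / pvol P r"
    by (rule nn_integral_opm[OF fin r]) measurable
  also have "(\<integral>\<^sup>+F. indicator ?S F * indicator (order_polytope P r) F \<partial>PL P)
    = (\<integral>\<^sup>+F. 1 * indicator (order_polytope P r) F * indicator {F. \<forall>i\<in>P. a \<le> F i \<and> F i \<le> a + c} F \<partial>PL P)"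
    by (intro nn_integral_cong) (auto simp: indicator_def)
  also have "\<dots> = ennreal (c ^ card P) * pvol P r"
    by (subst nn_integral_order_polytope_slab[OF fin r a]) (simp_all add: pvol_def sets_order_polytope fin r)
  also have "\<dots> / pvol P r = ennreal (c ^ card P)"
    using pvol_pos[OF fin po] pvol_fin[OF fin, of r]
    by (simp add: mult_divide_eq_ennreal)
  finally show ?thesis .
qed

lemma low_le_iff: "finite D \<Longrightarrow> 0 \<le> s \<Longrightarrow> low D F \<le> s \<longleftrightarrow> (\<forall>i\<in>D. F i \<le> s)"
  by (auto simp: low_def)

lemma high_ge_iff: "finite D \<Longrightarrow> s \<le> 1 \<Longrightarrow> s \<le> high D F \<longleftrightarrow> (\<forall>i\<in>D. s \<le> F i)"
  by (auto simp: high_def)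

lemma low_high_range:
  assumes "finite D" "F \<in> order_polytope D r"
  shows "0 \<le> low D F" "low D F \<le> 1" "0 \<le> high D F" "high D F \<le> 1"
proof -
  have *: "\<forall>i\<in>D. 0 \<le> F i \<and> F i \<le> 1" using assms(2) by (auto simp: order_polytope_def PiE_iff)
  then show "low D F \<le> 1" "0 \<le> high D F" using assms(1) by (auto simp: low_le_iff high_ge_iff)
  show "0 \<le> low D F"
  proof (cases "D = {}")
    case False
    then obtain i where "i \<in> D" by auto
    then show ?thesis using * False assms(1) by (auto simp: low_def Max_ge_iff)
  qed (simp add: low_def)
  show "high D F \<le> 1"
  proof (cases "D = {}")
    case False
    then obtain i where "i \<in> D" by auto
    then show ?thesis using * False assms(1) by (auto simp: high_def Min_le_iff)
  qed (simp add: high_def)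
qed

text \<open>Slabs of positive width determine the distribution function only on
  \<open>(0, 1]\<close>, hence the range of \<open>s\<close>; the support and right continuity give
  the rest.\<close>

lemma eq_alphaI:
  assumes M: "prob_space M" and [simp]: "sets M = sets borel"
    and ran: "AE x in M. 0 \<le> x \<and> x \<le> 1"
    and cdf: "\<And>s. 0 < s \<Longrightarrow> s \<le> 1 \<Longrightarrow> measure M {..s} = s ^ p"
  shows "M = alpha p"
proof (rule cdf_unique)
  interpret prob_space M by fact
  interpret A: prob_space "alpha p" by (rule prob_space_alpha)
  have sp[simp]: "space M = UNIV" by (metis assms(2) sets_eq_imp_space_eq space_borel)
  show "real_distribution M" by unfold_locales simp_all
  show "real_distribution (alpha p)" by unfold_locales simp_all
  have neg: "measure N {..s} = 0" if "prob_space N" "sets N = sets borel" "AE x in N. 0 \<le> x \<and> x \<le> 1" "s < 0" for N :: "real measure" and s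
  proof -
    interpret N: prob_space N by fact
    have "space N = UNIV" using that(2) by (metis sets_eq_imp_space_eq space_borel)
    then have "measure N {..s} = measure N {}"
    proof (intro measure_eq_AE)
      show "AE x in N. x \<in> {..s} \<longleftrightarrow> x \<in> {}" using that(3) by eventually_elim (use that(4) in auto)
    qed (use that(2) in auto)
    then show ?thesis by simp
  qed
  have one: "measure N {..s} = 1" if "prob_space N" "sets N = sets borel" "AE x in N. 0 \<le> x \<and> x \<le> 1" "1 < s" for N :: "real measure" and s
  proof -
    interpret N: prob_space N by fact
    have "space N = UNIV" using that(2) by (metis sets_eq_imp_space_eq space_borel)
    moreover have "AE x in N. x \<in> {..s}" using that(3) by eventually_elim (use that(4) in auto)
    ultimately show ?thesis using that(2) by (subst N.prob_eq_1) auto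
  qed
  have AA: "measure (alpha p) {..s} = s ^ p" if "0 \<le> s" "s \<le> 1" for s
    using alpha_atMost[OF that] that by (simp add: measure_def)
  \<comment> \<open>The value at 0 is the limit from the right: 1 for \<open>p = 0\<close>, where
    all mass sits at 0, and 0 otherwise.\<close>
  have zero: "measure M {..0} = 0 ^ p"
  proof -
    have RD: "real_distribution M" by unfold_locales simp_all
    have "(cdf M \<longlongrightarrow> cdf M 0) (at_right 0)"
      using finite_borel_measure.cdf_is_right_cont[OF real_distribution.finite_borel_measure_M[OF RD], of 0]
      by (simp add: continuous_within)
    moreover have "((\<lambda>s. s ^ p) \<longlongrightarrow> (0::real) ^ p) (at_right 0)"
      by (intro tendsto_intros)
    moreover have "\<forall>\<^sub>F s in at_right 0. cdf M s = s ^ p"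
      unfolding eventually_at_right_field cdf_def using cdf by (intro exI[of _ 1]) auto
    ultimately have "(cdf M \<longlongrightarrow> 0 ^ p) (at_right 0)" by (subst tendsto_cong)
    then have "cdf M 0 = 0 ^ p"
      using \<open>(cdf M \<longlongrightarrow> cdf M 0) (at_right 0)\<close>
      by (intro tendsto_unique[OF trivial_limit_at_right_real])
    then show ?thesis by (simp add: cdf_def)
  qed
  show "cdf M = cdf (alpha p)"
  proof
    fix s :: real
    consider "s < 0" | "s = 0" | "0 < s" "s \<le> 1" | "1 < s" by linarith
    then show "cdf M s = cdf (alpha p) s"
    proof cases
      case 1 then show ?thesis
        using neg[OF M assms(2) ran] neg[OF prob_space_alpha sets_alpha AE_alpha] by (simp only: cdf_def)
    next
      case 2 then show ?thesis using zero AA[of 0] by (simp add: cdf_def)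
    next
      case 3 then show ?thesis using cdf[of s] AA[of s] by (simp add: cdf_def)
    next
      case 4 then show ?thesis
        using one[OF M assms(2) ran] one[OF prob_space_alpha sets_alpha AE_alpha] by (simp only: cdf_def)
    qed
  qed
qed

text \<open>The largest coordinate is at most \<open>s\<close> exactly on the slab from 0 to
  \<open>s\<close>. Its law thus depends on the number of points alone, which is what decouples a
  summand from the shape of what lies below it.\<close>

lemma distr_low:
  assumes fin: "finite D" and po: "partial_order_on D r"
  shows "distr (opm D r) borel (low D) = alpha (card D)"
proof (rule eq_alphaI)
  interpret prob_space "opm D r" by (rule prob_space_opm[OF fin po])
  have m[measurable]: "low D \<in> borel_measurable (PL D)" using fin by simp
  then have m': "low D \<in> borel_measurable (opm D r)" by measurable
  show "prob_space (distr (opm D r) borel (low D))" by (rule prob_space_distr[OF m'])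
  show "sets (distr (opm D r) borel (low D)) = sets borel" by simp
  show "AE x in distr (opm D r) borel (low D). 0 \<le> x \<and> x \<le> 1"
  proof (subst AE_distr_iff[OF m'])
    show "AE F in opm D r. 0 \<le> low D F \<and> low D F \<le> 1"
      using AE_opm[OF fin po]
    proof eventually_elim
      case (elim F) then show ?case using low_high_range[OF fin elim] by simp
    qed
  qed simp
  fix s :: real assume s: "0 < s" "s \<le> 1"
  have "measure (distr (opm D r) borel (low D)) {..s} = measure (opm D r) {F \<in> space (PL D). low D F \<le> s}"
    by (subst measure_distr[OF m']) (auto intro!: arg_cong2[where f=measure])
  also have "\<dots> = measure (opm D r) {F \<in> space (PL D). \<forall>i\<in>D. 0 \<le> F i \<and> F i \<le> 0 + s}"
  proof (rule measure_eq_AE)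
    show "AE F in opm D r. F \<in> {F \<in> space (PL D). low D F \<le> s} \<longleftrightarrow> F \<in> {F \<in> space (PL D). \<forall>i\<in>D. 0 \<le> F i \<and> F i \<le> 0 + s}"
      using AE_opm[OF fin po] by eventually_elim (use fin s in \<open>auto simp: low_le_iff order_polytope_def PiE_iff\<close>)
    show "{F \<in> space (PL D). low D F \<le> s} \<in> sets (opm D r)" by measurable
    show "{F \<in> space (PL D). \<forall>i\<in>D. 0 \<le> F i \<and> F i \<le> 0 + s} \<in> sets (opm D r)"
      unfolding sets_opm using fin by (intro sets.sets_Collect_finite_All) measurable
  qed
  also have "\<dots> = s ^ card D"
    using slab_prob[OF fin po, of 0 s] s by (simp add: measure_def)
  finally show "measure (distr (opm D r) borel (low D)) {..s} = s ^ card D" .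
qed

lemma distr_high:
  assumes fin: "finite D" and po: "partial_order_on D r"
  shows "distr (opm D r) borel (\<lambda>F. 1 - high D F) = alpha (card D)"
proof (rule eq_alphaI)
  interpret prob_space "opm D r" by (rule prob_space_opm[OF fin po])
  have m[measurable]: "high D \<in> borel_measurable (PL D)" using fin by simp
  then have m': "(\<lambda>F. 1 - high D F) \<in> borel_measurable (opm D r)" by measurable
  show "prob_space (distr (opm D r) borel (\<lambda>F. 1 - high D F))" by (rule prob_space_distr[OF m'])
  show "sets (distr (opm D r) borel (\<lambda>F. 1 - high D F)) = sets borel" by simp
  show "AE x in distr (opm D r) borel (\<lambda>F. 1 - high D F). 0 \<le> x \<and> x \<le> 1"
  proof (subst AE_distr_iff[OF m'])
    show "AE F in opm D r. 0 \<le> 1 - high D F \<and> 1 - high D F \<le> 1"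
      using AE_opm[OF fin po]
    proof eventually_elim
      case (elim F) then show ?case using low_high_range[OF fin elim] by simp
    qed
  qed simp
  fix s :: real assume s: "0 < s" "s \<le> 1"
  have "measure (distr (opm D r) borel (\<lambda>F. 1 - high D F)) {..s} = measure (opm D r) {F \<in> space (PL D). 1 - high D F \<le> s}"
    by (subst measure_distr[OF m']) (auto intro!: arg_cong2[where f=measure])
  also have "\<dots> = measure (opm D r) {F \<in> space (PL D). \<forall>i\<in>D. 1 - s \<le> F i \<and> F i \<le> (1 - s) + s}"
  proof (rule measure_eq_AE)
    have *: "1 - high D F \<le> s \<longleftrightarrow> 1 - s \<le> high D F" for F by auto
    show "AE F in opm D r. F \<in> {F \<in> space (PL D). 1 - high D F \<le> s} \<longleftrightarrow> F \<in> {F \<in> space (PL D). \<forall>i\<in>D. 1 - s \<le> F i \<and> F i \<le> (1 - s) + s}"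
      using AE_opm[OF fin po] unfolding * by eventually_elim (use fin s in \<open>auto simp: high_ge_iff order_polytope_def PiE_iff\<close>)
    show "{F \<in> space (PL D). 1 - high D F \<le> s} \<in> sets (opm D r)" by measurable
    show "{F \<in> space (PL D). \<forall>i\<in>D. 1 - s \<le> F i \<and> F i \<le> (1 - s) + s} \<in> sets (opm D r)"
      unfolding sets_opm using fin by (intro sets.sets_Collect_finite_All) measurable
  qed
  also have "\<dots> = s ^ card D"
    using slab_prob[OF fin po, of "1 - s" s] s by (simp add: measure_def)
  finally show "measure (distr (opm D r) borel (\<lambda>F. 1 - high D F)) {..s} = s ^ card D" .
qed

subsection \<open>Ordinal sums\<close>

text \<open>An ordinal sum seen from one summand \<open>P\<close>. Either neighbour may be empty,
  which covers the ends of a series composition.\<close>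

definition ord3 :: "'a set \<Rightarrow> 'a rel \<Rightarrow> 'a set \<Rightarrow> 'a set \<Rightarrow> 'a set \<Rightarrow> bool" where
  "ord3 A r D P E \<longleftrightarrow> finite A \<and> partial_order_on A r \<and> A = D \<union> P \<union> E \<and> P \<noteq> {} \<and>
     D \<inter> P = {} \<and> D \<inter> E = {} \<and> P \<inter> E = {} \<and> D \<times> P \<subseteq> r \<and> D \<times> E \<subseteq> r \<and> P \<times> E \<subseteq> r"

lemma low_cong: "(\<And>i. i \<in> D \<Longrightarrow> F i = G i) \<Longrightarrow> low D F = low D G"
  by (simp add: low_def cong: image_cong)

lemma high_cong: "(\<And>i. i \<in> D \<Longrightarrow> F i = G i) \<Longrightarrow> high D F = high D G"
  by (simp add: high_def cong: image_cong)

lemma restrict_order_polytope: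
  assumes "F \<in> order_polytope A r" "r \<subseteq> A \<times> A" "X \<subseteq> A"
  shows "restrict F X \<in> order_polytope X (res r X)"
proof -
  have 1: "\<forall>x\<in>A. 0 \<le> F x \<and> F x \<le> 1" "\<forall>p\<in>r. F (fst p) \<le> F (snd p)"
    using assms(1) unfolding order_polytope_iff[OF assms(2)] by auto
  show ?thesis
    unfolding order_polytope_iff[OF res_sub] space_PL
  proof (intro conjI)
    show "\<forall>p\<in>res r X. restrict F X (fst p) \<le> restrict F X (snd p)"
      using 1(2) by (auto simp: res_def)
  qed (use 1(1) assms(3) in auto)
qed

text \<open>Comparisons across summands only say that \<open>P\<close> lies above the maximum on
  \<open>D\<close> and below the minimum on \<open>E\<close>; those between \<open>D\<close> and
  \<open>E\<close> then follow through a point of the nonempty \<open>P\<close>.\<close>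

lemma mem_ord3:
  assumes o: "ord3 A r D P E" and F: "F \<in> space (PL A)"
  shows "F \<in> order_polytope A r \<longleftrightarrow>
    restrict F D \<in> order_polytope D (res r D) \<and> restrict F E \<in> order_polytope E (res r E) \<and>
    restrict F P \<in> order_polytope P (res r P) \<and> (\<forall>i\<in>P. low D F \<le> F i \<and> F i \<le> high E F)"
    (is "?L \<longleftrightarrow> ?R")
proof
  have A: "A = D \<union> P \<union> E" and fin: "finite A" and po: "partial_order_on A r"
    and cr: "D \<times> P \<subseteq> r" "D \<times> E \<subseteq> r" "P \<times> E \<subseteq> r" and P: "P \<noteq> {}"
    and dj: "D \<inter> P = {}" "D \<inter> E = {}" "P \<inter> E = {}" using o by (auto simp: ord3_def)
  note r = partial_order_on_sub[OF po]
  have f: "finite D" "finite P" "finite E" using fin A by auto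
  {
    assume L: ?L
    then have 1: "\<forall>x\<in>A. 0 \<le> F x \<and> F x \<le> 1" "\<forall>p\<in>r. F (fst p) \<le> F (snd p)"
      unfolding order_polytope_iff[OF r] by auto
    have "low D F \<le> F i \<and> F i \<le> high E F" if i: "i \<in> P" for i
    proof -
      have b: "0 \<le> F i" "F i \<le> 1" using 1(1) i A by auto
      have "\<forall>j\<in>D. F j \<le> F i" "\<forall>j\<in>E. F i \<le> F j" using cr 1(2) i by fastforce+
      then show ?thesis using low_le_iff[OF f(1) b(1)] high_ge_iff[OF f(3) b(2)] by auto
    qed
    moreover have "D \<subseteq> A" "E \<subseteq> A" "P \<subseteq> A" using A by auto
    ultimately show ?R using restrict_order_polytope[OF L r] by blast
  }
  assume R: ?R
  have rd: "\<forall>x\<in>X. 0 \<le> F x \<and> F x \<le> 1" "\<forall>p\<in>res r X. F (fst p) \<le> F (snd p)"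
    if "restrict F X \<in> order_polytope X (res r X)" for X
  proof -
    have *: "\<forall>x\<in>X. 0 \<le> restrict F X x \<and> restrict F X x \<le> 1"
      "\<forall>p\<in>res r X. restrict F X (fst p) \<le> restrict F X (snd p)"
      using that unfolding order_polytope_iff[OF res_sub] by blast+
    show "\<forall>x\<in>X. 0 \<le> F x \<and> F x \<le> 1" using *(1) by auto
    show "\<forall>p\<in>res r X. F (fst p) \<le> F (snd p)"
    proof
      fix p assume p: "p \<in> res r X"
      then have "fst p \<in> X" "snd p \<in> X" by (auto simp: res_def)
      then show "F (fst p) \<le> F (snd p)" using *(2) p by fastforce
    qed
  qed
  have DP: "F x \<le> F i" if "x \<in> D" "i \<in> P" for x i
  proof -
    have "low D F \<le> F i" "0 \<le> F i" using R rd(1)[of P] that by auto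
    then show ?thesis using low_le_iff[OF f(1)] that by auto
  qed
  have PE: "F i \<le> F x" if "x \<in> E" "i \<in> P" for x i
  proof -
    have "F i \<le> high E F" "F i \<le> 1" using R rd(1)[of P] that by auto
    then show ?thesis using high_ge_iff[OF f(3)] that by auto
  qed
  obtain i0 where i0: "i0 \<in> P" using P by auto
  show ?L
    unfolding order_polytope_iff[OF r]
  proof (intro conjI F)
    show "\<forall>x\<in>A. 0 \<le> F x \<and> F x \<le> 1" using R rd(1)[of D] rd(1)[of P] rd(1)[of E] A by auto
    show "\<forall>p\<in>r. F (fst p) \<le> F (snd p)"
    proof
      fix p assume p: "p \<in> r"
      obtain x y where xy: "p = (x, y)" by (cases p)
      have xA: "x \<in> A" "y \<in> A" using p xy r by auto
      have anti: "False" if "(y, x) \<in> r" "x \<noteq> y"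
        using that p xy po by (auto simp: partial_order_on_def antisym_def)
      have same: "F x \<le> F y" if "x \<in> X" "y \<in> X" "restrict F X \<in> order_polytope X (res r X)" for X
        using bspec[OF rd(2)[OF that(3)], of "(x, y)"] that(1,2) p xy by (auto simp: res_def)
      show "F (fst p) \<le> F (snd p)"
      proof (cases "x \<in> D")
        case True
        then show ?thesis using R same[of D] DP[of x] PE[of y i0] DP[of x i0] i0 xA A xy
          by (metis UnE fst_conv snd_conv order_trans)
      next
        case nD: False
        show ?thesis
        proof (cases "x \<in> P")
          case True
          have "y \<notin> D" using anti True cr dj nD by blast
          then show ?thesis using True R same[of P] PE[of y x] xA A xy by auto
        next
          case False
          then have xE: "x \<in> E" using nD xA A by auto
          have "y \<notin> D" "y \<notin> P" using anti xE cr dj by blast+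
          then show ?thesis using xE R same[of E] xA A xy by auto
        qed
      qed
    qed
  qed
qed

text \<open>For independent points of \<open>D\<close> and \<open>E\<close> the maximum on
  \<open>D\<close> may exceed the minimum on \<open>E\<close>, and the truncation at 0 covers this
  case: if \<open>v \<le> u\<close>, a point of the slab has all coordinates equal to
  \<open>u\<close>, which is a null event.\<close>

lemma slab_inner:
  fixes f :: "('a \<Rightarrow> real) \<Rightarrow> ennreal"
  assumes fin: "finite P" and P: "P \<noteq> {}" and r: "r \<subseteq> P \<times> P" and uv: "0 \<le> u" "v \<le> 1"
    and f[measurable]: "f \<in> borel_measurable (PL P)"
  shows "(\<integral>\<^sup>+F. f F * indicator (order_polytope P r) F * indicator {F. \<forall>i\<in>P. u \<le> F i \<and> F i \<le> v} F \<partial>PL P)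
    = ennreal (max 0 (v - u) ^ card P) * (\<integral>\<^sup>+G. f (\<lambda>i\<in>P. u + (v - u) * G i) * indicator (order_polytope P r) G \<partial>PL P)"
proof (cases "u < v")
  case True
  then show ?thesis
    using nn_integral_order_polytope_slab[OF fin r uv(1), of "v - u" f] uv f by simp
next
  case False
  have "emeasure (PL P) (Pi\<^sub>E P (\<lambda>_. {u})) = (\<Prod>i\<in>P. 0)"
    by (subst lborel_prod.emeasure_PiM[OF fin]) auto
  also have "\<dots> = 0" using fin P by (simp add: card_gt_0_iff)
  finally have n: "Pi\<^sub>E P (\<lambda>_. {u}) \<in> null_sets (PL P)"
    by (rule null_setsI) (rule sets_PiM_I_finite[OF fin], simp)
  have "(\<integral>\<^sup>+F. f F * indicator (order_polytope P r) F * indicator {F. \<forall>i\<in>P. u \<le> F i \<and> F i \<le> v} F \<partial>PL P)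
    = (\<integral>\<^sup>+F. 0 \<partial>PL P)"
  proof (rule nn_integral_cong_AE)
    show "AE F in PL P. f F * indicator (order_polytope P r) F * indicator {F. \<forall>i\<in>P. u \<le> F i \<and> F i \<le> v} F = 0"
      using AE_not_in[OF n]
    proof (rule AE_mp)
      show "AE F in PL P. F \<notin> Pi\<^sub>E P (\<lambda>_. {u}) \<longrightarrow>
        f F * indicator (order_polytope P r) F * indicator {F. \<forall>i\<in>P. u \<le> F i \<and> F i \<le> v} F = 0"
      proof (intro AE_I2 impI)
        fix F :: "'a \<Rightarrow> real" assume "F \<in> space (PL P)" "F \<notin> Pi\<^sub>E P (\<lambda>_. {u})"
        then obtain i where "i \<in> P" "F i \<noteq> u" unfolding space_PL PiE_iff by blast
        then have "\<not> (\<forall>i\<in>P. u \<le> F i \<and> F i \<le> v)" using False by force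
        then show "f F * indicator (order_polytope P r) F * indicator {F. \<forall>i\<in>P. u \<le> F i \<and> F i \<le> v} F = 0"
          by simp
      qed
    qed
  qed
  moreover have "max 0 (v - u) ^ card P = 0" using False fin P by (simp add: max_def card_gt_0_iff)
  ultimately show ?thesis by simp
qed

lemma sigma_finite_PL: "finite A \<Longrightarrow> sigma_finite_measure (PL A)"
  by (rule lborel_prod.sigma_finite)

text \<open>Fubini with \<open>P\<close> innermost: for fixed coordinates on \<open>D\<close> and
  \<open>E\<close> the fibre is a scaled copy of the polytope of \<open>P\<close>, and the result
  depends on these coordinates only through the maximum on \<open>D\<close> and the minimum on
  \<open>E\<close>, whose laws are known.\<close>

lemma nn_integral_ord3:
  fixes f :: "real \<times> ('a \<Rightarrow> real) \<Rightarrow> ennreal"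
  assumes o: "ord3 A r D P E" and f[measurable]: "f \<in> borel_measurable (borel \<Otimes>\<^sub>M PL P)"
  shows "(\<integral>\<^sup>+F. f (low D F, restrict F P) * indicator (order_polytope A r) F \<partial>PL A) =
    pvol D (res r D) * (pvol E (res r E) * (\<integral>\<^sup>+u. \<integral>\<^sup>+w. ennreal (max 0 (1 - u - w) ^ card P) *
       (\<integral>\<^sup>+G. f (u, \<lambda>i\<in>P. u + (1 - u - w) * G i) * indicator (order_polytope P (res r P)) G \<partial>PL P)
       \<partial>alpha (card E) \<partial>alpha (card D)))"
proof -
  have A: "A = D \<union> P \<union> E" and fin: "finite A" and po: "partial_order_on A r" and P: "P \<noteq> {}"
    and dj: "D \<inter> P = {}" "D \<inter> E = {}" "P \<inter> E = {}" using o by (auto simp: ord3_def)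
  have fi[simp]: "finite D" "finite P" "finite E" using fin A by auto
  have sub: "D \<subseteq> A" "P \<subseteq> A" "E \<subseteq> A" using A by auto
  note poD = partial_order_on_res[OF po sub(1)] and poE = partial_order_on_res[OF po sub(3)]
  have [measurable]: "order_polytope D (res r D) \<in> sets (PL D)" "order_polytope P (res r P) \<in> sets (PL P)"
    "order_polytope E (res r E) \<in> sets (PL E)"
    by (auto intro!: sets_order_polytope res_sub)
  have [measurable]: "order_polytope A r \<in> sets (PL A)"
    using sets_order_polytope[OF fin partial_order_on_sub[OF po]] .
  have [measurable]: "low D \<in> borel_measurable (PL A)" "low D \<in> borel_measurable (PL D)" "high E \<in> borel_measurable (PL E)"
    "low D \<in> borel_measurable (PL (D \<union> E))" "high E \<in> borel_measurable (PL (D \<union> E))"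
    using sub by (auto intro!: low_measurable high_measurable)
  have [measurable]: "(\<lambda>F. restrict F P) \<in> measurable (PL A) (PL P)"
    "(\<lambda>F. restrict F D) \<in> measurable (PL (D \<union> E)) (PL D)" "(\<lambda>F. restrict F E) \<in> measurable (PL (D \<union> E)) (PL E)"
    using sub by (auto intro!: measurable_restrict_subset)
  interpret sP: sigma_finite_measure "PL P" by (rule sigma_finite_PL) simp
  interpret aE: prob_space "alpha (card E)" by (rule prob_space_alpha)
  \<comment> \<open>The integral over the fibre with lower end \<open>u\<close> and upper end
    \<open>1 - w\<close>, already rescaled to the polytope of \<open>P\<close>.\<close>
  define K where "K u w = ennreal (max 0 (1 - u - w) ^ card P) *
       (\<integral>\<^sup>+G. f (u, \<lambda>i\<in>P. u + (1 - u - w) * G i) * indicator (order_polytope P (res r P)) G \<partial>PL P)" for u w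
  have Km[measurable]: "(\<lambda>(u, w). K u w) \<in> borel_measurable (borel \<Otimes>\<^sub>M borel)"
    unfolding K_def by measurable
  define ID where "ID F = (indicator (order_polytope D (res r D)) F :: ennreal)" for F
  define IE where "IE F = (indicator (order_polytope E (res r E)) F :: ennreal)" for F
  define IP where "IP F = (indicator (order_polytope P (res r P)) F :: ennreal)" for F
  have [measurable]: "ID \<in> borel_measurable (PL D)" "IE \<in> borel_measurable (PL E)" "IP \<in> borel_measurable (PL P)"
    unfolding ID_def IE_def IP_def by measurable
  have "(\<integral>\<^sup>+F. f (low D F, restrict F P) * indicator (order_polytope A r) F \<partial>PL A) =
    (\<integral>\<^sup>+F. f (low D F, restrict F P) * indicator (order_polytope A r) F \<partial>PL ((D \<union> E) \<union> P))"
    using A by (simp add: Un_ac)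
  also have "\<dots> = (\<integral>\<^sup>+x. (\<integral>\<^sup>+y. f (low D (merge (D \<union> E) P (x, y)), restrict (merge (D \<union> E) P (x, y)) P)
       * indicator (order_polytope A r) (merge (D \<union> E) P (x, y)) \<partial>PL P) \<partial>PL (D \<union> E))"
  proof (rule lborel_prod.product_nn_integral_fold)
    have "(D \<union> E) \<union> P = A" using A by auto
    moreover have "(\<lambda>F. f (low D F, restrict F P) * indicator (order_polytope A r) F) \<in> borel_measurable (PL A)"
      by measurable
    ultimately show "(\<lambda>F. f (low D F, restrict F P) * indicator (order_polytope A r) F) \<in> borel_measurable (PL ((D \<union> E) \<union> P))"
      by (simp only:)
  qed (use dj in auto)
  also have "\<dots> = (\<integral>\<^sup>+x. ID (restrict x D) * (IE (restrict x E) * K (low D x) (1 - high E x)) \<partial>PL (D \<union> E))"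
  proof (rule nn_integral_cong)
    fix x :: "'a \<Rightarrow> real" assume x: "x \<in> space (PL (D \<union> E))"
    have "(\<integral>\<^sup>+y. f (low D (merge (D \<union> E) P (x, y)), restrict (merge (D \<union> E) P (x, y)) P)
       * indicator (order_polytope A r) (merge (D \<union> E) P (x, y)) \<partial>PL P)
      = (\<integral>\<^sup>+y. (ID (restrict x D) * IE (restrict x E)) *
         (f (low D x, y) * IP y * indicator {F. \<forall>i\<in>P. low D x \<le> F i \<and> F i \<le> high E x} y) \<partial>PL P)"
    proof (rule nn_integral_cong)
      fix y :: "'a \<Rightarrow> real" assume y: "y \<in> space (PL P)"
      let ?F = "merge (D \<union> E) P (x, y)"
      have F: "?F \<in> space (PL A)" using x y A unfolding space_PL
        by (auto simp: merge_def PiE_iff extensional_def)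
      have 1: "restrict ?F P = y" using y dj by (auto simp: merge_def space_PL PiE_iff extensional_def fun_eq_iff)
      have 2: "restrict ?F D = restrict x D" "restrict ?F E = restrict x E" using dj by (auto simp: merge_def fun_eq_iff)
      have 3: "low D ?F = low D x" by (rule low_cong) (auto simp: merge_def)
      have 4: "high E ?F = high E x" by (rule high_cong) (auto simp: merge_def)
      have 5: "(\<forall>i\<in>P. low D ?F \<le> ?F i \<and> ?F i \<le> high E ?F) \<longleftrightarrow> (\<forall>i\<in>P. low D x \<le> y i \<and> y i \<le> high E x)"
        unfolding 3 4 using dj by (auto simp: merge_def)
      show "f (low D ?F, restrict ?F P) * indicator (order_polytope A r) ?F =
        (ID (restrict x D) * IE (restrict x E)) *
         (f (low D x, y) * IP y * indicator {F. \<forall>i\<in>P. low D x \<le> F i \<and> F i \<le> high E x} y)"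
        using mem_ord3[OF o F] unfolding 5 unfolding 1 2 3
        by (simp add: ID_def IE_def IP_def indicator_def)
    qed
    also have "\<dots> = (ID (restrict x D) * IE (restrict x E)) *
      (\<integral>\<^sup>+y. f (low D x, y) * IP y * indicator {F. \<forall>i\<in>P. low D x \<le> F i \<and> F i \<le> high E x} y \<partial>PL P)"
    proof (rule nn_integral_cmult)
      have "{F \<in> space (PL P). \<forall>i\<in>P. low D x \<le> F i \<and> F i \<le> high E x} \<in> sets (PL P)"
        by (intro sets.sets_Collect_finite_All) measurable
      then have [measurable]: "(indicator {F. \<forall>i\<in>P. low D x \<le> F i \<and> F i \<le> high E x} :: _ \<Rightarrow> ennreal) \<in> borel_measurable (PL P)"
        by (subst borel_measurable_indicator_iff) (simp add: Int_def conj_commute)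
      show "(\<lambda>y. f (low D x, y) * IP y * indicator {F. \<forall>i\<in>P. low D x \<le> F i \<and> F i \<le> high E x} y)
        \<in> borel_measurable (PL P)"
        by measurable
    qed
    also have "\<dots> = ID (restrict x D) * (IE (restrict x E) * K (low D x) (1 - high E x))"
    proof (cases "restrict x D \<in> order_polytope D (res r D) \<and> restrict x E \<in> order_polytope E (res r E)")
      case True
      have "low D (restrict x D) = low D x" by (rule low_cong) simp
      moreover have "high E (restrict x E) = high E x" by (rule high_cong) simp
      ultimately have u: "0 \<le> low D x" "high E x \<le> 1"
        using low_high_range(1)[of D "restrict x D" "res r D"] low_high_range(4)[of E "restrict x E" "res r E"] True by auto
      have "(\<integral>\<^sup>+y. f (low D x, y) * IP y * indicator {F. \<forall>i\<in>P. low D x \<le> F i \<and> F i \<le> high E x} y \<partial>PL P)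
        = K (low D x) (1 - high E x)"
        unfolding IP_def K_def
        by (subst slab_inner[OF _ P res_sub u]) (simp_all add: algebra_simps)
      then show ?thesis by (simp add: mult.assoc)
    next
      case False then show ?thesis by (auto simp: ID_def IE_def)
    qed
    finally show "(\<integral>\<^sup>+y. f (low D (merge (D \<union> E) P (x, y)), restrict (merge (D \<union> E) P (x, y)) P)
       * indicator (order_polytope A r) (merge (D \<union> E) P (x, y)) \<partial>PL P) =
      ID (restrict x D) * (IE (restrict x E) * K (low D x) (1 - high E x))" .
  qed
  also have "\<dots> = (\<integral>\<^sup>+x. (\<integral>\<^sup>+y. ID (restrict (merge D E (x, y)) D) * (IE (restrict (merge D E (x, y)) E) *
      K (low D (merge D E (x, y))) (1 - high E (merge D E (x, y)))) \<partial>PL E) \<partial>PL D)"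
    by (rule lborel_prod.product_nn_integral_fold) (use dj in \<open>simp_all\<close>)
  also have "\<dots> = (\<integral>\<^sup>+x. (\<integral>\<^sup>+y. K (low D x) (1 - high E y) * IE y \<partial>PL E) * ID x \<partial>PL D)"
  proof (rule nn_integral_cong)
    fix x :: "'a \<Rightarrow> real" assume x: "x \<in> space (PL D)"
    have "(\<integral>\<^sup>+y. ID (restrict (merge D E (x, y)) D) * (IE (restrict (merge D E (x, y)) E) *
      K (low D (merge D E (x, y))) (1 - high E (merge D E (x, y)))) \<partial>PL E)
      = (\<integral>\<^sup>+y. ID x * (K (low D x) (1 - high E y) * IE y) \<partial>PL E)"
    proof (rule nn_integral_cong)
      fix y :: "'a \<Rightarrow> real" assume y: "y \<in> space (PL E)"
      have "restrict (merge D E (x, y)) D = x" "restrict (merge D E (x, y)) E = y"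
        using x y dj by (auto simp: merge_def space_PL PiE_iff extensional_def fun_eq_iff)
      moreover have "low D (merge D E (x, y)) = low D x" by (rule low_cong) (auto simp: merge_def)
      moreover have "high E (merge D E (x, y)) = high E y" by (rule high_cong) (use dj in \<open>auto simp: merge_def\<close>)
      ultimately show "ID (restrict (merge D E (x, y)) D) * (IE (restrict (merge D E (x, y)) E) *
        K (low D (merge D E (x, y))) (1 - high E (merge D E (x, y)))) = ID x * (K (low D x) (1 - high E y) * IE y)"
        by (simp add: mult_ac)
    qed
    also have "\<dots> = ID x * (\<integral>\<^sup>+y. K (low D x) (1 - high E y) * IE y \<partial>PL E)"
      by (rule nn_integral_cmult) measurable
    finally show "(\<integral>\<^sup>+y. ID (restrict (merge D E (x, y)) D) * (IE (restrict (merge D E (x, y)) E) *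
      K (low D (merge D E (x, y))) (1 - high E (merge D E (x, y)))) \<partial>PL E) =
      (\<integral>\<^sup>+y. K (low D x) (1 - high E y) * IE y \<partial>PL E) * ID x" by (simp add: mult.commute)
  qed
  also have "\<dots> = (\<integral>\<^sup>+x. (pvol E (res r E) * (\<integral>\<^sup>+w. K (low D x) w \<partial>alpha (card E))) * ID x \<partial>PL D)"
  proof (rule nn_integral_cong)
    fix x :: "'a \<Rightarrow> real"
    have "(\<integral>\<^sup>+y. K (low D x) (1 - high E y) * IE y \<partial>PL E) =
      pvol E (res r E) * (\<integral>\<^sup>+y. K (low D x) (1 - high E y) \<partial>opm E (res r E))"
      unfolding IE_def by (rule nn_integral_PL_opm[OF fi(3) poE]) measurable
    \<comment> \<open>Measured from the top wall, \<open>1 - high E\<close> has law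
      \<open>alpha (card E)\<close>, so both ends of the fibre are treated alike.\<close>
    also have "(\<integral>\<^sup>+y. K (low D x) (1 - high E y) \<partial>opm E (res r E)) = (\<integral>\<^sup>+w. K (low D x) w \<partial>alpha (card E))"
      unfolding distr_high[OF fi(3) poE, symmetric] by (subst nn_integral_distr) measurable
    finally show "(\<integral>\<^sup>+y. K (low D x) (1 - high E y) * IE y \<partial>PL E) * ID x =
      pvol E (res r E) * (\<integral>\<^sup>+w. K (low D x) w \<partial>alpha (card E)) * ID x" by simp
  qed
  also have "\<dots> = pvol D (res r D) * (\<integral>\<^sup>+x. pvol E (res r E) * (\<integral>\<^sup>+w. K (low D x) w \<partial>alpha (card E)) \<partial>opm D (res r D))"
    unfolding ID_def by (rule nn_integral_PL_opm[OF fi(1) poD]) measurable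
  also have "(\<integral>\<^sup>+x. pvol E (res r E) * (\<integral>\<^sup>+w. K (low D x) w \<partial>alpha (card E)) \<partial>opm D (res r D))
    = (\<integral>\<^sup>+u. pvol E (res r E) * (\<integral>\<^sup>+w. K u w \<partial>alpha (card E)) \<partial>alpha (card D))"
    unfolding distr_low[OF fi(1) poD, symmetric] by (subst nn_integral_distr) measurable
  also have "\<dots> = pvol E (res r E) * (\<integral>\<^sup>+u. \<integral>\<^sup>+w. K u w \<partial>alpha (card E) \<partial>alpha (card D))"
    by (rule nn_integral_cmult) measurable
  finally show ?thesis unfolding K_def .
qed

text \<open>The reciprocal of a multinomial coefficient: the normalizing constant of the Dirichlet
  law with parameters \<open>p\<close>, \<open>n + 1\<close>, \<open>q\<close> relative to the
  product of the two \<open>alpha\<close> laws.\<close>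

definition rho_norm :: "nat \<Rightarrow> nat \<Rightarrow> nat \<Rightarrow> real" where
  "rho_norm p n q = fact p * fact n * fact q / fact (p + n + q)"

lemma rho_norm_pos: "0 < rho_norm p n q"
  by (simp add: rho_norm_def)

abbreviation rho_norm_ennreal :: "nat \<Rightarrow> nat \<Rightarrow> nat \<Rightarrow> ennreal" where
  "rho_norm_ennreal p n q \<equiv> \<integral>\<^sup>+u. \<integral>\<^sup>+w. ennreal (max 0 (1 - u - w) ^ n) \<partial>alpha q \<partial>alpha p"

lemma pvol_ord3:
  assumes o: "ord3 A r D P E"
  shows "pvol A r = pvol D (res r D) * (pvol E (res r E) * (rho_norm_ennreal (card D) (card P) (card E) * pvol P (res r P)))"
proof -
  have A: "finite A" "r \<subseteq> A \<times> A" "finite P" using o partial_order_on_sub by (auto simp: ord3_def)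
  interpret aE: prob_space "alpha (card E)" by (rule prob_space_alpha)
  have "pvol A r = (\<integral>\<^sup>+F. (\<lambda>_. 1) (low D F, restrict F P) * indicator (order_polytope A r) F \<partial>PL A)"
    by (simp add: pvol_def sets_order_polytope A)
  also have "\<dots> = pvol D (res r D) * (pvol E (res r E) * (\<integral>\<^sup>+u. \<integral>\<^sup>+w. ennreal (max 0 (1 - u - w) ^ card P) *
       pvol P (res r P) \<partial>alpha (card E) \<partial>alpha (card D)))"
    by (subst nn_integral_ord3[OF o]) (simp_all add: nn_integral_pvol res_sub A pvol_def sets_order_polytope)
  also have "(\<integral>\<^sup>+u. \<integral>\<^sup>+w. ennreal (max 0 (1 - u - w) ^ card P) * pvol P (res r P) \<partial>alpha (card E) \<partial>alpha (card D))
    = rho_norm_ennreal (card D) (card P) (card E) * pvol P (res r P)"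
    by (simp add: nn_integral_multc)
  finally show ?thesis .
qed

lemma nn_integral_alpha_id: "(\<integral>\<^sup>+u. ennreal u \<partial>alpha p) = ennreal (p / (p + 1))"
proof -
  interpret prob_space "alpha (Suc p)" by (rule prob_space_alpha)
  have "(\<integral>\<^sup>+u. 1 \<partial>alpha (Suc p)) = 1" using emeasure_space_1 by simp
  then show ?thesis using alpha_moment[of "\<lambda>_. 1" p] by (simp add: add_ac)
qed

lemma nn_integral_alpha_compl: "(\<integral>\<^sup>+u. ennreal (max 0 (1 - u)) \<partial>alpha p) = ennreal (1 / (p + 1))"
proof -
  interpret prob_space "alpha p" by (rule prob_space_alpha)
  have "1 = (\<integral>\<^sup>+u. 1 \<partial>alpha p)" using emeasure_space_1 by simp
  also have "\<dots> = (\<integral>\<^sup>+u. ennreal u + ennreal (max 0 (1 - u)) \<partial>alpha p)"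
  proof (rule nn_integral_cong_AE)
    show "AE u in alpha p. 1 = ennreal u + ennreal (max 0 (1 - u))"
      using AE_alpha[of p] by eventually_elim (simp flip: ennreal_plus)
  qed
  also have "\<dots> = ennreal (p / (p + 1)) + (\<integral>\<^sup>+u. ennreal (max 0 (1 - u)) \<partial>alpha p)"
    by (subst nn_integral_add) (simp_all add: nn_integral_alpha_id)
  finally have *: "1 = ennreal (p / (p + 1)) + (\<integral>\<^sup>+u. ennreal (max 0 (1 - u)) \<partial>alpha p)" .
  have "real p / real (p + 1) + 1 / real (p + 1) = 1" by (simp add: field_simps)
  then have "1 = ennreal (p / (p + 1)) + ennreal (1 / (p + 1))"
    by (subst ennreal_plus[symmetric]) simp_all
  from trans[OF *[symmetric] this] show ?thesis
    unfolding ennreal_add_left_cancel by simp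
qed

lemma pvol_empty: "pvol {} (res r {}) = 1"
  by (simp add: pvol_def order_polytope_def res_def PiM_empty emeasure_count_space_finite)

lemma pvol_singleton: assumes "r \<subseteq> Id" shows "pvol {x} r = 1"
proof -
  have "order_polytope {x} r = Pi\<^sub>E {x} (\<lambda>_. {0..1})"
    using assms by (auto simp: order_polytope_def)
  then show ?thesis by (simp add: pvol_def lborel_prod.emeasure_PiM)
qed

lemma finite_linear_order_max:
  assumes "finite A" "A \<noteq> {}" "linear_order_on A L"
  shows "\<exists>x\<in>A. \<forall>y\<in>A. (y, x) \<in> L"
  using assms
proof (induction A arbitrary: L rule: finite_induct)
  case (insert a A)
  have L: "trans L" "total_on (insert a A) L" "refl_on (insert a A) L"
    using insert.prems by (auto simp: order_on_defs)
  show ?case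
  proof (cases "A = {}")
    case True then show ?thesis using L by (auto simp: refl_on_def)
  next
    case False
    have "linear_order_on A (res L A)"
      using insert.prems partial_order_on_res[of "insert a A" L A]
      by (auto simp: linear_order_on_def total_on_def res_def)
    from insert.IH[OF False this] obtain x where x: "x \<in> A" "\<forall>y\<in>A. (y, x) \<in> L" by (auto simp: res_def)
    show ?thesis
    proof (cases "(a, x) \<in> L")
      case True then show ?thesis using x by auto
    next
      case False
      then have xa: "(x, a) \<in> L" using L x insert.hyps by (auto simp: total_on_def)
      then have "\<forall>y\<in>A. (y, a) \<in> L" using x L(1) by (blast dest: transD)
      then show ?thesis using L by (auto simp: refl_on_def)
    qed
  qed
qed simp

lemma linear_order_on_res: "linear_order_on A L \<Longrightarrow> X \<subseteq> A \<Longrightarrow> linear_order_on X (res L X)"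
  using partial_order_on_res[of A L X] by (auto simp: linear_order_on_def total_on_def res_def)

text \<open>Peeling off the greatest element writes the chain as an ordinal sum with
  \<open>E\<close> empty and \<open>P\<close> a single point; integrating \<open>1 - u\<close> over
  the law of the maximum of the other \<open>n\<close> points contributes
  \<open>1 / (n + 1)\<close>.\<close>

lemma pvol_linear:
  assumes "finite A" "linear_order_on A L"
  shows "pvol A L = ennreal (1 / fact (card A))"
  using assms
proof (induction "card A" arbitrary: A L)
  case 0
  then have "A = {}" by simp
  moreover have "L = res L {}"
    using 0 \<open>A = {}\<close> partial_order_on_sub[of A L] by (auto simp: linear_order_on_def res_def)
  ultimately show ?case using pvol_empty[of L] by simp
next
  case (Suc n)
  then have "A \<noteq> {}" by auto
  with Suc finite_linear_order_max obtain x where x: "x \<in> A" "\<forall>y\<in>A. (y, x) \<in> L" by metis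
  have po: "partial_order_on A L" using Suc by (simp add: linear_order_on_def)
  have o: "ord3 A L (A - {x}) {x} {}"
    unfolding ord3_def using Suc x po by auto
  have c: "card (A - {x}) = n" using Suc x by simp
  have "pvol (A - {x}) (res L (A - {x})) = ennreal (1 / fact n)"
    using Suc.hyps(1)[of "A - {x}" "res L (A - {x})"] c Suc.prems linear_order_on_res[OF Suc.prems(2), of "A - {x}"] by auto
  moreover have "pvol {x} (res L {x}) = 1" by (rule pvol_singleton) (auto simp: res_def)
  \<comment> \<open>For \<open>q = 0\<close> the inner integral is evaluation at
    \<open>w = 0\<close>.\<close>
  moreover have "rho_norm_ennreal n 1 0 = ennreal (1 / (n + 1))"
    using nn_integral_alpha_compl[of n] by (simp add: alpha_def[of 0] nn_integral_return)
  ultimately show ?case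
    using pvol_ord3[OF o] c Suc.hyps(2)[symmetric]
    by (simp add: pvol_empty ennreal_mult[symmetric] field_simps)
qed

text \<open>The double integral is not evaluated directly. In a chain of \<open>p + n + q\<close>
  points cut into three, all volumes in the product formula are known reciprocals of factorials, and
  the integral is the only unknown.\<close>

lemma rho_norm_ennreal_eq: assumes "0 < n" shows "rho_norm_ennreal p n q = ennreal (rho_norm p n q)"
proof -
  define A where "A = {0..<p + n + q}"
  define L where "L = {(x, y). x \<in> A \<and> y \<in> A \<and> x \<le> (y :: nat)}"
  have lin: "linear_order_on A L"
    unfolding order_on_defs L_def refl_on_def trans_def antisym_def total_on_def by auto
  have fin: "finite A" by (simp add: A_def)
  have o: "ord3 A L {0..<p} {p..<p + n} {p + n..<p + n + q}"
    unfolding ord3_def using lin assms by (auto simp: A_def L_def linear_order_on_def)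
  have l: "pvol X (res L X) = ennreal (1 / fact (card X))" if "X \<subseteq> A" for X
    using that fin lin by (intro pvol_linear linear_order_on_res) (auto intro: finite_subset)
  have "ennreal (1 / fact (p + n + q)) = ennreal (1 / fact p) * (ennreal (1 / fact q) * (rho_norm_ennreal p n q * ennreal (1 / fact n)))"
    using pvol_ord3[OF o] pvol_linear[OF fin lin] l[of "{0..<p}"] l[of "{p..<p + n}"] l[of "{p + n..<p + n + q}"]
    by (simp add: A_def)
  also have "\<dots> = rho_norm_ennreal p n q * (ennreal (1 / fact p) * ennreal (1 / fact q) * ennreal (1 / fact n))"
    by (simp only: mult_ac)
  also have "ennreal (1 / fact p) * ennreal (1 / fact q) * ennreal (1 / fact n) = ennreal (1 / (fact p * fact q * fact n))"
    by (simp add: ennreal_mult[symmetric])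
  finally have *: "ennreal (1 / fact (p + n + q)) = rho_norm_ennreal p n q * ennreal (1 / (fact p * fact q * fact n))" .
  have "rho_norm_ennreal p n q = rho_norm_ennreal p n q * (ennreal (1 / (fact p * fact q * fact n)) * ennreal (fact p * fact q * fact n))"
    by (subst ennreal_mult[symmetric]) auto
  also have "\<dots> = ennreal (1 / fact (p + n + q)) * ennreal (fact p * fact q * fact n)"
    by (simp add: * mult.assoc)
  also have "\<dots> = ennreal (rho_norm p n q)"
    by (subst ennreal_mult[symmetric]) (auto simp: rho_norm_def mult_ac)
  finally show ?thesis .
qed

text \<open>The Dirichlet law of the vector \<open>(u, 1 - u - w, w)\<close> around a summand of
  \<open>n\<close> points. Taking the density relative to the \<open>alpha\<close> laws keeps
  \<open>p = 0\<close> and \<open>q = 0\<close> in the same formula.\<close>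

definition rho :: "nat \<Rightarrow> nat \<Rightarrow> nat \<Rightarrow> (real \<times> real) measure" where
  "rho p n q = density (alpha p \<Otimes>\<^sub>M alpha q) (\<lambda>x. ennreal (max 0 (1 - fst x - snd x) ^ n / rho_norm p n q))"

lemma sets_rho[simp, measurable_cong]: "sets (rho p n q) = sets (borel \<Otimes>\<^sub>M borel)"
  by (simp add: rho_def cong: sets_pair_measure_cong)

lemma space_rho[simp]: "space (rho p n q) = UNIV"
  by (simp add: rho_def space_pair_measure)

lemma nn_integral_rho:
  assumes [measurable]: "f \<in> borel_measurable (borel \<Otimes>\<^sub>M borel)"
  shows "(\<integral>\<^sup>+x. f x \<partial>rho p n q) = ennreal (1 / rho_norm p n q) *
    (\<integral>\<^sup>+u. \<integral>\<^sup>+w. ennreal (max 0 (1 - u - w) ^ n) * f (u, w) \<partial>alpha q \<partial>alpha p)"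
proof -
  interpret q: prob_space "alpha q" by (rule prob_space_alpha)
  have "(\<integral>\<^sup>+x. f x \<partial>rho p n q) = (\<integral>\<^sup>+x. ennreal (max 0 (1 - fst x - snd x) ^ n / rho_norm p n q) * f x \<partial>(alpha p \<Otimes>\<^sub>M alpha q))"
    unfolding rho_def by (rule nn_integral_density) measurable
  also have "\<dots> = (\<integral>\<^sup>+u. \<integral>\<^sup>+w. ennreal (max 0 (1 - u - w) ^ n / rho_norm p n q) * f (u, w) \<partial>alpha q \<partial>alpha p)"
    by (subst q.nn_integral_fst[symmetric]) auto
  also have "\<dots> = (\<integral>\<^sup>+u. \<integral>\<^sup>+w. ennreal (1 / rho_norm p n q) * (ennreal (max 0 (1 - u - w) ^ n) * f (u, w)) \<partial>alpha q \<partial>alpha p)"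
  proof -
    have "ennreal (max 0 (1 - u - w) ^ n / rho_norm p n q) = ennreal (1 / rho_norm p n q) * ennreal (max 0 (1 - u - w) ^ n)" for u w
      using rho_norm_pos[of p n q] by (subst ennreal_mult[symmetric]) auto
    then show ?thesis by (simp add: mult.assoc)
  qed
  finally show ?thesis by (simp add: nn_integral_cmult)
qed

lemma prob_space_rho: assumes "0 < n" shows "prob_space (rho p n q)"
proof
  have "emeasure (rho p n q) (space (rho p n q)) = (\<integral>\<^sup>+x. 1 \<partial>rho p n q)" by simp
  also have "\<dots> = ennreal (1 / rho_norm p n q) * ennreal (rho_norm p n q)"
    by (subst nn_integral_rho) (simp_all add: rho_norm_ennreal_eq[OF assms])
  also have "\<dots> = 1" using rho_norm_pos[of p n q] by (simp add: ennreal_mult[symmetric])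
  finally show "emeasure (rho p n q) (space (rho p n q)) = 1" .
qed

lemma pvol_cancel:
  assumes "finite A" "partial_order_on A r" "pvol A r * x = pvol A r * y"
  shows "x = y"
  using assms(3) pvol_pos[OF assms(1,2)] pvol_fin[OF assms(1), of r]
  unfolding ennreal_mult_cancel_left by auto

text \<open>Dividing the volume computation by the volume of the whole polytope normalizes its
  kernel to the Dirichlet law.\<close>

lemma nn_integral_opm_ord3:
  assumes o: "ord3 A r D P E" and f[measurable]: "f \<in> borel_measurable (borel \<Otimes>\<^sub>M PL P)"
  shows "(\<integral>\<^sup>+F. f (low D F, restrict F P) \<partial>opm A r) =
    (\<integral>\<^sup>+x. \<integral>\<^sup>+G. f (fst x, \<lambda>i\<in>P. fst x + (1 - fst x - snd x) * G i) \<partial>opm P (res r P) \<partial>rho (card D) (card P) (card E))"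
proof -
  have A: "finite A" "partial_order_on A r" "r \<subseteq> A \<times> A" "finite P" "finite D" "finite E" "P \<noteq> {}" "A = D \<union> P \<union> E"
    using o partial_order_on_sub by (auto simp: ord3_def)
  have sub: "P \<subseteq> A" "D \<subseteq> A" "E \<subseteq> A" using A by auto
  have poP: "partial_order_on P (res r P)" "partial_order_on D (res r D)" "partial_order_on E (res r E)"
    using partial_order_on_res A sub by blast+
  have cP: "0 < card P" using A by (simp add: card_gt_0_iff)
  interpret P: prob_space "opm P (res r P)" by (rule prob_space_opm[OF A(4) poP(1)])
  let ?z = "rho_norm (card D) (card P) (card E)"
  let ?I = "\<lambda>u w. \<integral>\<^sup>+G. f (u, \<lambda>i\<in>P. u + (1 - u - w) * G i) \<partial>opm P (res r P)"
  have [measurable]: "(\<lambda>F. restrict F P) \<in> measurable (PL A) (PL P)" "low D \<in> borel_measurable (PL A)"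
    using A sub by (auto intro!: measurable_restrict_subset low_measurable)
  interpret aE: prob_space "alpha (card E)" by (rule prob_space_alpha)
  let ?J = "\<integral>\<^sup>+u. \<integral>\<^sup>+w. ennreal (max 0 (1 - u - w) ^ card P) * ?I u w \<partial>alpha (card E) \<partial>alpha (card D)"
  have "pvol A r * (\<integral>\<^sup>+F. f (low D F, restrict F P) \<partial>opm A r) =
    (\<integral>\<^sup>+F. f (low D F, restrict F P) * indicator (order_polytope A r) F \<partial>PL A)"
    by (rule nn_integral_PL_opm[OF A(1,2), symmetric]) measurable
  also have "\<dots> = pvol D (res r D) * (pvol E (res r E) * (\<integral>\<^sup>+u. \<integral>\<^sup>+w. ennreal (max 0 (1 - u - w) ^ card P) *
       (pvol P (res r P) * ?I u w) \<partial>alpha (card E) \<partial>alpha (card D)))"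
    unfolding nn_integral_ord3[OF o f] by (subst nn_integral_PL_opm[OF A(4) poP(1)]) simp_all
  also have "\<dots> = pvol D (res r D) * (pvol E (res r E) * (\<integral>\<^sup>+u. \<integral>\<^sup>+w. pvol P (res r P) * (ennreal (max 0 (1 - u - w) ^ card P) *
       ?I u w) \<partial>alpha (card E) \<partial>alpha (card D)))"
    by (simp add: mult_ac)
  also have "\<dots> = pvol D (res r D) * (pvol E (res r E) * (pvol P (res r P) * ?J))"
    by (simp add: nn_integral_cmult)
  also have "\<dots> = pvol A r * (ennreal (1 / ?z) * ?J)"
  proof -
    have "ennreal (1 / ?z) * ennreal ?z = 1"
      using rho_norm_pos[of "card D" "card P" "card E"] by (simp add: ennreal_mult[symmetric])
    then have "(ennreal (1 / ?z) * ennreal ?z) * ?J = ?J" by (simp only: mult_1)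
    then have "ennreal ?z * (ennreal (1 / ?z) * ?J) = ?J" by (simp only: mult_ac)
    then show ?thesis unfolding pvol_ord3[OF o] rho_norm_ennreal_eq[OF cP] by (simp add: mult_ac)
  qed
  finally have "pvol A r * (\<integral>\<^sup>+F. f (low D F, restrict F P) \<partial>opm A r) = pvol A r * (ennreal (1 / ?z) * ?J)" .
  then have "(\<integral>\<^sup>+F. f (low D F, restrict F P) \<partial>opm A r) = ennreal (1 / ?z) * ?J"
    by (rule pvol_cancel[OF A(1,2)])
  also have "\<dots> = (\<integral>\<^sup>+x. ?I (fst x) (snd x) \<partial>rho (card D) (card P) (card E))"
    by (subst nn_integral_rho) simp_all
  finally show ?thesis .
qed

text \<open>The value \<open>low D F\<close> is carried along as the first component because the gap
  below a minimal point of \<open>P\<close> is measured from it.\<close>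

definition aff :: "'a set \<Rightarrow> (real \<times> real) \<times> ('a \<Rightarrow> real) \<Rightarrow> real \<times> ('a \<Rightarrow> real)" where
  "aff P = (\<lambda>(x, G). (fst x, \<lambda>i\<in>P. fst x + (1 - fst x - snd x) * G i))"

lemma aff_measurable[measurable]: "aff P \<in> measurable ((borel \<Otimes>\<^sub>M borel) \<Otimes>\<^sub>M PL P) (borel \<Otimes>\<^sub>M PL P)"
  unfolding aff_def by measurable

lemma distr_ord3:
  assumes o: "ord3 A r D P E"
  shows "distr (opm A r) (borel \<Otimes>\<^sub>M PL P) (\<lambda>F. (low D F, restrict F P)) =
    distr (rho (card D) (card P) (card E) \<Otimes>\<^sub>M opm P (res r P)) (borel \<Otimes>\<^sub>M PL P) (aff P)"
proof (rule measure_eqI)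
  have A: "finite A" "partial_order_on A r" "finite P" "finite D" "P \<noteq> {}" "A = D \<union> P \<union> E"
    using o by (auto simp: ord3_def)
  have sub: "P \<subseteq> A" "D \<subseteq> A" using A by auto
  have [measurable]: "(\<lambda>F. restrict F P) \<in> measurable (PL A) (PL P)" "low D \<in> borel_measurable (PL A)"
    using A sub by (auto intro!: measurable_restrict_subset low_measurable)
  interpret P: prob_space "opm P (res r P)" by (rule prob_space_opm[OF A(3) partial_order_on_res[OF A(2) sub(1)]])
  fix X assume "X \<in> sets (distr (opm A r) (borel \<Otimes>\<^sub>M PL P) (\<lambda>F. (low D F, restrict F P)))"
  then have [measurable]: "X \<in> sets (borel \<Otimes>\<^sub>M PL P)" by simp
  have "emeasure (distr (opm A r) (borel \<Otimes>\<^sub>M PL P) (\<lambda>F. (low D F, restrict F P))) X =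
    (\<integral>\<^sup>+y. indicator X y \<partial>distr (opm A r) (borel \<Otimes>\<^sub>M PL P) (\<lambda>F. (low D F, restrict F P)))" by simp
  also have "\<dots> = (\<integral>\<^sup>+F. indicator X (low D F, restrict F P) \<partial>opm A r)"
    by (rule nn_integral_distr) measurable
  also have "\<dots> = (\<integral>\<^sup>+x. \<integral>\<^sup>+G. indicator X (aff P (x, G)) \<partial>opm P (res r P) \<partial>rho (card D) (card P) (card E))"
    by (subst nn_integral_opm_ord3[OF o]) (simp_all add: aff_def)
  also have "\<dots> = (\<integral>\<^sup>+y. indicator X (aff P y) \<partial>(rho (card D) (card P) (card E) \<Otimes>\<^sub>M opm P (res r P)))"
    by (rule P.nn_integral_fst) measurable
  also have "\<dots> = (\<integral>\<^sup>+y. indicator X y \<partial>distr (rho (card D) (card P) (card E) \<Otimes>\<^sub>M opm P (res r P)) (borel \<Otimes>\<^sub>M PL P) (aff P))"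
    by (rule nn_integral_distr[symmetric]) measurable
  finally show "emeasure (distr (opm A r) (borel \<Otimes>\<^sub>M PL P) (\<lambda>F. (low D F, restrict F P))) X =
    emeasure (distr (rho (card D) (card P) (card E) \<Otimes>\<^sub>M opm P (res r P)) (borel \<Otimes>\<^sub>M PL P) (aff P)) X" by simp
qed simp

subsection \<open>Disjoint unions\<close>

definition par :: "'a set \<Rightarrow> 'a rel \<Rightarrow> 'a set \<Rightarrow> 'a set \<Rightarrow> bool" where
  "par A r B C \<longleftrightarrow> finite A \<and> partial_order_on A r \<and> A = B \<union> C \<and> B \<inter> C = {} \<and> r = res r B \<union> res r C"

lemma mem_par:
  assumes o: "par A r B C" and F: "F \<in> space (PL A)"
  shows "F \<in> order_polytope A r \<longleftrightarrow>
    restrict F B \<in> order_polytope B (res r B) \<and> restrict F C \<in> order_polytope C (res r C)"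
proof -
  have A: "A = B \<union> C" "r \<subseteq> A \<times> A" "r = res r B \<union> res r C" using o partial_order_on_sub by (auto simp: par_def)
  have *: "restrict F X \<in> order_polytope X (res r X) \<longleftrightarrow>
    (\<forall>x\<in>X. 0 \<le> F x \<and> F x \<le> 1) \<and> (\<forall>p\<in>res r X. F (fst p) \<le> F (snd p))" for X
  proof -
    have "(\<forall>p\<in>res r X. restrict F X (fst p) \<le> restrict F X (snd p)) \<longleftrightarrow> (\<forall>p\<in>res r X. F (fst p) \<le> F (snd p))"
      by (intro ball_cong refl) (auto simp: res_def)
    then show ?thesis unfolding order_polytope_iff[OF res_sub] space_PL by auto
  qed
  have "(\<forall>p\<in>r. F (fst p) \<le> F (snd p)) \<longleftrightarrow> (\<forall>p\<in>res r B. F (fst p) \<le> F (snd p)) \<and> (\<forall>p\<in>res r C. F (fst p) \<le> F (snd p))"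
    using A(3) by blast
  then show ?thesis unfolding * order_polytope_iff[OF A(2)] using F A(1) by auto
qed

text \<open>Without comparisons between the parts the polytope is a product, so Fubini factors the
  volume and leaves an integral over independent random points.\<close>

lemma nn_integral_par:
  assumes o: "par A r B C" and f[measurable]: "f \<in> borel_measurable (PL B \<Otimes>\<^sub>M PL C)"
  shows "(\<integral>\<^sup>+F. f (restrict F B, restrict F C) * indicator (order_polytope A r) F \<partial>PL A) =
    pvol B (res r B) * (pvol C (res r C) * (\<integral>\<^sup>+x. \<integral>\<^sup>+y. f (x, y) \<partial>opm C (res r C) \<partial>opm B (res r B)))"
proof -
  have A: "finite A" "partial_order_on A r" "r \<subseteq> A \<times> A" "finite B" "finite C" "A = B \<union> C" "B \<inter> C = {}"
    using o partial_order_on_sub by (auto simp: par_def)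
  have sub: "B \<subseteq> A" "C \<subseteq> A" using A by auto
  note po = partial_order_on_res[OF A(2) sub(1)] partial_order_on_res[OF A(2) sub(2)]
  have [measurable]: "(\<lambda>F. restrict F B) \<in> measurable (PL A) (PL B)" "(\<lambda>F. restrict F C) \<in> measurable (PL A) (PL C)"
    using sub by (auto intro!: measurable_restrict_subset)
  have [measurable]: "order_polytope B (res r B) \<in> sets (PL B)" "order_polytope C (res r C) \<in> sets (PL C)"
    "order_polytope A r \<in> sets (PL A)"
    by (rule sets_order_polytope[OF A(4) res_sub] sets_order_polytope[OF A(5) res_sub] sets_order_polytope[OF A(1,3)])+
  interpret C: prob_space "opm C (res r C)" by (rule prob_space_opm[OF A(5) po(2)])
  interpret sC: sigma_finite_measure "PL C" by (rule sigma_finite_PL[OF A(5)])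
  have "(\<integral>\<^sup>+F. f (restrict F B, restrict F C) * indicator (order_polytope A r) F \<partial>PL A) =
    (\<integral>\<^sup>+x. (\<integral>\<^sup>+y. f (restrict (merge B C (x, y)) B, restrict (merge B C (x, y)) C) *
       indicator (order_polytope A r) (merge B C (x, y)) \<partial>PL C) \<partial>PL B)"
  proof -
    have "(\<lambda>F. f (restrict F B, restrict F C) * indicator (order_polytope A r) F) \<in> borel_measurable (PL A)"
      by measurable
    then have "(\<lambda>F. f (restrict F B, restrict F C) * indicator (order_polytope A r) F) \<in> borel_measurable (PL (B \<union> C))"
      by (simp only: A(6))
    from lborel_prod.product_nn_integral_fold[OF A(7,4,5) this] show ?thesis by (simp only: A(6))
  qed
  also have "\<dots> = (\<integral>\<^sup>+x. (\<integral>\<^sup>+y. f (x, y) * indicator (order_polytope C (res r C)) y \<partial>PL C) * indicator (order_polytope B (res r B)) x \<partial>PL B)"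
  proof (rule nn_integral_cong)
    fix x :: "'a \<Rightarrow> real" assume x: "x \<in> space (PL B)"
    have "(\<integral>\<^sup>+y. f (restrict (merge B C (x, y)) B, restrict (merge B C (x, y)) C) *
       indicator (order_polytope A r) (merge B C (x, y)) \<partial>PL C) =
      (\<integral>\<^sup>+y. (f (x, y) * indicator (order_polytope C (res r C)) y) * indicator (order_polytope B (res r B)) x \<partial>PL C)"
    proof (rule nn_integral_cong)
      fix y :: "'a \<Rightarrow> real" assume y: "y \<in> space (PL C)"
      have F: "merge B C (x, y) \<in> space (PL A)" using x y A unfolding space_PL
        by (auto simp: merge_def PiE_iff extensional_def)
      have 1: "restrict (merge B C (x, y)) B = x" "restrict (merge B C (x, y)) C = y"
        using x y A by (auto simp: merge_def space_PL PiE_iff extensional_def fun_eq_iff)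
      show "f (restrict (merge B C (x, y)) B, restrict (merge B C (x, y)) C) *
       indicator (order_polytope A r) (merge B C (x, y)) =
       (f (x, y) * indicator (order_polytope C (res r C)) y) * indicator (order_polytope B (res r B)) x"
        using mem_par[OF o F] unfolding 1 by (simp add: indicator_def)
    qed
    also have "\<dots> = (\<integral>\<^sup>+y. f (x, y) * indicator (order_polytope C (res r C)) y \<partial>PL C) * indicator (order_polytope B (res r B)) x"
      using x by (intro nn_integral_multc) measurable
    finally show "(\<integral>\<^sup>+y. f (restrict (merge B C (x, y)) B, restrict (merge B C (x, y)) C) *
       indicator (order_polytope A r) (merge B C (x, y)) \<partial>PL C) =
       (\<integral>\<^sup>+y. f (x, y) * indicator (order_polytope C (res r C)) y \<partial>PL C) * indicator (order_polytope B (res r B)) x" .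
  qed
  also have "\<dots> = pvol B (res r B) * (\<integral>\<^sup>+x. (\<integral>\<^sup>+y. f (x, y) * indicator (order_polytope C (res r C)) y \<partial>PL C) \<partial>opm B (res r B))"
    by (rule nn_integral_PL_opm[OF A(4) po(1)]) measurable
  also have "(\<integral>\<^sup>+x. (\<integral>\<^sup>+y. f (x, y) * indicator (order_polytope C (res r C)) y \<partial>PL C) \<partial>opm B (res r B))
    = (\<integral>\<^sup>+x. pvol C (res r C) * (\<integral>\<^sup>+y. f (x, y) \<partial>opm C (res r C)) \<partial>opm B (res r B))"
    by (intro nn_integral_cong nn_integral_PL_opm[OF A(5) po(2)]) simp
  also have "\<dots> = pvol C (res r C) * (\<integral>\<^sup>+x. (\<integral>\<^sup>+y. f (x, y) \<partial>opm C (res r C)) \<partial>opm B (res r B))"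
    by (rule nn_integral_cmult) measurable
  finally show ?thesis .
qed

lemma distr_par:
  assumes o: "par A r B C"
  shows "distr (opm A r) (PL B \<Otimes>\<^sub>M PL C) (\<lambda>F. (restrict F B, restrict F C)) =
    opm B (res r B) \<Otimes>\<^sub>M opm C (res r C)"
proof (rule measure_eqI)
  have A: "finite A" "partial_order_on A r" "r \<subseteq> A \<times> A" "finite B" "finite C" "A = B \<union> C" "B \<inter> C = {}"
    using o partial_order_on_sub by (auto simp: par_def)
  have sub: "B \<subseteq> A" "C \<subseteq> A" using A by auto
  note po = partial_order_on_res[OF A(2) sub(1)] partial_order_on_res[OF A(2) sub(2)]
  have [measurable]: "(\<lambda>F. restrict F B) \<in> measurable (PL A) (PL B)" "(\<lambda>F. restrict F C) \<in> measurable (PL A) (PL C)"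
    using sub by (auto intro!: measurable_restrict_subset)
  interpret C: prob_space "opm C (res r C)" by (rule prob_space_opm[OF A(5) po(2)])
  interpret B: prob_space "opm B (res r B)" by (rule prob_space_opm[OF A(4) po(1)])
  show "sets (distr (opm A r) (PL B \<Otimes>\<^sub>M PL C) (\<lambda>F. (restrict F B, restrict F C))) =
    sets (opm B (res r B) \<Otimes>\<^sub>M opm C (res r C))" by (simp cong: sets_pair_measure_cong)
  have pv: "pvol A r = pvol B (res r B) * pvol C (res r C)"
    using nn_integral_par[OF o, of "\<lambda>_. 1"] C.emeasure_space_1 B.emeasure_space_1 nn_integral_pvol[OF A(1,3)]
    by simp
  fix X assume "X \<in> sets (distr (opm A r) (PL B \<Otimes>\<^sub>M PL C) (\<lambda>F. (restrict F B, restrict F C)))"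
  then have [measurable]: "X \<in> sets (PL B \<Otimes>\<^sub>M PL C)" by simp
  have "emeasure (distr (opm A r) (PL B \<Otimes>\<^sub>M PL C) (\<lambda>F. (restrict F B, restrict F C))) X =
    (\<integral>\<^sup>+y. indicator X y \<partial>distr (opm A r) (PL B \<Otimes>\<^sub>M PL C) (\<lambda>F. (restrict F B, restrict F C)))" by simp
  also have "\<dots> = (\<integral>\<^sup>+F. indicator X (restrict F B, restrict F C) \<partial>opm A r)"
    by (rule nn_integral_distr) measurable
  finally have 1: "emeasure (distr (opm A r) (PL B \<Otimes>\<^sub>M PL C) (\<lambda>F. (restrict F B, restrict F C))) X =
    (\<integral>\<^sup>+F. indicator X (restrict F B, restrict F C) \<partial>opm A r)" .
  have "pvol A r * (\<integral>\<^sup>+F. indicator X (restrict F B, restrict F C) \<partial>opm A r) =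
    (\<integral>\<^sup>+F. indicator X (restrict F B, restrict F C) * indicator (order_polytope A r) F \<partial>PL A)"
    by (rule nn_integral_PL_opm[OF A(1,2), symmetric]) measurable
  also have "\<dots> = pvol A r * (\<integral>\<^sup>+x. \<integral>\<^sup>+y. indicator X (x, y) \<partial>opm C (res r C) \<partial>opm B (res r B))"
    by (subst nn_integral_par[OF o]) (simp_all add: pv mult.assoc)
  finally have "pvol A r * (\<integral>\<^sup>+F. indicator X (restrict F B, restrict F C) \<partial>opm A r) =
    pvol A r * (\<integral>\<^sup>+x. \<integral>\<^sup>+y. indicator X (x, y) \<partial>opm C (res r C) \<partial>opm B (res r B))" .
  then have "(\<integral>\<^sup>+F. indicator X (restrict F B, restrict F C) \<partial>opm A r) =
    (\<integral>\<^sup>+x. \<integral>\<^sup>+y. indicator X (x, y) \<partial>opm C (res r C) \<partial>opm B (res r B))"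
    by (rule pvol_cancel[OF A(1,2)])
  also have "\<dots> = (\<integral>\<^sup>+z. indicator X z \<partial>(opm B (res r B) \<Otimes>\<^sub>M opm C (res r C)))"
    by (rule C.nn_integral_fst) measurable
  also have "\<dots> = emeasure (opm B (res r B) \<Otimes>\<^sub>M opm C (res r C)) X" by simp
  finally show "emeasure (distr (opm A r) (PL B \<Otimes>\<^sub>M PL C) (\<lambda>F. (restrict F B, restrict F C))) X =
    emeasure (opm B (res r B) \<Otimes>\<^sub>M opm C (res r C)) X" using 1 by simp
qed

subsection \<open>Moments of the Dirichlet law\<close>

text \<open>The density vanishes where \<open>u + w\<close> reaches 1, because \<open>n\<close> is
  positive. Strictness makes the slope \<open>1 - u - w\<close> of the affine map positive, so that
  the map can be inverted.\<close>

lemma AE_rho: "AE x in rho p n q. 0 \<le> fst x \<and> 0 \<le> snd x \<and> fst x + snd x < 1" if n: "0 < n"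
proof -
  interpret p: prob_space "alpha p" by (rule prob_space_alpha)
  interpret q: prob_space "alpha q" by (rule prob_space_alpha)
  interpret pair_sigma_finite "alpha p" "alpha q" ..
  have *: "AE x in alpha p \<Otimes>\<^sub>M alpha q. 0 \<le> fst x \<and> 0 \<le> snd x"
  proof (rule AE_pair_measure)
    show "AE u in alpha p. AE w in alpha q. 0 \<le> fst (u, w) \<and> 0 \<le> snd (u, w)"
      using AE_alpha[of p]
    proof eventually_elim
      case (elim u)
      show ?case using AE_alpha[of q] by eventually_elim (use elim in simp)
    qed
  qed measurable
  have pw: "0 < t" if "0 < ennreal (max 0 t ^ n / z)" for t z :: real
    using that n by (cases "t \<le> 0") (auto simp: max_absorb1 power_0_left)
  have **: "AE x in alpha p \<Otimes>\<^sub>M alpha q. 0 < ennreal (max 0 (1 - fst x - snd x) ^ n / rho_norm p n q) \<longrightarrow>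
      0 \<le> fst x \<and> 0 \<le> snd x \<and> fst x + snd x < 1"
    using *
  proof eventually_elim
    case (elim x)
    show ?case
    proof (rule impI)
      assume a: "0 < ennreal (max 0 (1 - fst x - snd x) ^ n / rho_norm p n q)"
      from pw[OF a] elim show "0 \<le> fst x \<and> 0 \<le> snd x \<and> fst x + snd x < 1" by simp
    qed
  qed
  show ?thesis
    unfolding rho_def by (rule iffD2[OF AE_density]) (measurable, rule **)
qed

lemma rho_norm_Suc:
  "rho_norm (Suc p) n q = rho_norm p n q * ((real p + 1) / (real p + real n + real q + 1))" (is "?A1 = ?B1")
  "rho_norm p (Suc n) q = rho_norm p n q * ((real n + 1) / (real p + real n + real q + 1))" (is "?A2 = ?B2")
  "rho_norm p n (Suc q) = rho_norm p n q * ((real q + 1) / (real p + real n + real q + 1))" (is "?A3 = ?B3")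
proof -
  have *: "(a * P) * B * C / (k * F) = P * B * C / F * (a / k)" "B * (a * P) * C / (k * F) = B * P * C / F * (a / k)"
    "B * C * (a * P) / (k * F) = B * C * P / F * (a / k)" for a P B C k F :: real
    by (simp_all add: mult_ac)
  show "?A1 = ?B1" "?A2 = ?B2" "?A3 = ?B3"
    unfolding rho_norm_def using * by (simp_all add: add_ac)
qed

text \<open>Multiplying by \<open>u\<close> raises the first Dirichlet parameter by one, so first
  and second moments follow by iteration, without evaluating an integral.\<close>

lemma nn_rho_fst:
  assumes [measurable]: "g \<in> borel_measurable (borel \<Otimes>\<^sub>M borel)"
  shows "(\<integral>\<^sup>+x. ennreal (fst x) * g x \<partial>rho p n q) =
    ennreal (p / (real p + real n + real q + 1)) * (\<integral>\<^sup>+x. g x \<partial>rho (Suc p) n q)"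
proof -
  interpret q: prob_space "alpha q" by (rule prob_space_alpha)
  define h where "h u = (\<integral>\<^sup>+w. ennreal (max 0 (1 - u - w) ^ n) * g (u, w) \<partial>alpha q)" for u
  have [measurable]: "h \<in> borel_measurable borel" unfolding h_def by measurable
  have 1: "(\<integral>\<^sup>+w. ennreal (max 0 (1 - u - w) ^ n) * (ennreal u * g (u, w)) \<partial>alpha q) = ennreal u * h u" for u
  proof -
    have "(\<integral>\<^sup>+w. ennreal (max 0 (1 - u - w) ^ n) * (ennreal u * g (u, w)) \<partial>alpha q) =
      (\<integral>\<^sup>+w. ennreal u * (ennreal (max 0 (1 - u - w) ^ n) * g (u, w)) \<partial>alpha q)"
      by (simp add: mult_ac)
    also have "\<dots> = ennreal u * h u"
      unfolding h_def by (rule nn_integral_cmult) measurable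
    finally show ?thesis .
  qed
  have "(\<integral>\<^sup>+x. ennreal (fst x) * g x \<partial>rho p n q) = ennreal (1 / rho_norm p n q) * (\<integral>\<^sup>+u. ennreal u * h u \<partial>alpha p)"
    by (subst nn_integral_rho) (simp_all add: 1)
  also have "\<dots> = (ennreal (1 / rho_norm p n q) * ennreal (p / (real p + 1))) * (\<integral>\<^sup>+u. h u \<partial>alpha (Suc p))"
    by (subst alpha_moment) (simp_all add: mult.assoc)
  also have "ennreal (1 / rho_norm p n q) * ennreal (p / (real p + 1)) = ennreal (p / (real p + real n + real q + 1)) * ennreal (1 / rho_norm (Suc p) n q)"
    using rho_norm_pos[of p n q] by (simp add: ennreal_mult[symmetric] rho_norm_Suc)
  finally show ?thesis
    by (subst nn_integral_rho) (simp_all add: h_def mult.assoc)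
qed

lemma nn_rho_snd:
  assumes [measurable]: "g \<in> borel_measurable (borel \<Otimes>\<^sub>M borel)"
  shows "(\<integral>\<^sup>+x. ennreal (snd x) * g x \<partial>rho p n q) =
    ennreal (q / (real p + real n + real q + 1)) * (\<integral>\<^sup>+x. g x \<partial>rho p n (Suc q))"
proof -
  interpret q: prob_space "alpha q" by (rule prob_space_alpha)
  interpret q1: prob_space "alpha (Suc q)" by (rule prob_space_alpha)
  have 1: "(\<integral>\<^sup>+w. ennreal (max 0 (1 - u - w) ^ n) * (ennreal w * g (u, w)) \<partial>alpha q) =
    ennreal (q / (real q + 1)) * (\<integral>\<^sup>+w. ennreal (max 0 (1 - u - w) ^ n) * g (u, w) \<partial>alpha (Suc q))" for u
  proof -
    have "(\<integral>\<^sup>+w. ennreal (max 0 (1 - u - w) ^ n) * (ennreal w * g (u, w)) \<partial>alpha q) =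
      (\<integral>\<^sup>+w. ennreal w * (ennreal (max 0 (1 - u - w) ^ n) * g (u, w)) \<partial>alpha q)"
      by (simp add: mult_ac)
    also have "\<dots> = ennreal (q / (real q + 1)) * (\<integral>\<^sup>+w. ennreal (max 0 (1 - u - w) ^ n) * g (u, w) \<partial>alpha (Suc q))"
      by (rule alpha_moment) measurable
    finally show ?thesis .
  qed
  have "(\<integral>\<^sup>+x. ennreal (snd x) * g x \<partial>rho p n q) = ennreal (1 / rho_norm p n q) *
     (\<integral>\<^sup>+u. ennreal (q / (real q + 1)) * (\<integral>\<^sup>+w. ennreal (max 0 (1 - u - w) ^ n) * g (u, w) \<partial>alpha (Suc q)) \<partial>alpha p)"
    by (subst nn_integral_rho) (simp_all add: 1)
  also have "\<dots> = (ennreal (1 / rho_norm p n q) * ennreal (q / (real q + 1))) *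
     (\<integral>\<^sup>+u. (\<integral>\<^sup>+w. ennreal (max 0 (1 - u - w) ^ n) * g (u, w) \<partial>alpha (Suc q)) \<partial>alpha p)"
    by (subst nn_integral_cmult) (simp_all add: mult.assoc)
  also have "ennreal (1 / rho_norm p n q) * ennreal (q / (real q + 1)) = ennreal (q / (real p + real n + real q + 1)) * ennreal (1 / rho_norm p n (Suc q))"
    using rho_norm_pos[of p n q] by (simp add: ennreal_mult[symmetric] rho_norm_Suc)
  finally show ?thesis
    by (subst nn_integral_rho) (simp_all add: mult.assoc)
qed

text \<open>The exponent \<open>n\<close> belongs to the Dirichlet parameter \<open>n + 1\<close>,
  hence a numerator \<open>n + 1\<close> where the other two coordinates have \<open>p\<close> and
  \<open>q\<close>.\<close>

lemma nn_rho_mid: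
  assumes [measurable]: "g \<in> borel_measurable (borel \<Otimes>\<^sub>M borel)"
  shows "(\<integral>\<^sup>+x. ennreal (1 - fst x - snd x) * g x \<partial>rho p n q) =
    ennreal ((real n + 1) / (real p + real n + real q + 1)) * (\<integral>\<^sup>+x. g x \<partial>rho p (Suc n) q)"
proof -
  have 1: "ennreal (max 0 (1 - u - w) ^ n) * (ennreal (1 - u - w) * y) = ennreal (max 0 (1 - u - w) ^ Suc n) * y" for u w y
  proof -
    have "ennreal (max 0 (1 - u - w) ^ n) * ennreal (max 0 (1 - u - w)) = ennreal (max 0 (1 - u - w) ^ Suc n)"
      by (subst ennreal_mult[symmetric]) (simp_all add: mult.commute)
    then have "ennreal (max 0 (1 - u - w) ^ n) * ennreal (1 - u - w) = ennreal (max 0 (1 - u - w) ^ Suc n)"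
      by (simp only: ennreal_max_0)
    then show ?thesis by (simp only: mult.assoc[symmetric])
  qed
  have "(\<integral>\<^sup>+x. ennreal (1 - fst x - snd x) * g x \<partial>rho p n q) = ennreal (1 / rho_norm p n q) *
    (\<integral>\<^sup>+u. \<integral>\<^sup>+w. ennreal (max 0 (1 - u - w) ^ Suc n) * g (u, w) \<partial>alpha q \<partial>alpha p)"
    by (subst nn_integral_rho) (simp_all add: 1 del: power_Suc)
  also have "ennreal (1 / rho_norm p n q) = ennreal ((real n + 1) / (real p + real n + real q + 1)) * ennreal (1 / rho_norm p (Suc n) q)"
    using rho_norm_pos[of p n q] by (simp add: ennreal_mult[symmetric] rho_norm_Suc)
  finally show ?thesis
    by (subst nn_integral_rho) (simp_all add: mult.assoc)
qed

lemma nn_rho_moments: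
  assumes n: "0 < n" and N: "N = real (p + n + q)"
  shows "(\<integral>\<^sup>+x. ennreal (fst x) \<partial>rho p n q) = ennreal (p / (N + 1))"
    "(\<integral>\<^sup>+x. ennreal (fst x) * ennreal (fst x) \<partial>rho p n q) = ennreal (p / (N + 1) * ((real p + 1) / (N + 2)))"
    "(\<integral>\<^sup>+x. ennreal (snd x) \<partial>rho p n q) = ennreal (q / (N + 1))"
    "(\<integral>\<^sup>+x. ennreal (snd x) * ennreal (snd x) \<partial>rho p n q) = ennreal (q / (N + 1) * ((real q + 1) / (N + 2)))"
    "(\<integral>\<^sup>+x. ennreal (1 - fst x - snd x) \<partial>rho p n q) = ennreal ((real n + 1) / (N + 1))"
    "(\<integral>\<^sup>+x. ennreal (1 - fst x - snd x) * ennreal (1 - fst x - snd x) \<partial>rho p n q) =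
      ennreal ((real n + 1) / (N + 1) * ((real n + 2) / (N + 2)))"
proof -
  have one: "(\<integral>\<^sup>+x. 1 \<partial>rho a b c) = 1" if "0 < b" for a b c
    using prob_space.emeasure_space_1[OF prob_space_rho[OF that]] by simp
  have u: "(\<integral>\<^sup>+x. ennreal (fst x) \<partial>rho a n c) = ennreal (a / (real a + real n + real c + 1))" for a c
    using nn_rho_fst[of "\<lambda>_. 1" a n c] one[OF n] by simp
  have w: "(\<integral>\<^sup>+x. ennreal (snd x) \<partial>rho a n c) = ennreal (c / (real a + real n + real c + 1))" for a c
    using nn_rho_snd[of "\<lambda>_. 1" a n c] one[OF n] by simp
  have m: "(\<integral>\<^sup>+x. ennreal (1 - fst x - snd x) \<partial>rho a b c) = ennreal ((real b + 1) / (real a + real b + real c + 1))" if "0 < b" for a b c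
    using nn_rho_mid[of "\<lambda>_. 1" a b c] one[of "Suc b"] that by simp
  show "(\<integral>\<^sup>+x. ennreal (fst x) \<partial>rho p n q) = ennreal (p / (N + 1))" using u N by simp
  show "(\<integral>\<^sup>+x. ennreal (snd x) \<partial>rho p n q) = ennreal (q / (N + 1))" using w N by simp
  show "(\<integral>\<^sup>+x. ennreal (1 - fst x - snd x) \<partial>rho p n q) = ennreal ((real n + 1) / (N + 1))"
    using m[OF n] N by (simp add: add_ac)
  show "(\<integral>\<^sup>+x. ennreal (fst x) * ennreal (fst x) \<partial>rho p n q) = ennreal (p / (N + 1) * ((real p + 1) / (N + 2)))"
    by (subst nn_rho_fst) (simp_all add: u N ennreal_mult[symmetric] add_ac)
  show "(\<integral>\<^sup>+x. ennreal (snd x) * ennreal (snd x) \<partial>rho p n q) = ennreal (q / (N + 1) * ((real q + 1) / (N + 2)))"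
    by (subst nn_rho_snd) (simp_all add: w N ennreal_mult[symmetric] add_ac)
  show "(\<integral>\<^sup>+x. ennreal (1 - fst x - snd x) * ennreal (1 - fst x - snd x) \<partial>rho p n q) =
      ennreal ((real n + 1) / (N + 1) * ((real n + 2) / (N + 2)))"
    by (subst nn_rho_mid) (simp_all add: m N ennreal_mult[symmetric] add_ac)
qed

lemma rho_moments:
  assumes n: "0 < n" and N: "N = real (p + n + q)"
  shows "(\<integral>x. fst x \<partial>rho p n q) = p / (N + 1)"
    "(\<integral>x. (fst x)\<^sup>2 \<partial>rho p n q) = p / (N + 1) * ((real p + 1) / (N + 2))"
    "(\<integral>x. snd x \<partial>rho p n q) = q / (N + 1)"
    "(\<integral>x. (snd x)\<^sup>2 \<partial>rho p n q) = q / (N + 1) * ((real q + 1) / (N + 2))"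
    "(\<integral>x. 1 - fst x - snd x \<partial>rho p n q) = (real n + 1) / (N + 1)"
    "(\<integral>x. (1 - fst x - snd x)\<^sup>2 \<partial>rho p n q) = (real n + 1) / (N + 1) * ((real n + 2) / (N + 2))"
proof -
  note AE = AE_rho[OF n, of p q]
  note nn = nn_rho_moments[OF n N]
  have *: "(\<integral>x. f x \<partial>rho p n q) = c" if "(\<integral>\<^sup>+x. g x \<partial>rho p n q) = ennreal c" "0 \<le> c"
    "f \<in> borel_measurable (borel \<Otimes>\<^sub>M borel)"
    "\<And>x. 0 \<le> fst x \<Longrightarrow> 0 \<le> snd x \<Longrightarrow> fst x + snd x < 1 \<Longrightarrow> g x = ennreal (f x) \<and> 0 \<le> f x" for f g c
  proof -
    have "(\<integral>\<^sup>+x. ennreal (f x) \<partial>rho p n q) = ennreal c"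
      unfolding that(1)[symmetric] by (rule nn_integral_cong_AE) (use AE in eventually_elim, use that(4) in simp)
    moreover have "AE x in rho p n q. 0 \<le> f x" using AE by eventually_elim (use that(4) in simp)
    ultimately show ?thesis using that(2,3) by (subst (asm) nn_integral_eq_integrable) auto
  qed
  have N0: "0 \<le> N" by (simp add: N)
  show "(\<integral>x. fst x \<partial>rho p n q) = p / (N + 1)" by (rule *[OF nn(1)]) (use N0 in auto)
  show "(\<integral>x. (fst x)\<^sup>2 \<partial>rho p n q) = p / (N + 1) * ((real p + 1) / (N + 2))"
    by (rule *[OF nn(2)]) (use N0 in \<open>auto simp: ennreal_mult power2_eq_square\<close>)
  show "(\<integral>x. snd x \<partial>rho p n q) = q / (N + 1)" by (rule *[OF nn(3)]) (use N0 in auto)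
  show "(\<integral>x. (snd x)\<^sup>2 \<partial>rho p n q) = q / (N + 1) * ((real q + 1) / (N + 2))"
    by (rule *[OF nn(4)]) (use N0 in \<open>auto simp: ennreal_mult power2_eq_square\<close>)
  show "(\<integral>x. 1 - fst x - snd x \<partial>rho p n q) = (real n + 1) / (N + 1)"
    by (rule *[OF nn(5)]) (use N0 in \<open>auto simp: max_def\<close>)
  show "(\<integral>x. (1 - fst x - snd x)\<^sup>2 \<partial>rho p n q) = (real n + 1) / (N + 1) * ((real n + 2) / (N + 2))"
    by (rule *[OF nn(6)]) (use N0 in \<open>auto simp: max_def ennreal_mult power2_eq_square\<close>)
qed

section \<open>Correlation, variance and moments of a survival function\<close>

text \<open>Chebyshev's association inequality: the double integral of
  \<open>(f x - f y) * (g x - g y)\<close> over two independent copies is nonnegative and equals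
  twice the covariance.\<close>

lemma (in prob_space) covariance_nonneg:
  assumes [measurable]: "random_variable borel f" "random_variable borel g"
    and b: "\<And>x. \<bar>f x\<bar> \<le> (1::real)" "\<And>x. \<bar>g x\<bar> \<le> (1::real)"
    and mon: "AE x in M. AE y in M. 0 \<le> (f x - f y) * (g x - g y)"
  shows "expectation f * expectation g \<le> expectation (\<lambda>x. f x * g x)"
proof -
  have i[simp]: "integrable M f" "integrable M g" by (auto intro!: integrable_const_bound[where B=1] simp: b)
  have "\<bar>f x * g x\<bar> \<le> 1" for x using mult_mono[OF b(1)[of x] b(2)[of x]] by (simp add: abs_mult)
  then have i2[simp]: "integrable M (\<lambda>x. f x * g x)" by (auto intro!: integrable_const_bound[where B=1])
  have "0 \<le> expectation (\<lambda>x. expectation (\<lambda>y. (f x - f y) * (g x - g y)))"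
  proof (rule integral_nonneg_AE)
    show "AE x in M. 0 \<le> expectation (\<lambda>y. (f x - f y) * (g x - g y))"
      using mon by eventually_elim (rule integral_nonneg_AE)
  qed
  also have "(\<lambda>x. expectation (\<lambda>y. (f x - f y) * (g x - g y))) =
    (\<lambda>x. f x * g x - f x * expectation g - expectation f * g x + expectation (\<lambda>y. f y * g y))"
  proof
    fix x
    have "expectation (\<lambda>y. (f x - f y) * (g x - g y)) = expectation (\<lambda>y. f x * g x - f x * g y - g x * f y + f y * g y)"
      by (simp add: algebra_simps)
    also have "\<dots> = f x * g x - f x * expectation g - expectation f * g x + expectation (\<lambda>y. f y * g y)"
      by (simp add: prob_space)
    finally show "expectation (\<lambda>y. (f x - f y) * (g x - g y)) =
      f x * g x - f x * expectation g - expectation f * g x + expectation (\<lambda>y. f y * g y)" .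
  qed
  also have "expectation \<dots> = 2 * (expectation (\<lambda>x. f x * g x) - expectation f * expectation g)"
    by (simp add: prob_space)
  finally show ?thesis by simp
qed

text \<open>The mean is at distance at least \<open>(a - b) / 2\<close> from one of the two tails,
  and whichever it is, that tail has probability at least \<open>c\<close>.\<close>

lemma (in prob_space) variance_ge_two_point:
  assumes [measurable]: "random_variable borel f"
    and b: "\<And>x. \<bar>f x\<bar> \<le> (1::real)"
    and c: "c \<le> prob {x \<in> space M. a \<le> f x}" "c \<le> prob {x \<in> space M. f x \<le> b}" and ab: "b \<le> a" and c0: "0 \<le> c"
  shows "(expectation f)\<^sup>2 + c * ((a - b) / 2)\<^sup>2 \<le> expectation (\<lambda>x. (f x)\<^sup>2)"
proof -
  define m where "m = expectation f"
  have i[simp]: "integrable M f" by (auto intro!: integrable_const_bound[where B=1] simp: b)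
  have i2[simp]: "integrable M (\<lambda>x. (f x)\<^sup>2)" by (auto intro!: integrable_const_bound[where B=1] simp: b abs_square_le_1)
  have v: "expectation (\<lambda>x. (f x - m)\<^sup>2) = expectation (\<lambda>x. (f x)\<^sup>2) - m\<^sup>2"
  proof -
    have "expectation (\<lambda>x. (f x - m)\<^sup>2) = expectation (\<lambda>x. (f x)\<^sup>2 - 2 * m * f x + m\<^sup>2)"
      by (simp add: power2_diff algebra_simps)
    also have "\<dots> = expectation (\<lambda>x. (f x)\<^sup>2) - 2 * m * m + m\<^sup>2" by (simp add: prob_space m_def)
    finally show ?thesis by (simp add: power2_eq_square)
  qed
  have i3[simp]: "integrable M (\<lambda>x. (f x - m)\<^sup>2)"
    by (simp add: power2_diff)
  have key: "c * ((a - b) / 2)\<^sup>2 \<le> expectation (\<lambda>x. (f x - m)\<^sup>2)"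
    if X: "X \<in> events" "c \<le> prob X" "\<And>x. x \<in> X \<Longrightarrow> ((a - b) / 2)\<^sup>2 \<le> (f x - m)\<^sup>2" for X
  proof -
    have "c * ((a - b) / 2)\<^sup>2 \<le> prob X * ((a - b) / 2)\<^sup>2" using X by (intro mult_right_mono) auto
    also have "\<dots> = expectation (\<lambda>x. ((a - b) / 2)\<^sup>2 * indicator X x)" using X by simp
    also have "\<dots> \<le> expectation (\<lambda>x. (f x - m)\<^sup>2)"
    proof (rule integral_mono)
      show "integrable M (\<lambda>x. ((a - b) / 2)\<^sup>2 * indicator X x)"
        using X(1) by (intro integrable_const_bound[where B="((a - b) / 2)\<^sup>2"]) (auto simp: indicator_def)
    qed (use X in \<open>auto simp: indicator_def\<close>)
    finally show ?thesis .
  qed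
  have "c * ((a - b) / 2)\<^sup>2 \<le> expectation (\<lambda>x. (f x - m)\<^sup>2)"
  proof (cases "m \<le> (a + b) / 2")
    case True
    show ?thesis
    proof (rule key[OF _ c(1)])
      fix x assume "x \<in> {x \<in> space M. a \<le> f x}"
      then have "(a - b) / 2 \<le> f x - m" using True by (simp add: field_simps)
      then show "((a - b) / 2)\<^sup>2 \<le> (f x - m)\<^sup>2" using ab by (intro power_mono) auto
    qed simp
  next
    case False
    show ?thesis
    proof (rule key[OF _ c(2)])
      fix x assume "x \<in> {x \<in> space M. f x \<le> b}"
      then have "(a - b) / 2 \<le> m - f x" using False by (simp add: field_simps)
      then have "((a - b) / 2)\<^sup>2 \<le> (m - f x)\<^sup>2" using ab by (intro power_mono) auto
      then show "((a - b) / 2)\<^sup>2 \<le> (f x - m)\<^sup>2" by (simp add: power2_commute)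
    qed simp
  qed
  then show ?thesis using v by (simp add: m_def)
qed

text \<open>For independent variables of the atomless law \<open>M\<close> these are the
  probabilities that a given one of two, or of three, is the smallest. Symmetry forces the values,
  and Fubini expresses the symmetry.\<close>

lemma survival_moments:
  assumes M: "prob_space M" and s[measurable_cong]: "sets M = sets (borel :: real measure)"
    and na: "\<And>t. measure M {t} = 0"
  shows "(\<integral>t. measure M {t<..} \<partial>M) = 1/2" "(\<integral>t. (measure M {t<..})\<^sup>2 \<partial>M) = 1/3"
proof -
  interpret prob_space M by fact
  interpret Q: pair_prob_space M M ..
  have sp[simp]: "space M = UNIV" using sets_eq_imp_space_eq[OF s] by simp
  have pU[simp]: "measure M UNIV = 1" using prob_space by simp
  define S where "S t = measure M {t<..}" for t
  have S01: "0 \<le> S t" "S t \<le> 1" for t by (auto simp: S_def)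
  have Santi: "S t \<le> S s" if "s \<le> t" for s t unfolding S_def using that by (intro finite_measure_mono) auto
  have "mono (\<lambda>t. - S t)" using Santi by (auto simp: mono_def)
  then have "(\<lambda>t. - S t) \<in> borel_measurable borel" by (rule borel_measurable_mono)
  then have Sm[measurable]: "S \<in> borel_measurable borel" using borel_measurable_uminus[of "\<lambda>t. - S t" borel] by simp
  have Sx: "(\<integral>y. indicator {x<..} y \<partial>M) = S x" for x unfolding S_def by simp
  have Sle: "measure M {..<x} = 1 - S x" for x
  proof -
    have "measure M {..x} = 1 - S x" unfolding S_def using prob_compl[of "{x<..}"] by (simp add: Compl_eq_Diff_UNIV[symmetric])
    moreover have "measure M {..x} = measure M {..<x} + measure M {x}"
      by (subst finite_measure_Union[symmetric]) (auto intro!: arg_cong[where f="measure M"])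
    ultimately show ?thesis using na by simp
  qed
  have iS[simp]: "integrable M S" by (intro integrable_const_bound[where B=1]) (auto simp: S01)
  have iS2[simp]: "integrable M (\<lambda>x. (S x)\<^sup>2)"
    by (intro integrable_const_bound[where B=1]) (auto simp: S01 abs_square_le_1)
  have bi: "integrable (M \<Otimes>\<^sub>M M) f" if "f \<in> borel_measurable (borel \<Otimes>\<^sub>M borel)" "\<And>z. \<bar>f z\<bar> \<le> (1::real)" for f
    using that by (intro Q.P.integrable_const_bound[where B=1]) auto
  have fub: "(\<integral>x. \<integral>y. f (x, y) \<partial>M \<partial>M) = (\<integral>y. \<integral>x. f (x, y) \<partial>M \<partial>M)"
    if "f \<in> borel_measurable (borel \<Otimes>\<^sub>M borel)" "\<And>z. \<bar>f z\<bar> \<le> (1::real)" for f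
    using Q.Fubini_integral[of "\<lambda>x y. f (x, y)"] bi[OF that] by (simp add: split_beta')
  have A: "(\<integral>x. S x * g x \<partial>M) = (\<integral>y. \<integral>x. indicator {x<..} y * g x \<partial>M \<partial>M)"
    if [measurable]: "g \<in> borel_measurable borel" and g: "\<And>x. \<bar>g x\<bar> \<le> 1" for g
  proof -
    have m: "(\<lambda>z. indicator {fst z<..} (snd z) * g (fst z)) \<in> borel_measurable (borel \<Otimes>\<^sub>M borel)"
    proof -
      have "(\<lambda>z. indicator {fst z<..} (snd z) * g (fst z)) = (\<lambda>z. (if fst z < snd z then 1 else 0) * g (fst z))"
        by (auto simp: indicator_def)
      then show ?thesis by simp
    qed
    have "(\<integral>x. S x * g x \<partial>M) = (\<integral>x. \<integral>y. indicator {x<..} y * g x \<partial>M \<partial>M)"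
      by (simp add: S_def)
    also have "\<dots> = (\<integral>y. \<integral>x. indicator {x<..} y * g x \<partial>M \<partial>M)"
      using fub[OF m] g by (simp add: indicator_def)
    finally show ?thesis .
  qed
  have "(\<integral>x. S x \<partial>M) = (\<integral>y. (\<integral>x. indicator {x<..} y \<partial>M) \<partial>M)"
    using A[of "\<lambda>_. 1"] by simp
  also have "\<dots> = (\<integral>y. 1 - S y \<partial>M)"
  proof (rule arg_cong[where f="integral\<^sup>L M"], rule ext)
    fix y :: real
    have "(\<integral>x. indicator {x<..} y \<partial>M) = (\<integral>x. indicator {..<y} x \<partial>M :: real)"
      by (intro Bochner_Integration.integral_cong) (auto simp: indicator_def)
    then show "(\<integral>x. indicator {x<..} y \<partial>M) = 1 - S y" using Sle by simp
  qed
  also have "\<dots> = 1 - (\<integral>x. S x \<partial>M)" by (simp add: prob_space)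
  finally have half: "(\<integral>x. S x \<partial>M) = 1/2" by simp
  then show "(\<integral>t. measure M {t<..} \<partial>M) = 1/2" by (simp add: S_def)
  have sq: "(S x)\<^sup>2 = (\<integral>y. indicator {x<..} y * S x \<partial>M)" for x
    by (simp add: S_def power2_eq_square)
  have s1: "(\<integral>x. (S x)\<^sup>2 \<partial>M) = (\<integral>x. \<integral>y. indicator {x<..} y * S x \<partial>M \<partial>M)" by (simp only: sq)
  have s2: "(\<integral>x. (S x)\<^sup>2 \<partial>M) = (\<integral>x. \<integral>y. indicator {y<..} x * S y \<partial>M \<partial>M)"
    using A[OF Sm] S01 by (simp add: power2_eq_square)
  \<comment> \<open>\<open>S (min x y)\<close> integrates to \<open>2 \<integral> S\<^sup>2\<close> by splitting on \<open>x < y\<close>, and to \<open>1 - \<integral> S\<^sup>2\<close> by writing it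
     as the mass above \<open>min x y\<close>.\<close>
  have s3: "(\<integral>x. (S x)\<^sup>2 \<partial>M) = (\<integral>x. \<integral>y. (1 - max (S x) (S y)) \<partial>M \<partial>M)"
  proof -
    have "(\<integral>z. (S z)\<^sup>2 \<partial>M) = (\<integral>z. \<integral>x. indicator {z<..} x * S z \<partial>M \<partial>M)" by (rule s1)
    also have "\<dots> = (\<integral>x. \<integral>z. indicator {z<..} x * S z \<partial>M \<partial>M)" using s1 s2 by simp
    also have "\<dots> = (\<integral>x. \<integral>y. (1 - max (S x) (S y)) \<partial>M \<partial>M)"
    proof (rule arg_cong[where f="integral\<^sup>L M"], rule ext)
      fix x :: real
      have m: "(\<lambda>z. indicator {fst z<..} (snd z) * indicator {fst z<..} x :: real) \<in> borel_measurable (borel \<Otimes>\<^sub>M borel)"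
      proof -
        have "(\<lambda>z. indicator {fst z<..} (snd z) * indicator {fst z<..} x) = (\<lambda>z. (if fst z < snd z \<and> fst z < x then 1 else (0::real)))"
          by (auto simp: indicator_def)
        moreover have "(\<lambda>z. (if fst z < snd z \<and> fst z < x then 1 else (0::real))) \<in> borel_measurable (borel \<Otimes>\<^sub>M borel)"
          by measurable
        ultimately show ?thesis by (simp only:)
      qed
      have "(\<integral>z. indicator {z<..} x * S z \<partial>M) = (\<integral>z. \<integral>y. indicator {z<..} y * indicator {z<..} x \<partial>M \<partial>M)"
        by (simp add: S_def mult.commute)
      also have "\<dots> = (\<integral>y. \<integral>z. indicator {z<..} y * indicator {z<..} x \<partial>M \<partial>M)"
        using fub[OF m] by (simp add: indicator_def)
      also have "\<dots> = (\<integral>y. (1 - max (S x) (S y)) \<partial>M)"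
      proof (rule arg_cong[where f="integral\<^sup>L M"], rule ext)
        fix y :: real
        have "(\<integral>z. indicator {z<..} y * indicator {z<..} x \<partial>M) = (\<integral>z. indicator {..<min x y} z \<partial>M :: real)"
          by (intro Bochner_Integration.integral_cong) (auto simp: indicator_def)
        also have "\<dots> = 1 - S (min x y)" using Sle by simp
        also have "S (min x y) = max (S x) (S y)" using Santi[of x y] Santi[of y x] by (cases "x \<le> y") (auto simp: max_def min_def)
        finally show "(\<integral>z. indicator {z<..} y * indicator {z<..} x \<partial>M) = 1 - max (S x) (S y)" .
      qed
      finally show "(\<integral>z. indicator {z<..} x * S z \<partial>M) = (\<integral>y. (1 - max (S x) (S y)) \<partial>M)" .
    qed
    finally show ?thesis .
  qed
  have im: "integrable M (\<lambda>y. max (S x) (S y))" for x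
    by (intro integrable_const_bound[where B=1]) (auto simp: S01 max_def)
  have "(\<integral>x. (S x)\<^sup>2 \<partial>M) + (\<integral>x. (S x)\<^sup>2 \<partial>M) = (\<integral>x. \<integral>y. max (S x) (S y) \<partial>M \<partial>M)"
  proof -
    have m: "(\<lambda>z. indicator {fst z<..} (snd z) * S (fst z)) \<in> borel_measurable (borel \<Otimes>\<^sub>M borel)"
      "(\<lambda>z. indicator {snd z<..} (fst z) * S (snd z)) \<in> borel_measurable (borel \<Otimes>\<^sub>M borel)"
    proof -
      have "(\<lambda>z. indicator {fst z<..} (snd z) * S (fst z)) = (\<lambda>z. (if fst z < snd z then S (fst z) else 0))"
        "(\<lambda>z. indicator {snd z<..} (fst z) * S (snd z)) = (\<lambda>z. (if snd z < fst z then S (snd z) else 0))"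
        by (auto simp: indicator_def)
      then show "(\<lambda>z. indicator {fst z<..} (snd z) * S (fst z)) \<in> borel_measurable (borel \<Otimes>\<^sub>M borel)"
        "(\<lambda>z. indicator {snd z<..} (fst z) * S (snd z)) \<in> borel_measurable (borel \<Otimes>\<^sub>M borel)"
        by simp_all
    qed
    have b: "integrable M (\<lambda>x. \<integral>y. indicator {x<..} y * S x \<partial>M)" "integrable M (\<lambda>x. \<integral>y. indicator {y<..} x * S y \<partial>M)"
      using Q.integrable_fst'[OF bi[OF m(1)]] Q.integrable_fst'[OF bi[OF m(2)]] S01 by (simp_all add: indicator_def)
    \<comment> \<open>Ties are null, so the two strict indicators together cover almost the whole
      plane.\<close>
    have ae: "AE y in M. y \<noteq> x" for x
      using na[of x] by (intro AE_I[of _ _ "{x}"]) (auto simp: emeasure_eq_measure)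
    have "(\<integral>x. (S x)\<^sup>2 \<partial>M) + (\<integral>x. (S x)\<^sup>2 \<partial>M) =
      (\<integral>x. (\<integral>y. indicator {x<..} y * S x \<partial>M) + (\<integral>y. indicator {y<..} x * S y \<partial>M) \<partial>M)"
      using b s1 s2 by simp
    also have "\<dots> = (\<integral>x. \<integral>y. max (S x) (S y) \<partial>M \<partial>M)"
    proof (rule arg_cong[where f="integral\<^sup>L M"], rule ext)
      fix x :: real
      have [measurable]: "(\<lambda>y. indicator {y<..} x :: real) \<in> borel_measurable borel"
      proof -
        have "(\<lambda>y. indicator {y<..} x :: real) = indicator {..<x}" by (auto simp: indicator_def)
        then show ?thesis by simp
      qed
      have i: "integrable M (\<lambda>y. indicator {x<..} y * S x)" "integrable M (\<lambda>y. indicator {y<..} x * S y)"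
        by (auto intro!: integrable_const_bound[where B=1] simp: indicator_def S01)
      have "(\<integral>y. indicator {x<..} y * S x \<partial>M) + (\<integral>y. indicator {y<..} x * S y \<partial>M) =
        (\<integral>y. indicator {x<..} y * S x + indicator {y<..} x * S y \<partial>M)" using i by simp
      also have "\<dots> = (\<integral>y. max (S x) (S y) \<partial>M)"
      proof (rule integral_cong_AE)
        show "AE y in M. indicator {x<..} y * S x + indicator {y<..} x * S y = max (S x) (S y)"
          using ae[of x]
        proof eventually_elim
          case (elim y)
          then show ?case using Santi[of x y] Santi[of y x] by (auto simp: indicator_def max_def)
        qed
      qed measurable
      finally show "(\<integral>y. indicator {x<..} y * S x \<partial>M) + (\<integral>y. indicator {y<..} x * S y \<partial>M) = (\<integral>y. max (S x) (S y) \<partial>M)" .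
    qed
    finally show ?thesis .
  qed
  moreover have "(\<integral>x. \<integral>y. (1 - max (S x) (S y)) \<partial>M \<partial>M) = 1 - (\<integral>x. \<integral>y. max (S x) (S y) \<partial>M \<partial>M)"
  proof -
    have "(\<lambda>z. max (S (fst z)) (S (snd z))) \<in> borel_measurable (borel \<Otimes>\<^sub>M borel)" by measurable
    from Q.integrable_fst'[OF bi[OF this]] have "integrable M (\<lambda>x. \<integral>y. max (S x) (S y) \<partial>M)"
      using S01 by (simp add: max_def)
    then show ?thesis using im by (simp add: prob_space)
  qed
  ultimately have "(\<integral>x. (S x)\<^sup>2 \<partial>M) = 1/3" using s3 by linarith
  then show "(\<integral>t. (measure M {t<..})\<^sup>2 \<partial>M) = 1/3" by (simp add: S_def)
qed

section \<open>Integrals over an ordinal sum, conditioned on the affine map\<close>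

lemma integrable_opm:
  assumes "finite A" "partial_order_on A r" "f \<in> borel_measurable (PL A)"
    and "\<And>F. F \<in> order_polytope A r \<Longrightarrow> \<bar>f F\<bar> \<le> (K::real)"
  shows "integrable (opm A r) f"
proof -
  interpret prob_space "opm A r" by (rule prob_space_opm[OF assms(1,2)])
  show ?thesis
  proof (rule integrable_const_bound[where B=K])
    show "AE F in opm A r. norm (f F) \<le> K"
      using AE_opm[OF assms(1,2)] by eventually_elim (use assms(4) in simp)
  qed (use assms(3) in measurable)
qed

lemma order_polytope_range: "F \<in> order_polytope A r \<Longrightarrow> x \<in> A \<Longrightarrow> 0 \<le> F x \<and> F x \<le> 1"
  by (auto simp: order_polytope_def PiE_iff)

lemma order_polytope_le: "F \<in> order_polytope A r \<Longrightarrow> (x, y) \<in> r \<Longrightarrow> F x \<le> F y"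
  by (cases "x = y") (auto simp: order_polytope_def)

lemma ord3_facts:
  assumes "ord3 A r D P E"
  shows "finite A" "partial_order_on A r" "finite D" "finite P" "finite E" "P \<subseteq> A" "D \<subseteq> A" "E \<subseteq> A"
    "partial_order_on P (res r P)" "0 < card P" "(\<lambda>F. restrict F P) \<in> measurable (PL A) (PL P)"
    "low D \<in> borel_measurable (PL A)" "prob_space (opm P (res r P))" "prob_space (opm A r)"
    "prob_space (rho (card D) (card P) (card E))" "card A = card D + card P + card E"
proof -
  show A: "finite A" "partial_order_on A r" "finite D" "finite P" "finite E" "P \<subseteq> A" "D \<subseteq> A" "E \<subseteq> A"
    using assms by (auto simp: ord3_def)
  show P: "partial_order_on P (res r P)" by (rule partial_order_on_res[OF A(2,6)])
  show c: "0 < card P" using assms A by (auto simp: ord3_def card_gt_0_iff)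
  show "(\<lambda>F. restrict F P) \<in> measurable (PL A) (PL P)" by (rule measurable_restrict_subset[OF A(6)])
  show "low D \<in> borel_measurable (PL A)" by (rule low_measurable[OF A(3,7)])
  show "prob_space (opm P (res r P))" by (rule prob_space_opm[OF A(4) P])
  show "prob_space (opm A r)" by (rule prob_space_opm[OF A(1,2)])
  show "prob_space (rho (card D) (card P) (card E))" by (rule prob_space_rho[OF c])
  have "A = (D \<union> P) \<union> E" "(D \<union> P) \<inter> E = {}" "D \<inter> P = {}" using assms by (auto simp: ord3_def)
  then show "card A = card D + card P + card E" using A by (simp add: card_Un_disjoint)
qed

lemma aff_fixed_measurable[measurable]: "(\<lambda>G. aff P (x, G)) \<in> measurable (PL P) (borel \<Otimes>\<^sub>M PL P)"
  unfolding aff_def split_def fst_conv snd_conv by measurable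

lemma integral_ord3:
  fixes g :: "real \<times> ('a \<Rightarrow> real) \<Rightarrow> real"
  assumes o: "ord3 A r D P E" and g[measurable]: "g \<in> borel_measurable (borel \<Otimes>\<^sub>M PL P)"
    and int: "integrable (opm A r) (\<lambda>F. g (low D F, restrict F P))"
  shows "(\<integral>F. g (low D F, restrict F P) \<partial>opm A r) =
    (\<integral>x. \<integral>G. g (aff P (x, G)) \<partial>opm P (res r P) \<partial>rho (card D) (card P) (card E))"
proof -
  note f = ord3_facts[OF o]
  note [measurable] = f(11,12)
  interpret P: prob_space "opm P (res r P)" by (rule f)
  interpret R: prob_space "rho (card D) (card P) (card E)" by (rule f)
  interpret pair_sigma_finite "rho (card D) (card P) (card E)" "opm P (res r P)" ..
  have m: "(\<lambda>F. (low D F, restrict F P)) \<in> measurable (opm A r) (borel \<Otimes>\<^sub>M PL P)"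
    "aff P \<in> measurable (rho (card D) (card P) (card E) \<Otimes>\<^sub>M opm P (res r P)) (borel \<Otimes>\<^sub>M PL P)"
    by measurable
  have "integrable (distr (opm A r) (borel \<Otimes>\<^sub>M PL P) (\<lambda>F. (low D F, restrict F P))) g"
    using int by (subst integrable_distr_eq[OF m(1)]) auto
  then have i: "integrable (rho (card D) (card P) (card E) \<Otimes>\<^sub>M opm P (res r P)) (\<lambda>z. g (aff P z))"
    unfolding distr_ord3[OF o] by (subst (asm) integrable_distr_eq[OF m(2)]) auto
  have "(\<integral>F. g (low D F, restrict F P) \<partial>opm A r) =
    (\<integral>z. g z \<partial>distr (opm A r) (borel \<Otimes>\<^sub>M PL P) (\<lambda>F. (low D F, restrict F P)))"
    by (rule integral_distr[OF m(1) g, symmetric])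
  also have "\<dots> = (\<integral>z. g (aff P z) \<partial>(rho (card D) (card P) (card E) \<Otimes>\<^sub>M opm P (res r P)))"
    unfolding distr_ord3[OF o] by (rule integral_distr[OF m(2) g])
  also have "\<dots> = (\<integral>x. \<integral>G. g (aff P (x, G)) \<partial>opm P (res r P) \<partial>rho (card D) (card P) (card E))"
    by (rule integral_fst'[OF i, symmetric])
  finally show ?thesis .
qed

lemma prob_ord3:
  assumes o: "ord3 A r D P E" and Q: "{z \<in> space (borel \<Otimes>\<^sub>M PL P). Q z} \<in> sets (borel \<Otimes>\<^sub>M PL P)"
  shows "measure (opm A r) {F \<in> space (PL A). Q (low D F, restrict F P)} =
    (\<integral>x. measure (opm P (res r P)) {G \<in> space (PL P). Q (aff P (x, G))} \<partial>rho (card D) (card P) (card E))"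
proof -
  note f = ord3_facts[OF o]
  note [measurable] = f(11,12)
  interpret P: prob_space "opm P (res r P)" by (rule f)
  interpret A: prob_space "opm A r" by (rule f)
  let ?X = "{z \<in> space (borel \<Otimes>\<^sub>M PL P). Q z}"
  have m: "(\<lambda>F. (low D F, restrict F P)) \<in> measurable (PL A) (borel \<Otimes>\<^sub>M PL P)"
    by (rule measurable_Pair[OF f(12,11)])
  have s1: "{F \<in> space (PL A). Q (low D F, restrict F P)} = (\<lambda>F. (low D F, restrict F P)) -` ?X \<inter> space (PL A)"
    using measurable_space[OF m] by auto
  have s2: "{G \<in> space (PL P). Q (aff P (x, G))} = (\<lambda>G. aff P (x, G)) -` ?X \<inter> space (PL P)" for x
  proof -
    show ?thesis using measurable_space[OF aff_fixed_measurable[of P x]] by auto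
  qed
  have S1: "{F \<in> space (PL A). Q (low D F, restrict F P)} \<in> sets (PL A)"
    unfolding s1 using m Q by (rule measurable_sets)
  have "integrable (opm A r) (\<lambda>F. indicat_real ?X (low D F, restrict F P))"
    by (rule integrable_opm[where K=1, OF f(1,2)]) (use measurable_compose[OF m borel_measurable_indicator[OF Q]] in simp, auto simp: indicator_def)
  from integral_ord3[OF o borel_measurable_indicator[OF Q] this]
  have 1: "(\<integral>F. indicat_real ?X (low D F, restrict F P) \<partial>opm A r) =
    (\<integral>x. \<integral>G. indicat_real ?X (aff P (x, G)) \<partial>opm P (res r P) \<partial>rho (card D) (card P) (card E))" .
  have 2: "(\<integral>F. indicat_real ?X (low D F, restrict F P) \<partial>opm A r) = measure (opm A r) {F \<in> space (PL A). Q (low D F, restrict F P)}"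
  proof -
    have "(\<integral>F. indicat_real ?X (low D F, restrict F P) \<partial>opm A r) = (\<integral>F. indicat_real {F \<in> space (PL A). Q (low D F, restrict F P)} F \<partial>opm A r)"
      unfolding s1 by (intro Bochner_Integration.integral_cong) (auto simp: indicator_def)
    then show ?thesis using S1 by simp
  qed
  have 3: "(\<integral>G. indicat_real ?X (aff P (x, G)) \<partial>opm P (res r P)) = measure (opm P (res r P)) {G \<in> space (PL P). Q (aff P (x, G))}" for x
  proof -
    have "(\<integral>G. indicat_real ?X (aff P (x, G)) \<partial>opm P (res r P)) = (\<integral>G. indicat_real {G \<in> space (PL P). Q (aff P (x, G))} G \<partial>opm P (res r P))"
      unfolding s2 by (intro Bochner_Integration.integral_cong) (auto simp: indicator_def)
    moreover have "{G \<in> space (PL P). Q (aff P (x, G))} \<in> sets (PL P)"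
      unfolding s2 using aff_fixed_measurable Q by (rule measurable_sets)
    ultimately show ?thesis by simp
  qed
  show ?thesis using 1 unfolding 2 3 .
qed

subsection \<open>Joint survival functions\<close>

text \<open>The survival function of the smaller of two coordinates. Its diagonal is the one-point
  survival function, so monotonicity and measurability are proved once for both.\<close>

definition jsurv :: "'a set \<Rightarrow> 'a rel \<Rightarrow> 'a \<Rightarrow> 'a \<Rightarrow> real \<Rightarrow> real" where
  "jsurv A r x y t = measure (opm A r) {F \<in> space (PL A). t < F x \<and> t < F y}"

abbreviation surv :: "'a set \<Rightarrow> 'a rel \<Rightarrow> 'a \<Rightarrow> real \<Rightarrow> real" where
  "surv A r x \<equiv> jsurv A r x x"

lemma jsurv_facts:
  assumes "finite A" "partial_order_on A r" "x \<in> A" "y \<in> A"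
  shows "0 \<le> jsurv A r x y t" "jsurv A r x y t \<le> 1" "s \<le> t \<Longrightarrow> jsurv A r x y t \<le> jsurv A r x y s"
    "jsurv A r x y \<in> borel_measurable borel"
proof -
  interpret prob_space "opm A r" by (rule prob_space_opm[OF assms(1,2)])
  note [measurable] = assms(3,4)
  show "0 \<le> jsurv A r x y t" "jsurv A r x y t \<le> 1" by (auto simp: jsurv_def)
  have anti: "jsurv A r x y t \<le> jsurv A r x y s" if "s \<le> t" for s t
    unfolding jsurv_def using that by (intro finite_measure_mono) (auto, measurable)
  then show "s \<le> t \<Longrightarrow> jsurv A r x y t \<le> jsurv A r x y s" by blast
  have "mono (\<lambda>t. - jsurv A r x y t)" using anti by (auto simp: mono_def)
  then have "(\<lambda>t. - jsurv A r x y t) \<in> borel_measurable borel" by (rule borel_measurable_mono)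
  then show "jsurv A r x y \<in> borel_measurable borel"
    using borel_measurable_uminus[of "\<lambda>t. - jsurv A r x y t" borel] by simp
qed

text \<open>Inverting the affine map turns the fixed level \<open>t\<close> into the random level
  \<open>(t - u) / (1 - u - w)\<close> for the point of the summand. Both coordinates see the same
  level, which is a source of positive correlation.\<close>

lemma jsurv_ord3:
  assumes o: "ord3 A r D P E" and xy: "x \<in> P" "y \<in> P"
  shows "jsurv A r x y t = (\<integral>z. jsurv P (res r P) x y ((t - fst z) / (1 - fst z - snd z)) \<partial>rho (card D) (card P) (card E))"
proof -
  note f = ord3_facts[OF o]
  note [measurable] = xy
  note [measurable] = jsurv_facts(4)[OF f(4,9) xy]
  have Q: "{z \<in> space (borel \<Otimes>\<^sub>M PL P). t < snd z x \<and> t < snd z y} \<in> sets (borel \<Otimes>\<^sub>M PL P)" by measurable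
  have "jsurv A r x y t = measure (opm A r) {F \<in> space (PL A). t < snd (low D F, restrict F P) x \<and> t < snd (low D F, restrict F P) y}"
    using xy by (simp add: jsurv_def)
  also have "\<dots> = (\<integral>z. measure (opm P (res r P)) {G \<in> space (PL P). t < snd (aff P (z, G)) x \<and> t < snd (aff P (z, G)) y} \<partial>rho (card D) (card P) (card E))"
    by (rule prob_ord3[OF o Q])
  also have "\<dots> = (\<integral>z. jsurv P (res r P) x y ((t - fst z) / (1 - fst z - snd z)) \<partial>rho (card D) (card P) (card E))"
  proof (rule integral_cong_AE)
    show "AE z in rho (card D) (card P) (card E). measure (opm P (res r P)) {G \<in> space (PL P). t < snd (aff P (z, G)) x \<and> t < snd (aff P (z, G)) y}
      = jsurv P (res r P) x y ((t - fst z) / (1 - fst z - snd z))"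
      using AE_rho[OF f(10)]
    proof eventually_elim
      case (elim z)
      have c: "t < fst z + (1 - fst z - snd z) * a \<longleftrightarrow> (t - fst z) / (1 - fst z - snd z) < a" for a
        using elim by (simp add: pos_divide_less_eq) (auto simp: algebra_simps)
      show ?case unfolding jsurv_def aff_def using xy by (simp add: c)
    qed
    interpret P: prob_space "opm P (res r P)" by (rule f)
    have "(\<lambda>z. \<integral>G. indicat_real {z. t < snd z x \<and> t < snd z y} (aff P (z, G)) \<partial>opm P (res r P)) \<in> borel_measurable (borel \<Otimes>\<^sub>M borel)"
    proof -
      have "(\<lambda>w. indicat_real {z. t < snd z x \<and> t < snd z y} (aff P w)) = (\<lambda>w. if t < snd (aff P w) x \<and> t < snd (aff P w) y then 1 else 0)"
        by (auto simp: indicator_def)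
      then have [measurable]: "(\<lambda>w. indicat_real {z. t < snd z x \<and> t < snd z y} (aff P w)) \<in> borel_measurable ((borel \<Otimes>\<^sub>M borel) \<Otimes>\<^sub>M opm P (res r P))"
        by simp
      show ?thesis by measurable
    qed
    moreover have "(\<integral>G. indicat_real {z. t < snd z x \<and> t < snd z y} (aff P (z, G)) \<partial>opm P (res r P)) =
      measure (opm P (res r P)) {G \<in> space (PL P). t < snd (aff P (z, G)) x \<and> t < snd (aff P (z, G)) y}" for z
    proof -
      have "(\<integral>G. indicat_real {z. t < snd z x \<and> t < snd z y} (aff P (z, G)) \<partial>opm P (res r P)) =
        (\<integral>G. indicat_real {G \<in> space (PL P). t < snd (aff P (z, G)) x \<and> t < snd (aff P (z, G)) y} G \<partial>opm P (res r P))"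
        by (intro Bochner_Integration.integral_cong) (auto simp: indicator_def)
      moreover have "{G \<in> space (PL P). t < snd (aff P (z, G)) x \<and> t < snd (aff P (z, G)) y} \<in> sets (PL P)"
        unfolding aff_def using xy by simp
      ultimately show ?thesis by simp
    qed
    ultimately show "(\<lambda>z. measure (opm P (res r P)) {G \<in> space (PL P). t < snd (aff P (z, G)) x \<and> t < snd (aff P (z, G)) y})
      \<in> borel_measurable (rho (card D) (card P) (card E))" by simp
    show "(\<lambda>z. jsurv P (res r P) x y ((t - fst z) / (1 - fst z - snd z))) \<in> borel_measurable (rho (card D) (card P) (card E))"
      by measurable
  qed
  finally show ?thesis .
qed

text \<open>Given the affine map, the joint probability dominates the product by hypothesis. Both
  factors are decreasing functions of the same random level, so by Chebyshev's association
  inequality the mean of the product is at least the product of the means.\<close>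

lemma assoc_ord3:
  assumes o: "ord3 A r D P E" and xy: "x \<in> P" "y \<in> P"
    and a: "\<And>t. surv P (res r P) x t * surv P (res r P) y t \<le> jsurv P (res r P) x y t"
  shows "surv A r x t * surv A r y t \<le> jsurv A r x y t"
proof -
  note f = ord3_facts[OF o]
  interpret R: prob_space "rho (card D) (card P) (card E)" by (rule f)
  define s where "s z = (t - fst z) / (1 - fst z - snd z)" for z :: "real \<times> real"
  have [measurable]: "s \<in> borel_measurable (borel \<Otimes>\<^sub>M borel)" unfolding s_def by measurable
  note jx = jsurv_facts[OF f(4,9) xy(1,1)] and jy = jsurv_facts[OF f(4,9) xy(2,2)] and jxy = jsurv_facts[OF f(4,9) xy]
  note [measurable] = jx(4) jy(4) jxy(4)
  have "surv A r x t * surv A r y t \<le> R.expectation (\<lambda>z. surv P (res r P) x (s z) * surv P (res r P) y (s z))"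
    unfolding jsurv_ord3[OF o xy(1,1)] jsurv_ord3[OF o xy(2,2)] s_def[symmetric]
  proof (rule R.covariance_nonneg)
    show "AE z in rho (card D) (card P) (card E). AE w in rho (card D) (card P) (card E).
      0 \<le> (surv P (res r P) x (s z) - surv P (res r P) x (s w)) * (surv P (res r P) y (s z) - surv P (res r P) y (s w))"
    proof (intro AE_I2)
      fix z w
      show "0 \<le> (surv P (res r P) x (s z) - surv P (res r P) x (s w)) * (surv P (res r P) y (s z) - surv P (res r P) y (s w))"
      proof (cases "s z \<le> s w")
        case True then show ?thesis using jx(3) jy(3) by (intro mult_nonneg_nonneg) auto
      next
        case False then show ?thesis using jx(3) jy(3) by (intro mult_nonpos_nonpos) auto
      qed
    qed
  qed (use jx(1,2) jy(1,2) in \<open>auto simp: abs_le_iff intro: order_trans[of _ 0]\<close>)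
  also have "\<dots> \<le> R.expectation (\<lambda>z. jsurv P (res r P) x y (s z))"
  proof (rule integral_mono)
    show "integrable (rho (card D) (card P) (card E)) (\<lambda>z. surv P (res r P) x (s z) * surv P (res r P) y (s z))"
      by (rule R.integrable_const_bound[where B=1]) (use jx(1,2) jy(1,2) in \<open>auto simp: mult_le_one\<close>)
    show "integrable (rho (card D) (card P) (card E)) (\<lambda>z. jsurv P (res r P) x y (s z))"
      by (rule R.integrable_const_bound[where B=1]) (use jxy in auto)
  qed (rule a)
  also have "\<dots> = jsurv A r x y t" unfolding jsurv_ord3[OF o xy] s_def ..
  finally show ?thesis .
qed

lemma jsurv_commute: "jsurv A r x y t = jsurv A r y x t"
  by (simp add: jsurv_def conj_commute)

text \<open>If \<open>x\<close> is below \<open>y\<close>, then \<open>F x\<close> above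
  \<open>t\<close> forces \<open>F y\<close> above \<open>t\<close>, so the joint probability is the
  survival probability of \<open>x\<close> alone, and the other factor is at most 1.\<close>

lemma assoc_comparable:
  assumes A: "finite A" "partial_order_on A r" and xy: "(x, y) \<in> r \<or> (y, x) \<in> r"
  shows "surv A r x t * surv A r y t \<le> jsurv A r x y t"
proof -
  have *: "surv A r x t * surv A r y t \<le> jsurv A r x y t" if xy: "(x, y) \<in> r" for x y
  proof -
    have xA: "x \<in> A" "y \<in> A" using xy partial_order_on_sub[OF A(2)] by auto
    note [measurable] = xA
    have "jsurv A r x y t = surv A r x t"
      unfolding jsurv_def
    proof (rule measure_eq_AE)
      show "AE F in opm A r. F \<in> {F \<in> space (PL A). t < F x \<and> t < F y} \<longleftrightarrow> F \<in> {F \<in> space (PL A). t < F x \<and> t < F x}"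
        using AE_opm[OF A] by eventually_elim (use order_polytope_le[OF _ xy] in fastforce)
    qed simp_all
    then show ?thesis
      using jsurv_facts(1)[OF A xA(1,1), of t] jsurv_facts(2)[OF A xA(2,2), of t]
        mult_left_le[of "surv A r y t" "surv A r x t"] by simp
  qed
  from xy show ?thesis
  proof
    assume "(y, x) \<in> r" from *[OF this] show ?thesis by (simp add: jsurv_commute[of A r x y] mult.commute)
  qed (rule *)
qed

lemma par_commute: "par A r B C \<Longrightarrow> par A r C B"
  by (auto simp: par_def)

lemma par_facts:
  assumes "par A r B C"
  shows "finite A" "partial_order_on A r" "finite B" "finite C" "B \<subseteq> A" "C \<subseteq> A"
    "partial_order_on B (res r B)" "partial_order_on C (res r C)"
    "(\<lambda>F. restrict F B) \<in> measurable (PL A) (PL B)" "(\<lambda>F. restrict F C) \<in> measurable (PL A) (PL C)"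
    "prob_space (opm B (res r B))" "prob_space (opm C (res r C))" "prob_space (opm A r)"
proof -
  show A: "finite A" "partial_order_on A r" "finite B" "finite C" "B \<subseteq> A" "C \<subseteq> A"
    using assms by (auto simp: par_def)
  show P: "partial_order_on B (res r B)" "partial_order_on C (res r C)"
    by (rule partial_order_on_res[OF A(2,5)], rule partial_order_on_res[OF A(2,6)])
  show "(\<lambda>F. restrict F B) \<in> measurable (PL A) (PL B)" "(\<lambda>F. restrict F C) \<in> measurable (PL A) (PL C)"
    by (rule measurable_restrict_subset[OF A(5)], rule measurable_restrict_subset[OF A(6)])
  show "prob_space (opm B (res r B))" "prob_space (opm C (res r C))" "prob_space (opm A r)"
    by (rule prob_space_opm[OF A(3) P(1)], rule prob_space_opm[OF A(4) P(2)], rule prob_space_opm[OF A(1,2)])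
qed

lemma prob_par:
  assumes o: "par A r B C" and Q: "{z \<in> space (PL B \<Otimes>\<^sub>M PL C). Q z} \<in> sets (PL B \<Otimes>\<^sub>M PL C)"
  shows "measure (opm A r) {F \<in> space (PL A). Q (restrict F B, restrict F C)} =
    measure (opm B (res r B) \<Otimes>\<^sub>M opm C (res r C)) {z \<in> space (PL B \<Otimes>\<^sub>M PL C). Q z}"
proof -
  note f = par_facts[OF o]
  note [measurable] = f(9,10)
  have m: "(\<lambda>F. (restrict F B, restrict F C)) \<in> measurable (opm A r) (PL B \<Otimes>\<^sub>M PL C)" by measurable
  have "{F \<in> space (PL A). Q (restrict F B, restrict F C)} =
    (\<lambda>F. (restrict F B, restrict F C)) -` {z \<in> space (PL B \<Otimes>\<^sub>M PL C). Q z} \<inter> space (opm A r)"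
    using measurable_space[OF m] by auto
  then show ?thesis unfolding distr_par[OF o, symmetric] using measure_distr[OF m Q] by simp
qed

lemma distr_par_fst:
  assumes o: "par A r B C"
  shows "distr (opm A r) (PL B) (\<lambda>F. restrict F B) = opm B (res r B)"
proof -
  note f = par_facts[OF o]
  note [measurable] = f(9,10)
  interpret B: prob_space "opm B (res r B)" by (rule f)
  interpret C: prob_space "opm C (res r C)" by (rule f)
  have "distr (opm A r) (PL B) (\<lambda>F. restrict F B) =
    distr (distr (opm A r) (PL B \<Otimes>\<^sub>M PL C) (\<lambda>F. (restrict F B, restrict F C))) (PL B) fst"
    by (subst distr_distr) (auto simp: comp_def)
  also have "\<dots> = opm B (res r B)"
    unfolding distr_par[OF o]
  proof (rule measure_eqI)
    fix X assume "X \<in> sets (distr (opm B (res r B) \<Otimes>\<^sub>M opm C (res r C)) (PL B) fst)"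
    then have X: "X \<in> sets (PL B)" by simp
    then have XB: "X \<subseteq> space (PL B)" by (rule sets.sets_into_space)
    have "emeasure (distr (opm B (res r B) \<Otimes>\<^sub>M opm C (res r C)) (PL B) fst) X =
      emeasure (opm B (res r B) \<Otimes>\<^sub>M opm C (res r C)) (fst -` X \<inter> space (opm B (res r B) \<Otimes>\<^sub>M opm C (res r C)))"
      using X by (intro emeasure_distr) auto
    also have "fst -` X \<inter> space (opm B (res r B) \<Otimes>\<^sub>M opm C (res r C)) = X \<times> space (PL C)"
      using XB by (auto simp: space_pair_measure)
    also have "emeasure (opm B (res r B) \<Otimes>\<^sub>M opm C (res r C)) (X \<times> space (PL C)) = emeasure (opm B (res r B)) X"
      using X C.emeasure_space_1 by (subst C.emeasure_pair_measure_Times) auto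
    finally show "emeasure (distr (opm B (res r B) \<Otimes>\<^sub>M opm C (res r C)) (PL B) fst) X = emeasure (opm B (res r B)) X" .
  qed simp
  finally show ?thesis .
qed

lemma prob_par_fst:
  assumes o: "par A r B C" and Q: "{z \<in> space (PL B). Q z} \<in> sets (PL B)"
  shows "measure (opm A r) {F \<in> space (PL A). Q (restrict F B)} = measure (opm B (res r B)) {z \<in> space (PL B). Q z}"
proof -
  have m: "(\<lambda>F. restrict F B) \<in> measurable (opm A r) (PL B)" using par_facts(9)[OF o] by simp
  have "{F \<in> space (PL A). Q (restrict F B)} = (\<lambda>F. restrict F B) -` {z \<in> space (PL B). Q z} \<inter> space (opm A r)"
    using measurable_space[OF m] by auto
  then show ?thesis using measure_distr[OF m Q] unfolding distr_par_fst[OF o] by simp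
qed

lemma jsurv_par: "par A r B C \<Longrightarrow> x \<in> B \<Longrightarrow> y \<in> B \<Longrightarrow> jsurv A r x y t = jsurv B (res r B) x y t"
  using prob_par_fst[of A r B C "\<lambda>F. t < F x \<and> t < F y"] by (simp add: jsurv_def)

lemma jsurv_par_cross:
  assumes o: "par A r B C" and xy: "x \<in> B" "y \<in> C"
  shows "jsurv A r x y t = surv A r x t * surv A r y t"
proof -
  note f = par_facts[OF o]
  note [measurable] = xy
  interpret C: prob_space "opm C (res r C)" by (rule f)
  have "jsurv A r x y t = measure (opm A r) {F \<in> space (PL A). t < fst (restrict F B, restrict F C) x \<and> t < snd (restrict F B, restrict F C) y}"
    using xy by (simp add: jsurv_def)
  also have "\<dots> = measure (opm B (res r B) \<Otimes>\<^sub>M opm C (res r C)) {z \<in> space (PL B \<Otimes>\<^sub>M PL C). t < fst z x \<and> t < snd z y}"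
    by (rule prob_par[OF o]) measurable
  also have "{z \<in> space (PL B \<Otimes>\<^sub>M PL C). t < fst z x \<and> t < snd z y} = {F \<in> space (PL B). t < F x} \<times> {F \<in> space (PL C). t < F y}"
    by (auto simp: space_pair_measure)
  also have "measure (opm B (res r B) \<Otimes>\<^sub>M opm C (res r C)) \<dots> = surv B (res r B) x t * surv C (res r C) y t"
    by (simp add: measure_def C.emeasure_pair_measure_Times enn2real_mult jsurv_def)
  also have "surv B (res r B) x t = surv A r x t" using jsurv_par[OF o xy(1,1)] by simp
  also have "surv C (res r C) y t = surv A r y t" using jsurv_par[OF par_commute[OF o] xy(2,2)] by simp
  finally show ?thesis .
qed

subsection \<open>Means, variances and gaps\<close>

definition coord_mean :: "'a set \<Rightarrow> 'a rel \<Rightarrow> 'a \<Rightarrow> real" where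
  "coord_mean A r x = (\<integral>F. F x \<partial>opm A r)"

definition coord_var :: "'a set \<Rightarrow> 'a rel \<Rightarrow> 'a \<Rightarrow> real" where
  "coord_var A r x = (\<integral>F. (F x - coord_mean A r x)\<^sup>2 \<partial>opm A r)"

lemma integrable_coord:
  assumes "finite A" "partial_order_on A r" "x \<in> A"
  shows "integrable (opm A r) (\<lambda>F. F x)"
  by (rule integrable_opm[OF assms(1,2), where K=1]) (use assms(3) order_polytope_range[OF _ assms(3)] in \<open>force simp: abs_le_iff\<close>)+

lemma coord_mean_range:
  assumes "finite A" "partial_order_on A r" "x \<in> A"
  shows "0 \<le> coord_mean A r x" "coord_mean A r x \<le> 1"
proof -
  interpret prob_space "opm A r" by (rule prob_space_opm[OF assms(1,2)])
  note i = integrable_coord[OF assms]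
  show "0 \<le> coord_mean A r x" unfolding coord_mean_def
    by (rule integral_nonneg_AE) (use AE_opm[OF assms(1,2)] in eventually_elim, use order_polytope_range[OF _ assms(3)] in blast)
  have "coord_mean A r x \<le> (\<integral>F. 1 \<partial>opm A r)" unfolding coord_mean_def
    by (rule integral_mono_AE) (use i in simp, simp, use AE_opm[OF assms(1,2)] in eventually_elim, use order_polytope_range[OF _ assms(3)] in blast)
  then show "coord_mean A r x \<le> 1" using prob_space by simp
qed

lemma sq_le_1: "0 \<le> a \<Longrightarrow> a \<le> 1 \<Longrightarrow> 0 \<le> b \<Longrightarrow> b \<le> 1 \<Longrightarrow> (a - b)\<^sup>2 \<le> (1::real)"
  by (simp add: abs_square_le_1 abs_le_iff)

lemma integrable_sq:
  assumes "finite A" "partial_order_on A r" "x \<in> A"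
  shows "integrable (opm A r) (\<lambda>F. (F x - coord_mean A r x)\<^sup>2)"
  by (rule integrable_opm[OF assms(1,2), where K=1])
    (use assms(3) sq_le_1 order_polytope_range[OF _ assms(3)] coord_mean_range[OF assms] in simp_all)

lemma coord_var_le_1:
  assumes "finite A" "partial_order_on A r" "x \<in> A"
  shows "0 \<le> coord_var A r x" "coord_var A r x \<le> 1"
proof -
  interpret prob_space "opm A r" by (rule prob_space_opm[OF assms(1,2)])
  show "0 \<le> coord_var A r x" by (simp add: coord_var_def)
  have "coord_var A r x \<le> (\<integral>F. 1 \<partial>opm A r)" unfolding coord_var_def
    by (rule integral_mono_AE) (use integrable_sq[OF assms] in simp, simp, use AE_opm[OF assms(1,2)] in eventually_elim,
      use sq_le_1 order_polytope_range[OF _ assms(3)] coord_mean_range[OF assms] in simp)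
  then show "coord_var A r x \<le> 1" using prob_space by simp
qed

text \<open>Rewriting \<open>u + (1 - u - w) * m\<close> as \<open>(1 - m) * u + m * (1 - w)\<close>
  exhibits the conditional mean as a mixture of the two ends of the slab, whose means are
  known.\<close>

lemma coord_mean_ord3:
  assumes o: "ord3 A r D P E" and x: "x \<in> P"
  defines "N \<equiv> real (card A)"
  defines "m \<equiv> coord_mean P (res r P) x"
  shows "coord_mean A r x = (1 - m) * (card D / (N + 1)) + m * (1 - card E / (N + 1))"
    "coord_mean A r x = (\<integral>z. fst z + (1 - fst z - snd z) * m \<partial>rho (card D) (card P) (card E))"
proof -
  note f = ord3_facts[OF o]
  note [measurable] = x
  interpret P: prob_space "opm P (res r P)" by (rule f)
  interpret R: prob_space "rho (card D) (card P) (card E)" by (rule f)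
  have N: "N = real (card D + card P + card E)" by (simp add: N_def f(16))
  note mom = rho_moments[OF f(10) N]
  have xA: "x \<in> A" using x f by auto
  have i: "integrable (opm A r) (\<lambda>F. snd (low D F, restrict F P) x)"
    using integrable_coord[OF f(1,2) xA] x by simp
  have iP: "integrable (opm P (res r P)) (\<lambda>G. G x)" by (rule integrable_coord[OF f(4,9) x])
  have "coord_mean A r x = (\<integral>F. snd (low D F, restrict F P) x \<partial>opm A r)" using x by (simp add: coord_mean_def)
  also have "\<dots> = (\<integral>z. \<integral>G. snd (aff P (z, G)) x \<partial>opm P (res r P) \<partial>rho (card D) (card P) (card E))"
    by (rule integral_ord3[OF o _ i]) measurable
  also have "\<dots> = (\<integral>z. fst z + (1 - fst z - snd z) * m \<partial>rho (card D) (card P) (card E))"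
    using x iP P.prob_space by (simp add: aff_def m_def coord_mean_def)
  finally show "coord_mean A r x = (\<integral>z. fst z + (1 - fst z - snd z) * m \<partial>rho (card D) (card P) (card E))" .
  note this
  also have "\<dots> = (\<integral>z. (1 - m) * fst z + m * (1 - snd z) \<partial>rho (card D) (card P) (card E))"
    by (simp add: algebra_simps)
  also have "\<dots> = (1 - m) * (card D / (N + 1)) + m * (1 - card E / (N + 1))"
  proof -
    have ae: "AE z in rho (card D) (card P) (card E). norm (fst z) \<le> 1 \<and> norm (snd z) \<le> 1"
      using AE_rho[OF f(10)] by eventually_elim auto
    have "integrable (rho (card D) (card P) (card E)) fst" "integrable (rho (card D) (card P) (card E)) snd"
      by (rule R.integrable_const_bound[where B=1], use ae in auto)+
    then show ?thesis using mom(1,3) R.prob_space by simp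
  qed
  finally show "coord_mean A r x = (1 - m) * (card D / (N + 1)) + m * (1 - card E / (N + 1))" .
qed

text \<open>The exact variance is \<open>p * (N + 1 - p) / ((N + 1)^2 * (N + 2))\<close>, largest at
  \<open>p = (N + 1) / 2\<close>. Uniformity in \<open>p\<close> lets every position in a series
  share one estimate.\<close>

lemma beta_variance_bound:
  fixes p N :: real
  assumes "0 \<le> N"
  shows "p / (N + 1) * ((p + 1) / (N + 2)) - (p / (N + 1))\<^sup>2 \<le> 1 / (4 * (N + 2))"
proof -
  have "p / (N + 1) * ((p + 1) / (N + 2)) - (p / (N + 1))\<^sup>2 = (p * (N + 1 - p)) / ((N + 1)\<^sup>2 * (N + 2))"
    using assms by (simp add: divide_simps power2_eq_square) (simp add: algebra_simps)
  also have "\<dots> \<le> ((N + 1)\<^sup>2 / 4) / ((N + 1)\<^sup>2 * (N + 2))"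
  proof (rule divide_right_mono)
    have "0 \<le> (N + 1 - 2 * p)\<^sup>2" by simp
    then show "p * (N + 1 - p) \<le> (N + 1)\<^sup>2 / 4" by (simp add: power2_eq_square algebra_simps)
  qed (use assms in simp)
  also have "\<dots> = 1 / (4 * (N + 2))" using assms by simp
  finally show ?thesis .
qed

lemma rho_integrable:
  fixes f :: "real \<times> real \<Rightarrow> real"
  assumes "0 < n" "f \<in> borel_measurable (borel \<Otimes>\<^sub>M borel)"
    and "\<And>x. 0 \<le> fst x \<Longrightarrow> 0 \<le> snd x \<Longrightarrow> fst x + snd x < 1 \<Longrightarrow> \<bar>f x\<bar> \<le> K"
  shows "integrable (rho p n q) f"
proof -
  interpret prob_space "rho p n q" by (rule prob_space_rho[OF assms(1)])
  show ?thesis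
  proof (rule integrable_const_bound[where B=K])
    show "AE x in rho p n q. norm (f x) \<le> K"
      using AE_rho[OF assms(1)] by eventually_elim (use assms(3) in simp)
  qed (use assms(2) in simp)
qed

lemma rho_variances:
  assumes n: "0 < n" and N: "N = real (p + n + q)"
  shows "(\<integral>x. (fst x - p / (N + 1))\<^sup>2 \<partial>rho p n q) \<le> 1 / (4 * (N + 2))"
    "(\<integral>x. (snd x - q / (N + 1))\<^sup>2 \<partial>rho p n q) \<le> 1 / (4 * (N + 2))"
proof -
  interpret prob_space "rho p n q" by (rule prob_space_rho[OF n])
  have one: "measure (rho p n q) UNIV = 1" using prob_space by simp
  note mom = rho_moments[OF n N]
  have N0: "0 \<le> N" by (simp add: N)
  have *: "(\<integral>x. (f x - a)\<^sup>2 \<partial>rho p n q) = (\<integral>x. (f x)\<^sup>2 \<partial>rho p n q) - a\<^sup>2"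
    if "integrable (rho p n q) f" "integrable (rho p n q) (\<lambda>x. (f x)\<^sup>2)" "(\<integral>x. f x \<partial>rho p n q) = a" for f and a :: real
  proof -
    have "(\<integral>x. (f x - a)\<^sup>2 \<partial>rho p n q) = (\<integral>x. (f x)\<^sup>2 - 2 * a * f x + a\<^sup>2 \<partial>rho p n q)"
      by (simp add: power2_diff algebra_simps)
    also have "\<dots> = (\<integral>x. (f x)\<^sup>2 \<partial>rho p n q) - 2 * a * a + a\<^sup>2" using that one by simp
    finally show ?thesis by (simp add: power2_eq_square)
  qed
  have i: "integrable (rho p n q) fst" "integrable (rho p n q) snd"
    by (rule rho_integrable[OF n, where K=1], auto)+
  have i2: "integrable (rho p n q) (\<lambda>x. (fst x)\<^sup>2)" "integrable (rho p n q) (\<lambda>x. (snd x)\<^sup>2)"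
    by (rule rho_integrable[OF n, where K=1], simp, simp add: abs_square_le_1)+
  show "(\<integral>x. (fst x - p / (N + 1))\<^sup>2 \<partial>rho p n q) \<le> 1 / (4 * (N + 2))"
    using *[OF i(1) i2(1) mom(1)] mom(2) beta_variance_bound[OF N0, of p] by simp
  show "(\<integral>x. (snd x - q / (N + 1))\<^sup>2 \<partial>rho p n q) \<le> 1 / (4 * (N + 2))"
    using *[OF i(2) i2(2) mom(3)] mom(4) beta_variance_bound[OF N0, of q] by simp
qed

text \<open>The difference of the two sides is \<open>m * (1 - m) * (a + b)^2\<close>. Through this
  convexity the covariance of \<open>u\<close> and \<open>w\<close> never has to be
  estimated.\<close>

lemma convex_comb_sq:
  fixes m a b :: real
  assumes "0 \<le> m" "m \<le> 1"
  shows "((1 - m) * a - m * b)\<^sup>2 \<le> (1 - m) * a\<^sup>2 + m * b\<^sup>2"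
proof -
  have "(1 - m) * a\<^sup>2 + m * b\<^sup>2 - ((1 - m) * a - m * b)\<^sup>2 = m * (1 - m) * (a + b)\<^sup>2"
    by (simp add: power2_eq_square algebra_simps)
  moreover have "0 \<le> m * (1 - m) * (a + b)\<^sup>2" using assms by simp
  ultimately show ?thesis by linarith
qed

lemma rho_mean_integrable:
  fixes m M :: real
  assumes n: "0 < n" and m: "0 \<le> m" "m \<le> 1" and M: "0 \<le> M" "M \<le> 1"
  shows "integrable (rho p n q) (\<lambda>z. (fst z + (1 - fst z - snd z) * m - M)\<^sup>2)"
proof (rule rho_integrable[OF n, where K=1])
  fix z :: "real \<times> real" assume z: "0 \<le> fst z" "0 \<le> snd z" "fst z + snd z < 1"
  have "0 \<le> (1 - fst z - snd z) * m" "(1 - fst z - snd z) * m \<le> 1 - fst z - snd z"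
    using z m by (auto intro: mult_left_le)
  then have "(fst z + (1 - fst z - snd z) * m - M)\<^sup>2 \<le> 1"
    using z M by (intro sq_le_1) linarith+
  then show "\<bar>(fst z + (1 - fst z - snd z) * m - M)\<^sup>2\<bar> \<le> 1" by simp
qed simp

text \<open>As a mixture of \<open>u\<close> and \<open>1 - w\<close>, the conditional mean inherits
  the variance bound that its two ends have in common.\<close>

lemma rho_mean_variance:
  assumes n: "0 < n" and N: "N = real (p + n + q)" and m: "0 \<le> m" "m \<le> 1"
  defines "M \<equiv> (1 - m) * (p / (N + 1)) + m * (1 - q / (N + 1))"
  shows "(\<integral>x. (fst x + (1 - fst x - snd x) * m - M)\<^sup>2 \<partial>rho p n q) \<le> 1 / (4 * (N + 2))"
proof -
  let ?a = "p / (N + 1)" and ?b = "q / (N + 1)"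
  have ab: "0 \<le> ?a" "?a \<le> 1" "0 \<le> ?b" "?b \<le> 1" using N by (auto simp: divide_simps)
  have i: "integrable (rho p n q) (\<lambda>x. (fst x - ?a)\<^sup>2)" "integrable (rho p n q) (\<lambda>x. (snd x - ?b)\<^sup>2)"
    by (rule rho_integrable[OF n, where K=1], simp, use ab in \<open>simp add: sq_le_1\<close>)+
  have "(\<integral>x. (fst x + (1 - fst x - snd x) * m - M)\<^sup>2 \<partial>rho p n q) \<le>
    (\<integral>x. (1 - m) * (fst x - ?a)\<^sup>2 + m * (snd x - ?b)\<^sup>2 \<partial>rho p n q)"
  proof (rule integral_mono)
    have e: "fst x + (1 - fst x - snd x) * m - M = (1 - m) * (fst x - ?a) - m * (snd x - ?b)" for x :: "real \<times> real"
      by (simp add: M_def algebra_simps)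
    show "(fst x + (1 - fst x - snd x) * m - M)\<^sup>2 \<le> (1 - m) * (fst x - ?a)\<^sup>2 + m * (snd x - ?b)\<^sup>2" for x
      unfolding e by (rule convex_comb_sq[OF m])
    have "0 \<le> M" unfolding M_def using ab m by (intro add_nonneg_nonneg mult_nonneg_nonneg) auto
    moreover have "M \<le> (1 - m) * 1 + m * 1" unfolding M_def using ab m by (intro add_mono mult_left_mono) auto
    ultimately show "integrable (rho p n q) (\<lambda>x. (fst x + (1 - fst x - snd x) * m - M)\<^sup>2)"
      by (intro rho_mean_integrable[OF n m]) auto
  qed (use i in simp)
  also have "\<dots> = (1 - m) * (\<integral>x. (fst x - ?a)\<^sup>2 \<partial>rho p n q) + m * (\<integral>x. (snd x - ?b)\<^sup>2 \<partial>rho p n q)"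
    using i by simp
  also have "\<dots> \<le> (1 - m) * (1 / (4 * (N + 2))) + m * (1 / (4 * (N + 2)))"
    using rho_variances[OF n N] m by (intro add_mono mult_left_mono) auto
  also have "\<dots> = ((1 - m) + m) * (1 / (4 * (N + 2)))" by (simp only: distrib_right)
  also have "\<dots> = 1 / (4 * (N + 2))" by simp
  finally show ?thesis .
qed

text \<open>The law of total variance: the variance inside \<open>P\<close> is scaled by the mean of
  \<open>(1 - u - w)^2\<close>, and the added term bounds the variance of the conditional
  mean.\<close>

lemma coord_var_ord3:
  assumes o: "ord3 A r D P E" and x: "x \<in> P"
  defines "N \<equiv> real (card A)" and "n \<equiv> real (card P)"
  shows "coord_var A r x \<le> (n + 1) / (N + 1) * ((n + 2) / (N + 2)) * coord_var P (res r P) x + 1 / (4 * (N + 2))"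
proof -
  note f = ord3_facts[OF o]
  note [measurable] = x
  let ?R = "rho (card D) (card P) (card E)"
  interpret P: prob_space "opm P (res r P)" by (rule f)
  interpret R: prob_space "rho (card D) (card P) (card E)" by (rule f)
  have one: "measure (opm P (res r P)) (space (PL P)) = 1" using P.prob_space by simp
  have N: "N = real (card D + card P + card E)" by (simp add: N_def f(16))
  note mom = rho_moments[OF f(10) N]
  have xA: "x \<in> A" using x f by auto
  define M where "M = coord_mean A r x"
  define m where "m = coord_mean P (res r P) x"
  define v where "v = coord_var P (res r P) x"
  have m01: "0 \<le> m" "m \<le> 1" unfolding m_def using coord_mean_range[OF f(4,9) x] by auto
  have M01: "0 \<le> M" "M \<le> 1" unfolding M_def using coord_mean_range[OF f(1,2) xA] by auto
  have i: "integrable (opm A r) (\<lambda>F. (snd (low D F, restrict F P) x - M)\<^sup>2)"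
    using integrable_sq[OF f(1,2) xA] x by (simp add: M_def)
  have iP: "integrable (opm P (res r P)) (\<lambda>G. G x)" by (rule integrable_coord[OF f(4,9) x])
  have iP2: "integrable (opm P (res r P)) (\<lambda>G. (G x - m)\<^sup>2)" unfolding m_def by (rule integrable_sq[OF f(4,9) x])
  have inner: "(\<integral>G. (snd (aff P (z, G)) x - M)\<^sup>2 \<partial>opm P (res r P)) =
    (1 - fst z - snd z)\<^sup>2 * v + (fst z + (1 - fst z - snd z) * m - M)\<^sup>2" for z
  proof -
    define c where "c = 1 - fst z - snd z"
    define k where "k = fst z + c * m - M"
    have "(\<integral>G. (snd (aff P (z, G)) x - M)\<^sup>2 \<partial>opm P (res r P)) =
      (\<integral>G. c\<^sup>2 * (G x - m)\<^sup>2 + 2 * c * k * (G x - m) + k\<^sup>2 \<partial>opm P (res r P))"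
      using x by (intro Bochner_Integration.integral_cong) (auto simp: aff_def c_def k_def power2_eq_square algebra_simps)
    also have "\<dots> = c\<^sup>2 * v + 2 * c * k * ((\<integral>G. G x \<partial>opm P (res r P)) - m) + k\<^sup>2"
      using iP iP2 one by (simp add: v_def coord_var_def m_def)
    \<comment> \<open>The cross term vanishes because \<open>m\<close> is the mean of
      \<open>G x\<close>.\<close>
    also have "(\<integral>G. G x \<partial>opm P (res r P)) - m = 0" by (simp add: m_def coord_mean_def)
    finally show ?thesis by (simp add: c_def k_def)
  qed
  have "coord_var A r x = (\<integral>F. (snd (low D F, restrict F P) x - M)\<^sup>2 \<partial>opm A r)"
    using x by (simp add: coord_var_def M_def)
  also have "\<dots> = (\<integral>z. \<integral>G. (snd (aff P (z, G)) x - M)\<^sup>2 \<partial>opm P (res r P) \<partial>?R)"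
    by (rule integral_ord3[OF o _ i]) measurable
  also have "\<dots> = (\<integral>z. (1 - fst z - snd z)\<^sup>2 * v + (fst z + (1 - fst z - snd z) * m - M)\<^sup>2 \<partial>?R)"
    by (simp add: inner)
  also have "\<dots> = (\<integral>z. (1 - fst z - snd z)\<^sup>2 \<partial>?R) * v + (\<integral>z. (fst z + (1 - fst z - snd z) * m - M)\<^sup>2 \<partial>?R)"
  proof -
    have "integrable ?R (\<lambda>z. (1 - fst z - snd z)\<^sup>2)"
      by (rule rho_integrable[OF f(10), where K=1]) (simp, simp add: abs_square_le_1)
    moreover have "integrable ?R (\<lambda>z. (fst z + (1 - fst z - snd z) * m - M)\<^sup>2)"
      by (rule rho_mean_integrable[OF f(10) m01 M01])
    ultimately show ?thesis by simp
  qed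
  also have "\<dots> \<le> (n + 1) / (N + 1) * ((n + 2) / (N + 2)) * v + 1 / (4 * (N + 2))"
    using mom(6) rho_mean_variance[OF f(10) N m01] coord_mean_ord3(1)[OF o x]
    by (simp add: n_def M_def m_def N_def)
  finally show ?thesis by (simp add: v_def)
qed

lemma (in prob_space) second_moment_tail:
  assumes [measurable]: "random_variable borel f" and i: "integrable M (\<lambda>x. (f x :: real)\<^sup>2)" and a: "0 < a"
  shows "prob {x \<in> space M. a \<le> \<bar>f x\<bar>} \<le> expectation (\<lambda>x. (f x)\<^sup>2) / a\<^sup>2"
proof -
  let ?X = "{x \<in> space M. a \<le> \<bar>f x\<bar>}"
  have "a\<^sup>2 * prob ?X = expectation (\<lambda>x. a\<^sup>2 * indicator ?X x)" by simp
  also have "\<dots> \<le> expectation (\<lambda>x. (f x)\<^sup>2)"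
  proof (rule integral_mono[OF _ i])
    show "integrable M (\<lambda>x. a\<^sup>2 * indicator ?X x)"
      by (rule integrable_const_bound[where B="a\<^sup>2"]) (auto simp: indicator_def)
    fix x
    show "a\<^sup>2 * indicator ?X x \<le> (f x)\<^sup>2"
    proof (cases "x \<in> ?X")
      case True
      then have "a\<^sup>2 \<le> \<bar>f x\<bar>\<^sup>2" using a by (intro power_mono) auto
      then show ?thesis using True by simp
    qed simp
  qed
  finally show ?thesis using a by (simp add: field_simps)
qed

lemma underS_res: "underS (res r P) x = underS r x \<inter> P" if "x \<in> P"
  using that by (auto simp: underS_def res_def)

lemma lower_bd_nonneg:
  assumes A: "finite A" "partial_order_on A r" and x: "x \<in> A" and F: "F \<in> order_polytope A r"
  shows "lower_bd r F x \<le> F x" "0 \<le> lower_bd r F x"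
proof -
  have sub: "underS r x \<subseteq> A" using partial_order_on_sub[OF A(2)] by (auto simp: underS_def)
  then have fin: "finite (underS r x)" using A(1) finite_subset by blast
  have 1: "F y \<le> F x" if "y \<in> underS r x" for y
    using that order_polytope_le[OF F] by (auto simp: underS_def)
  show "lower_bd r F x \<le> F x"
    using fin 1 order_polytope_range[OF F x] by (auto simp: lower_bd_def)
  show "0 \<le> lower_bd r F x"
  proof (cases "underS r x = {}")
    case False
    then obtain y where y: "y \<in> underS r x" by auto
    then have "0 \<le> F y" using order_polytope_range[OF F] sub by auto
    then show ?thesis using y fin False by (auto simp: lower_bd_def Max_ge_iff)
  qed (simp add: lower_bd_def)
qed

lemma lower_bd_measurable:
  assumes "finite A" "r \<subseteq> A \<times> A"
  shows "(\<lambda>F. lower_bd r F x) \<in> borel_measurable (PL A)"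
proof -
  have sub: "underS r x \<subseteq> A" using assms(2) by (auto simp: underS_def)
  then have fin: "finite (underS r x)" using assms(1) finite_subset by blast
  show ?thesis
  proof (cases "underS r x = {}")
    case True then show ?thesis by (simp add: lower_bd_def)
  next
    case False
    have "(\<lambda>F. Max ((\<lambda>i. F i) ` underS r x)) \<in> borel_measurable (PL A)"
      using sub by (intro borel_measurable_Max fin) auto
    then show ?thesis using False by (simp add: lower_bd_def)
  qed
qed

lemma Max_affine:
  assumes "finite U" "U \<noteq> {}" "0 \<le> (c::real)"
  shows "Max ((\<lambda>i. u + c * G i) ` U) = u + c * Max (G ` U)"
proof -
  have "mono (\<lambda>t. u + c * t)" using assms(3) by (auto simp: mono_def intro: mult_left_mono)
  from mono_Max_commute[OF this, of "G ` U"] show ?thesis using assms by (simp add: image_image)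
qed

text \<open>The affine map multiplies the gap below \<open>x\<close> by \<open>1 - u - w\<close>,
  whose mean is \<open>(card P + 1) / (card A + 1)\<close>. A point minimal in \<open>P\<close> fits
  in too: the value \<open>u\<close> from which its gap is measured is the image of the wall
  0.\<close>

lemma mean_gap_ord3:
  assumes o: "ord3 A r D P E" and x: "x \<in> P"
  shows "mean_gap A r x = (real (card P) + 1) / (real (card A) + 1) * mean_gap P (res r P) x"
proof -
  note f = ord3_facts[OF o]
  note [measurable] = x
  let ?R = "rho (card D) (card P) (card E)"
  have N: "real (card A) = real (card D + card P + card E)" by (simp add: f(16))
  note mom = rho_moments[OF f(10) N]
  have xA: "x \<in> A" using x f by auto
  define U where "U = underS (res r P) x"
  have UP: "U \<subseteq> P" by (auto simp: U_def underS_def res_def)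
  have finU: "finite U" using UP f(4) finite_subset by blast
  have US: "underS r x = D \<union> U"
  proof -
    have "underS r x \<subseteq> D \<union> P \<union> E" using partial_order_on_sub[OF f(2)] o by (auto simp: underS_def ord3_def)
    moreover have "underS r x \<inter> E = {}"
      using o x unfolding ord3_def underS_def partial_order_on_def antisym_def by blast
    moreover have "D \<subseteq> underS r x" using o x unfolding ord3_def underS_def by blast
    ultimately show ?thesis unfolding U_def underS_res[OF x] by blast
  qed
  \<comment> \<open>The values on \<open>D\<close> matter only when \<open>x\<close> is minimal in
    \<open>P\<close>; otherwise a point of \<open>P\<close> below \<open>x\<close> dominates all of
    \<open>D\<close>.\<close>
  define g where "g z = snd z x - (if U = {} then fst z else Max (snd z ` U))" for z :: "real \<times> ('a \<Rightarrow> real)"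
  have gm[measurable]: "g \<in> borel_measurable (borel \<Otimes>\<^sub>M PL P)"
  proof (cases "U = {}")
    case True then show ?thesis unfolding g_def by simp
  next
    case False
    have "(\<lambda>z. Max ((\<lambda>i. snd z i) ` U)) \<in> borel_measurable (borel \<Otimes>\<^sub>M PL P)"
      using UP by (intro borel_measurable_Max finU) (auto intro!: measurable_compose[OF measurable_snd] measurable_component_singleton)
    moreover have "(\<lambda>z. snd z x) \<in> borel_measurable (borel \<Otimes>\<^sub>M PL P)" by measurable
    ultimately have "(\<lambda>z. snd z x - Max ((\<lambda>i. snd z i) ` U)) \<in> borel_measurable (borel \<Otimes>\<^sub>M PL P)"
      by (rule borel_measurable_diff[rotated])
    then show ?thesis using False unfolding g_def by simp
  qed
  have g_eq: "F x - lower_bd r F x = g (low D F, restrict F P)" if F: "F \<in> order_polytope A r" for F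
  proof -
    have lowle: "low D F \<le> F i" if "i \<in> P" for i
      using mem_ord3[OF o, of F] F that order_polytope_iff[OF partial_order_on_sub[OF f(2)]] by blast
    have im: "restrict F P ` U = F ` U" using UP by (auto simp: image_def)
    show ?thesis
    proof (cases "U = {}")
      case True then show ?thesis using x by (simp add: g_def lower_bd_def US low_def)
    next
      case False
      have "lower_bd r F x = Max (F ` U)"
      proof (cases "D = {}")
        case True then show ?thesis using False by (simp add: lower_bd_def US)
      next
        case D: False
        obtain i where i: "i \<in> U" using False by auto
        have "low D F \<le> Max (F ` U)"
          using lowle[of i] i UP finU by (auto intro: order_trans[OF lowle] Max_ge)
        then show ?thesis using D False finU f(3)
          by (simp add: lower_bd_def US low_def image_Un Max_Un max_def)
      qed
      then show ?thesis using False x im by (simp add: g_def)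
    qed
  qed
  have "integrable (opm A r) (\<lambda>F. F x - lower_bd r F x)"
  proof (rule integrable_opm[OF f(1,2), where K=1])
    show "(\<lambda>F. F x - lower_bd r F x) \<in> borel_measurable (PL A)"
      using lower_bd_measurable[OF f(1) partial_order_on_sub[OF f(2)], of x] xA by simp
    fix F assume F: "F \<in> order_polytope A r"
    show "\<bar>F x - lower_bd r F x\<bar> \<le> 1"
      using lower_bd_nonneg[OF f(1,2) xA F] order_polytope_range[OF F xA] by simp
  qed
  moreover have ae: "AE F in opm A r. F x - lower_bd r F x = g (low D F, restrict F P)"
    using AE_opm[OF f(1,2)] by eventually_elim (rule g_eq)
  have mg: "(\<lambda>F. g (low D F, restrict F P)) \<in> borel_measurable (opm A r)"
    using f(11,12) by measurable
  have ml: "(\<lambda>F. F x - lower_bd r F x) \<in> borel_measurable (opm A r)"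
    using lower_bd_measurable[OF f(1) partial_order_on_sub[OF f(2)], of x] xA by simp
  ultimately have int: "integrable (opm A r) (\<lambda>F. g (low D F, restrict F P))"
    using integrable_cong_AE[OF ml mg ae] by simp
  have "mean_gap A r x = (\<integral>F. g (low D F, restrict F P) \<partial>opm A r)"
    unfolding mean_gap_def by (rule integral_cong_AE[OF ml mg ae])
  also have "\<dots> = (\<integral>z. \<integral>G. g (aff P (z, G)) \<partial>opm P (res r P) \<partial>?R)"
    by (rule integral_ord3[OF o gm int])
  also have "\<dots> = (\<integral>z. (1 - fst z - snd z) * mean_gap P (res r P) x \<partial>?R)"
  proof (rule integral_cong_AE)
    interpret P: prob_space "opm P (res r P)" by (rule f)
    have "(\<lambda>y. g (aff P y)) \<in> borel_measurable ((borel \<Otimes>\<^sub>M borel) \<Otimes>\<^sub>M opm P (res r P))"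
      by measurable
    then show "(\<lambda>z. \<integral>G. g (aff P (z, G)) \<partial>opm P (res r P)) \<in> borel_measurable ?R"
      by measurable
    show "AE z in ?R. (\<integral>G. g (aff P (z, G)) \<partial>opm P (res r P)) = (1 - fst z - snd z) * mean_gap P (res r P) x"
      using AE_rho[OF f(10)]
    proof eventually_elim
      case (elim z)
      have "g (aff P (z, G)) = (1 - fst z - snd z) * (G x - lower_bd (res r P) G x)" for G
      proof (cases "U = {}")
        case True then show ?thesis using x by (simp add: g_def aff_def lower_bd_def U_def[symmetric])
      next
        case False
        have "(\<lambda>i\<in>P. fst z + (1 - fst z - snd z) * G i) ` U = (\<lambda>i. fst z + (1 - fst z - snd z) * G i) ` U"
          using UP by (auto simp: image_def)
        then show ?thesis using False x Max_affine[OF finU False, of "1 - fst z - snd z" "fst z" G] elim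
          by (simp add: g_def aff_def lower_bd_def U_def[symmetric] algebra_simps)
      qed
      then show ?case by (simp add: mean_gap_def)
    qed
  qed measurable
  also have "\<dots> = (real (card P) + 1) / (real (card A) + 1) * mean_gap P (res r P) x"
    using mom(5) by simp
  finally show ?thesis .
qed

lemma mean_gap_par:
  assumes o: "par A r B C" and x: "x \<in> B"
  shows "mean_gap A r x = mean_gap B (res r B) x"
proof -
  note f = par_facts[OF o]
  have US: "underS r x = underS (res r B) x" "underS r x \<subseteq> B"
    using o x unfolding par_def underS_def res_def by blast+
  have "lower_bd r F x = lower_bd (res r B) (restrict F B) x" for F
  proof -
    have "restrict F B ` underS r x = F ` underS r x" using US(2) by (auto simp: image_def)
    then show ?thesis using US(1) by (simp add: lower_bd_def)
  qed
  then have "mean_gap A r x = (\<integral>F. (\<lambda>G. G x - lower_bd (res r B) G x) (restrict F B) \<partial>opm A r)"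
    using x by (simp add: mean_gap_def)
  also have "\<dots> = (\<integral>G. G x - lower_bd (res r B) G x \<partial>distr (opm A r) (PL B) (\<lambda>F. restrict F B))"
  proof (rule integral_distr[symmetric])
    show "(\<lambda>F. restrict F B) \<in> measurable (opm A r) (PL B)" using f(9) by simp
    show "(\<lambda>G. G x - lower_bd (res r B) G x) \<in> borel_measurable (PL B)"
      using lower_bd_measurable[OF f(3) res_sub[of r], of x] x by simp
  qed
  also have "\<dots> = mean_gap B (res r B) x" unfolding distr_par_fst[OF o] mean_gap_def ..
  finally show ?thesis .
qed

lemma coord_moments_par:
  assumes o: "par A r B C" and x: "x \<in> B"
  shows "coord_mean A r x = coord_mean B (res r B) x" "coord_var A r x = coord_var B (res r B) x"
proof -
  note f = par_facts[OF o]
  have *: "(\<integral>F. g (F x) \<partial>opm A r) = (\<integral>G. g (G x) \<partial>opm B (res r B))" if [measurable]: "g \<in> borel_measurable borel" for g :: "real \<Rightarrow> real"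
  proof -
    have "(\<integral>F. g (F x) \<partial>opm A r) = (\<integral>F. g (restrict F B x) \<partial>opm A r)" using x by simp
    also have "\<dots> = (\<integral>G. g (G x) \<partial>distr (opm A r) (PL B) (\<lambda>F. restrict F B))"
          proof (rule integral_distr[symmetric])
      show "(\<lambda>F. restrict F B) \<in> measurable (opm A r) (PL B)" using f(9) by (simp del: restrict_apply)
    qed (use x in simp)
    finally show ?thesis unfolding distr_par_fst[OF o] .
  qed
  show "coord_mean A r x = coord_mean B (res r B) x" unfolding coord_mean_def using *[of "\<lambda>t. t"] by simp
  then show "coord_var A r x = coord_var B (res r B) x" unfolding coord_var_def using *[of "\<lambda>t. (t - coord_mean A r x)\<^sup>2"] by simp
qed

subsection \<open>Anticoncentration of the affine map\<close>

text \<open>The Dirichlet density up to its constant, taken relative to Lebesgue measure, because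
  the shift argument wants a translation invariant reference measure.\<close>

definition rho_dens :: "nat \<Rightarrow> nat \<Rightarrow> nat \<Rightarrow> real \<Rightarrow> real \<Rightarrow> real" where
  "rho_dens p n q u w = (if 0 \<le> u \<and> 0 \<le> w \<and> u + w < 1
     then (p * u ^ (p - 1)) * (q * w ^ (q - 1)) * (1 - u - w) ^ n else 0)"

lemma rho_dens_measurable[measurable]: "(\<lambda>z. rho_dens p n q (fst z) (snd z)) \<in> borel_measurable (borel \<Otimes>\<^sub>M borel)"
  unfolding rho_dens_def by measurable

lemma rho_dens_nonneg: "0 \<le> rho_dens p n q u w"
  by (simp add: rho_dens_def)

lemma emeasure_rho_lborel:
  assumes pq: "0 < p" "0 < n" "0 < q" and Y[measurable]: "Y \<in> sets (borel \<Otimes>\<^sub>M borel)"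
  shows "emeasure (rho p n q) Y = ennreal (1 / rho_norm p n q) *
    (\<integral>\<^sup>+u. \<integral>\<^sup>+w. ennreal (rho_dens p n q u w) * indicator Y (u, w) \<partial>lborel \<partial>lborel)"
proof -
  interpret q: prob_space "alpha q" by (rule prob_space_alpha)
  let ?h = "\<lambda>u w. ennreal (max 0 (1 - u - w) ^ n) * indicator Y (u, w)"
  have "emeasure (rho p n q) Y = (\<integral>\<^sup>+z. indicator Y z \<partial>rho p n q)" by simp
  also have "\<dots> = ennreal (1 / rho_norm p n q) * (\<integral>\<^sup>+u. \<integral>\<^sup>+w. ?h u w \<partial>alpha q \<partial>alpha p)"
    by (rule nn_integral_rho) measurable
  also have "(\<integral>\<^sup>+u. \<integral>\<^sup>+w. ?h u w \<partial>alpha q \<partial>alpha p) =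
    (\<integral>\<^sup>+u. (ennreal (p * u ^ (p - 1)) * indicator {0..1} u) * (\<integral>\<^sup>+w. ?h u w \<partial>alpha q) \<partial>lborel)"
  proof -
    have a: "alpha p = density lborel (\<lambda>u. ennreal (p * u ^ (p - 1)) * indicator {0..1} u)"
      using pq by (simp add: alpha_def)
    show ?thesis unfolding a by (rule nn_integral_density) measurable
  qed
  also have "\<dots> = (\<integral>\<^sup>+u. \<integral>\<^sup>+w. ennreal (rho_dens p n q u w) * indicator Y (u, w) \<partial>lborel \<partial>lborel)"
  proof (rule nn_integral_cong)
    fix u :: real
    have a: "alpha q = density lborel (\<lambda>w. ennreal (q * w ^ (q - 1)) * indicator {0..1} w)"
      using pq by (simp add: alpha_def)
    have "(\<integral>\<^sup>+w. ?h u w \<partial>alpha q) = (\<integral>\<^sup>+w. (ennreal (q * w ^ (q - 1)) * indicator {0..1} w) * ?h u w \<partial>lborel)"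
      unfolding a by (rule nn_integral_density) measurable
    then have "(ennreal (p * u ^ (p - 1)) * indicator {0..1} u) * (\<integral>\<^sup>+w. ?h u w \<partial>alpha q) =
      (\<integral>\<^sup>+w. (ennreal (p * u ^ (p - 1)) * indicator {0..1} u) * ((ennreal (q * w ^ (q - 1)) * indicator {0..1} w) * ?h u w) \<partial>lborel)"
      by (simp only:) (rule nn_integral_cmult[symmetric], measurable)
    also have "\<dots> = (\<integral>\<^sup>+w. ennreal (rho_dens p n q u w) * indicator Y (u, w) \<partial>lborel)"
    proof (rule nn_integral_cong)
      fix w :: real
      show "(ennreal (p * u ^ (p - 1)) * indicator {0..1} u) * ((ennreal (q * w ^ (q - 1)) * indicator {0..1} w) * ?h u w) =
        ennreal (rho_dens p n q u w) * indicator Y (u, w)"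
      proof (cases "0 \<le> u \<and> 0 \<le> w \<and> u + w < 1")
        case True
        then have "ennreal (rho_dens p n q u w) = ennreal (p * u ^ (p - 1)) * (ennreal (q * w ^ (q - 1)) * ennreal (max 0 (1 - u - w) ^ n))"
          by (simp add: rho_dens_def ennreal_mult[symmetric] max_def mult.assoc)
        moreover have "indicator {0..1} u = (1::ennreal)" "indicator {0..1} w = (1::ennreal)" using True by auto
        ultimately show ?thesis by (simp add: mult.assoc)
      next
        case False
        then have "rho_dens p n q u w = 0" by (auto simp: rho_dens_def)
        moreover have "max 0 (1 - u - w) ^ n = 0" if "0 \<le> u" "0 \<le> w"
          using False that pq by (simp add: max_def)
        ultimately show ?thesis by (cases "0 \<le> u \<and> 0 \<le> w") auto
      qed
    qed
    finally show "(ennreal (p * u ^ (p - 1)) * indicator {0..1} u) * (\<integral>\<^sup>+w. ?h u w \<partial>alpha q) =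
      (\<integral>\<^sup>+w. ennreal (rho_dens p n q u w) * indicator Y (u, w) \<partial>lborel)" .
  qed
  finally show ?thesis .
qed

text \<open>Mass is transported by raising \<open>u\<close> and lowering \<open>w\<close> by the
  same \<open>d\<close>. This leaves \<open>1 - u - w\<close>, and with it the factor of power
  \<open>n\<close>, unchanged, so only the ratio of the other two factors has to be bounded
  below.\<close>

lemma rho_shift:
  assumes pq: "0 < p" "0 < n" "0 < q" and X[measurable]: "X \<in> sets (borel \<Otimes>\<^sub>M borel)" and k: "0 \<le> \<kappa>"
    and ratio: "\<And>u w. (u, w) \<in> X \<Longrightarrow> 0 \<le> u \<Longrightarrow> 0 \<le> w \<Longrightarrow> u + w < 1 \<Longrightarrow>
      0 \<le> u + d \<and> 0 \<le> w - d \<and> \<kappa> * (u ^ (p - 1) * w ^ (q - 1)) \<le> (u + d) ^ (p - 1) * (w - d) ^ (q - 1)"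
  shows "\<kappa> * measure (rho p n q) X \<le> measure (rho p n q) {z. (fst z - d, snd z + d) \<in> X}"
proof -
  interpret prob_space "rho p n q" by (rule prob_space_rho[OF pq(2)])
  let ?Y = "{z. (fst z - d, snd z + d) \<in> X}"
  have "?Y = (\<lambda>z. (fst z - d, snd z + d)) -` X \<inter> space (borel \<Otimes>\<^sub>M borel)" by (auto simp: space_pair_measure)
  also have "\<dots> \<in> sets (borel \<Otimes>\<^sub>M borel)" by (rule measurable_sets[OF _ X]) measurable
  finally have Y[measurable]: "?Y \<in> sets (borel \<Otimes>\<^sub>M borel)" .
  let ?f = "rho_dens p n q"
  have [measurable]: "(\<lambda>w. ?f u w) \<in> borel_measurable borel" for u
    unfolding rho_dens_def by measurable
  have "(\<integral>\<^sup>+u. \<integral>\<^sup>+w. ennreal (?f u w) * indicator ?Y (u, w) \<partial>lborel \<partial>lborel) =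
    (\<integral>\<^sup>+u. \<integral>\<^sup>+w. ennreal (?f (d + u) w) * indicator ?Y (d + u, w) \<partial>lborel \<partial>lborel)"
    by (subst nn_integral_real_affine[of _ 1 d]) auto
  also have "\<dots> = (\<integral>\<^sup>+u. \<integral>\<^sup>+w. ennreal (?f (d + u) (- d + w)) * indicator X (u, w) \<partial>lborel \<partial>lborel)"
  proof (rule nn_integral_cong)
    fix u
    show "(\<integral>\<^sup>+w. ennreal (?f (d + u) w) * indicator ?Y (d + u, w) \<partial>lborel) =
      (\<integral>\<^sup>+w. ennreal (?f (d + u) (- d + w)) * indicator X (u, w) \<partial>lborel)"
      by (subst nn_integral_real_affine[of _ 1 "- d"]) (auto simp: indicator_def)
  qed
  finally have 1: "(\<integral>\<^sup>+u. \<integral>\<^sup>+w. ennreal (?f u w) * indicator ?Y (u, w) \<partial>lborel \<partial>lborel) =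
    (\<integral>\<^sup>+u. \<integral>\<^sup>+w. ennreal (?f (d + u) (- d + w)) * indicator X (u, w) \<partial>lborel \<partial>lborel)" .
  have "ennreal \<kappa> * (\<integral>\<^sup>+u. \<integral>\<^sup>+w. ennreal (?f u w) * indicator X (u, w) \<partial>lborel \<partial>lborel) =
    (\<integral>\<^sup>+u. \<integral>\<^sup>+w. ennreal \<kappa> * (ennreal (?f u w) * indicator X (u, w)) \<partial>lborel \<partial>lborel)"
    by (simp add: nn_integral_cmult)
  also have "\<dots> \<le> (\<integral>\<^sup>+u. \<integral>\<^sup>+w. ennreal (?f (d + u) (- d + w)) * indicator X (u, w) \<partial>lborel \<partial>lborel)"
  proof (intro nn_integral_mono)
    fix u w
    show "ennreal \<kappa> * (ennreal (?f u w) * indicator X (u, w)) \<le> ennreal (?f (d + u) (- d + w)) * indicator X (u, w)"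
    proof (cases "(u, w) \<in> X \<and> 0 \<le> u \<and> 0 \<le> w \<and> u + w < 1")
      case True
      then have r: "0 \<le> u + d" "0 \<le> w - d" "\<kappa> * (u ^ (p - 1) * w ^ (q - 1)) \<le> (u + d) ^ (p - 1) * (w - d) ^ (q - 1)"
        using ratio by auto
      have "\<kappa> * ?f u w = (p * q * (1 - u - w) ^ n) * (\<kappa> * (u ^ (p - 1) * w ^ (q - 1)))"
        using True by (simp add: rho_dens_def mult_ac)
      also have "\<dots> \<le> (p * q * (1 - u - w) ^ n) * ((u + d) ^ (p - 1) * (w - d) ^ (q - 1))"
        using True by (intro mult_left_mono r(3)) auto
      also have "\<dots> = ?f (d + u) (- d + w)"
      proof -
        have e: "d + u = u + d" "- d + w = w - d" "1 - (u + d) - (w - d) = 1 - u - w" "(u + d) + (w - d) = u + w" by auto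
        show ?thesis unfolding e(1,2) rho_dens_def e(3,4) using True r(1,2) by (simp add: mult_ac)
      qed
      finally have "ennreal \<kappa> * ennreal (?f u w) \<le> ennreal (?f (d + u) (- d + w))"
        using k rho_dens_nonneg by (simp add: ennreal_mult[symmetric] ennreal_leI)
      then show ?thesis using True by simp
    next
      case False
      then have "(u, w) \<notin> X \<or> ?f u w = 0" by (auto simp: rho_dens_def)
      then show ?thesis by auto
    qed
  qed
  finally have 2: "ennreal \<kappa> * (\<integral>\<^sup>+u. \<integral>\<^sup>+w. ennreal (?f u w) * indicator X (u, w) \<partial>lborel \<partial>lborel) \<le>
    (\<integral>\<^sup>+u. \<integral>\<^sup>+w. ennreal (?f u w) * indicator ?Y (u, w) \<partial>lborel \<partial>lborel)" unfolding 1 .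
  have "ennreal \<kappa> * emeasure (rho p n q) X =
    ennreal (1 / rho_norm p n q) * (ennreal \<kappa> * (\<integral>\<^sup>+u. \<integral>\<^sup>+w. ennreal (?f u w) * indicator X (u, w) \<partial>lborel \<partial>lborel))"
    unfolding emeasure_rho_lborel[OF pq X] by (simp only: mult_ac)
  also have "\<dots> \<le> ennreal (1 / rho_norm p n q) * (\<integral>\<^sup>+u. \<integral>\<^sup>+w. ennreal (?f u w) * indicator ?Y (u, w) \<partial>lborel \<partial>lborel)"
    by (intro mult_left_mono 2) simp
  also have "\<dots> = emeasure (rho p n q) ?Y" unfolding emeasure_rho_lborel[OF pq Y] ..
  finally show ?thesis
    using k by (simp add: emeasure_eq_measure ennreal_mult[symmetric])
qed

lemma power_one_plus_ge:
  fixes x :: real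
  assumes "\<bar>x\<bar> \<le> 1 / 2"
  shows "exp (real k * (x - 2 * x\<^sup>2)) \<le> (1 + x) ^ k"
proof -
  have "\<bar>ln (1 + x) - x\<bar> \<le> 2 * x\<^sup>2" by (rule abs_ln_one_plus_x_minus_x_bound[OF assms])
  then have "x - 2 * x\<^sup>2 \<le> ln (1 + x)" by linarith
  then have "exp (x - 2 * x\<^sup>2) \<le> 1 + x" using assms by (simp add: ln_ge_iff abs_le_iff)
  then have "exp (x - 2 * x\<^sup>2) ^ k \<le> (1 + x) ^ k" by (intro power_mono) auto
  then show ?thesis by (simp add: exp_of_nat_mult)
qed

text \<open>With \<open>x = d / u\<close> and \<open>y = - d / w\<close> the logarithm of the ratio
  is \<open>(p - 1) * x + (q - 1) * y\<close> up to second order. Near the mean,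
  \<open>(p - 1) / u\<close> and \<open>(q - 1) / w\<close> both differ from \<open>N + 1\<close> by
  at most \<open>20 * sqrt N / l\<close>, so the first order terms cancel up to
  \<open>40 * C / l\<close>; the second order terms cost at most \<open>32 * C^2 / l^2\<close>. The
  ratio is thus bounded below independently of \<open>N\<close>.\<close>

lemma shift_ratio:
  fixes l C N u w d :: real
  assumes l: "0 < l" "l \<le> 1" and C: "0 \<le> C" and pq: "0 < p" "0 < q"
    and N: "1 \<le> N" "C / sqrt N \<le> l / 8" "2 / sqrt N \<le> l / 4"
    and pN: "real p + real q \<le> N" "l * N \<le> p" "l * N \<le> q"
    and u: "\<bar>u - p / (N + 1)\<bar> \<le> 2 / sqrt N" and w: "\<bar>w - q / (N + 1)\<bar> \<le> 2 / sqrt N" and d: "\<bar>d\<bar> \<le> C / sqrt N"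
  shows "0 \<le> u + d" "0 \<le> w - d"
    "exp (- (40 * C / l + 32 * C\<^sup>2 / l\<^sup>2)) * (u ^ (p - 1) * w ^ (q - 1)) \<le> (u + d) ^ (p - 1) * (w - d) ^ (q - 1)"
proof -
  define s where "s = sqrt N"
  have s: "0 < s" "s\<^sup>2 = N" "1 \<le> s" using N(1) by (auto simp: s_def)
  \<comment> \<open>As \<open>N / (N + 1)\<close> is at least 1/2, the centre is at least
    \<open>l / 2\<close>, and the deviation takes away at most \<open>l / 4\<close>.\<close>
  have low: "l / 4 \<le> y" if "\<bar>y - k / (N + 1)\<bar> \<le> 2 / sqrt N" "l * N \<le> k" for y k
  proof -
    have "l / 2 \<le> l * N / (N + 1)" using l N(1) by (simp add: divide_simps)
    also have "\<dots> \<le> k / (N + 1)" using that N(1) by (intro divide_right_mono) auto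
    finally show ?thesis using that(1) N(3) by linarith
  qed
  have u4: "l / 4 \<le> u" using low[OF u pN(2)] .
  have w4: "l / 4 \<le> w" using low[OF w pN(3)] .
  have u0: "0 < u" "0 < w" using u4 w4 l by linarith+
  have d8: "\<bar>d\<bar> \<le> l / 8" using d N(2) by linarith
  show "0 \<le> u + d" "0 \<le> w - d" using d8 u4 w4 l by linarith+
  define x where "x = d / u"
  define y where "y = - d / w"
  have sm: "\<bar>e / z\<bar> \<le> 1 / 2" "(e / z)\<^sup>2 \<le> 16 * C\<^sup>2 / (N * l\<^sup>2)" if "\<bar>e\<bar> = \<bar>d\<bar>" "l / 4 \<le> z" for e z
  proof -
    have z: "0 < z" using that l by linarith
    have "\<bar>e / z\<bar> \<le> (l / 8) / (l / 4)"
      unfolding abs_divide using that d8 l z by (intro frac_le) auto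
    then show "\<bar>e / z\<bar> \<le> 1 / 2" using l by simp
    have "\<bar>e / z\<bar> \<le> (C / s) / (l / 4)"
      unfolding abs_divide using that d l z C s by (intro frac_le) (auto simp: s_def)
    then have "\<bar>e / z\<bar>\<^sup>2 \<le> ((C / s) / (l / 4))\<^sup>2" by (intro power_mono) auto
    also have "\<dots> = 16 * C\<^sup>2 / (s\<^sup>2 * l\<^sup>2)" by (simp add: power_divide field_simps)
    finally show "(e / z)\<^sup>2 \<le> 16 * C\<^sup>2 / (N * l\<^sup>2)" unfolding power2_abs s(2) .
  qed
  have x: "\<bar>x\<bar> \<le> 1 / 2" "x\<^sup>2 \<le> 16 * C\<^sup>2 / (N * l\<^sup>2)" unfolding x_def using sm[of d u] u4 by auto
  have y: "\<bar>y\<bar> \<le> 1 / 2" "y\<^sup>2 \<le> 16 * C\<^sup>2 / (N * l\<^sup>2)" unfolding y_def using sm[of "- d" w] w4 by auto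
  \<comment> \<open>The numerator collects 1 from \<open>k - 1\<close> against \<open>k\<close> and
    \<open>4 * sqrt N\<close> from the deviation of \<open>z\<close>, together at most
    \<open>5 * sqrt N\<close>; the denominator is at least \<open>l / 4\<close>.\<close>
  have near: "\<bar>real (k - 1) / z - (N + 1)\<bar> \<le> 20 * s / l"
    if "\<bar>z - k / (N + 1)\<bar> \<le> 2 / sqrt N" "l / 4 \<le> z" "0 < k" for z k
  proof -
    have z: "0 < z" using that l by linarith
    have "real (k - 1) / z - (N + 1) = (- 1 - (N + 1) * (z - k / (N + 1))) / z"
    proof -
      have e: "(N + 1) * (z - k / (N + 1)) = (N + 1) * z - k" using N(1) by (simp add: right_diff_distrib)
      have "real (k - 1) = real k - 1" using that(3) by (simp add: of_nat_diff)
      then show ?thesis unfolding e using z by (simp add: diff_divide_distrib)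
    qed
    then have "\<bar>real (k - 1) / z - (N + 1)\<bar> = \<bar>- 1 - (N + 1) * (z - k / (N + 1))\<bar> / z" using z by (simp add: abs_divide)
    also have "\<dots> \<le> (5 * s) / (l / 4)"
    proof (rule frac_le)
      have "(N + 1) * \<bar>z - k / (N + 1)\<bar> \<le> (2 * N) * (2 / s)"
        using that(1) N(1) by (intro mult_mono) (auto simp: s_def)
      also have "\<dots> = 4 * s" using s by (simp add: field_simps power2_eq_square)
      finally have "\<bar>(N + 1) * (z - k / (N + 1))\<bar> \<le> 4 * s" using N(1) by (simp add: abs_mult)
      then show "\<bar>- 1 - (N + 1) * (z - k / (N + 1))\<bar> \<le> 5 * s" using s(3) by linarith
    qed (use s that l in auto)
    finally show ?thesis by (simp add: field_simps)
  qed
  have ex: "- (40 * C / l + 32 * C\<^sup>2 / l\<^sup>2) \<le> real (p - 1) * (x - 2 * x\<^sup>2) + real (q - 1) * (y - 2 * y\<^sup>2)"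
  proof -
    have "\<bar>real (p - 1) / u - real (q - 1) / w\<bar> \<le> 40 * s / l"
      using near[OF u u4 pq(1)] near[OF w w4 pq(2)] by linarith
    then have "\<bar>d * (real (p - 1) / u - real (q - 1) / w)\<bar> \<le> (C / s) * (40 * s / l)"
      unfolding abs_mult using d C s by (intro mult_mono) (auto simp: s_def)
    also have "\<dots> = 40 * C / l" using s by simp
    finally have 1: "- (40 * C / l) \<le> d * (real (p - 1) / u - real (q - 1) / w)" by linarith
    have "real (p - 1) * x\<^sup>2 + real (q - 1) * y\<^sup>2 \<le> real (p - 1) * (16 * C\<^sup>2 / (N * l\<^sup>2)) + real (q - 1) * (16 * C\<^sup>2 / (N * l\<^sup>2))"
      using x y by (intro add_mono mult_left_mono) auto
    also have "\<dots> = (real (p - 1) + real (q - 1)) * (16 * C\<^sup>2 / (N * l\<^sup>2))" by (simp only: distrib_right)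
    also have "\<dots> \<le> N * (16 * C\<^sup>2 / (N * l\<^sup>2))"
      using pN(1) pq N(1) by (intro mult_right_mono) (auto simp: of_nat_diff)
    also have "\<dots> = 16 * C\<^sup>2 / l\<^sup>2" using N(1) by simp
    finally have 2: "real (p - 1) * x\<^sup>2 + real (q - 1) * y\<^sup>2 \<le> 16 * C\<^sup>2 / l\<^sup>2" .
    have "real (p - 1) * (x - 2 * x\<^sup>2) + real (q - 1) * (y - 2 * y\<^sup>2) =
      d * (real (p - 1) / u - real (q - 1) / w) - 2 * (real (p - 1) * x\<^sup>2 + real (q - 1) * y\<^sup>2)"
      by (simp add: x_def y_def algebra_simps)
    moreover have "32 * C\<^sup>2 / l\<^sup>2 = 2 * (16 * C\<^sup>2 / l\<^sup>2)" by simp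
    moreover have "- (a + k2) \<le> e" if "e = b - 2 * c" "k2 = 2 * k1" "- a \<le> b" "c \<le> k1" for a b c e k1 k2 :: real
      using that by linarith
    ultimately show ?thesis using 1 2 by blast
  qed
  have "exp (- (40 * C / l + 32 * C\<^sup>2 / l\<^sup>2)) \<le> exp (real (p - 1) * (x - 2 * x\<^sup>2)) * exp (real (q - 1) * (y - 2 * y\<^sup>2))"
    unfolding exp_add[symmetric] using ex by simp
  also have "\<dots> \<le> (1 + x) ^ (p - 1) * (1 + y) ^ (q - 1)"
    using x y by (intro mult_mono power_one_plus_ge) (auto simp: abs_le_iff)
  finally have "exp (- (40 * C / l + 32 * C\<^sup>2 / l\<^sup>2)) * (u ^ (p - 1) * w ^ (q - 1)) \<le>
    ((1 + x) ^ (p - 1) * (1 + y) ^ (q - 1)) * (u ^ (p - 1) * w ^ (q - 1))"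
    using u0 by (intro mult_right_mono) auto
  also have "\<dots> = (u * (1 + x)) ^ (p - 1) * (w * (1 + y)) ^ (q - 1)" by (simp add: power_mult_distrib mult_ac)
  also have "u * (1 + x) = u + d" using u0 by (simp add: x_def algebra_simps)
  also have "w * (1 + y) = w - d" using u0 by (simp add: y_def algebra_simps)
  finally show "exp (- (40 * C / l + 32 * C\<^sup>2 / l\<^sup>2)) * (u ^ (p - 1) * w ^ (q - 1)) \<le> (u + d) ^ (p - 1) * (w - d) ^ (q - 1)" .
qed

text \<open>By Chebyshev's inequality each coordinate deviates by \<open>2 / sqrt N\<close> with
  probability at most 1/4. The half of the mass that remains is the stock to be shifted.\<close>

lemma rho_concentrated:
  assumes n: "0 < n" and N: "N = real (p + n + q)"
  shows "1 / 2 \<le> measure (rho p n q) {z. \<bar>fst z - p / (N + 1)\<bar> \<le> 2 / sqrt N \<and> \<bar>snd z - q / (N + 1)\<bar> \<le> 2 / sqrt N}"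
proof -
  interpret prob_space "rho p n q" by (rule prob_space_rho[OF n])
  have N1: "1 \<le> N" using n N by simp
  let ?a = "p / (N + 1)" and ?b = "q / (N + 1)"
  have ab: "0 \<le> ?a" "?a \<le> 1" "0 \<le> ?b" "?b \<le> 1" using N by (auto simp: divide_simps)
  have i: "integrable (rho p n q) (\<lambda>x. (fst x - ?a)\<^sup>2)" "integrable (rho p n q) (\<lambda>x. (snd x - ?b)\<^sup>2)"
    by (rule rho_integrable[OF n, where K=1], simp, use ab in \<open>simp add: sq_le_1\<close>)+
  have s: "0 < 2 / sqrt N" "(2 / sqrt N)\<^sup>2 = 4 / N" using N1 by (auto simp: power_divide)
  have b: "v / (2 / sqrt N)\<^sup>2 \<le> 1 / 4" if "v \<le> 1 / (4 * (N + 2))" for v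
  proof -
    have "v / (4 / N) \<le> (1 / (4 * (N + 2))) / (4 / N)" using that N1 by (intro divide_right_mono) auto
    also have "\<dots> \<le> 1 / 4" using N1 by (simp add: divide_simps)
    finally show ?thesis unfolding s .
  qed
  let ?X = "{z. 2 / sqrt N \<le> \<bar>fst z - ?a\<bar>}" and ?Y = "{z. 2 / sqrt N \<le> \<bar>snd z - ?b\<bar>}"
  have X: "prob ?X \<le> 1 / 4"
  proof -
    have "prob {z \<in> space (rho p n q). 2 / sqrt N \<le> \<bar>fst z - ?a\<bar>} \<le> 1 / 4"
      by (rule order_trans[OF second_moment_tail[OF _ i(1) s(1)] b[OF rho_variances(1)[OF n N]]]) measurable
    then show ?thesis by simp
  qed
  have Y: "prob ?Y \<le> 1 / 4"
  proof -
    have "prob {z \<in> space (rho p n q). 2 / sqrt N \<le> \<bar>snd z - ?b\<bar>} \<le> 1 / 4"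
      by (rule order_trans[OF second_moment_tail[OF _ i(2) s(1)] b[OF rho_variances(2)[OF n N]]]) measurable
    then show ?thesis by simp
  qed
  have sets: "?X \<in> events" "?Y \<in> events"
  proof -
    have "{z \<in> space (borel \<Otimes>\<^sub>M borel). 2 / sqrt N \<le> \<bar>fst z - ?a\<bar>} \<in> sets (borel \<Otimes>\<^sub>M borel)"
      "{z \<in> space (borel \<Otimes>\<^sub>M borel). 2 / sqrt N \<le> \<bar>snd z - ?b\<bar>} \<in> sets (borel \<Otimes>\<^sub>M borel)" by measurable
    then show "?X \<in> events" "?Y \<in> events" by (simp_all add: space_pair_measure)
  qed
  have "prob (?X \<union> ?Y) \<le> prob ?X + prob ?Y" by (rule measure_Un_le[OF sets])
  then have "prob (?X \<union> ?Y) \<le> 1 / 2" using X Y by linarith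
  moreover have "prob (UNIV - (?X \<union> ?Y)) = 1 - prob (?X \<union> ?Y)"
    using prob_compl[of "?X \<union> ?Y"] sets by simp
  moreover have "prob (UNIV - (?X \<union> ?Y)) \<le> prob {z. \<bar>fst z - ?a\<bar> \<le> 2 / sqrt N \<and> \<bar>snd z - ?b\<bar> \<le> 2 / sqrt N}"
  proof (rule finite_measure_mono)
    have "{z \<in> space (borel \<Otimes>\<^sub>M borel). \<bar>fst z - ?a\<bar> \<le> 2 / sqrt N \<and> \<bar>snd z - ?b\<bar> \<le> 2 / sqrt N} \<in> sets (borel \<Otimes>\<^sub>M borel)"
      by measurable
    then show "{z. \<bar>fst z - ?a\<bar> \<le> 2 / sqrt N \<and> \<bar>snd z - ?b\<bar> \<le> 2 / sqrt N} \<in> events" by (simp add: space_pair_measure)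
  qed auto
  ultimately show ?thesis by linarith
qed

text \<open>Shifting the box that holds half of the mass by \<open>C / sqrt N\<close> moves
  \<open>u + (1 - u - w) * m\<close> by exactly \<open>C / sqrt N\<close> for every
  \<open>m\<close>, while inside the box this value deviates from \<open>M\<close> by at most
  \<open>2 / sqrt N\<close>; hence \<open>C - 2\<close>. What counts is that \<open>\<kappa>\<close>
  depends on \<open>l\<close> and \<open>C\<close> alone.\<close>

lemma rho_mean_spread:
  fixes l C :: real
  assumes l: "0 < l" "l \<le> 1" and C: "0 \<le> C"
  shows "\<exists>\<kappa>>0. \<exists>N0. \<forall>p n q N. 0 < n \<longrightarrow> N = real (p + n + q) \<longrightarrow> N0 \<le> N \<longrightarrow> l * N \<le> p \<longrightarrow> l * N \<le> q \<longrightarrow>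
    (\<forall>m M. 0 \<le> m \<longrightarrow> m \<le> 1 \<longrightarrow> M = (1 - m) * (p / (N + 1)) + m * (1 - q / (N + 1)) \<longrightarrow>
      \<kappa> \<le> measure (rho p n q) {z. M + (C - 2) / sqrt N \<le> fst z + (1 - fst z - snd z) * m} \<and>
      \<kappa> \<le> measure (rho p n q) {z. fst z + (1 - fst z - snd z) * m \<le> M - (C - 2) / sqrt N})"
proof -
  define \<kappa> where "\<kappa> = exp (- (40 * C / l + 32 * C\<^sup>2 / l\<^sup>2))"
  \<comment> \<open>Large enough for \<open>C / sqrt N \<le> l / 8\<close> and
    \<open>2 / sqrt N \<le> l / 4\<close>, so that \<open>u + d\<close> and \<open>w - d\<close>
    stay nonnegative on the box.\<close>
  define N0 where "N0 = max 1 (max ((8 * C / l)\<^sup>2) ((8 / l)\<^sup>2))"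
  have main: "\<kappa> / 2 \<le> measure (rho p n q) {z. M + (C - 2) / sqrt N \<le> fst z + (1 - fst z - snd z) * m} \<and>
      \<kappa> / 2 \<le> measure (rho p n q) {z. fst z + (1 - fst z - snd z) * m \<le> M - (C - 2) / sqrt N}"
    if n: "0 < n" and N: "N = real (p + n + q)" and N0: "N0 \<le> N" and pq: "l * N \<le> p" "l * N \<le> q" and m: "0 \<le> m" "m \<le> 1"
      and M: "M = (1 - m) * (p / (N + 1)) + m * (1 - q / (N + 1))" for p n q N m M
  proof -
    interpret prob_space "rho p n q" by (rule prob_space_rho[OF n])
    have N1: "1 \<le> N" using N0 by (simp add: N0_def)
    have "8 * C / l \<le> sqrt N" using N0 by (intro real_le_rsqrt) (simp add: N0_def)
    then have Nc: "C / sqrt N \<le> l / 8" using l N1 by (simp add: field_simps)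
    have "8 / l \<le> sqrt N" using N0 by (intro real_le_rsqrt) (simp add: N0_def)
    then have Nd: "2 / sqrt N \<le> l / 4" using l N1 by (simp add: field_simps)
    have "0 < l * N" using l N1 by simp
    then have p0: "0 < p" "0 < q" using pq by (auto intro!: Nat.gr0I)
    have pN: "real p + real q \<le> N" using N by simp
    let ?G = "{z. \<bar>fst z - p / (N + 1)\<bar> \<le> 2 / sqrt N \<and> \<bar>snd z - q / (N + 1)\<bar> \<le> 2 / sqrt N}"
    have G: "?G \<in> sets (borel \<Otimes>\<^sub>M borel)"
    proof -
      have "{z \<in> space (borel \<Otimes>\<^sub>M borel). \<bar>fst z - p / (N + 1)\<bar> \<le> 2 / sqrt N \<and> \<bar>snd z - q / (N + 1)\<bar> \<le> 2 / sqrt N} \<in> sets (borel \<Otimes>\<^sub>M borel)"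
        by measurable
      then show ?thesis by (simp add: space_pair_measure)
    qed
    have sh: "\<kappa> / 2 \<le> prob {z. (fst z - d, snd z + d) \<in> ?G}" if d: "\<bar>d\<bar> \<le> C / sqrt N" for d
    proof -
      have "\<kappa> * (1 / 2) \<le> \<kappa> * prob ?G"
        using rho_concentrated[OF n N] by (intro mult_left_mono) (auto simp: \<kappa>_def)
      also have "\<dots> \<le> prob {z. (fst z - d, snd z + d) \<in> ?G}"
      proof (rule rho_shift[OF p0(1) n p0(2) G])
        fix u w assume "(u, w) \<in> ?G"
        then have "\<bar>u - p / (N + 1)\<bar> \<le> 2 / sqrt N" "\<bar>w - q / (N + 1)\<bar> \<le> 2 / sqrt N" by auto
        from shift_ratio[OF l C p0 N1 Nc Nd pN pq this d]
        show "0 \<le> u + d \<and> 0 \<le> w - d \<and> \<kappa> * (u ^ (p - 1) * w ^ (q - 1)) \<le> (u + d) ^ (p - 1) * (w - d) ^ (q - 1)"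
          by (simp add: \<kappa>_def)
      qed (simp add: \<kappa>_def)
      finally show ?thesis by simp
    qed
    have mu: "\<bar>fst z + (1 - fst z - snd z) * m - M - d\<bar> \<le> 2 / sqrt N" if "(fst z - d, snd z + d) \<in> ?G" for z d
    proof -
      let ?x = "fst z - d - p / (N + 1)" and ?y = "snd z + d - q / (N + 1)"
      have xy: "\<bar>?x\<bar> \<le> 2 / sqrt N" "\<bar>?y\<bar> \<le> 2 / sqrt N" using that by auto
      have "fst z + (1 - fst z - snd z) * m - M - d = (1 - m) * ?x - m * ?y"
        by (simp add: M algebra_simps)
      also have "\<bar>\<dots>\<bar> \<le> \<bar>(1 - m) * ?x\<bar> + \<bar>m * ?y\<bar>" by (rule abs_triangle_ineq4)
      also have "\<dots> = (1 - m) * \<bar>?x\<bar> + m * \<bar>?y\<bar>" using m by (simp add: abs_mult)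
      also have "\<dots> \<le> (1 - m) * (2 / sqrt N) + m * (2 / sqrt N)"
        using xy m by (intro add_mono mult_left_mono) auto
      also have "\<dots> = ((1 - m) + m) * (2 / sqrt N)" by (simp only: distrib_right)
      also have "\<dots> = 2 / sqrt N" by simp
      finally show ?thesis .
    qed
    have C0: "\<bar>C / sqrt N\<bar> \<le> C / sqrt N" "\<bar>- (C / sqrt N)\<bar> \<le> C / sqrt N" using C N1 by auto
    have ev: "{z. M + (C - 2) / sqrt N \<le> fst z + (1 - fst z - snd z) * m} \<in> events"
      "{z. fst z + (1 - fst z - snd z) * m \<le> M - (C - 2) / sqrt N} \<in> events"
    proof -
      have "{z \<in> space (borel \<Otimes>\<^sub>M borel). M + (C - 2) / sqrt N \<le> fst z + (1 - fst z - snd z) * m} \<in> sets (borel \<Otimes>\<^sub>M borel)"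
        "{z \<in> space (borel \<Otimes>\<^sub>M borel). fst z + (1 - fst z - snd z) * m \<le> M - (C - 2) / sqrt N} \<in> sets (borel \<Otimes>\<^sub>M borel)"
        by measurable
      then show "{z. M + (C - 2) / sqrt N \<le> fst z + (1 - fst z - snd z) * m} \<in> events"
        "{z. fst z + (1 - fst z - snd z) * m \<le> M - (C - 2) / sqrt N} \<in> events" by (simp_all add: space_pair_measure)
    qed
    have "prob {z. (fst z - C / sqrt N, snd z + C / sqrt N) \<in> ?G} \<le>
      prob {z. M + (C - 2) / sqrt N \<le> fst z + (1 - fst z - snd z) * m}"
    proof (rule finite_measure_mono[OF _ ev(1)], rule subsetI, rule CollectI)
      fix z assume "z \<in> {z. (fst z - C / sqrt N, snd z + C / sqrt N) \<in> ?G}"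
      then have "\<bar>fst z + (1 - fst z - snd z) * m - M - C / sqrt N\<bar> \<le> 2 / sqrt N" by (intro mu) blast
      then show "M + (C - 2) / sqrt N \<le> fst z + (1 - fst z - snd z) * m" unfolding diff_divide_distrib by linarith
    qed
    moreover have "prob {z. (fst z - - (C / sqrt N), snd z + - (C / sqrt N)) \<in> ?G} \<le>
      prob {z. fst z + (1 - fst z - snd z) * m \<le> M - (C - 2) / sqrt N}"
    proof (rule finite_measure_mono[OF _ ev(2)], rule subsetI, rule CollectI)
      fix z assume "z \<in> {z. (fst z - - (C / sqrt N), snd z + - (C / sqrt N)) \<in> ?G}"
      then have "\<bar>fst z + (1 - fst z - snd z) * m - M - - (C / sqrt N)\<bar> \<le> 2 / sqrt N" by (intro mu) blast
      then show "fst z + (1 - fst z - snd z) * m \<le> M - (C - 2) / sqrt N" unfolding diff_divide_distrib by linarith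
    qed
    ultimately show ?thesis using sh[OF C0(1)] sh[OF C0(2)] by linarith
  qed
  show ?thesis
    by (rule exI[of _ "\<kappa> / 2"], rule conjI, simp add: \<kappa>_def, rule exI[of _ N0]) (use main in blast)
qed

section \<open>Ties between coordinates are null events\<close>

text \<open>Fubini in the coordinate \<open>i\<close>. It serves for ties, which on each line along
  \<open>i\<close> occur at a single value.\<close>

lemma AE_PL_section:
  assumes A: "finite A" "i \<in> A" and Q: "{F \<in> space (PL A). \<not> Q F} \<in> sets (PL A)"
    and ae: "\<And>F. F \<in> space (PL (A - {i})) \<Longrightarrow> AE v in lborel. Q (F(i := v))"
  shows "AE F in PL A. Q F"
proof -
  let ?N = "{F \<in> space (PL A). \<not> Q F}"
  have ins: "insert i (A - {i}) = A" using A by auto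
  have "emeasure (PL A) ?N = (\<integral>\<^sup>+F. indicator ?N F \<partial>PL (insert i (A - {i})))" using Q ins by simp
  also have "\<dots> = (\<integral>\<^sup>+F. \<integral>\<^sup>+v. indicator ?N (F(i := v)) \<partial>lborel \<partial>PL (A - {i}))"
    by (rule lborel_prod.product_nn_integral_insert) (use A Q ins in auto)
  also have "\<dots> = (\<integral>\<^sup>+F. 0 \<partial>PL (A - {i}))"
  proof (rule nn_integral_cong)
    fix F assume "F \<in> space (PL (A - {i}))"
    from ae[OF this] have "(\<integral>\<^sup>+v. indicator ?N (F(i := v)) \<partial>lborel) = (\<integral>\<^sup>+v. 0 \<partial>(lborel :: real measure))"
      by (intro nn_integral_cong_AE) (elim eventually_mono, auto simp: indicator_def)
    then show "(\<integral>\<^sup>+v. indicator ?N (F(i := v)) \<partial>lborel) = 0" by simp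
  qed
  finally have "?N \<in> null_sets (PL A)" using Q by auto
  from AE_not_in[OF this] show ?thesis
    by (rule AE_mp) (rule AE_I2, auto)
qed

lemma AE_PL_neq_const:
  assumes "finite A" "x \<in> A"
  shows "AE F in PL A. F x \<noteq> t"
proof (rule AE_PL_section[OF assms])
  show "{F \<in> space (PL A). \<not> F x \<noteq> t} \<in> sets (PL A)" using assms(2) by measurable
  show "AE v in lborel. (F(x := v)) x \<noteq> t" for F :: "'a \<Rightarrow> real"
    using AE_lborel_singleton[of t] by simp
qed

lemma AE_PL_neq:
  assumes "finite A" "x \<in> A" "y \<in> A" "x \<noteq> y"
  shows "AE F in PL A. F x \<noteq> F y"
proof (rule AE_PL_section[OF assms(1,2)])
  have "(\<lambda>F. F x) \<in> borel_measurable (PL A)" "(\<lambda>F. F y) \<in> borel_measurable (PL A)"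
    using assms(2,3) by measurable
  from borel_measurable_eq[OF this] show "{F \<in> space (PL A). \<not> F x \<noteq> F y} \<in> sets (PL A)" by simp
  show "AE v in lborel. (F(x := v)) x \<noteq> (F(x := v)) y" for F :: "'a \<Rightarrow> real"
    using AE_lborel_singleton[of "F y"] assms(4) by simp
qed

lemma AE_opm_of_PL:
  assumes "finite A" "r \<subseteq> A \<times> A" "AE F in PL A. Q F"
  shows "AE F in opm A r. Q F"
  unfolding order_polytope_measure_def
  by (rule AE_uniform_measureI[OF sets_order_polytope[OF assms(1,2)]]) (use assms(3) in eventually_elim, simp)

subsection \<open>One-point marginals\<close>

definition law :: "'a set \<Rightarrow> 'a rel \<Rightarrow> 'a \<Rightarrow> real measure" where
  "law A r x = distr (opm A r) borel (\<lambda>F. F x)"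

lemma law_facts:
  assumes A: "finite A" "partial_order_on A r" and x: "x \<in> A"
  shows "prob_space (law A r x)" "sets (law A r x) = sets borel" "space (law A r x) = UNIV"
    "measure (law A r x) {t<..} = surv A r x t" "measure (law A r x) {t} = 0"
    "(\<lambda>F. F x) \<in> measurable (opm A r) borel"
proof -
  interpret prob_space "opm A r" by (rule prob_space_opm[OF A])
  show m: "(\<lambda>F. F x) \<in> measurable (opm A r) borel" using x by measurable
  show "prob_space (law A r x)" unfolding law_def by (rule prob_space_distr[OF m])
  show "sets (law A r x) = sets borel" "space (law A r x) = UNIV" by (simp_all add: law_def)
  show "measure (law A r x) {t<..} = surv A r x t"
    unfolding law_def jsurv_def by (subst measure_distr[OF m]) (auto intro!: arg_cong[where f="measure (opm A r)"])
  have "measure (law A r x) {t} = measure (opm A r) {F \<in> space (PL A). F x = t}"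
    unfolding law_def by (subst measure_distr[OF m]) (auto intro!: arg_cong[where f="measure (opm A r)"])
  also have "\<dots> = measure (opm A r) {}"
  proof (rule measure_eq_AE)
    show "AE F in opm A r. F \<in> {F \<in> space (PL A). F x = t} \<longleftrightarrow> F \<in> {}"
      using AE_opm_of_PL[OF A(1) partial_order_on_sub[OF A(2)] AE_PL_neq_const[OF A(1) x, of t]]
      by eventually_elim simp
    show "{F \<in> space (PL A). F x = t} \<in> events" unfolding sets_opm using x by measurable
  qed simp
  finally show "measure (law A r x) {t} = 0" by simp
qed

lemma law_eqI:
  assumes A: "finite A" "partial_order_on A r" "x \<in> A" and B: "finite B" "partial_order_on B s" "y \<in> B"
    and eq: "\<And>t. surv A r x t = surv B s y t"
  shows "law A r x = law B s y"
proof (rule cdf_unique)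
  have rd: "real_distribution (law A r x)" if "finite A" "partial_order_on A r" "x \<in> A" for A :: "'c set" and r x
  proof -
    interpret prob_space "law A r x" by (rule law_facts[OF that])
    show ?thesis by unfold_locales (simp_all add: law_facts[OF that])
  qed
  show "real_distribution (law A r x)" by (rule rd[OF A])
  show "real_distribution (law B s y)"
  proof -
    interpret prob_space "law B s y" by (rule law_facts[OF B])
    show ?thesis by unfold_locales (simp_all add: law_facts[OF B])
  qed
  show "cdf (law A r x) = cdf (law B s y)"
  proof
    fix t :: real
    interpret a: prob_space "law A r x" by (rule law_facts[OF A])
    interpret b: prob_space "law B s y" by (rule law_facts[OF B])
    have c: "{..t} = UNIV - {t<..}" by auto
    have "measure (law A r x) {..t} = 1 - surv A r x t"
      unfolding c using a.prob_compl[of "{t<..}"] by (simp add: law_facts[OF A])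
    moreover have "measure (law B s y) {..t} = 1 - surv B s y t"
      unfolding c using b.prob_compl[of "{t<..}"] by (simp add: law_facts[OF B])
    ultimately show "cdf (law A r x) t = cdf (law B s y) t" by (simp add: cdf_def eq)
  qed
qed

lemma integral_law:
  assumes A: "finite A" "partial_order_on A r" "x \<in> A" and g: "g \<in> borel_measurable borel"
  shows "(\<integral>t. g t \<partial>law A r x) = (\<integral>F. (g (F x) :: real) \<partial>opm A r)"
  unfolding law_def by (rule integral_distr[OF law_facts(6)[OF A] g])

text \<open>Chebyshev's inequality at two standard deviations, with \<open>\<sigma>\<close> as an
  upper bound for the standard deviation.\<close>

lemma surv_tail:
  assumes A: "finite A" "partial_order_on A r" "x \<in> A" and v: "coord_var A r x \<le> \<sigma>\<^sup>2" and \<sigma>: "0 < \<sigma>"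
  shows "s \<le> coord_mean A r x - 2 * \<sigma> \<Longrightarrow> 3 / 4 \<le> surv A r x s" "coord_mean A r x + 2 * \<sigma> \<le> s \<Longrightarrow> surv A r x s \<le> 1 / 4"
proof -
  interpret prob_space "opm A r" by (rule prob_space_opm[OF A(1,2)])
  note [measurable] = A(3)
  let ?T = "{F \<in> space (PL A). 2 * \<sigma> \<le> \<bar>F x - coord_mean A r x\<bar>}"
  have "prob {F \<in> space (opm A r). 2 * \<sigma> \<le> \<bar>F x - coord_mean A r x\<bar>} \<le> coord_var A r x / (2 * \<sigma>)\<^sup>2"
    unfolding coord_var_def by (rule second_moment_tail[OF _ integrable_sq[OF A]]) (use \<sigma> in \<open>simp_all\<close>)
  also have "\<dots> \<le> \<sigma>\<^sup>2 / (2 * \<sigma>)\<^sup>2" using v by (intro divide_right_mono) auto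
  also have "\<dots> = 1 / 4" using \<sigma> by (simp add: power2_eq_square)
  finally have T: "prob ?T \<le> 1 / 4" by simp
  have Ts: "?T \<in> events" unfolding sets_opm by measurable
  {
    assume s: "s \<le> coord_mean A r x - 2 * \<sigma>"
    let ?U = "{F \<in> space (PL A). s < F x \<and> s < F x}"
    have U: "?U \<in> events" unfolding sets_opm by measurable
    have "prob (space (PL A) - ?U) \<le> prob ?T" using s by (intro finite_measure_mono Ts) auto
    then have "1 - prob ?U \<le> prob ?T" using prob_compl[OF U] by simp
    then show "3 / 4 \<le> surv A r x s" using T by (simp add: jsurv_def)
  }
  {
    assume s: "coord_mean A r x + 2 * \<sigma> \<le> s"
    have "surv A r x s \<le> prob ?T" unfolding jsurv_def using s by (intro finite_measure_mono Ts) auto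
    then show "surv A r x s \<le> 1 / 4" using T by simp
  }
qed

section \<open>The gain from moving two coordinates together\<close>

text \<open>Given the affine map, association and equal marginals bound the joint probability below
  by the square of the survival probability of \<open>x\<close> at the random level. The mean of a
  square exceeds the square of the mean by the variance, and there is variance here because the
  survival probability is at least 3/4 and at most 1/4 with probability at least
  \<open>\<kappa>\<close> each, provided that \<open>t\<close> is within \<open>\<tau>\<close> of
  the mean.\<close>

lemma jsurv_gain:
  assumes o: "ord3 A r D P E" and xy: "x \<in> P" "y \<in> P"
    and eq: "\<And>t. surv P (res r P) y t = surv P (res r P) x t"
    and assoc: "\<And>t. surv P (res r P) x t * surv P (res r P) y t \<le> jsurv P (res r P) x y t"
    and v: "coord_var P (res r P) x \<le> \<sigma>\<^sup>2" "0 < \<sigma>" and k: "0 \<le> \<kappa>"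
    and k1: "\<kappa> \<le> measure (rho (card D) (card P) (card E)) {z. coord_mean A r x + \<tau> + 2 * \<sigma> \<le> fst z + (1 - fst z - snd z) * coord_mean P (res r P) x}"
    and k2: "\<kappa> \<le> measure (rho (card D) (card P) (card E)) {z. fst z + (1 - fst z - snd z) * coord_mean P (res r P) x \<le> coord_mean A r x - (\<tau> + 2 * \<sigma>)}"
    and t: "\<bar>t - coord_mean A r x\<bar> \<le> \<tau>"
  shows "(surv A r x t)\<^sup>2 + \<kappa> / 16 \<le> jsurv A r x y t"
proof -
  note f = ord3_facts[OF o]
  let ?R = "rho (card D) (card P) (card E)"
  interpret R: prob_space ?R by (rule f)
  define s where "s z = (t - fst z) / (1 - fst z - snd z)" for z :: "real \<times> real"
  have [measurable]: "s \<in> borel_measurable (borel \<Otimes>\<^sub>M borel)" unfolding s_def by measurable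
  note jx = jsurv_facts[OF f(4,9) xy(1,1)] and jxy = jsurv_facts[OF f(4,9) xy]
  note [measurable] = jx(4) jxy(4)
  let ?S = "surv P (res r P) x" and ?m = "coord_mean P (res r P) x" and ?M = "coord_mean A r x"
  have fm: "(\<lambda>z. ?S (s z)) \<in> borel_measurable ?R" by measurable
  have sp: "space ?R = UNIV" by simp
  \<comment> \<open>If the conditional mean is at least \<open>t + 2 * \<sigma>\<close>, the level
    \<open>s z\<close> is at least \<open>2 * \<sigma>\<close> below the mean in \<open>P\<close>:
    dividing by the slope \<open>c \<le> 1\<close> only enlarges the distance.\<close>
  have c1: "\<kappa> \<le> measure ?R {z \<in> space ?R. 3 / 4 \<le> ?S (s z)}"
  proof (rule order_trans[OF k1], rule R.finite_measure_mono_AE)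
    show "AE z in ?R. z \<in> {z. ?M + \<tau> + 2 * \<sigma> \<le> fst z + (1 - fst z - snd z) * ?m} \<longrightarrow> z \<in> {z \<in> space ?R. 3 / 4 \<le> ?S (s z)}"
      using AE_rho[OF f(10)]
    proof eventually_elim
      case (elim z)
      define c where "c = 1 - fst z - snd z"
      have c: "0 < c" "c \<le> 1" using elim by (auto simp: c_def)
      show ?case
      proof (rule impI)
        assume "z \<in> {z. ?M + \<tau> + 2 * \<sigma> \<le> fst z + (1 - fst z - snd z) * ?m}"
        then have "t + 2 * \<sigma> \<le> fst z + c * ?m" using t by (auto simp: c_def)
        moreover have "c * (2 * \<sigma>) \<le> 2 * \<sigma>" using c v(2) by (simp add: mult_left_le_one_le)
        ultimately have "t - fst z \<le> c * (?m - 2 * \<sigma>)" by (simp add: right_diff_distrib)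
        then have "s z \<le> ?m - 2 * \<sigma>" using c unfolding s_def c_def[symmetric] by (simp add: pos_divide_le_eq mult.commute)
        then show "z \<in> {z \<in> space ?R. 3 / 4 \<le> ?S (s z)}" using surv_tail(1)[OF f(4,9) xy(1) v] by simp
      qed
    qed
    have "{z \<in> space ?R. 3 / 4 \<le> ?S (s z)} \<in> sets ?R" using fm by measurable
    then show "{z \<in> space ?R. 3 / 4 \<le> ?S (s z)} \<in> R.events" .
  qed
  have c2: "\<kappa> \<le> measure ?R {z \<in> space ?R. ?S (s z) \<le> 1 / 4}"
  proof (rule order_trans[OF k2], rule R.finite_measure_mono_AE)
    show "AE z in ?R. z \<in> {z. fst z + (1 - fst z - snd z) * ?m \<le> ?M - (\<tau> + 2 * \<sigma>)} \<longrightarrow> z \<in> {z \<in> space ?R. ?S (s z) \<le> 1 / 4}"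
      using AE_rho[OF f(10)]
    proof eventually_elim
      case (elim z)
      define c where "c = 1 - fst z - snd z"
      have c: "0 < c" "c \<le> 1" using elim by (auto simp: c_def)
      show ?case
      proof (rule impI)
        assume "z \<in> {z. fst z + (1 - fst z - snd z) * ?m \<le> ?M - (\<tau> + 2 * \<sigma>)}"
        then have "fst z + c * ?m + 2 * \<sigma> \<le> t" using t by (auto simp: c_def)
        moreover have "c * (2 * \<sigma>) \<le> 2 * \<sigma>" using c v(2) by (simp add: mult_left_le_one_le)
        ultimately have "c * (?m + 2 * \<sigma>) \<le> t - fst z" by (simp add: distrib_left)
        then have "?m + 2 * \<sigma> \<le> s z" using c unfolding s_def c_def[symmetric] by (simp add: pos_le_divide_eq mult.commute)
        then show "z \<in> {z \<in> space ?R. ?S (s z) \<le> 1 / 4}" using surv_tail(2)[OF f(4,9) xy(1) v] by simp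
      qed
    qed
    have "{z \<in> space ?R. ?S (s z) \<le> 1 / 4} \<in> sets ?R" using fm by measurable
    then show "{z \<in> space ?R. ?S (s z) \<le> 1 / 4} \<in> R.events" .
  qed
  have b: "\<bar>?S (s z)\<bar> \<le> 1" for z using jx(1,2)[of "s z"] by simp
  \<comment> \<open>Thresholds 1/2 apart give \<open>((3 / 4 - 1 / 4) / 2)^2 = 1 / 16\<close> per
    unit of \<open>\<kappa>\<close>.\<close>
  have "(R.expectation (\<lambda>z. ?S (s z)))\<^sup>2 + \<kappa> * ((3 / 4 - 1 / 4) / 2)\<^sup>2 \<le> R.expectation (\<lambda>z. (?S (s z))\<^sup>2)"
    by (rule R.variance_ge_two_point[OF fm b c1 c2 _ k]) simp
  also have "\<dots> \<le> R.expectation (\<lambda>z. jsurv P (res r P) x y (s z))"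
  proof (rule integral_mono)
    show "integrable ?R (\<lambda>z. (?S (s z))\<^sup>2)"
      by (rule R.integrable_const_bound[where B=1]) (use b in \<open>simp_all add: abs_square_le_1\<close>)
    show "integrable ?R (\<lambda>z. jsurv P (res r P) x y (s z))"
      by (rule R.integrable_const_bound[where B=1]) (use jxy in simp_all)
    show "(?S (s z))\<^sup>2 \<le> jsurv P (res r P) x y (s z)" for z
      using assoc[of "s z"] by (simp add: eq power2_eq_square)
  qed
  also have "\<dots> = jsurv A r x y t" unfolding jsurv_ord3[OF o xy] s_def ..
  also have "R.expectation (\<lambda>z. ?S (s z)) = surv A r x t" unfolding jsurv_ord3[OF o xy(1,1)] s_def ..
  finally show ?thesis by (simp add: power2_eq_square)
qed

text \<open>The base inequality alone yields 1/3, the second moment of the survival function at an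
  independent point of the same law. Chebyshev's inequality puts at least half of that law within
  \<open>\<tau>\<close> of its mean, where \<open>k\<close> is gained on top.\<close>

lemma jsurv_integral_gain:
  assumes A: "finite A" "partial_order_on A r" "x \<in> A" "y \<in> A" and B: "finite B" "partial_order_on B s" "z \<in> B"
    and eq: "\<And>t. surv B s z t = surv A r x t"
    and base: "\<And>t. (surv A r x t)\<^sup>2 \<le> jsurv A r x y t"
    and gain: "\<And>t. \<bar>t - coord_mean A r x\<bar> \<le> \<tau> \<Longrightarrow> (surv A r x t)\<^sup>2 + k \<le> jsurv A r x y t"
    and k: "0 \<le> k" and \<tau>: "0 < \<tau>" "2 * coord_var A r x < \<tau>\<^sup>2"
  shows "1 / 3 + k / 2 \<le> (\<integral>F. jsurv A r x y (F z) \<partial>opm B s)"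
proof -
  note l = law_facts[OF A(1-3)]
  interpret L: prob_space "law A r x" by (rule l)
  have sL: "sets (law A r x) = sets borel" by (rule l)
  note [measurable_cong] = sL
  note jx = jsurv_facts[OF A(1-3,3)] and jxy = jsurv_facts[OF A(1-4)]
  note [measurable] = jx(4) jxy(4)
  have law_eq: "law B s z = law A r x" by (rule law_eqI[OF B A(1-3) eq])
  let ?I = "{t. \<bar>t - coord_mean A r x\<bar> \<le> \<tau>}"
  have Im: "?I \<in> sets borel" by measurable
  have half: "1 / 2 \<le> L.prob ?I"
  proof -
    interpret P: prob_space "opm A r" by (rule prob_space_opm[OF A(1,2)])
    note [measurable] = A(3)
    let ?T = "{F \<in> space (PL A). \<tau> \<le> \<bar>F x - coord_mean A r x\<bar>}"
    have "P.prob {F \<in> space (opm A r). \<tau> \<le> \<bar>F x - coord_mean A r x\<bar>} \<le> coord_var A r x / \<tau>\<^sup>2"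
      unfolding coord_var_def by (rule P.second_moment_tail[OF _ integrable_sq[OF A(1-3)]]) (use \<tau> in \<open>simp_all\<close>)
    also have "\<dots> \<le> 1 / 2" using \<tau> by (simp add: field_simps)
    finally have T: "P.prob ?T \<le> 1 / 2" by simp
    have Ts: "?T \<in> P.events" unfolding sets_opm by measurable
    have "L.prob ?I = P.prob {F \<in> space (PL A). \<bar>F x - coord_mean A r x\<bar> \<le> \<tau>}"
      unfolding law_def by (subst measure_distr[OF l(6)]) (auto simp: Im intro!: arg_cong[where f="measure (opm A r)"])
    also have "\<dots> \<ge> P.prob (space (PL A) - ?T)"
    proof (rule P.finite_measure_mono)
      show "{F \<in> space (PL A). \<bar>F x - coord_mean A r x\<bar> \<le> \<tau>} \<in> P.events" unfolding sets_opm by measurable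
    qed auto
    finally show ?thesis using P.prob_compl[OF Ts] T by simp
  qed
  have i1: "integrable (law A r x) (\<lambda>t. (surv A r x t)\<^sup>2)"
    by (rule L.integrable_const_bound[where B=1]) (use jx in \<open>simp_all add: abs_square_le_1\<close>)
  have i2: "integrable (law A r x) (\<lambda>t. k * indicator ?I t)"
    by (rule L.integrable_const_bound[where B=k]) (use k Im in \<open>auto simp: indicator_def\<close>)
  have i3: "integrable (law A r x) (jsurv A r x y)"
    by (rule L.integrable_const_bound[where B=1]) (use jxy in simp_all)
  have "1 / 3 = (\<integral>t. (surv A r x t)\<^sup>2 \<partial>law A r x)"
    using survival_moments(2)[OF l(1,2,5)] by (simp add: l(4))
  moreover have "k * (1 / 2) \<le> k * L.prob ?I" using half k by (rule mult_left_mono)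
  moreover have "k * L.prob ?I = (\<integral>t. k * indicator ?I t \<partial>law A r x)" using Im by (simp add: l(3))
  moreover have "(\<integral>t. (surv A r x t)\<^sup>2 + k * indicator ?I t \<partial>law A r x) =
    (\<integral>t. (surv A r x t)\<^sup>2 \<partial>law A r x) + (\<integral>t. k * indicator ?I t \<partial>law A r x)"
    by (rule Bochner_Integration.integral_add[OF i1 i2])
  ultimately have "1 / 3 + k / 2 \<le> (\<integral>t. (surv A r x t)\<^sup>2 + k * indicator ?I t \<partial>law A r x)"
    by linarith
  also have "\<dots> \<le> (\<integral>t. jsurv A r x y t \<partial>law A r x)"
  proof (rule integral_mono)
    show "integrable (law A r x) (\<lambda>t. (surv A r x t)\<^sup>2 + k * indicator ?I t)"
      by (rule Bochner_Integration.integrable_add[OF i1 i2])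
    show "(surv A r x t)\<^sup>2 + k * indicator ?I t \<le> jsurv A r x y t" for t
      using base[of t] gain[of t] by (auto simp: indicator_def)
  qed (rule i3)
  also have "\<dots> = (\<integral>F. jsurv A r x y (F z) \<partial>opm B s)"
    unfolding law_eq[symmetric] by (rule integral_law[OF B]) measurable
  finally show ?thesis .
qed

lemma surv_integral_half:
  assumes A: "finite A" "partial_order_on A r" "x \<in> A" and B: "finite B" "partial_order_on B s" "z \<in> B"
    and eq: "\<And>t. surv B s z t = surv A r x t"
  shows "(\<integral>F. surv A r x (F z) \<partial>opm B s) = 1 / 2"
proof -
  note l = law_facts[OF A]
  have "(\<integral>t. surv A r x t \<partial>law A r x) = 1 / 2"
    using survival_moments(1)[OF l(1,2,5)] by (simp add: l(4))
  moreover have "law B s z = law A r x" by (rule law_eqI[OF B A eq])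
  ultimately show ?thesis
    using integral_law[OF B jsurv_facts(4)[OF A A(3)]] by simp
qed

text \<open>Independence lets the point of the other branch be fixed first; the inner probability is
  then a joint survival function at its value. The case \<open>x = y\<close> treats a single
  comparison.\<close>

lemma prob_par_below:
  assumes o: "par A r B C" and x: "x \<in> B" "y \<in> B" and z: "z \<in> C"
  shows "measure (opm A r) {F \<in> space (PL A). F z < F x \<and> F z < F y} = (\<integral>F. jsurv B (res r B) x y (F z) \<partial>opm C (res r C))"
proof -
  note f = par_facts[OF o]
  note [measurable] = x z
  interpret B: prob_space "opm B (res r B)" by (rule f)
  interpret C: prob_space "opm C (res r C)" by (rule f)
  interpret pair_sigma_finite "opm B (res r B)" "opm C (res r C)" ..
  interpret BC: pair_prob_space "opm B (res r B)" "opm C (res r C)" ..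
  let ?X = "{w \<in> space (PL B \<Otimes>\<^sub>M PL C). snd w z < fst w x \<and> snd w z < fst w y}"
  have X: "?X \<in> sets (PL B \<Otimes>\<^sub>M PL C)" by measurable
  have sBC: "sets (opm B (res r B) \<Otimes>\<^sub>M opm C (res r C)) = sets (PL B \<Otimes>\<^sub>M PL C)"
    by (rule sets_pair_measure_cong) simp_all
  have "measure (opm A r) {F \<in> space (PL A). F z < F x \<and> F z < F y} =
    measure (opm A r) {F \<in> space (PL A). snd (restrict F B, restrict F C) z < fst (restrict F B, restrict F C) x \<and>
      snd (restrict F B, restrict F C) z < fst (restrict F B, restrict F C) y}"
    using x z by simp
  also have "\<dots> = measure (opm B (res r B) \<Otimes>\<^sub>M opm C (res r C)) ?X" by (rule prob_par[OF o X])
  also have "\<dots> = (\<integral>w. indicator ?X w \<partial>(opm B (res r B) \<Otimes>\<^sub>M opm C (res r C)))"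
    using X sBC by simp
  also have "\<dots> = (\<integral>G. \<integral>F. indicator ?X (F, G) \<partial>opm B (res r B) \<partial>opm C (res r C))"
  proof -
    have "integrable (opm B (res r B) \<Otimes>\<^sub>M opm C (res r C)) (\<lambda>w. indicat_real ?X w)"
      using X sBC by (intro BC.integrable_const_bound[where B=1]) (auto simp: indicator_def)
    then have "integrable (opm B (res r B) \<Otimes>\<^sub>M opm C (res r C)) (case_prod (\<lambda>F G. indicat_real ?X (F, G)))"
      by simp
    from integral_snd[OF this] show ?thesis by simp
  qed
  also have "\<dots> = (\<integral>G. jsurv B (res r B) x y (G z) \<partial>opm C (res r C))"
  proof (rule Bochner_Integration.integral_cong[OF refl])
    fix G assume "G \<in> space (opm C (res r C))"
    then have G: "G \<in> space (PL C)" by simp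
    have "(\<integral>F. indicat_real ?X (F, G) \<partial>opm B (res r B)) =
      (\<integral>F. indicat_real {F \<in> space (PL B). G z < F x \<and> G z < F y} F \<partial>opm B (res r B))"
      using G by (intro Bochner_Integration.integral_cong) (auto simp: indicator_def space_pair_measure)
    also have "\<dots> = jsurv B (res r B) x y (G z)" by (simp add: jsurv_def)
    finally show "(\<integral>F. indicat_real ?X (F, G) \<partial>opm B (res r B)) = jsurv B (res r B) x y (G z)" .
  qed
  finally show ?thesis .
qed

subsection \<open>Classes of posets closed under series and parallel composition\<close>

text \<open>Classes of posets are predicates on carrier and order: several copies of a poset are
  disjoint parts that satisfy the same predicate, and no isomorphism has to be carried
  along.\<close>

definition point :: "nat set \<Rightarrow> nat rel \<Rightarrow> bool" where
  "point A r \<longleftrightarrow> (\<exists>x. A = {x} \<and> r = {(x, x)})"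

text \<open>\<open>h\<close> names the summand of each point, numbered from the bottom. One height
  function replaces an iterated binary ordinal sum, and any summand can be singled out at
  once.\<close>

definition branch :: "(nat \<Rightarrow> nat set \<Rightarrow> nat rel \<Rightarrow> bool) \<Rightarrow> nat \<Rightarrow> nat set \<Rightarrow> nat rel \<Rightarrow> (nat \<Rightarrow> nat) \<Rightarrow> bool" where
  "branch S m B r h \<longleftrightarrow> finite B \<and> partial_order_on B r \<and> (\<forall>x\<in>B. h x < m) \<and>
     (\<forall>x\<in>B. \<forall>y\<in>B. h x < h y \<longrightarrow> (x, y) \<in> r) \<and>
     (\<forall>i<m. S i {x \<in> B. h x = i} (res r {x \<in> B. h x = i}))"

definition series :: "(nat \<Rightarrow> nat set \<Rightarrow> nat rel \<Rightarrow> bool) \<Rightarrow> nat \<Rightarrow> nat set \<Rightarrow> nat rel \<Rightarrow> bool" where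
  "series S m B r \<longleftrightarrow> (\<exists>h. branch S m B r h)"

definition twin :: "(nat set \<Rightarrow> nat rel \<Rightarrow> bool) \<Rightarrow> nat set \<Rightarrow> nat rel \<Rightarrow> bool" where
  "twin Q A r \<longleftrightarrow> (\<exists>B C. par A r B C \<and> Q B (res r B) \<and> Q C (res r C))"

text \<open>Positivity is included because a summand that is singled out in an ordinal sum must be
  nonempty.\<close>

definition sized :: "(nat set \<Rightarrow> nat rel \<Rightarrow> bool) \<Rightarrow> nat \<Rightarrow> bool" where
  "sized Q n \<longleftrightarrow> 0 < n \<and> (\<forall>A r. Q A r \<longrightarrow> finite A \<and> partial_order_on A r \<and> card A = n)"

lemma sizedD: "sized Q n \<Longrightarrow> Q A r \<Longrightarrow> finite A" "sized Q n \<Longrightarrow> Q A r \<Longrightarrow> partial_order_on A r"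
  "sized Q n \<Longrightarrow> Q A r \<Longrightarrow> card A = n" "sized Q n \<Longrightarrow> 0 < n"
  by (simp_all add: sized_def)

lemma sized_nonempty: "sized Q n \<Longrightarrow> Q A r \<Longrightarrow> A \<noteq> {}"
  using sizedD(3)[of Q n A r] sizedD(4)[of Q n] by auto

lemma sized_point: "sized point 1"
  by (auto simp: sized_def point_def order_on_defs refl_on_def trans_def antisym_def)

lemma branchD:
  assumes "branch S m B r h"
  shows "finite B" "partial_order_on B r" "\<And>x. x \<in> B \<Longrightarrow> h x < m"
    "\<And>x y. x \<in> B \<Longrightarrow> y \<in> B \<Longrightarrow> h x < h y \<Longrightarrow> (x, y) \<in> r"
    "\<And>i. i < m \<Longrightarrow> S i {x \<in> B. h x = i} (res r {x \<in> B. h x = i})"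
  using assms by (auto simp: branch_def)

lemma branch_card:
  assumes br: "branch S m B r h" and sz: "\<And>i. i < m \<Longrightarrow> sized (S i) (sz i)" and i: "i \<le> m"
  shows "card {x \<in> B. h x < i} = (\<Sum>j<i. sz j)"
  using i
proof (induction i)
  case (Suc i)
  have "{x \<in> B. h x < Suc i} = {x \<in> B. h x < i} \<union> {x \<in> B. h x = i}" by auto
  moreover have "card {x \<in> B. h x = i} = sz i"
    using sizedD(3)[OF sz branchD(5)[OF br]] Suc.prems by simp
  ultimately show ?case
    using Suc branchD(1)[OF br] by (simp add: card_Un_disjoint disjoint_iff)
qed simp

lemma branch_card_all:
  assumes br: "branch S m B r h" and sz: "\<And>i. i < m \<Longrightarrow> sized (S i) (sz i)"
  shows "card B = (\<Sum>j<m. sz j)"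
proof -
  have "{x \<in> B. h x < m} = B" using branchD(3)[OF br] by auto
  then show ?thesis using branch_card[OF br sz, of m] by simp
qed

lemma branch_ord3:
  assumes br: "branch S m B r h" and sz: "\<And>i. i < m \<Longrightarrow> sized (S i) (sz i)" and i: "i < m"
  shows "ord3 B r {x \<in> B. h x < i} {x \<in> B. h x = i} {x \<in> B. i < h x}"
proof -
  have "{x \<in> B. h x = i} \<noteq> {}" by (rule sized_nonempty[OF sz[OF i] branchD(5)[OF br i]])
  moreover have "B = {x \<in> B. h x < i} \<union> {x \<in> B. h x = i} \<union> {x \<in> B. i < h x}" by auto
  ultimately show ?thesis
    unfolding ord3_def using branchD(1,2)[OF br]
    by (auto intro!: branchD(4)[OF br])
qed

lemma branch_cards:
  assumes br: "branch S m B r h" and sz: "\<And>i. i < m \<Longrightarrow> sized (S i) (sz i)" and i: "i < m"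
  shows "card {x \<in> B. h x < i} = (\<Sum>j<i. sz j)" "card {x \<in> B. h x = i} = sz i"
    "card {x \<in> B. i < h x} = (\<Sum>j<m. sz j) - (\<Sum>j<i. sz j) - sz i"
proof -
  show 1: "card {x \<in> B. h x < i} = (\<Sum>j<i. sz j)" using branch_card[OF br sz] i by simp
  show 2: "card {x \<in> B. h x = i} = sz i" using sizedD(3)[OF sz[OF i] branchD(5)[OF br i]] .
  show "card {x \<in> B. i < h x} = (\<Sum>j<m. sz j) - (\<Sum>j<i. sz j) - sz i"
    using ord3_facts(16)[OF branch_ord3[OF br sz i]] branch_card_all[OF br sz] 1 2 by simp
qed

lemma sized_series:
  assumes "\<And>i. i < m \<Longrightarrow> sized (S i) (sz i)" "0 < m"
  shows "sized (series S m) (\<Sum>j<m. sz j)"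
proof -
  have "0 < (\<Sum>j<m. sz j)"
    using assms sizedD(4) by (intro sum_pos) (auto simp: lessThan_empty_iff)
  moreover have "finite A \<and> partial_order_on A r \<and> card A = (\<Sum>j<m. sz j)" if ser: "series S m A r" for A r
  proof -
    obtain h where h: "branch S m A r h" using ser by (auto simp: series_def)
    show ?thesis using branchD(1,2)[OF h] branch_card_all[OF h assms(1)] by simp
  qed
  ultimately show ?thesis by (simp add: sized_def)
qed

lemma sized_twin: "sized Q n \<Longrightarrow> sized (twin Q) (2 * n)"
  unfolding sized_def twin_def par_def by (auto simp: card_Un_disjoint)

lemma order_on_refl: "partial_order_on A r \<Longrightarrow> x \<in> A \<Longrightarrow> (x, x) \<in> r"
  by (simp add: order_on_defs refl_on_def)

text \<open>Every level set of the one-point marginals meets every maximal chain.\<close>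

definition transversal :: "(nat set \<Rightarrow> nat rel \<Rightarrow> bool) \<Rightarrow> bool" where
  "transversal Q \<longleftrightarrow> (\<forall>A r A' r' x y. Q A r \<longrightarrow> Q A' r' \<longrightarrow> x \<in> A \<longrightarrow> y \<in> A' \<longrightarrow>
     (\<exists>y'\<in>A'. (\<forall>t. surv A' r' y' t = surv A r x t) \<and> ((y', y) \<in> r' \<or> (y, y') \<in> r')))"

lemma law_singleton:
  assumes "point {x} r"
  shows "law {x} r x = alpha 1"
proof -
  have po: "partial_order_on {x} r" using sizedD(2)[OF sized_point assms] .
  have "low {x} = (\<lambda>F. F x)" by (auto simp: low_def)
  then show ?thesis using distr_low[OF _ po] by (simp add: law_def)
qed

lemma transversal_point: "transversal point"
  unfolding transversal_def
proof (intro allI impI)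
  fix A r A' r' and x y :: nat
  assume h: "point A r" "point A' r'" "x \<in> A" "y \<in> A'"
  then have A: "A = {x}" "A' = {y}" "r' = {(y, y)}" by (auto simp: point_def)
  note f = sizedD(1,2)[OF sized_point h(1)] sizedD(1,2)[OF sized_point h(2)]
  have "surv A' r' y t = surv A r x t" for t
    using law_singleton[of x r] law_singleton[of y r'] h A law_facts(4)[OF f(1,2) h(3), of t] law_facts(4)[OF f(3,4) h(4), of t]
    by simp
  then show "\<exists>y'\<in>A'. (\<forall>t. surv A' r' y' t = surv A r x t) \<and> ((y', y) \<in> r' \<or> (y, y') \<in> r')"
    using A by auto
qed

text \<open>The Dirichlet law depends only on the numbers of points below, in and above the summand,
  so corresponding summands in two members of the class undergo the same random map.\<close>

lemma branch_surv_eq: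
  assumes br: "branch S m B r h" "branch S m B' r' h'" and sz: "\<And>i. i < m \<Longrightarrow> sized (S i) (sz i)" and i: "i < m"
    and x: "x \<in> {x \<in> B. h x = i}" and y: "y \<in> {x \<in> B'. h' x = i}"
    and eq: "\<And>t. surv {x \<in> B'. h' x = i} (res r' {x \<in> B'. h' x = i}) y t = surv {x \<in> B. h x = i} (res r {x \<in> B. h x = i}) x t"
  shows "surv B' r' y t = surv B r x t"
proof -
  note a = jsurv_ord3[OF branch_ord3[OF br(1) sz i] x x, of t]
  note b = jsurv_ord3[OF branch_ord3[OF br(2) sz i] y y, of t]
  have c: "card {x \<in> B'. h' x < i} = card {x \<in> B. h x < i}" "card {x \<in> B'. h' x = i} = card {x \<in> B. h x = i}"
    "card {x \<in> B'. i < h' x} = card {x \<in> B. i < h x}"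
    using branch_cards[OF br(1) sz i] branch_cards[OF br(2) sz i] by simp_all
  have "surv B' r' y t = (\<integral>z. surv {x \<in> B. h x = i} (res r {x \<in> B. h x = i}) x ((t - fst z) / (1 - fst z - snd z))
    \<partial>rho (card {x \<in> B. h x < i}) (card {x \<in> B. h x = i}) (card {x \<in> B. i < h x}))"
    using b by (simp only: c eq)
  then show ?thesis using a by simp
qed

text \<open>The point sought is taken in the summand with the index of \<open>x\<close>. Points of
  different summands are comparable, so the hypothesis on the summand matters only when
  \<open>y\<close> lies in that very summand.\<close>

lemma transversal_series:
  assumes sz: "\<And>i. i < m \<Longrightarrow> sized (S i) (sz i)" and tr: "\<And>i. i < m \<Longrightarrow> transversal (S i)"
  shows "transversal (series S m)"
  unfolding transversal_def
proof (intro allI impI)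
  fix B r B' r' and x y :: nat
  assume "series S m B r" "series S m B' r'" and xy: "x \<in> B" "y \<in> B'"
  then obtain h h' where br: "branch S m B r h" "branch S m B' r' h'" by (auto simp: series_def)
  define i where "i = h x"
  have i: "i < m" using branchD(3)[OF br(1) xy(1)] by (simp add: i_def)
  let ?P = "{x \<in> B. h x = i}" and ?P' = "{x \<in> B'. h' x = i}"
  have x: "x \<in> ?P" using xy by (simp add: i_def)
  have S: "S i ?P (res r ?P)" "S i ?P' (res r' ?P')" using branchD(5)[OF br(1) i] branchD(5)[OF br(2) i] by auto
  \<comment> \<open>\<open>y\<close> itself if it lies in the summand of index \<open>i\<close>, and
    an arbitrary point of that summand otherwise.\<close>
  obtain y0 where y0: "y0 \<in> ?P'" "y \<in> ?P' \<longrightarrow> y0 = y"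
    using sized_nonempty[OF sz[OF i] S(2)] by blast
  obtain y' where y': "y' \<in> ?P'" "\<And>t. surv ?P' (res r' ?P') y' t = surv ?P (res r ?P) x t"
    "(y', y0) \<in> res r' ?P' \<or> (y0, y') \<in> res r' ?P'"
    using tr[OF i] S x y0(1) unfolding transversal_def by blast
  have "surv B' r' y' t = surv B r x t" for t
    by (rule branch_surv_eq[OF br sz i x y'(1,2)])
  moreover have "(y', y) \<in> r' \<or> (y, y') \<in> r'"
  proof (cases "y \<in> ?P'")
    case True then show ?thesis using y0 y'(3) by (auto simp: res_def)
  next
    case False
    then have "h' y < h' y' \<or> h' y' < h' y" using y'(1) xy by auto
    then show ?thesis using branchD(4)[OF br(2)] y'(1) xy by auto
  qed
  ultimately show "\<exists>y'\<in>B'. (\<forall>t. surv B' r' y' t = surv B r x t) \<and> ((y', y) \<in> r' \<or> (y, y') \<in> r')"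
    using y'(1) by auto
qed

lemma twin_branchE:
  assumes "twin Q A r" "x \<in> A"
  obtains B C where "par A r B C" "Q B (res r B)" "Q C (res r C)" "x \<in> B"
proof -
  obtain B C where p: "par A r B C" "Q B (res r B)" "Q C (res r C)" using assms(1) by (auto simp: twin_def)
  have "x \<in> B \<or> x \<in> C" using p(1) assms(2) by (auto simp: par_def)
  then show ?thesis using that[OF p] that[OF par_commute[OF p(1)] p(3,2)] by blast
qed

text \<open>Comparability confines \<open>y'\<close> to the branch of \<open>y\<close>. Both
  branches belong to the same class, so the marginal of \<open>x\<close> occurs there as
  well.\<close>

lemma transversal_twin:
  assumes tr: "transversal Q"
  shows "transversal (twin Q)"
  unfolding transversal_def
proof (intro allI impI)
  fix A r A' r' and x y :: nat
  assume "twin Q A r" "twin Q A' r'" and xy: "x \<in> A" "y \<in> A'"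
  then obtain B C B' C' where p: "par A r B C" "par A' r' B' C'" "Q B (res r B)" "Q B' (res r' B')" "x \<in> B" "y \<in> B'"
    by (metis twin_branchE)
  obtain y' where y': "y' \<in> B'" "\<And>t. surv B' (res r' B') y' t = surv B (res r B) x t"
    "(y', y) \<in> res r' B' \<or> (y, y') \<in> res r' B'"
    using tr p unfolding transversal_def by blast
  have "surv A' r' y' t = surv A r x t" for t
    using jsurv_par[OF p(1) p(5,5)] jsurv_par[OF p(2) y'(1,1)] y'(2) by simp
  then show "\<exists>y'\<in>A'. (\<forall>t. surv A' r' y' t = surv A r x t) \<and> ((y', y) \<in> r' \<or> (y, y') \<in> r')"
    using y' par_facts(5)[OF p(2)] by (auto simp: res_def)
qed

definition assoc :: "(nat set \<Rightarrow> nat rel \<Rightarrow> bool) \<Rightarrow> bool" where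
  "assoc Q \<longleftrightarrow> (\<forall>A r x y t. Q A r \<longrightarrow> x \<in> A \<longrightarrow> y \<in> A \<longrightarrow> surv A r x t * surv A r y t \<le> jsurv A r x y t)"

lemma assoc_point: "assoc point"
  unfolding assoc_def
proof (intro allI impI)
  fix A r t and x y :: nat
  assume h: "point A r" "x \<in> A" "y \<in> A"
  then have "(x, y) \<in> r" by (auto simp: point_def)
  then show "surv A r x t * surv A r y t \<le> jsurv A r x y t"
    using assoc_comparable[OF sizedD(1,2)[OF sized_point h(1)]] by blast
qed

text \<open>Points in different summands are comparable, and points in one summand share its affine
  map; both situations are already settled.\<close>

lemma assoc_series:
  assumes sz: "\<And>i. i < m \<Longrightarrow> sized (S i) (sz i)" and as: "\<And>i. i < m \<Longrightarrow> assoc (S i)"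
  shows "assoc (series S m)"
  unfolding assoc_def
proof (intro allI impI)
  fix B r t and x y :: nat
  assume "series S m B r" and xy: "x \<in> B" "y \<in> B"
  then obtain h where br: "branch S m B r h" by (auto simp: series_def)
  show "surv B r x t * surv B r y t \<le> jsurv B r x y t"
  proof (cases "h x = h y")
    case True
    have i: "h x < m" using branchD(3)[OF br xy(1)] .
    let ?P = "{z \<in> B. h z = h x}"
    have P: "x \<in> ?P" "y \<in> ?P" using True xy by auto
    show ?thesis
    proof (rule assoc_ord3[OF branch_ord3[OF br sz i] P])
      show "surv ?P (res r ?P) x t * surv ?P (res r ?P) y t \<le> jsurv ?P (res r ?P) x y t" for t
        using as[OF i] branchD(5)[OF br i] P unfolding assoc_def by blast
    qed
  next
    case False
    then have "(x, y) \<in> r \<or> (y, x) \<in> r" using branchD(4)[OF br xy] branchD(4)[OF br xy(2,1)] by linarith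
    then show ?thesis by (rule assoc_comparable[OF branchD(1,2)[OF br]])
  qed
qed

lemma assoc_twin:
  assumes as: "assoc Q"
  shows "assoc (twin Q)"
  unfolding assoc_def
proof (intro allI impI)
  fix A r t and x y :: nat
  assume "twin Q A r" and xy: "x \<in> A" "y \<in> A"
  then obtain B C where p: "par A r B C" "Q B (res r B)" "Q C (res r C)" "x \<in> B"
    by (metis twin_branchE)
  show "surv A r x t * surv A r y t \<le> jsurv A r x y t"
  proof (cases "y \<in> B")
    case True
    then show ?thesis
      using as p jsurv_par[OF p(1)] unfolding assoc_def by simp
  next
    case False
    then have "y \<in> C" using xy p(1) by (auto simp: par_def)
    then show ?thesis using jsurv_par_cross[OF p(1,4)] by simp
  qed
qed

definition vbound :: "(nat set \<Rightarrow> nat rel \<Rightarrow> bool) \<Rightarrow> real \<Rightarrow> bool" where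
  "vbound Q v \<longleftrightarrow> (\<forall>A r x. Q A r \<longrightarrow> x \<in> A \<longrightarrow> coord_var A r x \<le> v)"

lemma vbound_sized_1:
  assumes "sized Q n"
  shows "vbound Q 1"
  unfolding vbound_def
proof (intro allI impI)
  fix A r and x :: nat
  assume "Q A r" "x \<in> A"
  then show "coord_var A r x \<le> 1" by (intro coord_var_le_1(2) sizedD(1,2)[OF assms])
qed

lemma vbound_series:
  assumes sz: "\<And>i. i < m \<Longrightarrow> sized (S i) (sz i)" and v: "\<And>i. i < m \<Longrightarrow> vbound (S i) (v i)"
    and N: "N = real (\<Sum>j<m. sz j)"
    and w: "\<And>i. i < m \<Longrightarrow> (real (sz i) + 1) / (N + 1) * ((real (sz i) + 2) / (N + 2)) * v i + 1 / (4 * (N + 2)) \<le> w"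
  shows "vbound (series S m) w"
  unfolding vbound_def
proof (intro allI impI)
  fix B r and x :: nat
  assume "series S m B r" and x: "x \<in> B"
  then obtain h where br: "branch S m B r h" by (auto simp: series_def)
  have i: "h x < m" using branchD(3)[OF br x] .
  let ?P = "{z \<in> B. h z = h x}"
  have P: "x \<in> ?P" using x by auto
  have N0: "0 \<le> N" unfolding N by (rule of_nat_0_le_iff)
  have "coord_var B r x \<le> (real (sz (h x)) + 1) / (N + 1) * ((real (sz (h x)) + 2) / (N + 2)) * coord_var ?P (res r ?P) x + 1 / (4 * (N + 2))"
    using coord_var_ord3[OF branch_ord3[OF br sz i] P] branch_card_all[OF br sz] branch_cards(2)[OF br sz i] by (simp add: N)
  also have "\<dots> \<le> (real (sz (h x)) + 1) / (N + 1) * ((real (sz (h x)) + 2) / (N + 2)) * v (h x) + 1 / (4 * (N + 2))"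
  proof (intro add_right_mono mult_left_mono)
    show "coord_var ?P (res r ?P) x \<le> v (h x)" using v[OF i] branchD(5)[OF br i] P unfolding vbound_def by blast
  qed (use N0 in simp)
  also have "\<dots> \<le> w" by (rule w[OF i])
  finally show "coord_var B r x \<le> w" .
qed

lemma vbound_twin:
  assumes v: "vbound Q v"
  shows "vbound (twin Q) v"
  unfolding vbound_def
proof (intro allI impI)
  fix A r and x :: nat
  assume "twin Q A r" "x \<in> A"
  then obtain B C where p: "par A r B C" "Q B (res r B)" "x \<in> B" by (rule twin_branchE)
  then show "coord_var A r x \<le> v" using v coord_moments_par(2)[OF p(1,3)] unfolding vbound_def by simp
qed

definition gapbound :: "(nat set \<Rightarrow> nat rel \<Rightarrow> bool) \<Rightarrow> real \<Rightarrow> bool" where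
  "gapbound Q s \<longleftrightarrow> (\<forall>A r. Q A r \<longrightarrow> s \<le> gap_sum A r)"

text \<open>The only coordinate is uniform on the unit interval and has nothing below it, so its gap
  is the coordinate itself.\<close>

lemma gapbound_point: "gapbound point (1 / 2)"
  unfolding gapbound_def
proof (intro allI impI)
  fix A r assume p: "point A r"
  then obtain x where x: "A = {x}" "r = {(x, x)}" by (auto simp: point_def)
  note f = sizedD(1,2)[OF sized_point p]
  have "mean_gap A r x = (\<integral>F. F x \<partial>opm A r)"
    using x by (simp add: mean_gap_def lower_bd_def underS_def)
  also have "\<dots> = (\<integral>t. t \<partial>law A r x)"
    using integral_law[OF f, of x "\<lambda>t. t"] x by simp
  also have "law A r x = alpha 1" using law_singleton[of x r] p x by simp
  also have "(\<integral>t. t \<partial>alpha 1) = 1 / 2"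
  proof -
    have "AE t in alpha 1. 0 \<le> t" using AE_alpha[of 1] by eventually_elim simp
    moreover have "(\<integral>\<^sup>+t. ennreal t \<partial>alpha 1) = ennreal (1 / 2)" using nn_integral_alpha_id[of 1] by simp
    ultimately show ?thesis using nn_integral_eq_integrable[of "\<lambda>t. t" "alpha 1" "1 / 2"] by simp
  qed
  finally show "1 / 2 \<le> gap_sum A r" using x by (simp add: gap_sum_def)
qed

lemma gapbound_series:
  assumes sz: "\<And>i. i < m \<Longrightarrow> sized (S i) (sz i)" and s: "\<And>i. i < m \<Longrightarrow> gapbound (S i) (s i)"
    and N: "N = real (\<Sum>j<m. sz j)"
  shows "gapbound (series S m) (\<Sum>i<m. (real (sz i) + 1) / (N + 1) * s i)"
  unfolding gapbound_def
proof (intro allI impI)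
  fix B r assume "series S m B r"
  then obtain h where br: "branch S m B r h" by (auto simp: series_def)
  have N0: "0 \<le> N" unfolding N by (rule of_nat_0_le_iff)
  have "gap_sum B r = (\<Sum>x\<in>B. mean_gap B r x)" by (simp add: gap_sum_def)
  also have "\<dots> = (\<Sum>i<m. \<Sum>x\<in>{x \<in> B. h x = i}. mean_gap B r x)"
    by (rule sum.group[symmetric]) (use branchD(1,3)[OF br] in auto)
  also have "\<dots> = (\<Sum>i<m. (real (sz i) + 1) / (N + 1) * gap_sum {x \<in> B. h x = i} (res r {x \<in> B. h x = i}))"
  proof (rule sum.cong[OF refl])
    fix i assume "i \<in> {..<m}"
    then have i: "i < m" by simp
    show "(\<Sum>x\<in>{x \<in> B. h x = i}. mean_gap B r x) =
      (real (sz i) + 1) / (N + 1) * gap_sum {x \<in> B. h x = i} (res r {x \<in> B. h x = i})"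
      unfolding gap_sum_def sum_distrib_left
    proof (rule sum.cong[OF refl])
      fix x assume x: "x \<in> {x \<in> B. h x = i}"
      show "mean_gap B r x = (real (sz i) + 1) / (N + 1) * mean_gap {x \<in> B. h x = i} (res r {x \<in> B. h x = i}) x"
        using mean_gap_ord3[OF branch_ord3[OF br sz i] x] branch_card_all[OF br sz] branch_cards(2)[OF br sz i]
        by (simp add: N)
    qed
  qed
  also have "\<dots> \<ge> (\<Sum>i<m. (real (sz i) + 1) / (N + 1) * s i)"
  proof (rule sum_mono)
    fix i assume "i \<in> {..<m}"
    then have "s i \<le> gap_sum {x \<in> B. h x = i} (res r {x \<in> B. h x = i})"
      using s branchD(5)[OF br] unfolding gapbound_def by simp
    then show "(real (sz i) + 1) / (N + 1) * s i \<le> (real (sz i) + 1) / (N + 1) * gap_sum {x \<in> B. h x = i} (res r {x \<in> B. h x = i})"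
      by (rule mult_left_mono) (use N0 in simp)
  qed
  finally show "(\<Sum>i<m. (real (sz i) + 1) / (N + 1) * s i) \<le> gap_sum B r" .
qed

lemma gapbound_twin: "gapbound Q s \<Longrightarrow> gapbound (twin Q) (2 * s)"
  unfolding gapbound_def
proof (intro allI impI)
  fix A r assume s: "\<forall>A r. Q A r \<longrightarrow> s \<le> gap_sum A r" and "twin Q A r"
  then obtain B C where p: "par A r B C" "Q B (res r B)" "Q C (res r C)" by (auto simp: twin_def)
  have "gap_sum A r = (\<Sum>x\<in>B. mean_gap A r x) + (\<Sum>x\<in>C. mean_gap A r x)"
    unfolding gap_sum_def using p(1) par_facts(3,4)[OF p(1)] by (auto simp: par_def sum.union_disjoint)
  also have "(\<Sum>x\<in>B. mean_gap A r x) = gap_sum B (res r B)"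
    unfolding gap_sum_def by (intro sum.cong refl mean_gap_par[OF p(1)])
  also have "(\<Sum>x\<in>C. mean_gap A r x) = gap_sum C (res r C)"
    unfolding gap_sum_def by (intro sum.cong refl mean_gap_par[OF par_commute[OF p(1)]])
  finally show "2 * s \<le> gap_sum A r" using s p(2,3) by (smt (verit))
qed

definition wide :: "(nat set \<Rightarrow> nat rel \<Rightarrow> bool) \<Rightarrow> nat \<Rightarrow> bool" where
  "wide Q w \<longleftrightarrow> (\<forall>A r. Q A r \<longrightarrow> (\<exists>S\<subseteq>A. antichain r S \<and> card S = w))"

lemma wide_series: "i < m \<Longrightarrow> wide (S i) w \<Longrightarrow> wide (series S m) w"
  unfolding wide_def
proof (intro allI impI)
  fix B r assume i: "i < m" and w: "\<forall>A r. S i A r \<longrightarrow> (\<exists>S\<subseteq>A. antichain r S \<and> card S = w)" and "series S m B r"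
  then obtain h where br: "branch S m B r h" by (auto simp: series_def)
  obtain X where X: "X \<subseteq> {x \<in> B. h x = i}" "antichain (res r {x \<in> B. h x = i}) X" "card X = w"
    using w branchD(5)[OF br i] by blast
  then have "antichain r X" unfolding antichain_def res_def by blast
  with X show "\<exists>S\<subseteq>B. antichain r S \<and> card S = w" by blast
qed

lemma wide_twin: "wide Q w \<Longrightarrow> wide (twin Q) (2 * w)"
  unfolding wide_def
proof (intro allI impI)
  fix A r assume w: "\<forall>A r. Q A r \<longrightarrow> (\<exists>S\<subseteq>A. antichain r S \<and> card S = w)" and "twin Q A r"
  then obtain B C where p: "par A r B C" "Q B (res r B)" "Q C (res r C)" by (auto simp: twin_def)
  obtain X Y where X: "X \<subseteq> B" "antichain (res r B) X" "card X = w" and Y: "Y \<subseteq> C" "antichain (res r C) Y" "card Y = w"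
    using w p(2,3) by meson
  have d: "B \<inter> C = {}" "r = res r B \<union> res r C" using p(1) by (auto simp: par_def)
  have "antichain r (X \<union> Y)"
    unfolding antichain_def
  proof (intro ballI impI notI)
    fix x y assume xy: "x \<in> X \<union> Y" "y \<in> X \<union> Y" "x \<noteq> y" "(x, y) \<in> r"
    from xy(4) d(2) have "(x, y) \<in> res r B \<or> (x, y) \<in> res r C" by blast
    then show False
    proof
      assume r: "(x, y) \<in> res r B"
      then have "x \<in> X" "y \<in> X" using xy(1,2) d(1) Y(1) by (auto simp: res_def)
      then show False using X(2) r xy(3) by (simp add: antichain_def)
    next
      assume r: "(x, y) \<in> res r C"
      then have "x \<in> Y" "y \<in> Y" using xy(1,2) d(1) X(1) by (auto simp: res_def)
      then show False using Y(2) r xy(3) by (simp add: antichain_def)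
    qed
  qed
  moreover have "card (X \<union> Y) = 2 * w"
    using X Y d(1) par_facts(3,4)[OF p(1)] by (subst card_Un_disjoint) (auto intro: finite_subset)
  moreover have "X \<union> Y \<subseteq> A" using X Y par_facts(5,6)[OF p(1)] by auto
  ultimately show "\<exists>S\<subseteq>A. antichain r S \<and> card S = 2 * w" by blast
qed

text \<open>Asking for a carrier inside any given infinite set, rather than for mere existence, is
  what lets disjoint copies be placed side by side in the induction.\<close>

definition realizable :: "(nat set \<Rightarrow> nat rel \<Rightarrow> bool) \<Rightarrow> bool" where
  "realizable Q \<longleftrightarrow> (\<forall>X. infinite X \<longrightarrow> (\<exists>A r. A \<subseteq> X \<and> Q A r))"

lemma realizable_point: "realizable point"
  unfolding realizable_def
proof (intro allI impI)
  fix X :: "nat set" assume "infinite X"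
  then obtain x where "x \<in> X" using infinite_imp_nonempty by blast
  then show "\<exists>A r. A \<subseteq> X \<and> point A r" by (intro exI[of _ "{x}"] exI[of _ "{(x, x)}"]) (auto simp: point_def)
qed

text \<open>Pairing of natural numbers cuts an infinite set into infinitely many infinite parts, one
  for each summand or branch.\<close>

lemma infinite_split:
  assumes "infinite (X :: nat set)"
  obtains c where "\<And>i :: nat. infinite {x \<in> X. c x = i}"
proof -
  obtain e :: "nat \<Rightarrow> nat" where e: "inj e" "range e \<subseteq> X" using assms infinite_countable_subset by metis
  define c where "c x = fst (prod_decode (inv e x))" for x
  have "infinite {x \<in> X. c x = i}" for i
  proof -
    have "inj (\<lambda>j. e (prod_encode (i, j)))"
      by (auto intro!: injI dest!: injD[OF e(1)] simp: prod_encode_eq)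
    then have "infinite (range (\<lambda>j. e (prod_encode (i, j))))" by (simp add: finite_image_iff)
    moreover have "range (\<lambda>j. e (prod_encode (i, j))) \<subseteq> {x \<in> X. c x = i}"
      using e by (auto simp: c_def)
    ultimately show ?thesis using finite_subset by blast
  qed
  then show ?thesis by (rule that)
qed

lemma realizable_series:
  assumes sz: "\<And>i. i < m \<Longrightarrow> sized (S i) (sz i)" and re: "\<And>i. i < m \<Longrightarrow> realizable (S i)"
  shows "realizable (series S m)"
  unfolding realizable_def
proof (intro allI impI)
  fix X :: "nat set" assume "infinite X"
  then obtain c where c: "\<And>i :: nat. infinite {x \<in> X. c x = i}" using infinite_split by blast
  have "\<forall>i. \<exists>p. i < m \<longrightarrow> fst p \<subseteq> {x \<in> X. c x = i} \<and> S i (fst p) (snd p)"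
    using re c unfolding realizable_def by (metis fst_conv snd_conv)
  then obtain p where p: "\<And>i. i < m \<Longrightarrow> fst (p i) \<subseteq> {x \<in> X. c x = i}" "\<And>i. i < m \<Longrightarrow> S i (fst (p i)) (snd (p i))"
    by metis
  define B where "B = (\<Union>i<m. fst (p i))"
  \<comment> \<open>The lexicographic order: first by the colour \<open>c\<close>, then by the order
    of the piece.\<close>
  define r where "r = {(x, y). x \<in> B \<and> y \<in> B \<and> (c x < c y \<or> (c x = c y \<and> (x, y) \<in> snd (p (c x))))}"
  have cm: "c x < m \<and> x \<in> fst (p (c x))" if "x \<in> B" for x
    using that p(1) by (auto simp: B_def)
  have piece: "{x \<in> B. c x = i} = fst (p i)" if "i < m" for i
    using that p(1) by (auto simp: B_def)
  have po: "partial_order_on (fst (p i)) (snd (p i))" if "i < m" for i using sizedD(2)[OF sz[OF that] p(2)[OF that]] .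
  have sub: "snd (p i) \<subseteq> fst (p i) \<times> fst (p i)" if "i < m" for i by (rule partial_order_on_sub[OF po[OF that]])
  have "branch S m B r c"
    unfolding branch_def
  proof (intro conjI ballI allI impI)
    show "finite B" unfolding B_def using sizedD(1)[OF sz p(2)] by auto
    show "c x < m" if "x \<in> B" for x using cm[OF that] by simp
    show "(x, y) \<in> r" if "x \<in> B" "y \<in> B" "c x < c y" for x y using that by (simp add: r_def)
    show "S i {x \<in> B. c x = i} (res r {x \<in> B. c x = i})" if i: "i < m" for i
    proof -
      have "res r (fst (p i)) = snd (p i)"
      proof (intro equalityI subrelI)
        fix x y assume xy: "(x, y) \<in> res r (fst (p i))"
        then have "c x = i" "c y = i" using p(1)[OF i] by (auto simp: res_def)
        with xy show "(x, y) \<in> snd (p i)" using p(1)[OF i] by (auto simp: res_def r_def)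
      next
        fix x y assume xy: "(x, y) \<in> snd (p i)"
        then have "x \<in> fst (p i)" "y \<in> fst (p i)" using sub[OF i] by auto
        moreover have "fst (p i) \<subseteq> B" using i by (auto simp: B_def)
        ultimately show "(x, y) \<in> res r (fst (p i))" using xy p(1)[OF i] by (auto simp: res_def r_def)
      qed
      then show ?thesis unfolding piece[OF i] using p(2)[OF i] by simp
    qed
    have "refl_on B r"
      unfolding refl_on_def r_def using cm order_on_refl[OF po] by auto
    moreover have "antisym r"
    proof (rule antisymI)
      fix x y assume "(x, y) \<in> r" "(y, x) \<in> r"
      then have "x \<in> B" "c x = c y" "(x, y) \<in> snd (p (c x))" "(y, x) \<in> snd (p (c x))" by (auto simp: r_def)
      then show "x = y" using po[of "c x"] cm[of x] by (auto simp: partial_order_on_def dest: antisymD)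
    qed
    moreover have "trans r"
    proof (rule transI)
      fix x y z assume 1: "(x, y) \<in> r" "(y, z) \<in> r"
      then have B: "x \<in> B" "z \<in> B" by (auto simp: r_def)
      show "(x, z) \<in> r"
      proof (cases "c x = c y \<and> c y = c z")
        case True
        then have "(x, y) \<in> snd (p (c x))" "(y, z) \<in> snd (p (c x))" using 1 by (auto simp: r_def)
        moreover have "trans (snd (p (c x)))"
          using po[of "c x"] cm[OF B(1)] by (simp add: partial_order_on_def preorder_on_def)
        ultimately have "(x, z) \<in> snd (p (c x))" by (blast dest: transD)
        then show ?thesis using B True by (simp add: r_def)
      next
        case False
        then have "c x < c z" using 1 by (auto simp: r_def)
        then show ?thesis using B by (simp add: r_def)
      qed
    qed
    moreover have "r \<subseteq> B \<times> B" by (auto simp: r_def)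
    ultimately show "partial_order_on B r" by (simp add: partial_order_on_def preorder_on_def)
  qed
  moreover have "B \<subseteq> X" using p(1) by (auto simp: B_def)
  ultimately show "\<exists>A r. A \<subseteq> X \<and> series S m A r" by (auto simp: series_def)
qed

lemma realizable_twin:
  assumes sz: "sized Q n" and re: "realizable Q"
  shows "realizable (twin Q)"
  unfolding realizable_def
proof (intro allI impI)
  fix X :: "nat set" assume "infinite X"
  then obtain c where c: "\<And>i :: nat. infinite {x \<in> X. c x = i}" using infinite_split by blast
  obtain B s where B: "B \<subseteq> {x \<in> X. c x = 0}" "Q B s" using re c unfolding realizable_def by meson
  obtain C t where C: "C \<subseteq> {x \<in> X. c x = 1}" "Q C t" using re c unfolding realizable_def by meson
  note f = sizedD(1,2)[OF sz B(2)] sizedD(1,2)[OF sz C(2)]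
  have d: "B \<inter> C = {}" using B(1) C(1) by fastforce
  note sub = partial_order_on_sub[OF f(2)] partial_order_on_sub[OF f(4)]
  have res: "res (s \<union> t) B = s" "res (s \<union> t) C = t" using sub d by (auto simp: res_def)
  have "refl_on (B \<union> C) (s \<union> t)"
    using order_on_refl[OF f(2)] order_on_refl[OF f(4)] by (auto simp: refl_on_def)
  moreover have "trans (s \<union> t)"
  proof (rule transI)
    fix x y z assume 1: "(x, y) \<in> s \<union> t" "(y, z) \<in> s \<union> t"
    have tr: "trans s" "trans t" using f by (auto simp: partial_order_on_def preorder_on_def)
    have "(x, y) \<in> s \<and> (y, z) \<in> s \<or> (x, y) \<in> t \<and> (y, z) \<in> t" using 1 sub d by blast
    then show "(x, z) \<in> s \<union> t" using tr by (blast dest: transD)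
  qed
  moreover have "antisym (s \<union> t)"
  proof (rule antisymI)
    fix x y assume 1: "(x, y) \<in> s \<union> t" "(y, x) \<in> s \<union> t"
    have tr: "antisym s" "antisym t" using f by (auto simp: partial_order_on_def)
    have "(x, y) \<in> s \<and> (y, x) \<in> s \<or> (x, y) \<in> t \<and> (y, x) \<in> t" using 1 sub d by blast
    then show "x = y" using tr by (blast dest: antisymD)
  qed
  ultimately have po: "partial_order_on (B \<union> C) (s \<union> t)"
    using sub unfolding partial_order_on_def preorder_on_def by blast
  have "par (B \<union> C) (s \<union> t) B C" unfolding par_def using f d po res by simp
  then have "twin Q (B \<union> C) (s \<union> t)" unfolding twin_def using res B(2) C(2) by metis
  then show "\<exists>A r. A \<subseteq> X \<and> twin Q A r" using B C by blast
qed

subsection \<open>Linear extensions and simplices\<close>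

definition induced_order :: "'a set \<Rightarrow> ('a \<Rightarrow> real) \<Rightarrow> 'a rel" where
  "induced_order A F = {(a, b). a \<in> A \<and> b \<in> A \<and> F a \<le> F b}"

lemma linear_order_eqI:
  assumes L: "linear_order_on A L" and M: "linear_order_on A M" and sub: "L \<subseteq> M"
  shows "L = M"
proof (rule equalityI[OF sub], rule subrelI)
  fix a b assume ab: "(a, b) \<in> M"
  have "a \<in> A" "b \<in> A" using ab M partial_order_on_sub unfolding linear_order_on_def by blast+
  show "(a, b) \<in> L"
  proof (cases "a = b")
    case True
    then show ?thesis using L \<open>a \<in> A\<close> by (simp add: order_on_defs refl_on_def)
  next
    case False
    then consider "(a, b) \<in> L" | "(b, a) \<in> L"
      using L \<open>a \<in> A\<close> \<open>b \<in> A\<close> unfolding linear_order_on_def total_on_def by blast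
    then show ?thesis
    proof cases
      case 2
      then have "(b, a) \<in> M" using sub by blast
      then have "a = b" using ab M by (auto simp: order_on_defs dest: antisymD)
      with False show ?thesis by simp
    qed
  qed
qed

lemma linear_order_induced:
  assumes "inj_on F A"
  shows "linear_order_on A (induced_order A F)"
proof -
  have "trans (induced_order A F)" by (auto simp: trans_def induced_order_def)
  moreover have "antisym (induced_order A F)"
    using assms by (auto simp: antisym_def induced_order_def inj_on_def)
  moreover have "total_on A (induced_order A F)" by (auto simp: total_on_def induced_order_def)
  moreover have "refl_on A (induced_order A F)" "induced_order A F \<subseteq> A \<times> A" by (auto simp: refl_on_def induced_order_def)
  ultimately show ?thesis by (simp add: order_on_defs)
qed

lemma finite_linear_extensions: "finite A \<Longrightarrow> finite (linear_extensions A r)"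
  by (rule finite_subset[of _ "Pow (A \<times> A)"])
    (auto simp: linear_extensions_def order_on_defs)

lemma AE_inj_PL: assumes "finite A" shows "AE F in PL A. inj_on F A"
proof -
  have "AE F in PL A. \<forall>x\<in>A. \<forall>y\<in>A. x \<noteq> y \<longrightarrow> F x \<noteq> F y"
  proof (intro AE_finite_allI assms)
    fix x y assume "x \<in> A" "y \<in> A"
    then show "AE F in PL A. x \<noteq> y \<longrightarrow> F x \<noteq> F y"
      by (cases "x = y") (use AE_PL_neq[OF assms] in auto)
  qed
  then show ?thesis by eventually_elim (auto simp: inj_on_def)
qed

text \<open>Up to ties, the polytope splits into the simplices of the linear extensions, each of
  volume \<open>1 / fact (card A)\<close>; an event that depends only on the relative order of the
  coordinates is a union of such simplices.\<close>

lemma emeasure_linear_extensions: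
  assumes A: "finite A" "partial_order_on A r" and W: "W \<in> sets (PL A)"
    and Q: "\<And>F. F \<in> space (PL A) \<Longrightarrow> inj_on F A \<Longrightarrow> F \<in> W \<longleftrightarrow> Q (induced_order A F)"
  shows "emeasure (PL A) (order_polytope A r \<inter> W) = ennreal (real (card {L \<in> linear_extensions A r. Q L}) / fact (card A))"
proof -
  let ?E = "{L \<in> linear_extensions A r. Q L}"
  have fE: "finite ?E" using finite_linear_extensions[OF A(1)] by simp
  have lin: "linear_order_on A L" "r \<subseteq> L" "L \<subseteq> A \<times> A" if "L \<in> ?E" for L
    using that by (auto simp: linear_extensions_def order_on_defs)
  have O: "order_polytope A r \<in> sets (PL A)" by (rule sets_order_polytope[OF A(1) partial_order_on_sub[OF A(2)]])
  have "emeasure (PL A) (order_polytope A r \<inter> W) = (\<integral>\<^sup>+F. indicator (order_polytope A r \<inter> W) F \<partial>PL A)"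
    using O W by simp
  also have "\<dots> = (\<integral>\<^sup>+F. (\<Sum>L\<in>?E. indicator (order_polytope A L) F) \<partial>PL A)"
  proof (rule nn_integral_cong_AE)
    show "AE F in PL A. indicator (order_polytope A r \<inter> W) F = (\<Sum>L\<in>?E. indicator (order_polytope A L) F :: ennreal)"
      using AE_inj_PL[OF A(1)] AE_space
    proof eventually_elim
      case (elim F)
      let ?L = "induced_order A F"
      have linF: "linear_order_on A ?L" by (rule linear_order_induced[OF elim(1)])
      have iff: "F \<in> order_polytope A L \<longleftrightarrow> (\<forall>x\<in>A. 0 \<le> F x \<and> F x \<le> 1) \<and> L \<subseteq> ?L" if "L \<subseteq> A \<times> A" for L
        unfolding order_polytope_iff[OF that] using elim(2) that by (fastforce simp: induced_order_def)
      \<comment> \<open>A linear order whose polytope contains \<open>F\<close> is included in the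
        one induced by \<open>F\<close>, and inclusion of linear orders is equality; so at most one
        summand is nonzero.\<close>
      have iL: "indicator (order_polytope A L) F = (if L = ?L \<and> (\<forall>x\<in>A. 0 \<le> F x \<and> F x \<le> 1) then 1 else 0 :: ennreal)"
        if "L \<in> ?E" for L
        using iff[OF lin(3)[OF that]] linear_order_eqI[OF lin(1)[OF that] linF] by (auto simp: indicator_def)
      have "(\<Sum>L\<in>?E. indicator (order_polytope A L) F :: ennreal) =
        (\<Sum>L\<in>?E. if L = ?L then (if \<forall>x\<in>A. 0 \<le> F x \<and> F x \<le> 1 then 1 else 0) else 0)"
        by (rule sum.cong[OF refl]) (use iL in auto)
      also have "\<dots> = (if ?L \<in> ?E \<and> (\<forall>x\<in>A. 0 \<le> F x \<and> F x \<le> 1) then 1 else 0)"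
        using fE by (simp add: sum.delta)
      also have "?L \<in> ?E \<and> (\<forall>x\<in>A. 0 \<le> F x \<and> F x \<le> 1) \<longleftrightarrow> F \<in> order_polytope A r \<inter> W"
        using iff[OF partial_order_on_sub[OF A(2)]] Q[OF elim(2,1)] linF by (auto simp: linear_extensions_def)
      finally show ?case by (simp add: indicator_def)
    qed
  qed
  also have "\<dots> = (\<Sum>L\<in>?E. \<integral>\<^sup>+F. indicator (order_polytope A L) F \<partial>PL A)"
    by (rule nn_integral_sum) (use sets_order_polytope[OF A(1) lin(3)] in auto)
  also have "\<dots> = (\<Sum>L\<in>?E. ennreal (1 / fact (card A)))"
    by (rule sum.cong[OF refl]) (use nn_integral_pvol[OF A(1) lin(3)] pvol_linear[OF A(1) lin(1)] in simp)
  also have "\<dots> = ennreal (real (card ?E) / fact (card A))"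
    by (simp add: ennreal_of_nat_eq_real_of_nat ennreal_mult[symmetric])
  finally show ?thesis .
qed

text \<open>The link between the combinatorial and the continuous side: all simplices have equal
  volume, so the order of the coordinates of a random point is a uniformly random linear
  extension.\<close>

lemma chain_prob_eq:
  assumes A: "finite A" "partial_order_on A r" and x: "\<And>i. i \<in> {1..k} \<Longrightarrow> x (\<pi> i) \<in> A"
  shows "chain_prob A r k x \<pi> = measure (opm A r) {F \<in> space (PL A). \<forall>i\<in>{1..<k}. F (x (\<pi> i)) < F (x (\<pi> (i + 1)))}"
proof -
  let ?Q = "\<lambda>L. \<forall>i\<in>{1..<k}. (x (\<pi> i), x (\<pi> (i + 1))) \<in> L - Id"
  let ?W = "{F \<in> space (PL A). \<forall>i\<in>{1..<k}. F (x (\<pi> i)) < F (x (\<pi> (i + 1)))}"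
  let ?LE = "linear_extensions A r"
  note O = sets_order_polytope[OF A(1) partial_order_on_sub[OF A(2)]]
  have W: "?W \<in> sets (PL A)"
  proof (intro sets.sets_Collect_finite_All)
    fix i assume "i \<in> {1..<k}"
    then have "x (\<pi> i) \<in> A" "x (\<pi> (i + 1)) \<in> A" using x by auto
    then show "{F \<in> space (PL A). F (x (\<pi> i)) < F (x (\<pi> (i + 1)))} \<in> sets (PL A)" by measurable
  qed simp
  have 1: "emeasure (PL A) (order_polytope A r \<inter> ?W) = ennreal (real (card {L \<in> ?LE. ?Q L}) / fact (card A))"
  proof (rule emeasure_linear_extensions[OF A W])
    fix F assume F: "F \<in> space (PL A)" "inj_on F A"
    have "F a < F b \<longleftrightarrow> (a, b) \<in> induced_order A F - Id" if "a \<in> A" "b \<in> A" for a b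
      using that F(2) by (auto simp: induced_order_def inj_on_def less_le)
    moreover have "x (\<pi> i) \<in> A" "x (\<pi> (i + 1)) \<in> A" if "i \<in> {1..<k}" for i using that x by auto
    ultimately have "(\<forall>i\<in>{1..<k}. F (x (\<pi> i)) < F (x (\<pi> (i + 1)))) \<longleftrightarrow> ?Q (induced_order A F)" by blast
    then show "F \<in> ?W \<longleftrightarrow> ?Q (induced_order A F)" using F(1) by simp
  qed
  have "order_polytope A r \<subseteq> space (PL A)" using O by (rule sets.sets_into_space)
  then have "pvol A r = emeasure (PL A) (order_polytope A r \<inter> space (PL A))" by (simp add: pvol_def Int_absorb2)
  also have "\<dots> = ennreal (real (card {L \<in> ?LE. True}) / fact (card A))"
    by (rule emeasure_linear_extensions[OF A]) auto
  finally have 2: "pvol A r = ennreal (real (card ?LE) / fact (card A))" by simp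
  have ne: "?LE \<noteq> {}"
  proof
    assume "?LE = {}"
    then have "pvol A r = 0" using 2 by simp
    with pvol_pos[OF A] show False by simp
  qed
  have c0: "0 < card ?LE" using ne finite_linear_extensions[OF A(1)] by (simp add: card_gt_0_iff)
  have "chain_prob A r k x \<pi> = card (?LE \<inter> {L. ?Q L}) / card ?LE"
    unfolding chain_prob_def by (rule measure_pmf_of_set[OF ne finite_linear_extensions[OF A(1)]])
  also have "?LE \<inter> {L. ?Q L} = {L \<in> ?LE. ?Q L}" by auto
  also have "real (card {L \<in> ?LE. ?Q L}) / real (card ?LE) =
    (real (card {L \<in> ?LE. ?Q L}) / fact (card A)) / (real (card ?LE) / fact (card A))"
    by simp
  also have "\<dots> = measure (PL A) (order_polytope A r \<inter> ?W) / measure (PL A) (order_polytope A r)"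
    using 1 2 by (simp add: measure_def pvol_def)
  also have "\<dots> = measure (opm A r) ?W"
    unfolding order_polytope_measure_def
  proof (rule measure_uniform_measure[symmetric])
    show "emeasure (PL A) (order_polytope A r) \<noteq> 0" "emeasure (PL A) (order_polytope A r) \<noteq> \<infinity>"
      using pvol_pos[OF A] pvol_fin[OF A(1), of r] by (auto simp: pvol_def)
  qed (rule W)
  finally show ?thesis .
qed

definition lt :: "'a set \<Rightarrow> 'a \<Rightarrow> 'a \<Rightarrow> ('a \<Rightarrow> real) set" where
  "lt A a b = {F \<in> space (PL A). F a < F b}"

lemma sets_lt: "a \<in> A \<Longrightarrow> b \<in> A \<Longrightarrow> lt A a b \<in> sets (PL A)"
  unfolding lt_def by measurable

lemma lt_total:
  assumes A: "finite A" "partial_order_on A r" and ab: "a \<in> A" "b \<in> A" "a \<noteq> b"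
  shows "measure (opm A r) (lt A a b) + measure (opm A r) (lt A b a) = 1"
proof -
  interpret prob_space "opm A r" by (rule prob_space_opm[OF A])
  have s: "lt A a b \<in> events" "lt A b a \<in> events" using sets_lt ab by auto
  have "measure (opm A r) (lt A b a) = measure (opm A r) (space (opm A r) - lt A a b)"
  proof (rule measure_eq_AE)
    show "AE F in opm A r. F \<in> lt A b a \<longleftrightarrow> F \<in> space (opm A r) - lt A a b"
      using AE_opm_of_PL[OF A(1) partial_order_on_sub[OF A(2)] AE_PL_neq[OF A(1) ab]] AE_space
      by eventually_elim (auto simp: lt_def)
  qed (use s in auto)
  then show ?thesis using prob_compl[OF s(1)] by simp
qed

lemma chain_prob_2:
  assumes A: "finite A" "partial_order_on A r" and x: "x \<in> {1..2} \<rightarrow>\<^sub>E A" and \<pi>: "\<pi> permutes {1..2}"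
  shows "chain_prob A r 2 x \<pi> = measure (opm A r) (lt A (x (\<pi> 1)) (x (\<pi> 2)))"
proof -
  have "chain_prob A r 2 x \<pi> = measure (opm A r) {F \<in> space (PL A). \<forall>i\<in>{1..<2}. F (x (\<pi> i)) < F (x (\<pi> (i + 1)))}"
    by (rule chain_prob_eq[OF A]) (use x permutes_in_image[OF \<pi>] in \<open>auto simp: PiE_iff\<close>)
  also have "{1..<2} = {1 :: nat}" by auto
  finally show ?thesis by (simp add: lt_def numeral_2_eq_2)
qed

text \<open>The two orders of a pair have probabilities adding up to 1, so no pair has a minimum
  above 1/2, and one balanced pair attains it.\<close>

lemma delta_2_eq_half:
  assumes A: "finite A" "partial_order_on A r" and ab: "a \<in> A" "b \<in> A" "a \<noteq> b"
    and half: "measure (opm A r) (lt A a b) = 1 / 2"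
  shows "delta 2 A r = 1 / 2"
proof -
  let ?X = "{x \<in> {1..2 :: nat} \<rightarrow>\<^sub>E A. inj_on x {1..2}}"
  let ?m = "\<lambda>x. Min (chain_prob A r 2 x ` {\<pi>. \<pi> permutes {1..2}})"
  have two: "{1..2 :: nat} = {1, 2}" by auto
  have fX: "finite ?X" by (rule finite_subset[OF _ finite_PiE[of "{1..2}" "\<lambda>_. A"]]) (use A in auto)
  have fP: "finite {\<pi>. \<pi> permutes {1..2 :: nat}}" by (rule finite_permutations) simp
  define sw :: "nat \<Rightarrow> nat" where "sw = Transposition.transpose 1 2"
  have sw: "sw permutes {1..2}" unfolding sw_def by (rule permutes_swap_id) auto
  have le: "?m x \<le> 1 / 2" if "x \<in> ?X" for x
  proof -
    have inj: "inj_on x {1..2}" and xE: "x \<in> {1..2} \<rightarrow>\<^sub>E A" using that by auto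
    have x: "x \<in> {1..2} \<rightarrow>\<^sub>E A" "x 1 \<in> A" "x 2 \<in> A" "x 1 \<noteq> x 2"
      using xE inj_on_eq_iff[OF inj, of 1 2] by (auto simp: PiE_iff)
    have "?m x \<le> chain_prob A r 2 x id" "?m x \<le> chain_prob A r 2 x sw"
      using fP sw permutes_id by (auto intro!: Min_le)
    moreover have "chain_prob A r 2 x id + chain_prob A r 2 x sw = 1"
      using chain_prob_2[OF A x(1) permutes_id] chain_prob_2[OF A x(1) sw] lt_total[OF A x(2-4)]
      by (simp add: sw_def)
    ultimately show ?thesis by linarith
  qed
  define x where "x = (\<lambda>i\<in>{1..2 :: nat}. if i = 1 then a else b)"
  have x: "x \<in> ?X" using ab by (auto simp: x_def inj_on_def)
  have ba: "measure (opm A r) (lt A b a) = 1 / 2" using lt_total[OF A ab] half by simp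
  have all: "chain_prob A r 2 x \<pi> = 1 / 2" if "\<pi> permutes {1..2}" for \<pi>
  proof -
    have "\<pi> 1 \<in> {1, 2}" "\<pi> 2 \<in> {1, 2}" using permutes_in_image[OF that] two by auto
    moreover have "\<pi> 1 \<noteq> \<pi> 2" using inj_eq[OF permutes_inj[OF that], of 1 2] by simp
    ultimately have "(\<pi> 1 = 1 \<and> \<pi> 2 = 2) \<or> (\<pi> 1 = 2 \<and> \<pi> 2 = 1)" by auto
    then show ?thesis using chain_prob_2[OF A _ that, of x] x half ba by (auto simp: x_def)
  qed
  have "chain_prob A r 2 x ` {\<pi>. \<pi> permutes {1..2}} = (\<lambda>_. 1 / 2) ` {\<pi>. \<pi> permutes {1..2 :: nat}}"
    by (rule image_cong) (use all in auto)
  also have "\<dots> = {1 / 2}" by (rule image_constant) (rule CollectI, rule permutes_id)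
  finally have mx: "?m x = 1 / 2" by simp
  have "1 / 2 \<in> ?m ` ?X" by (rule image_eqI[OF _ x]) (simp only: mx)
  show ?thesis
    unfolding delta_def by (rule Max_eqI) (use fX le \<open>1 / 2 \<in> ?m ` ?X\<close> in auto)
qed

definition triple_prob :: "'a set \<Rightarrow> 'a rel \<Rightarrow> 'a \<Rightarrow> 'a \<Rightarrow> 'a \<Rightarrow> real" where
  "triple_prob A r a b d = measure (opm A r) (lt A a b \<inter> lt A b d)"

text \<open>The minimum over permutations is at most the probability of any single order, so one
  rare order in each triple is enough.\<close>

lemma delta_3_le:
  assumes A: "finite A" "partial_order_on A r" "3 \<le> card A"
    and t: "\<And>x y z. x \<in> A \<Longrightarrow> y \<in> A \<Longrightarrow> z \<in> A \<Longrightarrow> x \<noteq> y \<Longrightarrow> x \<noteq> z \<Longrightarrow> y \<noteq> z \<Longrightarrow>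
      \<exists>a b d. {a, b, d} = {x, y, z} \<and> triple_prob A r a b d \<le> c"
  shows "delta 3 A r \<le> c"
proof -
  let ?X = "{x \<in> {1..3 :: nat} \<rightarrow>\<^sub>E A. inj_on x {1..3}}"
  let ?m = "\<lambda>x. Min (chain_prob A r 3 x ` {\<pi>. \<pi> permutes {1..3}})"
  have three: "{1..3 :: nat} = {1, 2, 3}" "{1..<3 :: nat} = {1, 2}" by auto
  have fX: "finite ?X" by (rule finite_subset[OF _ finite_PiE[of "{1..3}" "\<lambda>_. A"]]) (use A in auto)
  have fP: "finite {\<pi>. \<pi> permutes {1..3 :: nat}}" by (rule finite_permutations) simp
  have ne: "?X \<noteq> {}"
  proof -
    obtain f where f: "f ` {1..3 :: nat} \<subseteq> A" "inj_on f {1..3 :: nat}"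
      using card_le_inj[of "{1..3 :: nat}" A] A by auto
    then have "restrict f {1..3} \<in> ?X" by (auto simp: inj_on_restrict_eq)
    then show ?thesis by blast
  qed
  have le: "?m x \<le> c" if "x \<in> ?X" for x
  proof -
    have inj: "inj_on x {1..3}" and xE: "x \<in> {1..3} \<rightarrow>\<^sub>E A" using that by auto
    have x: "x \<in> {1..3} \<rightarrow>\<^sub>E A" "x 1 \<in> A" "x 2 \<in> A" "x 3 \<in> A" "x 1 \<noteq> x 2" "x 1 \<noteq> x 3" "x 2 \<noteq> x 3"
      using xE inj_on_eq_iff[OF inj, of 1 2] inj_on_eq_iff[OF inj, of 1 3] inj_on_eq_iff[OF inj, of 2 3]
      by (auto simp: PiE_iff)
    obtain a b d where abd: "{a, b, d} = {x 1, x 2, x 3}" "triple_prob A r a b d \<le> c" using t[OF x(2-7)] by blast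
    have "a \<in> x ` {1, 2, 3}" "b \<in> x ` {1, 2, 3}" "d \<in> x ` {1, 2, 3}" using abd(1) by auto
    then obtain p q s where pqs: "p \<in> {1, 2, 3}" "q \<in> {1, 2, 3}" "s \<in> {1, 2, 3}" "a = x p" "b = x q" "d = x s" by blast
    have card3: "card {a, b, d} = 3" unfolding abd(1) using x(5-7) by simp
    have dist: "a \<noteq> b" "a \<noteq> d" "b \<noteq> d"
      using card3 by (auto simp: card_insert_if split: if_splits)
    then have pq: "p \<noteq> q" "p \<noteq> s" "q \<noteq> s" using pqs by auto
    \<comment> \<open>The permutation of the indices that lists the triple as \<open>a\<close>,
      \<open>b\<close>, \<open>d\<close>.\<close>
    define \<pi> where "\<pi> i = (if i = 1 then p else if i = 2 then q else if i = 3 then s else i)" for i :: nat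
    have \<pi>: "\<pi> permutes {1..3}"
    proof (rule bij_imp_permutes)
      have "inj_on \<pi> {1, 2, 3}" using pq by (auto simp: inj_on_def \<pi>_def)
      moreover have "\<pi> ` {1, 2, 3} \<subseteq> {1, 2, 3}" using pqs by (auto simp: \<pi>_def)
      ultimately have "\<pi> ` {1, 2, 3} = {1, 2, 3}" by (intro endo_inj_surj) auto
      with \<open>inj_on \<pi> {1, 2, 3}\<close> show "bij_betw \<pi> {1..3} {1..3}" unfolding three by (simp add: bij_betw_def)
    qed (auto simp: \<pi>_def)
    have "?m x \<le> chain_prob A r 3 x \<pi>" using fP \<pi> by (auto intro!: Min_le)
    also have "\<dots> = measure (opm A r) {F \<in> space (PL A). \<forall>i\<in>{1..<3}. F (x (\<pi> i)) < F (x (\<pi> (i + 1)))}"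
      by (rule chain_prob_eq[OF A(1,2)]) (use x(1) permutes_in_image[OF \<pi>] in \<open>auto simp: PiE_iff\<close>)
    also have "{F \<in> space (PL A). \<forall>i\<in>{1..<3}. F (x (\<pi> i)) < F (x (\<pi> (i + 1)))} = lt A a b \<inter> lt A b d"
      unfolding three(2) using pqs by (auto simp: lt_def \<pi>_def)
    also have "measure (opm A r) \<dots> = triple_prob A r a b d" by (simp add: triple_prob_def)
    finally show ?thesis using abd(2) by simp
  qed
  show ?thesis unfolding delta_def using fX ne le by (subst Max_le_iff) auto
qed

lemma triple_prob_comparable:
  assumes A: "finite A" "partial_order_on A r" and xy: "(x, y) \<in> r" and d: "d \<in> A"
  shows "triple_prob A r y x d = 0"
proof -
  have xA: "x \<in> A" "y \<in> A" using xy partial_order_on_sub[OF A(2)] by auto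
  have "triple_prob A r y x d = measure (opm A r) {}"
    unfolding triple_prob_def
  proof (rule measure_eq_AE)
    show "AE F in opm A r. F \<in> lt A y x \<inter> lt A x d \<longleftrightarrow> F \<in> {}"
      using AE_opm[OF A]
    proof eventually_elim
      case (elim F)
      then show ?case using order_polytope_le[OF elim xy] by (simp add: lt_def)
    qed
    show "lt A y x \<inter> lt A x d \<in> sets (opm A r)" unfolding sets_opm by (intro sets.Int sets_lt xA d)
  qed simp
  then show ?thesis by simp
qed

lemma triple_prob_par:
  assumes o: "par A r B C" and x: "a \<in> B" "b \<in> B" "d \<in> B"
  shows "triple_prob A r a b d = triple_prob B (res r B) a b d"
proof -
  have "lt A a b \<inter> lt A b d = {F \<in> space (PL A). restrict F B a < restrict F B b \<and> restrict F B b < restrict F B d}"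
    using x by (auto simp: lt_def)
  moreover have "lt B a b \<inter> lt B b d = {F \<in> space (PL B). F a < F b \<and> F b < F d}" by (auto simp: lt_def)
  moreover have "{F \<in> space (PL B). F a < F b \<and> F b < F d} \<in> sets (PL B)" using x by measurable
  ultimately show ?thesis
    using prob_par_fst[OF o, of "\<lambda>F. F a < F b \<and> F b < F d"] by (simp add: triple_prob_def)
qed

text \<open>The slope of the affine map is almost surely positive, so the map is invisible to order
  events inside one summand.\<close>

lemma triple_prob_ord3:
  assumes o: "ord3 A r D P E" and x: "a \<in> P" "b \<in> P" "d \<in> P"
  shows "triple_prob A r a b d = triple_prob P (res r P) a b d"
proof -
  note f = ord3_facts[OF o]
  interpret R: prob_space "rho (card D) (card P) (card E)" by (rule f)
  have Q: "{z \<in> space (borel \<Otimes>\<^sub>M PL P). snd z a < snd z b \<and> snd z b < snd z d} \<in> sets (borel \<Otimes>\<^sub>M PL P)"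
    using x by measurable
  have "lt A a b \<inter> lt A b d = {F \<in> space (PL A). snd (low D F, restrict F P) a < snd (low D F, restrict F P) b
     \<and> snd (low D F, restrict F P) b < snd (low D F, restrict F P) d}"
    using x by (auto simp: lt_def)
  then have "triple_prob A r a b d = (\<integral>z. measure (opm P (res r P)) {G \<in> space (PL P). snd (aff P (z, G)) a < snd (aff P (z, G)) b
     \<and> snd (aff P (z, G)) b < snd (aff P (z, G)) d} \<partial>rho (card D) (card P) (card E))"
    unfolding triple_prob_def by (simp only: prob_ord3[OF o Q])
  also have "\<dots> = (\<integral>z. triple_prob P (res r P) a b d \<partial>rho (card D) (card P) (card E))"
  proof (rule integral_cong_AE)
    show ae: "AE z in rho (card D) (card P) (card E). measure (opm P (res r P)) {G \<in> space (PL P). snd (aff P (z, G)) a < snd (aff P (z, G)) b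
     \<and> snd (aff P (z, G)) b < snd (aff P (z, G)) d} = triple_prob P (res r P) a b d"
      using AE_rho[OF f(10)]
    proof eventually_elim
      case (elim z)
      then have "0 < 1 - fst z - snd z" by simp
      then have "{G \<in> space (PL P). snd (aff P (z, G)) a < snd (aff P (z, G)) b
     \<and> snd (aff P (z, G)) b < snd (aff P (z, G)) d} = lt P a b \<inter> lt P b d"
        using x by (auto simp: aff_def lt_def)
      then show ?case by (simp add: triple_prob_def)
    qed
    interpret P: prob_space "opm P (res r P)" by (rule f)
    have "(\<lambda>z. \<integral>G. indicat_real {z. snd z a < snd z b \<and> snd z b < snd z d} (aff P (z, G)) \<partial>opm P (res r P)) \<in> borel_measurable (borel \<Otimes>\<^sub>M borel)"
    proof -
      have "(\<lambda>w. indicat_real {z. snd z a < snd z b \<and> snd z b < snd z d} (aff P w)) = (\<lambda>w. if snd (aff P w) a < snd (aff P w) b \<and> snd (aff P w) b < snd (aff P w) d then 1 else 0)"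
        by (auto simp: indicator_def)
      moreover have "(\<lambda>w. snd (aff P w) i) \<in> borel_measurable ((borel \<Otimes>\<^sub>M borel) \<Otimes>\<^sub>M opm P (res r P))" if "i \<in> P" for i
        using that by (simp add: aff_def split_beta)
      note [measurable] = this[OF x(1)] this[OF x(2)] this[OF x(3)]
      have "(\<lambda>w. if snd (aff P w) a < snd (aff P w) b \<and> snd (aff P w) b < snd (aff P w) d then 1 else 0 :: real) \<in> borel_measurable ((borel \<Otimes>\<^sub>M borel) \<Otimes>\<^sub>M opm P (res r P))"
        by measurable
      ultimately have [measurable]: "(\<lambda>w. indicat_real {z. snd z a < snd z b \<and> snd z b < snd z d} (aff P w)) \<in> borel_measurable ((borel \<Otimes>\<^sub>M borel) \<Otimes>\<^sub>M opm P (res r P))"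
        by (simp only:)
      show ?thesis by measurable
    qed
    moreover have "(\<integral>G. indicat_real {z. snd z a < snd z b \<and> snd z b < snd z d} (aff P (z, G)) \<partial>opm P (res r P)) =
      measure (opm P (res r P)) {G \<in> space (PL P). snd (aff P (z, G)) a < snd (aff P (z, G)) b \<and> snd (aff P (z, G)) b < snd (aff P (z, G)) d}" for z
    proof -
      have "(\<integral>G. indicat_real {z. snd z a < snd z b \<and> snd z b < snd z d} (aff P (z, G)) \<partial>opm P (res r P)) =
        (\<integral>G. indicat_real {G \<in> space (PL P). snd (aff P (z, G)) a < snd (aff P (z, G)) b \<and> snd (aff P (z, G)) b < snd (aff P (z, G)) d} G \<partial>opm P (res r P))"
        by (intro Bochner_Integration.integral_cong) (auto simp: indicator_def)
      moreover have "{G \<in> space (PL P). snd (aff P (z, G)) a < snd (aff P (z, G)) b \<and> snd (aff P (z, G)) b < snd (aff P (z, G)) d} \<in> sets (PL P)"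
        unfolding aff_def using x by simp
      ultimately show ?thesis by simp
    qed
    ultimately show "(\<lambda>z. measure (opm P (res r P)) {G \<in> space (PL P). snd (aff P (z, G)) a < snd (aff P (z, G)) b
     \<and> snd (aff P (z, G)) b < snd (aff P (z, G)) d}) \<in> borel_measurable (rho (card D) (card P) (card E))" by simp
  qed simp
  also have "\<dots> = triple_prob P (res r P) a b d" using R.prob_space by simp
  finally show ?thesis .
qed

subsection \<open>Triples\<close>

text \<open>Meant for \<open>2 * L + 2\<close> slots: the middle slots \<open>L\<close> and
  \<open>L + 1\<close> hold the two copies, and the single points below and above them form the two
  chains of \<open>L\<close> points.\<close>

definition slot :: "nat \<Rightarrow> (nat set \<Rightarrow> nat rel \<Rightarrow> bool) \<Rightarrow> nat \<Rightarrow> nat set \<Rightarrow> nat rel \<Rightarrow> bool" where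
  "slot L Q i = (if i = L \<or> i = Suc L then Q else point)"

definition slot_size :: "nat \<Rightarrow> nat \<Rightarrow> nat \<Rightarrow> nat" where
  "slot_size L n i = (if i = L \<or> i = Suc L then n else 1)"

lemma sized_slot: "sized Q n \<Longrightarrow> sized (slot L Q i) (slot_size L n i)"
  using sized_point by (simp add: slot_def slot_size_def)

lemma sum_slot_size:
  "(\<Sum>j<L. slot_size L n j) = L" "(\<Sum>j<Suc L. slot_size L n j) = L + n"
  "(\<Sum>j<2 * L + 2. slot_size L n j) = 2 * L + 2 * n"
proof -
  show 1: "(\<Sum>j<L. slot_size L n j) = L" by (simp add: slot_size_def)
  show 2: "(\<Sum>j<Suc L. slot_size L n j) = L + n" unfolding sum.lessThan_Suc 1 by (simp add: slot_size_def)
  have "(\<Sum>j<Suc (Suc L) + d. slot_size L n j) = L + 2 * n + d" for d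
  proof (induction d)
    case 0
    have "(\<Sum>j<Suc (Suc L). slot_size L n j) = L + n + n"
      unfolding sum.lessThan_Suc[of _ "Suc L"] 2 by (simp add: slot_size_def)
    then show ?case by simp
  qed (simp add: slot_size_def)
  from this[of L] show "(\<Sum>j<2 * L + 2. slot_size L n j) = 2 * L + 2 * n" by (simp add: mult_2)
qed

text \<open>What a branch has to offer to the argument for triples: a replacement \<open>y'\<close>
  for \<open>y\<close> that is comparable to \<open>y\<close>, has the marginal of \<open>x\<close>,
  and beats independence from \<open>x\<close> by \<open>k\<close> on a window wide enough to hold
  half of that marginal.\<close>

definition correlated :: "(nat set \<Rightarrow> nat rel \<Rightarrow> bool) \<Rightarrow> real \<Rightarrow> bool" where
  "correlated Q k \<longleftrightarrow> (\<forall>B r x y. Q B r \<longrightarrow> x \<in> B \<longrightarrow> y \<in> B \<longrightarrow> x \<noteq> y \<longrightarrow> (x, y) \<notin> r \<longrightarrow> (y, x) \<notin> r \<longrightarrow>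
    (\<exists>y'\<in>B. ((y', y) \<in> r \<or> (y, y') \<in> r) \<and> (\<forall>t. surv B r y' t = surv B r x t) \<and>
      (\<exists>\<tau>>0. 2 * coord_var B r x < \<tau>\<^sup>2 \<and>
        (\<forall>t. \<bar>t - coord_mean B r x\<bar> \<le> \<tau> \<longrightarrow> (surv B r x t)\<^sup>2 + k \<le> jsurv B r x y' t))))"

text \<open>Incomparable points lie in one slot, and this slot is a copy of \<open>Q\<close>, since
  the others are single points. The copy has \<open>L\<close> points on one side and
  \<open>L + n\<close> on the other; these are the two pairs for which \<open>K\<close> provides the
  spread.\<close>

lemma correlated_slot:
  fixes N \<sigma> \<tau> \<kappa> w :: real
  assumes Q: "sized Q n" "transversal Q" "assoc Q" "vbound Q (\<sigma>\<^sup>2)" and \<sigma>: "0 < \<sigma>" and N: "N = real (2 * L + 2 * n)"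
    and k: "0 \<le> \<kappa>"
    and K: "\<And>p q m M. p = L \<and> q = L + n \<or> p = L + n \<and> q = L \<Longrightarrow> 0 \<le> m \<Longrightarrow> m \<le> 1 \<Longrightarrow>
      M = (1 - m) * (real p / (N + 1)) + m * (1 - real q / (N + 1)) \<Longrightarrow>
      \<kappa> \<le> measure (rho p n q) {z. M + \<tau> + 2 * \<sigma> \<le> fst z + (1 - fst z - snd z) * m} \<and>
      \<kappa> \<le> measure (rho p n q) {z. fst z + (1 - fst z - snd z) * m \<le> M - (\<tau> + 2 * \<sigma>)}"
    and w: "vbound (series (slot L Q) (2 * L + 2)) w" "2 * w < \<tau>\<^sup>2" and \<tau>: "0 < \<tau>"
  shows "correlated (series (slot L Q) (2 * L + 2)) (\<kappa> / 16)"
  unfolding correlated_def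
proof (intro allI impI)
  fix B r and x y :: nat
  assume ser: "series (slot L Q) (2 * L + 2) B r" and xy: "x \<in> B" "y \<in> B" "x \<noteq> y" "(x, y) \<notin> r" "(y, x) \<notin> r"
  obtain h where br: "branch (slot L Q) (2 * L + 2) B r h" using ser by (auto simp: series_def)
  note sz = sized_slot[OF Q(1), of L]
  have heq: "h y = h x" using branchD(4)[OF br xy(1,2)] branchD(4)[OF br xy(2,1)] xy(4,5) by (metis nat_neq_iff)
  define i where "i = h x"
  have i: "i < 2 * L + 2" using branchD(3)[OF br xy(1)] by (simp add: i_def)
  let ?P = "{z \<in> B. h z = i}"
  have P: "x \<in> ?P" "y \<in> ?P" using xy heq by (auto simp: i_def)
  have Si: "slot L Q i ?P (res r ?P)" by (rule branchD(5)[OF br i])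
  have iL: "i = L \<or> i = Suc L"
  proof (rule ccontr)
    assume "\<not> (i = L \<or> i = Suc L)"
    then have "point ?P (res r ?P)" using Si by (simp add: slot_def)
    then obtain a where a: "?P = {a}" by (auto simp: point_def)
    have "x \<in> {a}" "y \<in> {a}" using P by (simp_all only: a)
    then show False using xy(3) by simp
  qed
  have QP: "Q ?P (res r ?P)" using Si iL by (simp add: slot_def)
  note fP = sizedD(1,2)[OF Q(1) QP]
  obtain y' where y': "y' \<in> ?P" "\<And>t. surv ?P (res r ?P) y' t = surv ?P (res r ?P) x t"
    "(y', y) \<in> res r ?P \<or> (y, y') \<in> res r ?P"
    using Q(2) QP P unfolding transversal_def by blast
  have o: "ord3 B r {x \<in> B. h x < i} ?P {x \<in> B. i < h x}" by (rule branch_ord3[OF br sz i])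
  note cards = branch_cards[OF br sz i]
  define p where "p = card {x \<in> B. h x < i}"
  define q where "q = card {x \<in> B. i < h x}"
  have n: "card ?P = n" using sizedD(3)[OF Q(1) QP] .
  have pq: "p = L \<and> q = L + n \<or> p = L + n \<and> q = L"
    using iL cards sum_slot_size[of L n] by (auto simp: p_def q_def slot_size_def)
  have cB: "real (card B) = N" using branch_card_all[OF br sz] sum_slot_size(3)[of L n] N by simp
  have xB: "x \<in> B" by (rule xy(1))
  let ?m = "coord_mean ?P (res r ?P) x" and ?M = "coord_mean B r x"
  have m: "0 \<le> ?m" "?m \<le> 1" using coord_mean_range[OF fP P(1)] by auto
  have M: "?M = (1 - ?m) * (real p / (N + 1)) + ?m * (1 - real q / (N + 1))"
    using coord_mean_ord3(1)[OF o P(1)] cB by (simp add: p_def q_def)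
  note KK = K[OF pq m M]
  have "coord_var ?P (res r ?P) x \<le> \<sigma>\<^sup>2" using Q(4) QP P(1) unfolding vbound_def by blast
  have gain: "(surv B r x t)\<^sup>2 + \<kappa> / 16 \<le> jsurv B r x y' t" if t: "\<bar>t - ?M\<bar> \<le> \<tau>" for t
  proof (rule jsurv_gain[OF o P(1) y'(1,2) _ _ \<sigma> k _ _ t])
    show "coord_var ?P (res r ?P) x \<le> \<sigma>\<^sup>2" by fact
    show "surv ?P (res r ?P) x t * surv ?P (res r ?P) y' t \<le> jsurv ?P (res r ?P) x y' t" for t
      using Q(3) QP P(1) y'(1) unfolding assoc_def by blast
    show "\<kappa> \<le> measure (rho (card {x \<in> B. h x < i}) (card ?P) (card {x \<in> B. i < h x}))
      {z. ?M + \<tau> + 2 * \<sigma> \<le> fst z + (1 - fst z - snd z) * ?m}"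
      using KK unfolding p_def q_def n by blast
    show "\<kappa> \<le> measure (rho (card {x \<in> B. h x < i}) (card ?P) (card {x \<in> B. i < h x}))
      {z. fst z + (1 - fst z - snd z) * ?m \<le> ?M - (\<tau> + 2 * \<sigma>)}"
      using KK unfolding p_def q_def n by blast
  qed
  have "surv B r y' t = surv B r x t" for t
    unfolding jsurv_ord3[OF o P(1) P(1)] jsurv_ord3[OF o y'(1) y'(1)] y'(2) ..
  moreover have "2 * coord_var B r x < \<tau>\<^sup>2"
  proof -
    have "coord_var B r x \<le> w" using w(1) ser xB unfolding vbound_def by blast
    then show ?thesis using w(2) by linarith
  qed
  moreover have "(y', y) \<in> r \<or> (y, y') \<in> r" using y'(3) by (auto simp: res_def)
  moreover have "y' \<in> B" using y'(1) by simp
  ultimately show "\<exists>y'\<in>B. ((y', y) \<in> r \<or> (y, y') \<in> r) \<and> (\<forall>t. surv B r y' t = surv B r x t) \<and>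
      (\<exists>\<tau>>0. 2 * coord_var B r x < \<tau>\<^sup>2 \<and>
        (\<forall>t. \<bar>t - coord_mean B r x\<bar> \<le> \<tau> \<longrightarrow> (surv B r x t)\<^sup>2 + \<kappa> / 16 \<le> jsurv B r x y' t))"
    using gain \<tau> by blast
qed

text \<open>Stated through the set of the three points, so that renaming is free and a case analysis
  may pick a convenient order of the arguments.\<close>

definition unbalanced_triple :: "'a set \<Rightarrow> 'a rel \<Rightarrow> 'a \<Rightarrow> 'a \<Rightarrow> 'a \<Rightarrow> real \<Rightarrow> bool" where
  "unbalanced_triple A r x y z c \<longleftrightarrow> (\<exists>a b d. {a, b, d} = {x, y, z} \<and> triple_prob A r a b d \<le> c)"

lemma unbalanced_tripleI: "{a, b, d} = {x, y, z} \<Longrightarrow> triple_prob A r a b d \<le> c \<Longrightarrow> unbalanced_triple A r x y z c"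
  unfolding unbalanced_triple_def by (intro exI conjI)

lemma unbalanced_triple_cong: "{x, y, z} = {x', y', z'} \<Longrightarrow> unbalanced_triple A r x y z c = unbalanced_triple A r x' y' z' c"
  by (simp add: unbalanced_triple_def)

lemma unbalanced_triple_swap: "unbalanced_triple A r y x z c = unbalanced_triple A r x y z c" "unbalanced_triple A r x z y c = unbalanced_triple A r x y z c"
  by (rule unbalanced_triple_cong, simp add: insert_commute)+

lemma unbalanced_triple_transfer:
  assumes "unbalanced_triple P s x y z c"
    and triple_prob: "\<And>a b d. a \<in> {x, y, z} \<Longrightarrow> b \<in> {x, y, z} \<Longrightarrow> d \<in> {x, y, z} \<Longrightarrow> triple_prob A r a b d = triple_prob P s a b d"
  shows "unbalanced_triple A r x y z c"
proof -
  from assms(1) obtain a b d where abd: "{a, b, d} = {x, y, z}" "triple_prob P s a b d \<le> c"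
    unfolding unbalanced_triple_def by (elim exE conjE) (rule that)
  have "a \<in> {a, b, d}" "b \<in> {a, b, d}" "d \<in> {a, b, d}" by simp_all
  then have "triple_prob A r a b d = triple_prob P s a b d" unfolding abd(1) by (rule triple_prob)
  with abd show ?thesis by (intro unbalanced_tripleI[of a b d]) simp_all
qed

lemma unbalanced_triple_comparable:
  assumes A: "finite A" "partial_order_on A r" and xyz: "x \<in> A" "y \<in> A" "z \<in> A" and c: "0 \<le> c"
    and cmp: "(x, y) \<in> r \<or> (y, x) \<in> r"
  shows "unbalanced_triple A r x y z c"
  using cmp
proof
  assume "(x, y) \<in> r"
  then have "triple_prob A r y x z \<le> c" using triple_prob_comparable[OF A _ xyz(3)] c by simp
  then show ?thesis by (intro unbalanced_tripleI[of y x z]) (simp_all add: insert_commute)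
next
  assume "(y, x) \<in> r"
  then have "triple_prob A r x y z \<le> c" using triple_prob_comparable[OF A _ xyz(3)] c by simp
  then show ?thesis by (intro unbalanced_tripleI[of x y z]) simp_all
qed

definition unbalanced :: "(nat set \<Rightarrow> nat rel \<Rightarrow> bool) \<Rightarrow> real \<Rightarrow> bool" where
  "unbalanced Q c \<longleftrightarrow> (\<forall>A r x y z. Q A r \<longrightarrow> x \<in> A \<longrightarrow> y \<in> A \<longrightarrow> z \<in> A \<longrightarrow> x \<noteq> y \<longrightarrow> x \<noteq> z \<longrightarrow> y \<noteq> z \<longrightarrow>
    unbalanced_triple A r x y z c)"

lemma unbalancedD:
  "unbalanced Q c \<Longrightarrow> Q A r \<Longrightarrow> x \<in> A \<Longrightarrow> y \<in> A \<Longrightarrow> z \<in> A \<Longrightarrow> x \<noteq> y \<Longrightarrow> x \<noteq> z \<Longrightarrow> y \<noteq> z \<Longrightarrow> unbalanced_triple A r x y z c"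
  unfolding unbalanced_def by blast

lemma unbalanced_point: "unbalanced point c"
  unfolding unbalanced_def point_def by blast

text \<open>Two points in different summands are comparable, which makes some order impossible; a
  triple inside one summand keeps the probabilities that it has there.\<close>

lemma unbalanced_series:
  assumes sz: "\<And>i. i < m \<Longrightarrow> sized (S i) (sz i)" and g: "\<And>i. i < m \<Longrightarrow> unbalanced (S i) c" and c: "0 \<le> c"
  shows "unbalanced (series S m) c"
  unfolding unbalanced_def
proof (intro allI impI)
  fix B r and x y z :: nat
  assume "series S m B r" and xyz: "x \<in> B" "y \<in> B" "z \<in> B" and d: "x \<noteq> y" "x \<noteq> z" "y \<noteq> z"
  then obtain h where br: "branch S m B r h" by (auto simp: series_def)
  note f = branchD(1,2)[OF br]
  have cmp: "(u, v) \<in> r \<or> (v, u) \<in> r" if "u \<in> B" "v \<in> B" "h u \<noteq> h v" for u v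
    using that branchD(4)[OF br that(1,2)] branchD(4)[OF br that(2,1)] by linarith
  show "unbalanced_triple B r x y z c"
  proof (cases "h x = h y \<and> h x = h z")
    case True
    define i where "i = h x"
    have i: "i < m" using branchD(3)[OF br xyz(1)] by (simp add: i_def)
    let ?P = "{z \<in> B. h z = i}"
    have P: "x \<in> ?P" "y \<in> ?P" "z \<in> ?P" using True xyz by (auto simp: i_def)
    have o: "ord3 B r {x \<in> B. h x < i} ?P {x \<in> B. i < h x}" by (rule branch_ord3[OF br sz i])
    have "unbalanced_triple ?P (res r ?P) x y z c" by (rule unbalancedD[OF g[OF i] branchD(5)[OF br i] P d])
    then show ?thesis
    proof (rule unbalanced_triple_transfer)
      fix a b e assume "a \<in> {x, y, z}" "b \<in> {x, y, z}" "e \<in> {x, y, z}"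
      then have "a \<in> ?P" "b \<in> ?P" "e \<in> ?P" using P by auto
      then show "triple_prob B r a b e = triple_prob ?P (res r ?P) a b e" by (rule triple_prob_ord3[OF o])
    qed
  next
    case False
    then consider "h x \<noteq> h y" | "h x \<noteq> h z" by blast
    then show ?thesis
    proof cases
      case 1 then show ?thesis by (intro unbalanced_triple_comparable[OF f xyz c] cmp[OF xyz(1,2)])
    next
      case 2
      then have "unbalanced_triple B r x z y c" by (intro unbalanced_triple_comparable[OF f xyz(1,3,2) c] cmp[OF xyz(1,3)])
      then show ?thesis by (simp only: unbalanced_triple_swap)
    qed
  qed
qed

section \<open>Distances between comparison events\<close>

context prob_space
begin

definition symdiff_prob :: "'a set \<Rightarrow> 'a set \<Rightarrow> real" where
  "symdiff_prob U V = prob ((U - V) \<union> (V - U))"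

lemma symdiff_prob_triangle:
  assumes "U \<in> events" "V \<in> events" "W \<in> events"
  shows "symdiff_prob U W \<le> symdiff_prob U V + symdiff_prob V W"
proof -
  have "symdiff_prob U W \<le> prob (((U - V) \<union> (V - U)) \<union> ((V - W) \<union> (W - V)))"
    unfolding symdiff_prob_def using assms by (intro finite_measure_mono) auto
  also have "\<dots> \<le> symdiff_prob U V + symdiff_prob V W"
    unfolding symdiff_prob_def using assms by (intro measure_Un_le) auto
  finally show ?thesis .
qed

lemma symdiff_prob_eq:
  assumes "U \<in> events" "V \<in> events"
  shows "symdiff_prob U V = prob U + prob V - 2 * prob (U \<inter> V)"
proof -
  have "symdiff_prob U V = prob (U - V) + prob (V - U)"
    unfolding symdiff_prob_def using assms by (intro finite_measure_Union) auto
  moreover have "prob (U - V) = prob U - prob (U \<inter> V)"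
    using assms finite_measure_Diff'[of U V] by simp
  moreover have "prob (V - U) = prob V - prob (U \<inter> V)"
    using assms finite_measure_Diff'[of V U] by (simp add: Int_commute)
  ultimately show ?thesis by simp
qed

lemma symdiff_prob_nested:
  assumes "U \<in> events" "V \<in> events" and ae: "AE x in M. x \<in> U \<longrightarrow> x \<in> V"
  shows "symdiff_prob U V = prob V - prob U"
proof -
  have "prob (U \<inter> V) = prob U"
    by (rule measure_eq_AE) (use assms in \<open>auto elim: AE_mp\<close>)
  then show ?thesis using symdiff_prob_eq[OF assms(1,2)] by simp
qed

end

text \<open>Comparable points make the two events nested up to a null set, so their distance is just
  the difference of their probabilities. This is why replacement points are chosen comparable to the
  points they replace.\<close>

lemma symdiff_prob_comparable:
  assumes A: "finite A" "partial_order_on A r" and ab: "(a, b) \<in> r \<or> (b, a) \<in> r" and z: "z \<in> A"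
  shows "prob_space.symdiff_prob (opm A r) (lt A z a) (lt A z b) = \<bar>measure (opm A r) (lt A z a) - measure (opm A r) (lt A z b)\<bar>"
    "prob_space.symdiff_prob (opm A r) (lt A a z) (lt A b z) = \<bar>measure (opm A r) (lt A a z) - measure (opm A r) (lt A b z)\<bar>"
proof -
  interpret prob_space "opm A r" by (rule prob_space_opm[OF A])
  have abA: "a \<in> A" "b \<in> A" using ab partial_order_on_sub[OF A(2)] by auto
  have s: "lt A u v \<in> events" if "u \<in> A" "v \<in> A" for u v using sets_lt[OF that] by simp
  have comm: "symdiff_prob U V = symdiff_prob V U" for U V unfolding symdiff_prob_def by (simp add: Un_commute)
  have 1: "symdiff_prob (lt A z u) (lt A z v) = prob (lt A z v) - prob (lt A z u)" if "(u, v) \<in> r" "u \<in> A" "v \<in> A" for u v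
  proof (rule symdiff_prob_nested)
    show "AE F in opm A r. F \<in> lt A z u \<longrightarrow> F \<in> lt A z v"
      using AE_opm[OF A]
    proof eventually_elim
      case (elim F) show ?case using order_polytope_le[OF elim that(1)] by (auto simp: lt_def)
    qed
  qed (use s z that in auto)
  have 2: "symdiff_prob (lt A v z) (lt A u z) = prob (lt A u z) - prob (lt A v z)" if "(u, v) \<in> r" "u \<in> A" "v \<in> A" for u v
  proof (rule symdiff_prob_nested)
    show "AE F in opm A r. F \<in> lt A v z \<longrightarrow> F \<in> lt A u z"
      using AE_opm[OF A]
    proof eventually_elim
      case (elim F) show ?case using order_polytope_le[OF elim that(1)] by (auto simp: lt_def)
    qed
  qed (use s z that in auto)
  have pos: "0 \<le> symdiff_prob U V" for U V by (simp add: symdiff_prob_def)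
  from ab show "symdiff_prob (lt A z a) (lt A z b) = \<bar>prob (lt A z a) - prob (lt A z b)\<bar>"
  proof
    assume r: "(a, b) \<in> r" show ?thesis using 1[OF r abA] pos[of "lt A z a" "lt A z b"] by linarith
  next
    assume r: "(b, a) \<in> r" show ?thesis using 1[OF r abA(2,1)] pos[of "lt A z b" "lt A z a"] comm[of "lt A z a"] by simp
  qed
  from ab show "symdiff_prob (lt A a z) (lt A b z) = \<bar>prob (lt A a z) - prob (lt A b z)\<bar>"
  proof
    assume r: "(a, b) \<in> r" show ?thesis using 2[OF r abA] pos[of "lt A b z" "lt A a z"] comm[of "lt A a z"] by simp
  next
    assume r: "(b, a) \<in> r" show ?thesis using 2[OF r abA(2,1)] pos[of "lt A a z" "lt A b z"] by linarith
  qed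
qed

text \<open>The six orders are disjoint and each decides all pairs; the two orders with
  \<open>z\<close> in the middle lie in the symmetric difference of the events that compare
  \<open>z\<close> with \<open>x\<close> and with \<open>y\<close>.\<close>

lemma triple_prob_sums:
  assumes A: "finite A" "partial_order_on A r" and xyz: "x \<in> A" "y \<in> A" "z \<in> A"
  shows "triple_prob A r z x y + triple_prob A r z y x + triple_prob A r y z x \<le> measure (opm A r) (lt A z x)"
    "triple_prob A r x z y + triple_prob A r x y z + triple_prob A r y x z \<le> measure (opm A r) (lt A x z)"
    "triple_prob A r x z y + triple_prob A r y z x \<le> prob_space.symdiff_prob (opm A r) (lt A z x) (lt A z y)"
proof -
  interpret prob_space "opm A r" by (rule prob_space_opm[OF A])
  have s: "lt A u v \<in> events" if "u \<in> A" "v \<in> A" for u v using sets_lt[OF that] by simp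
  have s3: "lt A u v \<inter> lt A v w \<in> events" if "u \<in> A" "v \<in> A" "w \<in> A" for u v w using s that by blast
  have three: "prob U + prob V + prob W \<le> prob X"
    if "U \<in> events" "V \<in> events" "W \<in> events" "X \<in> events" "U \<inter> V = {}" "(U \<union> V) \<inter> W = {}" "U \<union> V \<union> W \<subseteq> X" for U V W X
  proof -
    have "prob U + prob V + prob W = prob (U \<union> V \<union> W)"
      using that by (subst finite_measure_Union; (subst finite_measure_Union)?) auto
    also have "\<dots> \<le> prob X" using that by (intro finite_measure_mono) auto
    finally show ?thesis .
  qed
  show "triple_prob A r z x y + triple_prob A r z y x + triple_prob A r y z x \<le> prob (lt A z x)"
    unfolding triple_prob_def by (intro three s3 s xyz) (auto simp: lt_def)
  show "triple_prob A r x z y + triple_prob A r x y z + triple_prob A r y x z \<le> prob (lt A x z)"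
    unfolding triple_prob_def by (intro three s3 s xyz) (auto simp: lt_def)
  have "prob (lt A x z \<inter> lt A z y) + prob (lt A y z \<inter> lt A z x) + prob {} \<le>
    prob ((lt A z x - lt A z y) \<union> (lt A z y - lt A z x))"
    by (intro three s3 xyz sets.Un sets.Diff s) (auto simp: lt_def)
  then show "triple_prob A r x z y + triple_prob A r y z x \<le> symdiff_prob (lt A z x) (lt A z y)"
    by (simp add: triple_prob_def symdiff_prob_def)
qed

text \<open>If every order had probability above \<open>1 / 6 - \<eta>\<close>, then
  \<open>z\<close> would lie between \<open>x\<close> and \<open>y\<close> with probability above
  \<open>1 / 3 - 2 * \<eta>\<close>. But the path from \<open>lt A z x\<close> over
  \<open>lt A z' x\<close>, \<open>lt A z' y'\<close> and \<open>lt A z y'\<close> to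
  \<open>lt A z y\<close> has length at most
  \<open>3 * \<eta> + (1 / 3 - k) + 3 * \<eta> + 6 * \<eta>\<close>, which is a contradiction once
  \<open>14 * \<eta> \<le> k\<close>.\<close>

lemma twin_triple:
  assumes o: "par A r B C" and Q: "Q B (res r B)" "Q C (res r C)"
    and sz: "sized Q n" and tr: "transversal Q" and as: "assoc Q" and ga: "correlated Q k"
    and \<eta>: "0 \<le> \<eta>" "\<eta> \<le> 1 / 6" "14 * \<eta> \<le> k"
    and xyz: "x \<in> B" "y \<in> B" "z \<in> C" "x \<noteq> y"
  shows "unbalanced_triple A r x y z (1 / 6 - \<eta>)"
proof (cases "(x, y) \<in> r \<or> (y, x) \<in> r")
  case True
  have inA: "x \<in> A" "y \<in> A" "z \<in> A" using xyz par_facts(5,6)[OF o] by auto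
  have "0 \<le> 1 / 6 - \<eta>" using \<eta> by linarith
  then show ?thesis by (rule unbalanced_triple_comparable[OF par_facts(1,2)[OF o] inA _ True])
next
  case False
  note f = par_facts[OF o]
  have k: "0 \<le> k" using \<eta> by linarith
  show ?thesis
  proof (rule ccontr)
    assume neg: "\<not> ?thesis"
    have T: "1 / 6 - \<eta> < triple_prob A r a b d" if "{a, b, d} = {x, y, z}" for a b d
    proof (rule ccontr)
      assume "\<not> 1 / 6 - \<eta> < triple_prob A r a b d"
      then have "triple_prob A r a b d \<le> 1 / 6 - \<eta>" by simp
      with that have "unbalanced_triple A r x y z (1 / 6 - \<eta>)" by (rule unbalanced_tripleI)
      with neg show False ..
    qed
    have tris: "1 / 6 - \<eta> < triple_prob A r x y z" "1 / 6 - \<eta> < triple_prob A r x z y" "1 / 6 - \<eta> < triple_prob A r y x z"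
      "1 / 6 - \<eta> < triple_prob A r y z x" "1 / 6 - \<eta> < triple_prob A r z x y" "1 / 6 - \<eta> < triple_prob A r z y x"
      by (rule T, simp add: insert_commute)+
    have xyr: "(x, y) \<notin> res r B" "(y, x) \<notin> res r B" using False by (auto simp: res_def)
    obtain y' \<tau> where y': "y' \<in> B" "(y', y) \<in> res r B \<or> (y, y') \<in> res r B" "\<And>t. surv B (res r B) y' t = surv B (res r B) x t"
      "0 < \<tau>" "2 * coord_var B (res r B) x < \<tau>\<^sup>2"
      "\<And>t. \<bar>t - coord_mean B (res r B) x\<bar> \<le> \<tau> \<Longrightarrow> (surv B (res r B) x t)\<^sup>2 + k \<le> jsurv B (res r B) x y' t"
      using ga Q(1) xyz(1,2,4) xyr unfolding correlated_def by blast
    obtain z' where z': "z' \<in> C" "\<And>t. surv C (res r C) z' t = surv B (res r B) x t"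
      "(z', z) \<in> res r C \<or> (z, z') \<in> res r C"
      using tr Q xyz(1,3) unfolding transversal_def by blast
    interpret prob_space "opm A r" by (rule f)
    have inA: "x \<in> A" "y \<in> A" "z \<in> A" "y' \<in> A" "z' \<in> A" using xyz y' z' f(5,6) by auto
    have s: "lt A u v \<in> events" if "u \<in> A" "v \<in> A" for u v using sets_lt[OF that] by simp
    have int: "prob (lt A u v) = (\<integral>F. surv B (res r B) v (F u) \<partial>opm C (res r C))" if "u \<in> C" "v \<in> B" for u v
    proof -
      have "lt A u v = {F \<in> space (PL A). F u < F v \<and> F u < F v}" by (auto simp: lt_def)
      then show ?thesis using prob_par_below[OF o that(2,2,1)] by simp
    qed
    have half: "prob (lt A z' x) = 1 / 2" "prob (lt A z' y') = 1 / 2"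
      using int[OF z'(1) xyz(1)] int[OF z'(1) y'(1)] surv_integral_half[OF f(3,7) xyz(1) f(4,8) z'(1,2)]
      by (simp_all add: y'(3))
    \<comment> \<open>\<open>x\<close> and \<open>y'\<close> have the same marginal, and both are
      independent of \<open>z\<close>.\<close>
    have same: "prob (lt A z y') = prob (lt A z x)"
      using int[OF xyz(3,1)] int[OF xyz(3) y'(1)] by (simp add: y'(3))
    have "lt A z' x \<inter> lt A z' y' = {F \<in> space (PL A). F z' < F x \<and> F z' < F y'}" by (auto simp: lt_def)
    then have "prob (lt A z' x \<inter> lt A z' y') = (\<integral>F. jsurv B (res r B) x y' (F z') \<partial>opm C (res r C))"
      using prob_par_below[OF o xyz(1) y'(1) z'(1)] by simp
    also have "1 / 3 + k / 2 \<le> \<dots>"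
    proof (rule jsurv_integral_gain[OF f(3,7) xyz(1) y'(1) f(4,8) z'(1,2) _ y'(6) k y'(4,5)])
      show "(surv B (res r B) x t)\<^sup>2 \<le> jsurv B (res r B) x y' t" for t
        using as Q(1) xyz(1) y'(1) y'(3)[of t] unfolding assoc_def by (metis power2_eq_square)
    qed
    finally have both: "1 / 3 + k / 2 \<le> prob (lt A z' x \<inter> lt A z' y')" .
    \<comment> \<open>The distance is \<open>1 / 2 + 1 / 2\<close> minus twice the probability of
      the intersection, at most \<open>1 - 2 * (1 / 3 + k / 2)\<close>.\<close>
    have m: "symdiff_prob (lt A z' x) (lt A z' y') \<le> 1 / 3 - k"
      using symdiff_prob_eq[OF s s] half both inA by simp
    \<comment> \<open>Three of the six orders put \<open>z\<close> below \<open>x\<close> and three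
      above it, each with probability above \<open>1 / 6 - \<eta>\<close>.\<close>
    have zx: "1 / 2 - 3 * \<eta> \<le> prob (lt A z x)" "prob (lt A z x) \<le> 1 / 2 + 3 * \<eta>"
    proof -
      have "z \<noteq> x" using xyz o by (auto simp: par_def)
      then have "prob (lt A z x) + prob (lt A x z) = 1" by (rule lt_total[OF f(1,2) inA(3,1)])
      then show "1 / 2 - 3 * \<eta> \<le> prob (lt A z x)" "prob (lt A z x) \<le> 1 / 2 + 3 * \<eta>"
        using triple_prob_sums(1,2)[OF f(1,2) inA(1-3)] tris by linarith+
    qed
    have zy: "1 / 2 - 3 * \<eta> \<le> prob (lt A z y)" "prob (lt A z y) \<le> 1 / 2 + 3 * \<eta>"
    proof -
      have "z \<noteq> y" using xyz o by (auto simp: par_def)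
      then have "prob (lt A z y) + prob (lt A y z) = 1" by (rule lt_total[OF f(1,2) inA(3,2)])
      then show "1 / 2 - 3 * \<eta> \<le> prob (lt A z y)" "prob (lt A z y) \<le> 1 / 2 + 3 * \<eta>"
        using triple_prob_sums(1,2)[OF f(1,2) inA(2,1,3)] tris by linarith+
    qed
    have zz: "(z, z') \<in> r \<or> (z', z) \<in> r" using z'(3) by (auto simp: res_def)
    have yy: "(y', y) \<in> r \<or> (y, y') \<in> r" using y'(2) by (auto simp: res_def)
    have d1: "symdiff_prob (lt A z x) (lt A z' x) \<le> 3 * \<eta>"
      using symdiff_prob_comparable(2)[OF f(1,2) zz inA(1)] half zx by linarith
    have d2: "symdiff_prob (lt A z' y') (lt A z y') \<le> 3 * \<eta>"
      using symdiff_prob_comparable(2)[OF f(1,2) _ inA(4), of z' z] zz half zx same by (smt (verit))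
    \<comment> \<open>Both probabilities lie within \<open>3 * \<eta>\<close> of 1/2, the first one
      because it equals that of \<open>lt A z x\<close>.\<close>
    have d3: "symdiff_prob (lt A z y') (lt A z y) \<le> 6 * \<eta>"
      using symdiff_prob_comparable(1)[OF f(1,2) yy inA(3)] same zx zy by linarith
    have "symdiff_prob (lt A z x) (lt A z y) \<le> symdiff_prob (lt A z x) (lt A z' x) + symdiff_prob (lt A z' x) (lt A z y)"
      by (rule symdiff_prob_triangle) (use s inA in auto)
    also have "symdiff_prob (lt A z' x) (lt A z y) \<le> symdiff_prob (lt A z' x) (lt A z' y') + symdiff_prob (lt A z' y') (lt A z y)"
      by (rule symdiff_prob_triangle) (use s inA in auto)
    also have "symdiff_prob (lt A z' y') (lt A z y) \<le> symdiff_prob (lt A z' y') (lt A z y') + symdiff_prob (lt A z y') (lt A z y)"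
      by (rule symdiff_prob_triangle) (use s inA in auto)
    finally have "symdiff_prob (lt A z x) (lt A z y) \<le> 1 / 3 - k + 12 * \<eta>" using d1 d2 d3 m by linarith
    then show False using triple_prob_sums(3)[OF f(1,2) inA(1-3)] tris \<eta>(3) by linarith
  qed
qed

text \<open>Two of the three points share a branch by the pigeonhole principle; if all three do, the
  branch itself provides the rare order.\<close>

lemma unbalanced_twin:
  assumes sz: "sized Q n" and tr: "transversal Q" and as: "assoc Q" and ga: "correlated Q k"
    and \<eta>: "0 \<le> \<eta>" "\<eta> \<le> 1 / 6" "14 * \<eta> \<le> k" and g: "unbalanced Q (1 / 6 - \<eta>)"
  shows "unbalanced (twin Q) (1 / 6 - \<eta>)"
  unfolding unbalanced_def
proof (intro allI impI)
  fix A r and x y z :: nat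
  assume tw: "twin Q A r" and xyz: "x \<in> A" "y \<in> A" "z \<in> A" and d: "x \<noteq> y" "x \<noteq> z" "y \<noteq> z"
  obtain B C where p: "par A r B C" "Q B (res r B)" "Q C (res r C)" "x \<in> B"
    using twin_branchE[OF tw xyz(1)] by blast
  note p' = par_commute[OF p(1)]
  have BC: "A = B \<union> C" "B \<inter> C = {}" using p(1) by (auto simp: par_def)
  note tt = twin_triple[OF p(1-3) sz tr as ga \<eta>] and tt' = twin_triple[OF p' p(3,2) sz tr as ga \<eta>]
  consider "y \<in> B" "z \<in> B" | "y \<in> B" "z \<in> C" | "y \<in> C" "z \<in> B" | "y \<in> C" "z \<in> C" using xyz BC by blast
  then show "unbalanced_triple A r x y z (1 / 6 - \<eta>)"
  proof cases
    case 1
    have "unbalanced_triple B (res r B) x y z (1 / 6 - \<eta>)" by (rule unbalancedD[OF g p(2,4) 1 d])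
    then show ?thesis
    proof (rule unbalanced_triple_transfer)
      fix a b e assume "a \<in> {x, y, z}" "b \<in> {x, y, z}" "e \<in> {x, y, z}"
      then have "a \<in> B" "b \<in> B" "e \<in> B" using p(4) 1 by auto
      then show "triple_prob A r a b e = triple_prob B (res r B) a b e" by (rule triple_prob_par[OF p(1)])
    qed
  next
    case 2 show ?thesis by (rule tt[OF p(4) 2 d(1)])
  next
    case 3
    have "unbalanced_triple A r x z y (1 / 6 - \<eta>)" by (rule tt[OF p(4) 3(2,1) d(2)])
    then show ?thesis by (simp only: unbalanced_triple_swap)
  next
    case 4
    have "unbalanced_triple A r y z x (1 / 6 - \<eta>)" by (rule tt'[OF 4 p(4) d(3)])
    then show ?thesis using unbalanced_triple_cong[of y z x x y z A r] by (simp add: insert_commute)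
  qed
qed

subsection \<open>The tower\<close>

text \<open>Rounding with a margin: the added constants make \<open>g * pad g n\<close> at least
  \<open>n + g + 3\<close>, which absorbs the lower order terms of the variance recursion at a
  bounded cost in size.\<close>

definition pad :: "nat \<Rightarrow> nat \<Rightarrow> nat" where
  "pad g n = (n + 2) div g + 2"

primrec tsize :: "nat \<Rightarrow> nat \<Rightarrow> nat \<Rightarrow> nat" where
  "tsize g b 0 = b"
| "tsize g b (Suc k) = 2 * (2 * pad g (tsize g b k) + 2 * tsize g b k)"

lemma tsize_ge: "b + k \<le> tsize g b k"
proof (induction k)
  case (Suc k)
  have "tsize g b k + 1 \<le> tsize g b (Suc k)" by (simp add: pad_def)
  with Suc show ?case by linarith
qed simp

text \<open>The base level is a chain of \<open>b\<close> points. A large \<open>b\<close> makes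
  estimates that hold for large \<open>N\<close> available at every level.\<close>

primrec tower :: "nat \<Rightarrow> nat \<Rightarrow> nat \<Rightarrow> nat set \<Rightarrow> nat rel \<Rightarrow> bool" where
  "tower g b 0 = series (\<lambda>_. point) b"
| "tower g b (Suc k) = twin (series (slot (pad g (tsize g b k)) (tower g b k)) (2 * pad g (tsize g b k) + 2))"

lemma sized_series_slot: "sized Q n \<Longrightarrow> sized (series (slot L Q) (2 * L + 2)) (2 * L + 2 * n)"
  using sized_series[of "2 * L + 2" "slot L Q" "slot_size L n"] sized_slot[of Q n L] sum_slot_size(3)[of L n] by simp

lemma sized_tower: "0 < b \<Longrightarrow> sized (tower g b k) (tsize g b k)"
proof (induction k)
  case 0
  then show ?case using sized_series[of b "\<lambda>_. point" "\<lambda>_. 1"] sized_point by simp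
next
  case (Suc k)
  show ?case unfolding tower.simps tsize.simps by (intro sized_twin sized_series_slot Suc.IH Suc.prems)
qed

lemma transversal_series_slot:
  assumes "sized Q n" "transversal Q"
  shows "transversal (series (slot L Q) (2 * L + 2))"
  by (rule transversal_series[OF sized_slot[OF assms(1)]]) (simp add: slot_def assms(2) transversal_point)

lemma transversal_tower: "0 < b \<Longrightarrow> transversal (tower g b k)"
proof (induction k)
  case 0
  show ?case using transversal_series[of b "\<lambda>_. point" "\<lambda>_. 1"] sized_point transversal_point by simp
next
  case (Suc k)
  show ?case unfolding tower.simps
    by (rule transversal_twin[OF transversal_series_slot[OF sized_tower[OF Suc.prems] Suc.IH[OF Suc.prems]]])
qed

lemma assoc_series_slot:
  assumes "sized Q n" "assoc Q"
  shows "assoc (series (slot L Q) (2 * L + 2))"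
  by (rule assoc_series[OF sized_slot[OF assms(1)]]) (simp add: slot_def assms(2) assoc_point)

lemma assoc_tower: "0 < b \<Longrightarrow> assoc (tower g b k)"
proof (induction k)
  case 0
  show ?case using assoc_series[of b "\<lambda>_. point" "\<lambda>_. 1"] sized_point assoc_point by simp
next
  case (Suc k)
  show ?case unfolding tower.simps
    by (rule assoc_twin[OF assoc_series_slot[OF sized_tower[OF Suc.prems] Suc.IH[OF Suc.prems]]])
qed

lemma realizable_tower: "0 < b \<Longrightarrow> realizable (tower g b k)"
proof (induction k)
  case 0
  show ?case using realizable_series[of b "\<lambda>_. point" "\<lambda>_. 1"] sized_point realizable_point by simp
next
  case (Suc k)
  let ?L = "pad g (tsize g b k)"
  have "realizable (series (slot ?L (tower g b k)) (2 * ?L + 2))"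
    by (rule realizable_series[OF sized_slot[OF sized_tower[OF Suc.prems]]])
      (simp add: slot_def Suc realizable_point)
  then show ?case unfolding tower.simps by (rule realizable_twin[OF sized_series_slot[OF sized_tower[OF Suc.prems]]])
qed

lemma wide_point: "wide point 1"
  unfolding wide_def
proof (intro allI impI)
  fix A r assume "point A r"
  then obtain x where "A = {x}" by (auto simp: point_def)
  then show "\<exists>S\<subseteq>A. antichain r S \<and> card S = 1" by (intro exI[of _ A]) (simp add: antichain_def)
qed

lemma wide_tower: "0 < b \<Longrightarrow> wide (tower g b k) (2 ^ k)"
proof (induction k)
  case 0
  then show ?case using wide_series[of 0 b "\<lambda>_. point"] wide_point by simp
next
  case (Suc k)
  let ?L = "pad g (tsize g b k)"
  have "wide (series (slot ?L (tower g b k)) (2 * ?L + 2)) (2 ^ k)"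
    by (rule wide_series[of ?L]) (simp_all add: slot_def Suc)
  then show ?case unfolding tower.simps power_Suc by (rule wide_twin)
qed

lemma width_ge:
  assumes "wide Q w" "Q A r" "finite A"
  shows "w \<le> width A r"
proof -
  obtain S where S: "S \<subseteq> A" "antichain r S" "card S = w" using assms unfolding wide_def by blast
  have "finite {C. C \<subseteq> A \<and> antichain r C}" using assms(3) by simp
  then show ?thesis unfolding width_def using S by (intro Max_ge) auto
qed

lemma pad_bounds:
  assumes "2 \<le> g"
  shows "real n + real g + 3 \<le> real g * real (pad g n)" "2 * real (pad g n) \<le> real n + 6"
    "real g * real (pad g n) \<le> real n + 2 + 2 * real g"
proof -
  have d: "(n + 2) div g * g + (n + 2) mod g = n + 2" by (rule div_mult_mod_eq)
  have m: "(n + 2) mod g < g" using assms by simp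
  have "g * pad g n = (n + 2) div g * g + 2 * g" by (simp add: pad_def algebra_simps)
  then have "n + g + 3 \<le> g * pad g n" "g * pad g n \<le> n + 2 + 2 * g" using d m by linarith+
  then have "real (n + g + 3) \<le> real (g * pad g n)" "real (g * pad g n) \<le> real (n + 2 + 2 * g)"
    unfolding of_nat_le_iff by blast+
  then show "real n + real g + 3 \<le> real g * real (pad g n)" "real g * real (pad g n) \<le> real n + 2 + 2 * real g" by simp_all
  have "(n + 2) div g \<le> (n + 2) div 2" using assms by (intro div_le_mono2) auto
  then have "2 * pad g n \<le> n + 6" by (simp add: pad_def)
  then have "real (2 * pad g n) \<le> real (n + 6)" unfolding of_nat_le_iff .
  then show "2 * real (pad g n) \<le> real n + 6" by simp
qed

text \<open>The bound \<open>(g + 1) / (size + 1)\<close> reproduces itself. Padding holds the share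
  of a copy below one half, in the form \<open>(n + 2) * (g + 1) / (N + 2) \<le> g / 2\<close>, and
  this leaves room for the fresh variance \<open>1 / (4 * (N + 2))\<close> of the affine map. The
  denominator \<open>2 * N + 1\<close> anticipates the doubling of the size by the parallel
  step.\<close>

lemma vbound_tower_step:
  fixes N :: real
  assumes Q: "sized Q n" "vbound Q ((real g + 1) / (real n + 1))" and g: "2 \<le> g" and L: "L = pad g n"
    and N: "N = real (2 * L + 2 * n)"
  shows "vbound (series (slot L Q) (2 * L + 2)) ((real g + 1) / (2 * N + 1))"
proof (rule vbound_series[OF sized_slot[OF Q(1)], where v = "\<lambda>i. if i = L \<or> i = Suc L then (real g + 1) / (real n + 1) else 1"])
  show "vbound (slot L Q i) (if i = L \<or> i = Suc L then (real g + 1) / (real n + 1) else 1)" for i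
    using Q(2) vbound_sized_1[OF sized_point] by (simp add: slot_def)
  show "N = real (\<Sum>j<2 * L + 2. slot_size L n j)" unfolding sum_slot_size(3) N ..
  have n: "1 \<le> n" using sizedD(4)[OF Q(1)] by simp
  have Lg: "2 * (real g + 1) * (real n + 2) \<le> real g * (N + 2)"
    using pad_bounds(1)[OF g, of n] by (simp add: N L algebra_simps)
  have L2: "2 \<le> L" by (simp add: L pad_def)
  then have N6: "6 \<le> N" using n by (simp add: N)
  have fin: "(real g + 1 / 2) / (2 * (N + 1)) \<le> (real g + 1) / (2 * N + 1)"
    using N6 by (intro frac_le) auto
  fix i
  show "(real (slot_size L n i) + 1) / (N + 1) * ((real (slot_size L n i) + 2) / (N + 2)) *
      (if i = L \<or> i = Suc L then (real g + 1) / (real n + 1) else 1) + 1 / (4 * (N + 2)) \<le> (real g + 1) / (2 * N + 1)"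
  proof (cases "i = L \<or> i = Suc L")
    case True
    have "(real n + 1) / (N + 1) * ((real n + 2) / (N + 2)) * ((real g + 1) / (real n + 1)) + 1 / (4 * (N + 2))
      = ((real n + 2) * (real g + 1) / (N + 2)) / (N + 1) + 1 / (4 * (N + 2))"
      by (simp add: divide_simps) (simp add: algebra_simps)?
    also have "\<dots> \<le> (real g / 2) / (N + 1) + 1 / (4 * (N + 1))"
    proof (intro add_mono divide_right_mono)
      show "(real n + 2) * (real g + 1) / (N + 2) \<le> real g / 2" using Lg N6 by (simp add: field_simps)
      show "1 / (4 * (N + 2)) \<le> 1 / (4 * (N + 1))" using N6 by (intro divide_left_mono) auto
    qed (use N6 in simp)
    also have "\<dots> = (real g + 1 / 2) / (2 * (N + 1))"
    proof -
      have "a / 2 / M + 1 / (4 * M) = (a + 1 / 2) / (2 * M)" if "M \<noteq> 0" for a M :: real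
        using that by (simp add: divide_simps)
      from this[of "N + 1"] show ?thesis using N6 by simp
    qed
    also note fin
    finally show ?thesis using True by (simp add: slot_size_def)
  next
    case False
    \<comment> \<open>A point of a chain has variance at most 1 and a mean squared slope of order
      \<open>1 / N^2\<close>. The comparison ends with \<open>5 / 2 \<le> g + 1 / 2\<close>, that is
      \<open>2 \<le> g\<close>.\<close>
    have "2 / (N + 1) * (3 / (N + 2)) + 1 / (4 * (N + 2)) \<le> (6 / (N + 2)) / (N + 1) + 1 / (4 * (N + 1))"
      using N6 by (intro add_mono divide_left_mono) (auto simp: mult.commute)
    also have "\<dots> \<le> 1 / (N + 1) + 1 / (4 * (N + 1))"
      using N6 by (intro add_mono divide_right_mono) auto
    also have "\<dots> = (5 / 2) / (2 * (N + 1))"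
    proof -
      have "1 / M + 1 / (4 * M) = (5 / 2) / (2 * M)" if "M \<noteq> 0" for M :: real using that by (simp add: divide_simps)
      from this[of "N + 1"] show ?thesis using N6 by simp
    qed
    also have "\<dots> \<le> (real g + 1 / 2) / (2 * (N + 1))" using N6 g by (intro divide_right_mono) auto
    also note fin
    finally show ?thesis using False by (simp add: slot_size_def)
  qed
qed

lemma vbound_tower:
  assumes b: "0 < b" and g: "2 \<le> g"
  shows "vbound (tower g b k) ((real g + 1) / (real (tsize g b k) + 1))"
proof (induction k)
  case 0
  have "vbound (series (\<lambda>_. point) b) ((real g + 1) / (real b + 1))"
  proof (rule vbound_series[where sz = "\<lambda>_. 1" and v = "\<lambda>_. 1" and N = "real b"])
    have "2 / (real b + 1) * (3 / (real b + 2)) + 1 / (4 * (real b + 2)) \<le> (6 / (real b + 2)) / (real b + 1) + 1 / (4 * (real b + 1))"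
      by (intro add_mono divide_left_mono) (auto simp: mult.commute)
    also have "\<dots> \<le> 2 / (real b + 1) + 1 / (4 * (real b + 1))"
      using b by (intro add_mono divide_right_mono) (auto simp: field_simps)
    also have "\<dots> = (9 / 4) / (real b + 1)"
    proof -
      have "2 / M + 1 / (4 * M) = (9 / 4) / M" if "M \<noteq> 0" for M :: real using that by (simp add: divide_simps)
      from this[of "real b + 1"] show ?thesis by simp
    qed
    also have "\<dots> \<le> (real g + 1) / (real b + 1)" using g by (intro divide_right_mono) auto
    finally show "(real 1 + 1) / (real b + 1) * ((real 1 + 2) / (real b + 2)) * 1 + 1 / (4 * (real b + 2)) \<le> (real g + 1) / (real b + 1)"
      by simp
  qed (use sized_point vbound_sized_1[OF sized_point] in auto)
  then show ?case by simp
next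
  case (Suc k)
  show ?case unfolding tower.simps
    using vbound_twin[OF vbound_tower_step[OF sized_tower[OF b] Suc.IH g refl refl]] by (simp add: algebra_simps)
qed

text \<open>The gaps of the chains are bounded below by 0; each of the two copies keeps its gap sum
  up to the factor \<open>(n + 1) / (N + 1)\<close>.\<close>

lemma gapbound_series_slot:
  assumes Q: "sized Q n" "gapbound Q s"
  shows "gapbound (series (slot L Q) (2 * L + 2)) (2 * (real n + 1) / (2 * real L + 2 * real n + 1) * s)"
proof -
  let ?N = "real (2 * L + 2 * n)"
  let ?s = "\<lambda>i. if i = L \<or> i = Suc L then s else 0"
  have "gapbound (slot L Q i) (?s i)" for i
  proof (cases "i = L \<or> i = Suc L")
    case False
    have "gapbound point 0" using gapbound_point unfolding gapbound_def by (meson order_trans zero_le_divide_1_iff zero_le_numeral)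
    then show ?thesis using False by (simp add: slot_def)
  qed (use Q(2) in \<open>simp add: slot_def\<close>)
  then have "gapbound (series (slot L Q) (2 * L + 2)) (\<Sum>i<2 * L + 2. (real (slot_size L n i) + 1) / (?N + 1) * ?s i)"
    by (intro gapbound_series[OF sized_slot[OF Q(1)]]) (simp_all only: sum_slot_size)
  also have "(\<Sum>i<2 * L + 2. (real (slot_size L n i) + 1) / (?N + 1) * ?s i) = (\<Sum>i\<in>{L, Suc L}. (real n + 1) / (?N + 1) * s)"
    by (rule sum.mono_neutral_cong_right) (auto simp: slot_size_def)
  also have "\<dots> = 2 * (real n + 1) / (2 * real L + 2 * real n + 1) * s" by simp
  finally show ?thesis .
qed

text \<open>The lower bound that the two composition lemmas produce for the gap sum. In the base
  chain each of the \<open>b\<close> mean gaps is \<open>1 / (b + 1)\<close>.\<close>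

primrec tgap :: "nat \<Rightarrow> nat \<Rightarrow> nat \<Rightarrow> real" where
  "tgap g b 0 = real b / (real b + 1)"
| "tgap g b (Suc k) = 2 * (2 * (real (tsize g b k) + 1) / (2 * real (pad g (tsize g b k)) + 2 * real (tsize g b k) + 1) * tgap g b k)"

lemma tgap_pos: "0 < b \<Longrightarrow> 0 < tgap g b k"
  by (induction k) (auto intro!: mult_pos_pos divide_pos_pos add_pos_nonneg add_nonneg_pos)

lemma gapbound_tower:
  assumes b: "0 < b"
  shows "gapbound (tower g b k) (tgap g b k)"
proof (induction k)
  case 0
  have "gapbound (series (\<lambda>_. point) b) (\<Sum>i<b. (real 1 + 1) / (real b + 1) * (1 / 2))"
    by (rule gapbound_series) (use sized_point gapbound_point in auto)
  also have "(\<Sum>i<b. (real 1 + 1) / (real b + 1) * (1 / 2)) = real b / (real b + 1)" by (simp add: divide_simps)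
  finally show ?case by simp
next
  case (Suc k)
  show ?case unfolding tower.simps tgap.simps
    by (rule gapbound_twin[OF gapbound_series_slot[OF sized_tower[OF b] Suc.IH]])
qed

text \<open>A point of one branch has a counterpart with the same marginal in the other branch; the
  two are independent, so each is below the other with probability 1/2.\<close>

lemma delta_2_twin:
  assumes sz: "sized Q n" and tr: "transversal Q" and A: "twin Q A r"
  shows "delta 2 A r = 1 / 2"
proof -
  obtain B C where p: "par A r B C" "Q B (res r B)" "Q C (res r C)" using A by (auto simp: twin_def)
  note f = par_facts[OF p(1)]
  obtain x where x: "x \<in> B" using sized_nonempty[OF sz p(2)] by blast
  obtain z where z: "z \<in> C" using sized_nonempty[OF sz p(3)] by blast
  obtain z' where z': "z' \<in> C" "\<And>t. surv C (res r C) z' t = surv B (res r B) x t"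
    using tr p x z unfolding transversal_def by blast
  have "lt A z' x = {F \<in> space (PL A). F z' < F x \<and> F z' < F x}" by (auto simp: lt_def)
  then have "measure (opm A r) (lt A z' x) = 1 / 2"
    using prob_par_below[OF p(1) x x z'(1)] surv_integral_half[OF f(3,7) x f(4,8) z'] by simp
  moreover have "z' \<noteq> x" using p(1) x z' by (auto simp: par_def)
  moreover have "z' \<in> A" "x \<in> A" using f(5,6) x z' by auto
  ultimately show ?thesis by (intro delta_2_eq_half[OF f(1,2), of z' x])
qed

lemma vbound_mono: "vbound Q v \<Longrightarrow> v \<le> w \<Longrightarrow> vbound Q w"
  unfolding vbound_def by (meson order_trans)

text \<open>The constant \<open>\<eta>\<close> depends on \<open>g\<close> alone, because the
  relative padding, the scaled variance bound and the spread of the affine map are uniform over all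
  levels.\<close>

lemma unbalanced_tower:
  assumes g: "2 \<le> g"
  shows "\<exists>\<eta>>0. \<exists>N0. \<forall>b k. N0 \<le> real b \<longrightarrow> 0 < b \<longrightarrow> unbalanced (tower g b k) (1 / 6 - \<eta>)"
proof -
  \<comment> \<open>From \<open>n \<le> g * L\<close> follows
    \<open>N = 2 * L + 2 * n \<le> 2 * (g + 1) * L\<close>, so both sides of a copy hold at least
    the share \<open>l\<close> of the branch.\<close>
  define l where "l = 1 / (2 * (real g + 1))"
  \<comment> \<open>Chosen so that \<open>(C - 2) / sqrt N\<close> is
    \<open>\<tau> + 2 * \<sigma>\<close>: the window \<open>\<tau>\<close> comes from twice the
    variance of the branch, and \<open>\<sigma>\<close> from the variance of a copy together with
    \<open>N \<le> 6 * (n + 1)\<close>.\<close>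
  define C where "C = 2 + sqrt (2 * (real g + 1)) + 2 * sqrt (6 * (real g + 1))"
  have l: "0 < l" "l \<le> 1" by (auto simp: l_def)
  have C: "0 \<le> C" by (auto simp: C_def)
  obtain \<kappa> N0 where \<kappa>: "0 < \<kappa>" and K: "\<And>p n q N m M. 0 < n \<Longrightarrow> N = real (p + n + q) \<Longrightarrow> N0 \<le> N \<Longrightarrow> l * N \<le> p \<Longrightarrow> l * N \<le> q \<Longrightarrow>
    0 \<le> m \<Longrightarrow> m \<le> 1 \<Longrightarrow> M = (1 - m) * (p / (N + 1)) + m * (1 - q / (N + 1)) \<Longrightarrow>
      \<kappa> \<le> measure (rho p n q) {z. M + (C - 2) / sqrt N \<le> fst z + (1 - fst z - snd z) * m} \<and>
      \<kappa> \<le> measure (rho p n q) {z. fst z + (1 - fst z - snd z) * m \<le> M - (C - 2) / sqrt N}"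
    using rho_mean_spread[OF l C] by (elim exE conjE) (rule that, blast+)
  \<comment> \<open>The number 224 is 14 times 16: 14 from the path of events in a triple and 16
    from the gain in joint survival. The cap 1/7 keeps \<open>\<eta>\<close> below 1/6.\<close>
  define \<eta> where "\<eta> = min (\<kappa> / 224) (1 / 7)"
  have \<eta>: "0 < \<eta>" "0 \<le> \<eta>" "\<eta> \<le> 1 / 6" "14 * \<eta> \<le> \<kappa> / 16" using \<kappa> by (auto simp: \<eta>_def)
  have "unbalanced (tower g b k) (1 / 6 - \<eta>)" if b: "N0 \<le> real b" "0 < b" for b k
  proof (induction k)
    case 0
    have "unbalanced (series (\<lambda>_. point) b) (1 / 6 - \<eta>)"
      by (rule unbalanced_series[where sz = "\<lambda>_. 1"]) (use \<eta> unbalanced_point sized_point in auto)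
    then show ?case by simp
  next
    case (Suc k)
    define n where "n = tsize g b k"
    define Q where "Q = tower g b k"
    define L where "L = pad g n"
    define N where "N = real (2 * L + 2 * n)"
    note Q = sized_tower[OF b(2), of g k, folded Q_def n_def] transversal_tower[OF b(2), of g k, folded Q_def]
      assoc_tower[OF b(2), of g k, folded Q_def] vbound_tower[OF b(2) g, of k, folded Q_def n_def]
    have n: "0 < n" using sizedD(4)[OF Q(1)] .
    have bn: "b \<le> n" using tsize_ge[of b k g] by (simp add: n_def)
    have N0: "0 < N" "N0 \<le> N" using n bn b by (auto simp: N_def)
    have N6: "N \<le> 6 * (real n + 1)" using pad_bounds(2)[OF g, of n] by (simp add: N_def L_def)
    have lN: "l * N \<le> real L"
      using pad_bounds(1)[OF g, of n] by (simp add: N_def L_def l_def field_simps)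
    define \<sigma> where "\<sigma> = sqrt (6 * (real g + 1)) / sqrt N"
    define \<tau> where "\<tau> = sqrt (2 * (real g + 1)) / sqrt N"
    have pos: "0 < \<sigma>" "0 < \<tau>" using N0 by (auto simp: \<sigma>_def \<tau>_def intro!: divide_pos_pos)
    have \<tau>\<sigma>: "\<tau> + 2 * \<sigma> = (C - 2) / sqrt N" by (simp add: \<sigma>_def \<tau>_def C_def add_divide_distrib)
    have \<sigma>2: "\<sigma>\<^sup>2 = 6 * (real g + 1) / N" and \<tau>2: "\<tau>\<^sup>2 = 2 * (real g + 1) / N"
      using N0 by (simp_all add: \<sigma>_def \<tau>_def power_divide)
    have v: "vbound Q (\<sigma>\<^sup>2)"
    proof (rule vbound_mono[OF Q(4)])
      have "(real g + 1) * N \<le> (real g + 1) * (6 * (real n + 1))" using N6 by (intro mult_left_mono) auto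
      then have "(real g + 1) * N \<le> 6 * (real g + 1) * (real n + 1)" by (simp only: ac_simps)
      then show "(real g + 1) / (real n + 1) \<le> \<sigma>\<^sup>2"
        unfolding \<sigma>2 using N0 by (subst frac_le_eq) (auto intro!: divide_nonpos_pos)
    qed
    have ga: "correlated (series (slot L Q) (2 * L + 2)) (\<kappa> / 16)"
    proof (rule correlated_slot[OF Q(1-3) v pos(1) N_def _ _ vbound_tower_step[OF Q(1,4) g L_def N_def] _ pos(2)])
      show "0 \<le> \<kappa>" using \<kappa> by simp
      have "2 * (real g + 1) / (2 * N + 1) < 2 * (real g + 1) / N"
        by (rule divide_strict_left_mono) (use N0 in auto)
      then show "2 * ((real g + 1) / (2 * N + 1)) < \<tau>\<^sup>2" unfolding \<tau>2 by simp
      fix p q m M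
      assume pq: "p = L \<and> q = L + n \<or> p = L + n \<and> q = L" and m: "0 \<le> m" "m \<le> 1"
        and M: "M = (1 - m) * (real p / (N + 1)) + m * (1 - real q / (N + 1))"
      have "N = real (p + n + q)" "l * N \<le> real p" "l * N \<le> real q" using pq lN by (auto simp: N_def)
      from K[OF n this(1) N0(2) this(2,3) m M]
      show "\<kappa> \<le> measure (rho p n q) {z. M + \<tau> + 2 * \<sigma> \<le> fst z + (1 - fst z - snd z) * m} \<and>
        \<kappa> \<le> measure (rho p n q) {z. fst z + (1 - fst z - snd z) * m \<le> M - (\<tau> + 2 * \<sigma>)}"
        unfolding \<tau>\<sigma>[symmetric] by (simp only: add.assoc)
    qed
    have "unbalanced (series (slot L Q) (2 * L + 2)) (1 / 6 - \<eta>)"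
      by (rule unbalanced_series[OF sized_slot[OF Q(1)]])
        (use \<eta> unbalanced_point Suc.IH in \<open>auto simp: slot_def Q_def\<close>)
    then have "unbalanced (twin (series (slot L Q) (2 * L + 2))) (1 / 6 - \<eta>)"
      by (rule unbalanced_twin[OF sized_series_slot[OF Q(1)] transversal_series_slot[OF Q(1,2)] assoc_series_slot[OF Q(1,3)] ga \<eta>(2-4)])
    then show ?case by (simp add: Q_def L_def n_def)
  qed
  then show ?thesis using \<eta>(1) by blast
qed

section \<open>Growth rates and the choice of parameters\<close>

text \<open>With \<open>X = 1\<close> the ratio would grow by
  \<open>2 / 4 powr (1 / 2 - \<epsilon>)\<close>, which is \<open>2 powr (2 * \<epsilon>)\<close>.
  The factors \<open>X\<close> cost at most \<open>X^2\<close> in all, which takes at most half of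
  this exponent.\<close>

lemma growth_step:
  fixes n n' s s' X \<epsilon> :: real
  assumes \<epsilon>: "0 < \<epsilon>" "\<epsilon> < 1 / 2" and X: "1 \<le> X" "X\<^sup>2 \<le> 2 powr \<epsilon>"
    and n: "0 < n" "0 < n'" "n' \<le> 4 * X * n" and s: "0 \<le> s" "2 / X * s \<le> s'"
  shows "2 powr \<epsilon> * (s / n powr (1 / 2 - \<epsilon>)) \<le> s' / n' powr (1 / 2 - \<epsilon>)"
proof -
  define e where "e = 2 powr \<epsilon>"
  define d where "d = n powr (1 / 2 - \<epsilon>)"
  define d' where "d' = n' powr (1 / 2 - \<epsilon>)"
  have pos: "0 < e" "0 < d" "0 < d'" using n by (auto simp: e_def d_def d'_def)
  have "(4 :: real) powr (1 / 2 - \<epsilon>) = (2 powr 2) powr (1 / 2 - \<epsilon>)" by simp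
  also have "\<dots> = 2 powr (1 - (\<epsilon> + \<epsilon>))" unfolding powr_powr by (simp add: algebra_simps)
  also have "\<dots> = 2 / e\<^sup>2" unfolding powr_diff powr_add e_def power2_eq_square by simp
  finally have four: "(4 :: real) powr (1 / 2 - \<epsilon>) = 2 / e\<^sup>2" .
  have "d' \<le> (4 * X * n) powr (1 / 2 - \<epsilon>)" unfolding d'_def using n \<epsilon> by (intro powr_mono2) auto
  also have "\<dots> = 2 / e\<^sup>2 * X powr (1 / 2 - \<epsilon>) * d" using n X four by (simp add: powr_mult d_def)
  also have "\<dots> \<le> 2 / e\<^sup>2 * X * d"
    using powr_mono[of "1 / 2 - \<epsilon>" 1 X] X \<epsilon> pos by (intro mult_right_mono mult_left_mono) auto
  finally have d': "d' \<le> 2 / e\<^sup>2 * X * d" .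
  have "e * s * d' \<le> e * s * (2 / e\<^sup>2 * X * d)" using d' s pos by (intro mult_left_mono) auto
  also have "\<dots> = (2 / X * s) * d * (X\<^sup>2 / e)" using pos X by (simp add: field_simps power2_eq_square)
  also have "\<dots> \<le> (2 / X * s) * d * 1" using X s pos by (intro mult_left_mono) (auto simp: e_def)
  also have "\<dots> \<le> s' * d" using mult_right_mono[OF s(2), of d] pos by simp
  finally have "e * s * d' \<le> s' * d" .
  then have "e * (s / d) \<le> s' / d'" using pos by (simp add: divide_simps)
  then show ?thesis unfolding e_def d_def d'_def .
qed

lemma geometric_growth_at_top:
  fixes u :: "nat \<Rightarrow> real"
  assumes "1 < \<rho>" "0 < u 0" "\<And>k. \<rho> * u k \<le> u (Suc k)"
  shows "filterlim u at_top sequentially"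
proof -
  have le: "\<rho> ^ k * u 0 \<le> u k" for k
  proof (induction k)
    case (Suc k)
    have "\<rho> ^ Suc k * u 0 \<le> \<rho> * u k" using Suc assms(1) by (simp add: mult.assoc)
    also note assms(3)[of k]
    finally show ?case .
  qed simp
  have "filterlim (\<lambda>k. \<rho> ^ k) at_infinity sequentially"
    by (rule filterlim_realpow_sequentially_gt1) (use assms(1) in simp)
  then have "filterlim (\<lambda>k. \<rho> ^ k) at_top sequentially"
    by (rule filterlim_at_infinity_imp_filterlim_at_top) (use assms(1) in simp)
  then have "filterlim (\<lambda>k. u 0 * \<rho> ^ k) at_top sequentially"
    by (rule filterlim_tendsto_pos_mult_at_top[OF tendsto_const assms(2)])
  then show ?thesis by (rule filterlim_at_top_mono) (use le in \<open>simp add: mult.commute\<close>)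
qed

theorem theorem6:
  fixes \<epsilon> :: real
  assumes "0 < \<epsilon>" and "\<epsilon> < 1 / 2"
  shows "\<exists>\<eta>>0. \<exists>(A :: nat \<Rightarrow> nat set) (r :: nat \<Rightarrow> nat rel).
    (\<forall>i. finite (A i) \<and> partial_order_on (A i) (r i) \<and> 3 \<le> card (A i)) \<and>
    filterlim (\<lambda>i. card (A i)) at_top sequentially \<and>
    filterlim (\<lambda>i. gap_sum (A i) (r i) / real (card (A i)) powr (1 / 2 - \<epsilon>)) at_top sequentially \<and>
    (\<forall>i. delta 3 (A i) (r i) \<le> 1 / 6 - \<eta>) \<and>
    filterlim (\<lambda>i. real (width (A i) (r i)) / real (card (A i)) powr (1 / 2 - \<epsilon>)) at_top sequentially \<and>
    (\<forall>i. delta 2 (A i) (r i) = 1 / 2)"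
proof -
  have e1: "1 < 2 powr (\<epsilon> / 2)" "1 < 2 powr \<epsilon>" using assms by simp_all
  \<comment> \<open>Makes \<open>X = 1 + 2 / g\<close> at most
    \<open>2 powr (\<epsilon> / 2)\<close>, so that \<open>X^2\<close> is at most
    \<open>2 powr \<epsilon>\<close>.\<close>
  obtain g :: nat where g: "2 \<le> g" "2 / (2 powr (\<epsilon> / 2) - 1) \<le> real g"
  proof -
    obtain h :: nat where "2 / (2 powr (\<epsilon> / 2) - 1) \<le> real h" using real_arch_simple by blast
    then show ?thesis using that[of "max 2 h"] by simp
  qed
  define X where "X = 1 + 2 / real g"
  have X: "1 \<le> X" "X \<le> 2 powr (\<epsilon> / 2)" using g e1 by (auto simp: X_def field_simps)
  have "X\<^sup>2 \<le> (2 powr (\<epsilon> / 2))\<^sup>2" using X by (intro power_mono) auto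
  also have "\<dots> = 2 powr \<epsilon>" by (simp add: power2_eq_square flip: powr_add)
  finally have X2: "X\<^sup>2 \<le> 2 powr \<epsilon>" .
  obtain \<eta> N0 where \<eta>: "0 < \<eta>" and G: "\<And>b k. N0 \<le> real b \<Longrightarrow> 0 < b \<Longrightarrow> unbalanced (tower g b k) (1 / 6 - \<eta>)"
    using unbalanced_tower[OF g(1)] by blast
  obtain b0 :: nat where b0: "N0 \<le> real b0" using real_arch_simple by blast
  \<comment> \<open>At least \<open>N0\<close>, for the bound on triples at all levels, and at least
    \<open>2 * g + 2\<close>, so that the rounding in \<open>pad\<close> is absorbed by a second
    \<open>n\<close>: then \<open>g * pad g n \<le> 2 * n\<close> at every level.\<close>
  define b where "b = max b0 (2 * g + 2)"
  have b: "N0 \<le> real b" "0 < b" "2 * g + 2 \<le> b" using b0 by (auto simp: b_def)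
  let ?n = "tsize g b" and ?s = "tgap g b"
  have n_ge: "b + k \<le> ?n k" for k by (rule tsize_ge)
  \<comment> \<open>The sequence starts at level 1: level 0 is a chain, in which no pair is
    balanced.\<close>
  have "\<exists>A r. tower g b (Suc i) A r" for i
    using realizable_tower[OF b(2), of g "Suc i"] infinite_UNIV_nat unfolding realizable_def by blast
  then obtain A r where tw: "\<And>i. tower g b (Suc i) (A i) (r i)" by metis
  note sz = sized_tower[OF b(2), of g]
  have fin: "finite (A i)" "partial_order_on (A i) (r i)" and card: "card (A i) = ?n (Suc i)" for i
    using sizedD(1-3)[OF sz tw] by blast+
  have three: "3 \<le> card (A i)" for i using n_ge[of "Suc i"] b(3) unfolding card by linarith
  have npos: "0 < real (?n k)" for k using n_ge[of k] b(2) by simp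
  have Xn: "real (pad g (?n k)) + real (?n k) \<le> X * real (?n k)" for k
  proof -
    have "real (2 * g + 2) \<le> real (?n k)" unfolding of_nat_le_iff using n_ge[of k] b(3) by linarith
    then have "real g * real (pad g (?n k)) \<le> 2 * real (?n k)" using pad_bounds(3)[OF g(1), of "?n k"] by simp
    then show ?thesis using g(1) by (simp add: X_def field_simps)
  qed
  have n_le: "real (?n (Suc k)) \<le> 4 * X * real (?n k)" for k using Xn[of k] by simp
  \<comment> \<open>With \<open>L\<close> the padding and \<open>n\<close> the size,
    \<open>L + n \<le> X * n\<close> and \<open>1 \<le> X\<close> bound
    \<open>2 * L + 2 * n + 1\<close> by \<open>2 * X * (n + 1)\<close>, so one level multiplies the
    gap bound by at least \<open>2 / X\<close>.\<close>
  have s_ge: "2 / X * ?s k \<le> ?s (Suc k)" for k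
  proof -
    have "2 * real (pad g (?n k)) + 2 * real (?n k) + 1 \<le> 2 * (X * (real (?n k) + 1))"
      using Xn[of k] X(1) by (simp add: algebra_simps)
    then have "4 * (real (?n k) + 1) / (2 * (X * (real (?n k) + 1))) \<le>
      4 * (real (?n k) + 1) / (2 * real (pad g (?n k)) + 2 * real (?n k) + 1)"
      by (intro divide_left_mono) (use X(1) in \<open>auto intro!: mult_pos_pos add_nonneg_pos\<close>)
    moreover have "4 * (real (?n k) + 1) / (2 * (X * (real (?n k) + 1))) = 2 / X"
      using X(1) npos[of k] by (simp add: divide_simps)
    ultimately have "2 / X * ?s k \<le> 4 * (real (?n k) + 1) / (2 * real (pad g (?n k)) + 2 * real (?n k) + 1) * ?s k"
      using tgap_pos[OF b(2), of g k] by (intro mult_right_mono) auto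
    moreover have "2 * (2 * a / D * s) = 4 * a / D * s" for a D s :: real by simp
    ultimately show ?thesis unfolding tgap.simps by presburger
  qed
  have w_ge: "2 / X * 2 ^ k \<le> (2 :: real) ^ Suc k" for k using X(1) by (simp add: field_simps)
  have growth: "filterlim (\<lambda>k. u (Suc k) / real (?n (Suc k)) powr (1 / 2 - \<epsilon>)) at_top sequentially"
    if u: "\<And>k. 0 < u k" "\<And>k. 2 / X * u k \<le> u (Suc k)" for u :: "nat \<Rightarrow> real"
  proof (rule geometric_growth_at_top[OF e1(2)])
    show "0 < u (Suc 0) / real (?n (Suc 0)) powr (1 / 2 - \<epsilon>)" using u(1) npos[of "Suc 0"] by simp
    show "2 powr \<epsilon> * (u (Suc k) / real (?n (Suc k)) powr (1 / 2 - \<epsilon>)) \<le>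
      u (Suc (Suc k)) / real (?n (Suc (Suc k))) powr (1 / 2 - \<epsilon>)" for k
      by (rule growth_step[OF assms X(1) X2 npos npos n_le less_imp_le[OF u(1)] u(2)])
  qed
  have lim: "filterlim (\<lambda>i. card (A i)) at_top sequentially"
  proof (rule filterlim_at_top_mono[OF filterlim_ident])
    have "i \<le> card (A i)" for i using n_ge[of "Suc i"] unfolding card by linarith
    then show "\<forall>\<^sub>F i in sequentially. i \<le> card (A i)" by simp
  qed
  have gap: "filterlim (\<lambda>i. gap_sum (A i) (r i) / real (card (A i)) powr (1 / 2 - \<epsilon>)) at_top sequentially"
  proof (rule filterlim_at_top_mono[OF growth[of ?s]])
    show "\<forall>\<^sub>F i in sequentially. ?s (Suc i) / real (?n (Suc i)) powr (1 / 2 - \<epsilon>) \<le>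
      gap_sum (A i) (r i) / real (card (A i)) powr (1 / 2 - \<epsilon>)"
    proof (rule always_eventually, rule allI)
      fix i
      have "?s (Suc i) \<le> gap_sum (A i) (r i)" using gapbound_tower[OF b(2), of g "Suc i"] tw[of i] unfolding gapbound_def by blast
      then show "?s (Suc i) / real (?n (Suc i)) powr (1 / 2 - \<epsilon>) \<le> gap_sum (A i) (r i) / real (card (A i)) powr (1 / 2 - \<epsilon>)"
        unfolding card by (rule divide_right_mono) simp
    qed
  qed (use s_ge tgap_pos[OF b(2)] in auto)
  have wid: "filterlim (\<lambda>i. real (width (A i) (r i)) / real (card (A i)) powr (1 / 2 - \<epsilon>)) at_top sequentially"
  proof (rule filterlim_at_top_mono[OF growth[of "\<lambda>k. 2 ^ k"]])
    show "\<forall>\<^sub>F i in sequentially. 2 ^ Suc i / real (?n (Suc i)) powr (1 / 2 - \<epsilon>) \<le>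
      real (width (A i) (r i)) / real (card (A i)) powr (1 / 2 - \<epsilon>)"
    proof (rule always_eventually, rule allI)
      fix i
      have "real (2 ^ Suc i) \<le> real (width (A i) (r i))"
        unfolding of_nat_le_iff by (rule width_ge[OF wide_tower[OF b(2)] tw fin(1)])
      then have "2 ^ Suc i \<le> real (width (A i) (r i))" by simp
      then show "2 ^ Suc i / real (?n (Suc i)) powr (1 / 2 - \<epsilon>) \<le> real (width (A i) (r i)) / real (card (A i)) powr (1 / 2 - \<epsilon>)"
        unfolding card by (rule divide_right_mono) simp
    qed
  qed (use w_ge in auto)
  have d3: "delta 3 (A i) (r i) \<le> 1 / 6 - \<eta>" for i
    by (rule delta_3_le[OF fin three]) (rule unbalancedD[OF G[OF b(1,2)] tw, unfolded unbalanced_triple_def])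
  have d2: "delta 2 (A i) (r i) = 1 / 2" for i
    by (rule delta_2_twin[OF sized_series_slot[OF sz] transversal_series_slot[OF sz transversal_tower[OF b(2)]] tw[unfolded tower.simps]])
  show ?thesis
    by (intro exI[of _ \<eta>] exI[of _ A] exI[of _ r] conjI allI) (rule \<eta> fin three lim gap wid d3 d2)+
qed

end
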